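(* For any updown tableau $T=(\Lambda_1,\dots,\Lambda_n)$ with contents $(c_1,\dots,c_n)$ and exponents $p_1,\dots,p_n$, the consecutive evaluations $$(u_1-c_1)^{p_1}\cdots(u_n-c_n)^{p_n}\,\Omega(u_1,\dots,u_n)\big|_{u_1=c_1}\big|_{u_2=c_2}\dots\big|_{u_n=c_n}$$ are well-defined, and the resulting value coincides with $h(T)\,E_T$, where $E_T\in\mathcal{B}_n(\omega)$ is the primitive idempotent associated with $T$ and $h(T)$ is the constant defined in the context.
   Context: Let $\omega$ be an indeterminate. The Brauer algebra $\mathcal{B}_n(\omega)$ is the $\mathbb{C}(\omega)$-linear span of the $n$-diagrams (two rows of $n$ dots, the $2n$ dots being joined pairwise by $n$ edges, each dot lying on exactly one edge). The product $d_1d_2$ is obtained by placing $d_1$ above $d_2$, identifying the bottom row of $d_1$ with the top row of $d_2$, and multiplying the resulting diagram with loops deleted by $\omega^s$, where $s$ is the number of closed loops. For $1\leqslant i<j\leqslant n$, $s_{ij}=s_{ji}$ is the diagram of the transposition $(i,j)$, and $\epsilon_{ij}=\epsilon_{ji}$ is the diagram in which the $i$-th and $j$-th dots of the top row are joined, the $i$-th and $j$-th dots of the bottom row are joined, and the $k$-th top dot is joined to the $k$-th bottom dot for $k\ne i,j$. $\mathcal{B}_{n-1}(\omega)$ is regarded as the subalgebra of $\mathcal{B}_n(\omega)$ spanned by the diagrams in which the $n$-th top and bottom dots are joined. Jucys--Murphy elements: $x_r=\frac{\omega-1}{2}+\sum_{i=1}^{r-1}(s_{ir}-\epsilon_{ir})$.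 Partitions are identified with Young diagrams; $(i,j)$ is the box in row $i$, column $j$, and it lies on the diagonal $j-i$. An updown $\lambda$-tableau is a sequence $T=(\Lambda_1,\dots,\Lambda_n)$ of diagrams with $\Lambda_n=\lambda$ such that each $\Lambda_r$ is obtained from $\Lambda_{r-1}$ by adding or removing one box, where $\Lambda_0=\varnothing$. Its contents are $c_r=\frac{\omega-1}{2}+j-i$ if $\Lambda_r$ is obtained by adding the box $(i,j)$ to $\Lambda_{r-1}$, and $c_r=-(\frac{\omega-1}{2}+j-i)$ if it is obtained by removing the box $(i,j)$. The idempotents $E_T$ are defined by $E_T=1$ for $n=1$ and, for $n\geqslant2$, with $U=(\Lambda_1,\dots,\Lambda_{n-1})$, $\mu=\Lambda_{n-1}$, $$E_T=E_U\,\frac{(x_n-a_1)\cdots(x_n-a_k)}{(c_n-a_1)\cdots(c_n-a_k)},$$ where $\alpha$ is the box added to or removed from $\mu$ to get $\Lambda_n$ and $a_1,\dots,a_k$ are the contents ($\frac{\omega-1}{2}+j-i$ for an addable box $(i,j)$, $-(\frac{\omega-1}{2}+j-i)$ for a removable box $(i,j)$) of all boxes, excluding $\alpha$, which can be added to or removed from $\mu$ to get a diagram. Set $\varkappa=\frac{\omega}{2}-1$, $\rho_{ij}(u)=1-\frac{s_{ij}}{u}+\frac{\epsilon_{ij}}{u-\varkappa}$ and $$\Omega(u_1,\dots,u_n)=\prod_{1\leqslant i<j\leqslant n}\rho_{ij}(-u_i-u_j+\varkappa)\prod_{1\leqslant i<j\leqslant n}\rho_{ij}(u_i-u_j),$$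 both products taken (left to right) in the lexicographic order on the pairs $(i,j)$. Exponents. For an updown tableau $U=(\Lambda_1,\dots,\Lambda_{n-1})$ let $m_{ij}$ (resp. $m'_{ij}$) be the number of times the box $(i,j)$ was added (resp. removed) in the sequence $(\varnothing=\Lambda_0,\Lambda_1,\dots,\Lambda_{n-1})$. For $k\in\mathbb{Z}$ put $d_k=\sum_{j-i=k}m_{ij}$, $d'_k=\sum_{j-i=k}m'_{ij}$, and $$g_k(U)=\delta_{k0}+d_{k-1}+d_{k+1}-2d_k,\qquad g'_k(U)=d'_{k-1}+d'_{k+1}-2d'_k.$$ For $T=(\Lambda_1,\dots,\Lambda_n)$ the exponents $p_1,\dots,p_n$ are defined inductively so that $p_r$ depends only on $(\Lambda_1,\dots,\Lambda_r)$, with $p_n=1-g_{k_n}(U)$ if $\Lambda_n$ is obtained from $\Lambda_{n-1}$ by adding a box on the diagonal $k_n$, and $p_n=1-g'_{k_n}(U)$ if it is obtained by removing a box on the diagonal $k_n$, where $U=(\Lambda_1,\dots,\Lambda_{n-1})$. Constants. $h(T)=1$ for $T=(\Lambda_1)$, and $h(T)=h(U)\,\psi(U,T)$ for $U=(\Lambda_1,\dots,\Lambda_{n-1})$, $T=(\Lambda_1,\dots,\Lambda_n)$, $n\geqslant2$, where, writing $g_k=g_k(U)$, $g'_k=g'_k(U)$, $$\psi(U,T)=\frac{4k_n+\omega}{2k_n+\omega}\prod_{k\ne k_n}(k_n-k)^{g_k}\prod_k(k_n+k+\omega-1)^{g'_k}$$ if $\Lambda_n$ is obtained from $\Lambda_{n-1}$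 by adding a box on the diagonal $k_n$, and $$\psi(U,T)=\frac{4k_n+3\omega-4}{2k_n+\omega-2}\prod_{k\ne k_n}(-k_n+k)^{g'_k}\prod_k(-k_n-k-\omega+1)^{g_k}$$ if it is obtained by removing a box on the diagonal $k_n$; the products are over all integers $k$ (only finitely many factors differ from $1$). Consecutive evaluations means that one first sets $u_1=c_1$, then sets $u_2=c_2$ in the resulting (simplified) rational function of $u_2,\dots,u_n$, and so on. *)

theory Defs
  imports
    Complex_Main
    "HOL-Library.Poly_Mapping"
    "HOL-Library.Product_Lexorder"
    "HOL-Combinatorics.Transposition"
    "HOL-Computational_Algebra.Polynomial"
    "HOL-Computational_Algebra.Fraction_Field"
begin

text \<open>
  A diagram is a set of edges, an edge being a two-element set of dots.  The row \<open>Mid\<close> does not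
  occur in an \<open>n\<close>-diagram; it is the identified middle row when two diagrams are multiplied.
\<close>

datatype row = Top | Mid | Bot

type_synonym dot = "row \<times> nat"
type_synonym diagram = "dot set set"

definition dots :: "nat \<Rightarrow> dot set" where
  "dots n = {Top, Bot} \<times> {1..n}"

definition diagrams :: "nat \<Rightarrow> diagram set" where
  "diagrams n = {d. (\<forall>e\<in>d. e \<subseteq> dots n \<and> card e = 2) \<and> (\<forall>x\<in>dots n. \<exists>!e. e \<in> d \<and> x \<in> e)}"

fun upper_dot :: "dot \<Rightarrow> dot" where
  "upper_dot (q, i) = (if q = Bot then Mid else q, i)"

fun lower_dot :: "dot \<Rightarrow> dot" where
  "lower_dot (q, i) = (if q = Top then Mid else q, i)"

definition stack :: "diagram \<Rightarrow> diagram \<Rightarrow> dot set set" where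
  "stack d1 d2 = (`) upper_dot ` d1 \<union> (`) lower_dot ` d2"

definition connected_dots :: "dot set set \<Rightarrow> (dot \<times> dot) set" where
  "connected_dots G = {(x, y). \<exists>e\<in>G. x \<in> e \<and> y \<in> e}\<^sup>*"

definition compose :: "diagram \<Rightarrow> diagram \<Rightarrow> diagram" where
  "compose d1 d2 = {{x, y} | x y. x \<noteq> y \<and> fst x \<noteq> Mid \<and> fst y \<noteq> Mid \<and>
     (x, y) \<in> connected_dots (stack d1 d2)}"

text \<open>The closed loops are the connected components that stay in the middle row.\<close>

definition loops :: "nat \<Rightarrow> diagram \<Rightarrow> diagram \<Rightarrow> nat" where
  "loops n d1 d2 = card {C. C \<subseteq> {Mid} \<times> UNIV \<and>
     (\<exists>i\<in>{1..n}. C = connected_dots (stack d1 d2) `` {(Mid, i)})}"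

text \<open>
  An element of the Brauer algebra over a field \<open>'k\<close> is given by its coefficients on the diagrams
  (zero outside \<open>diagrams n\<close>); \<open>w\<close> is the parameter of the algebra.
\<close>

type_synonym 'k brauer = "diagram \<Rightarrow> 'k"

definition brauer_basis :: "diagram \<Rightarrow> 'k::field brauer" where
  "brauer_basis d = (\<lambda>d'. if d' = d then 1 else 0)"

definition brauer_mult :: "nat \<Rightarrow> 'k::field \<Rightarrow> 'k brauer \<Rightarrow> 'k brauer \<Rightarrow> 'k brauer" where
  "brauer_mult n w a b = (\<lambda>d. \<Sum>d1\<in>diagrams n. \<Sum>d2\<in>diagrams n.
     if compose d1 d2 = d then a d1 * b d2 * w ^ loops n d1 d2 else 0)"

definition brauer_one :: "nat \<Rightarrow> 'k::field brauer" where
  "brauer_one n = brauer_basis {{(Top, k), (Bot, k)} | k. k \<in> {1..n}}"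

definition brauer_prod :: "nat \<Rightarrow> 'k::field \<Rightarrow> 'k brauer list \<Rightarrow> 'k brauer" where
  "brauer_prod n w as = foldr (brauer_mult n w) as (brauer_one n)"

definition s_elem :: "nat \<Rightarrow> nat \<Rightarrow> nat \<Rightarrow> 'k::field brauer" where
  "s_elem n i j =
     brauer_basis {{(Top, k), (Bot, Transposition.transpose i j k)} | k. k \<in> {1..n}}"

definition eps_elem :: "nat \<Rightarrow> nat \<Rightarrow> nat \<Rightarrow> 'k::field brauer" where
  "eps_elem n i j = brauer_basis ({{(Top, i), (Top, j)}, {(Bot, i), (Bot, j)}} \<union>
     {{(Top, k), (Bot, k)} | k. k \<in> {1..n} - {i, j}})"

definition jm_elem :: "nat \<Rightarrow> 'k::field \<Rightarrow> nat \<Rightarrow> 'k brauer" where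
  "jm_elem n w r = (\<lambda>d. (w - 1) / 2 * brauer_one n d +
     (\<Sum>i\<in>{1..<r}. s_elem n i r d - eps_elem n i r d))"

type_synonym scal = "complex poly fract"

definition omega :: scal where
  "omega = Fract [:0, 1:] 1"

type_synonym box = "nat \<times> nat"

definition young_diagram :: "box set \<Rightarrow> bool" where
  "young_diagram D \<longleftrightarrow> finite D \<and> (\<forall>(i, j)\<in>D. 1 \<le> i \<and> 1 \<le> j \<and>
     (\<forall>i'\<in>{1..i}. \<forall>j'\<in>{1..j}. (i', j') \<in> D))"

definition diag :: "box \<Rightarrow> int" where
  "diag b = int (snd b) - int (fst b)"

definition addable :: "box set \<Rightarrow> box set" where
  "addable D = {b. b \<notin> D \<and> young_diagram (insert b D)}"

definition removable :: "box set \<Rightarrow> box set" where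
  "removable D = {b. b \<in> D \<and> young_diagram (D - {b})}"

text \<open>\<open>shape T r\<close> is \<open>\<Lambda>\<^sub>r\<close>, where \<open>T = [\<Lambda>\<^sub>1, \<dots>, \<Lambda>\<^sub>n]\<close> and \<open>\<Lambda>\<^sub>0\<close> is empty.\<close>

definition shape :: "box set list \<Rightarrow> nat \<Rightarrow> box set" where
  "shape T r = ({} # T) ! r"

definition updown_tableau :: "box set \<Rightarrow> box set list \<Rightarrow> bool" where
  "updown_tableau lam T \<longleftrightarrow> T \<noteq> [] \<and> last T = lam \<and> (\<forall>D\<in>set T. young_diagram D) \<and>
     (\<forall>r\<in>{1..length T}.
        (\<exists>b\<in>addable (shape T (r - 1)). shape T r = insert b (shape T (r - 1))) \<or>
        (\<exists>b\<in>removable (shape T (r - 1)). shape T r = shape T (r - 1) - {b}))"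

definition added :: "box set list \<Rightarrow> nat \<Rightarrow> bool" where
  "added T r \<longleftrightarrow> shape T (r - 1) \<subset> shape T r"

definition box_at :: "box set list \<Rightarrow> nat \<Rightarrow> box" where
  "box_at T r = the_elem ((shape T r - shape T (r - 1)) \<union> (shape T (r - 1) - shape T r))"

definition add_content :: "box \<Rightarrow> scal" where
  "add_content b = (omega - 1) / 2 + of_int (diag b)"

definition rem_content :: "box \<Rightarrow> scal" where
  "rem_content b = - ((omega - 1) / 2 + of_int (diag b))"

definition content :: "box set list \<Rightarrow> nat \<Rightarrow> scal" where
  "content T r = (if added T r then add_content (box_at T r) else rem_content (box_at T r))"

text \<open>
  A box of a diagram is never simultaneously addable and removable, so deleting \<open>b\<close> from both sets
  deletes exactly the box of the current step.
\<close>

definition other_contents :: "box set \<Rightarrow> box \<Rightarrow> scal list" where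
  "other_contents mu b =
     map add_content (sorted_list_of_set (addable mu - {b})) @
     map rem_content (sorted_list_of_set (removable mu - {b}))"

text \<open>
  \<open>idem_step n T r\<close> is the idempotent of \<open>(\<Lambda>\<^sub>1, \<dots>, \<Lambda>\<^sub>r)\<close>, taken inside the algebra of
  \<open>n\<close>-diagrams: the inclusion of the smaller algebra adds vertical edges and thus maps \<open>s\<^sub>i\<^sub>j\<close>,
  \<open>\<epsilon>\<^sub>i\<^sub>j\<close> and \<open>x\<^sub>r\<close> to the elements denoted by the same letters.
\<close>

fun idem_step :: "nat \<Rightarrow> box set list \<Rightarrow> nat \<Rightarrow> scal brauer" where
  "idem_step n T 0 = brauer_one n"
| "idem_step n T (Suc 0) = brauer_one n"
| "idem_step n T (Suc (Suc r)) =
     (let m = Suc (Suc r);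
          as = other_contents (shape T (m - 1)) (box_at T m);
          num = brauer_prod n omega
            (map (\<lambda>a d. jm_elem n omega m d - a * brauer_one n d) as);
          den = prod_list (map (\<lambda>a. content T m - a) as)
      in brauer_mult n omega (idem_step n T (m - 1)) (\<lambda>d. num d / den))"

definition idempotent :: "box set list \<Rightarrow> scal brauer" where
  "idempotent T = idem_step (length T) T (length T)"

definition m_add :: "box set list \<Rightarrow> box \<Rightarrow> nat" where
  "m_add U b = card {r\<in>{1..length U}. added U r \<and> box_at U r = b}"

definition m_rem :: "box set list \<Rightarrow> box \<Rightarrow> nat" where
  "m_rem U b = card {r\<in>{1..length U}. \<not> added U r \<and> box_at U r = b}"

definition d_add :: "box set list \<Rightarrow> int \<Rightarrow> int" where
  "d_add U k = Sum_any (\<lambda>b. if diag b = k then int (m_add U b) else 0)"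

definition d_rem :: "box set list \<Rightarrow> int \<Rightarrow> int" where
  "d_rem U k = Sum_any (\<lambda>b. if diag b = k then int (m_rem U b) else 0)"

definition g_add :: "box set list \<Rightarrow> int \<Rightarrow> int" where
  "g_add U k = (if k = 0 then 1 else 0) + d_add U (k - 1) + d_add U (k + 1) - 2 * d_add U k"

definition g_rem :: "box set list \<Rightarrow> int \<Rightarrow> int" where
  "g_rem U k = d_rem U (k - 1) + d_rem U (k + 1) - 2 * d_rem U k"

definition exponent :: "box set list \<Rightarrow> nat \<Rightarrow> int" where
  "exponent T r =
     (let U = take (r - 1) T; k = diag (box_at T r)
      in if added T r then 1 - g_add U k else 1 - g_rem U k)"

text \<open>\<open>psi T r\<close> is \<open>\<psi>((\<Lambda>\<^sub>1, \<dots>, \<Lambda>\<^sub>r\<^sub>-\<^sub>1), (\<Lambda>\<^sub>1, \<dots>, \<Lambda>\<^sub>r))\<close>.\<close>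

definition psi :: "box set list \<Rightarrow> nat \<Rightarrow> scal" where
  "psi T r =
     (let U = take (r - 1) T; kr = diag (box_at T r); K = of_int kr
      in if added T r then
           (4 * K + omega) / (2 * K + omega) *
           Prod_any (\<lambda>k. if k = kr then 1 else (K - of_int k) powi g_add U k) *
           Prod_any (\<lambda>k. (K + of_int k + omega - 1) powi g_rem U k)
         else
           (4 * K + 3 * omega - 4) / (2 * K + omega - 2) *
           Prod_any (\<lambda>k. if k = kr then 1 else (- K + of_int k) powi g_rem U k) *
           Prod_any (\<lambda>k. (- K - of_int k - omega + 1) powi g_add U k))"

definition h_const :: "box set list \<Rightarrow> scal" where
  "h_const T = (\<Prod>r\<in>{2..length T}. psi T r)"

text \<open>
  Polynomials in the variables \<open>u\<^sub>0, u\<^sub>1, u\<^sub>2, \<dots>\<close> over \<open>scal\<close>, as finitely supported maps from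
  monomials (exponent vectors) to coefficients, and their field of fractions.
\<close>

type_synonym upoly = "(nat \<Rightarrow>\<^sub>0 nat) \<Rightarrow>\<^sub>0 scal"
type_synonym ufun = "upoly fract"

definition const :: "scal \<Rightarrow> ufun" where
  "const c = Fract (Poly_Mapping.single 0 c) 1"

definition var :: "nat \<Rightarrow> ufun" where
  "var r = Fract (Poly_Mapping.single (Poly_Mapping.single r 1) 1) 1"

definition subst_poly :: "nat \<Rightarrow> scal \<Rightarrow> upoly \<Rightarrow> upoly" where
  "subst_poly r c p = (\<Sum>m\<in>Poly_Mapping.keys p.
     Poly_Mapping.single (Poly_Mapping.update r 0 m)
       (Poly_Mapping.lookup p m * c ^ Poly_Mapping.lookup m r))"

text \<open>
  A rational function can be evaluated at \<open>u\<^sub>r = c\<close> if it is a quotient of polynomials whose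
  denominator does not vanish identically after the substitution; the value is a rational function
  of the other variables.
\<close>

definition value_at :: "nat \<Rightarrow> scal \<Rightarrow> ufun \<Rightarrow> ufun \<Rightarrow> bool" where
  "value_at r c f v \<longleftrightarrow> (\<exists>p q. subst_poly r c q \<noteq> 0 \<and> f = Fract p q \<and>
     v = Fract (subst_poly r c p) (subst_poly r c q))"

lemma subst_poly_superset:
  assumes "finite A" "Poly_Mapping.keys p \<subseteq> A"
  shows "subst_poly r c p = (\<Sum>m\<in>A. Poly_Mapping.single (Poly_Mapping.update r 0 m)
    (Poly_Mapping.lookup p m * c ^ Poly_Mapping.lookup m r))"
  unfolding subst_poly_def using assms
  by (intro sum.mono_neutral_left) (auto simp: in_keys_iff)

lemma subst_poly_add: "subst_poly r c (p + q) = subst_poly r c p + subst_poly r c q"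
proof -
  let ?A = "Poly_Mapping.keys p \<union> Poly_Mapping.keys q"
  have "Poly_Mapping.keys (p + q) \<subseteq> ?A"
    by (rule Poly_Mapping.keys_add)
  then show ?thesis
    by (simp add: subst_poly_superset[of ?A] lookup_add distrib_right single_add sum.distrib)
qed

lemma subst_poly_single: "subst_poly r c (Poly_Mapping.single m a) =
    Poly_Mapping.single (Poly_Mapping.update r 0 m) (a * c ^ Poly_Mapping.lookup m r)"
  by (simp add: subst_poly_superset[of "{m}"])

lemma poly_mapping_add_induct:
  fixes p :: "'a \<Rightarrow>\<^sub>0 'b::comm_monoid_add"
  assumes "P 0" "\<And>m a q. P q \<Longrightarrow> P (Poly_Mapping.single m a + q)"
  shows "P p"
proof -
  have "P (\<Sum>m\<in>A. Poly_Mapping.single m (Poly_Mapping.lookup p m))" if "finite A" for A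
    using that by (induction A) (auto intro: assms)
  moreover have "p = (\<Sum>m\<in>Poly_Mapping.keys p. Poly_Mapping.single m (Poly_Mapping.lookup p m))"
    by (intro poly_mapping_eqI)
      (auto simp: lookup_sum lookup_single when_def in_keys_iff sum.delta)
  ultimately show ?thesis
    by (metis finite_keys)
qed

lemma subst_poly_mult: "subst_poly r c (p * q) = subst_poly r c p * subst_poly r c q"
proof -
  have upd: "Poly_Mapping.update r 0 (m + m') = Poly_Mapping.update r 0 m + Poly_Mapping.update r 0 m'"
    for m m' :: "nat \<Rightarrow>\<^sub>0 nat"
    by (intro poly_mapping_eqI) (simp add: lookup_add update.rep_eq)
  have z: "subst_poly r c 0 = 0"
    by (simp add: subst_poly_def)
  have single: "subst_poly r c (Poly_Mapping.single m a * q) =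
      subst_poly r c (Poly_Mapping.single m a) * subst_poly r c q" for m a
    by (induction q rule: poly_mapping_add_induct)
      (simp_all add: z distrib_left subst_poly_add subst_poly_single mult_single upd lookup_add
        power_add mult_ac)
  show ?thesis
    by (induction p rule: poly_mapping_add_induct)
      (simp_all add: z distrib_right subst_poly_add single)
qed

text \<open>The value does not depend on the representing fraction, so \<open>eval_at\<close> is meaningful at regular points.\<close>

lemma value_at_unique:
  assumes "value_at r c f v" "value_at r c f v'"
  shows "v = v'"
proof -
  obtain p q where 1: "subst_poly r c q \<noteq> 0" "f = Fract p q"
      "v = Fract (subst_poly r c p) (subst_poly r c q)"
    using assms(1) by (auto simp: value_at_def)
  obtain p' q' where 2: "subst_poly r c q' \<noteq> 0" "f = Fract p' q'"
      "v' = Fract (subst_poly r c p') (subst_poly r c q')"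
    using assms(2) by (auto simp: value_at_def)
  have "q \<noteq> 0" "q' \<noteq> 0"
    using 1 2 by (auto simp: subst_poly_def)
  then have "p * q' = p' * q"
    using 1 2 by (simp add: eq_fract)
  then have "subst_poly r c p * subst_poly r c q' = subst_poly r c p' * subst_poly r c q"
    by (metis subst_poly_mult)
  then show ?thesis
    using 1 2 by (simp add: eq_fract)
qed

definition regular_at :: "nat \<Rightarrow> scal \<Rightarrow> ufun \<Rightarrow> bool" where
  "regular_at r c f \<longleftrightarrow> (\<exists>v. value_at r c f v)"

definition eval_at :: "nat \<Rightarrow> scal \<Rightarrow> ufun \<Rightarrow> ufun" where
  "eval_at r c f = (THE v. value_at r c f v)"

primrec consec_eval :: "(nat \<Rightarrow> scal) \<Rightarrow> ufun brauer \<Rightarrow> nat \<Rightarrow> ufun brauer" where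
  "consec_eval c F 0 = F"
| "consec_eval c F (Suc r) = (\<lambda>d. eval_at (Suc r) (c (Suc r)) (consec_eval c F r d))"

definition consec_eval_defined :: "(nat \<Rightarrow> scal) \<Rightarrow> ufun brauer \<Rightarrow> nat \<Rightarrow> bool" where
  "consec_eval_defined c F n \<longleftrightarrow>
     (\<forall>r\<in>{1..n}. \<forall>d. regular_at r (c r) (consec_eval c F (r - 1) d))"

definition kappa :: ufun where
  "kappa = const (omega / 2 - 1)"

definition rho :: "nat \<Rightarrow> nat \<Rightarrow> nat \<Rightarrow> ufun \<Rightarrow> ufun brauer" where
  "rho n i j u = (\<lambda>d. brauer_one n d - s_elem n i j d / u + eps_elem n i j d / (u - kappa))"

definition lex_pairs :: "nat \<Rightarrow> (nat \<times> nat) list" where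
  "lex_pairs n = sorted_list_of_set {(i, j). 1 \<le> i \<and> i < j \<and> j \<le> n}"

definition Omega :: "nat \<Rightarrow> ufun brauer" where
  "Omega n = brauer_prod n (const omega)
     (map (\<lambda>(i, j). rho n i j (- var i - var j + kappa)) (lex_pairs n) @
      map (\<lambda>(i, j). rho n i j (var i - var j)) (lex_pairs n))"

definition weighted_Omega :: "box set list \<Rightarrow> ufun brauer" where
  "weighted_Omega T = (\<lambda>d. (\<Prod>r\<in>{1..length T}. (var r - const (content T r)) powi exponent T r) *
     Omega (length T) d)"

end

theory Submission
  imports "HOL-Computational_Algebra.Formal_Power_Series" "HOL-Library.FuncSet" Defs
begin

text \<open>
  Write \<open>x\<^sub>r\<close> for the Jucys--Murphy elements, \<open>\<kappa> = \<omega>/2 - 1\<close>, and \<open>U\<close> for the tableau \<open>T\<close> without its last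
  diagram.  The proof evaluates one variable at a time, and rests on three facts.

  First, the Yang--Baxter equation lets one sort the two triangular products into
  \<open>\<Omega>(u\<^sub>1,\<dots>,u\<^sub>n) = B\<^sub>1 \<cdots> B\<^sub>n\<close>, where \<open>B\<^sub>r\<close> is the product of all factors that involve \<open>u\<^sub>r\<close> and some
  \<open>u\<^sub>i\<close> with \<open>i < r\<close> (\<open>triangular_factorization\<close>).  So the variable \<open>u\<^sub>r\<close> may be evaluated when the factors to
  the left of \<open>B\<^sub>r\<close> have already become a multiple of an idempotent.

  Secondly, a reflection identity for a single pair of factors turns \<open>B\<^sub>n\<close>, multiplied by the
  idempotent \<open>E\<^sub>U\<close>, into a resolvent of \<open>x\<^sub>n\<close>:
  \<open>E\<^sub>U B\<^sub>n(u) = \<phi>(u) E\<^sub>U (u + x\<^sub>n - \<kappa>) (u - x\<^sub>n)\<^sup>-\<^sup>1\<close> with an explicit scalar \<open>\<phi>\<close> (\<open>idempotent_fusion\<close>).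

  Thirdly, \<open>E\<^sub>U\<close> kills the product of the \<open>x\<^sub>n - a\<close> over all contents \<open>a\<close> of boxes that can be added to
  or removed from the shape of \<open>U\<close> (\<open>minimal_polynomial\<close>).  Therefore the resolvent can be written
  with denominators \<open>u - a\<close> only, and the pole at \<open>u = c\<^sub>n\<close> isolates the product over the other
  contents, which is \<open>E\<^sub>T\<close> up to its normalization.  The order of vanishing of \<open>\<phi>\<close> at \<open>c\<^sub>n\<close> and its
  leading coefficient, expressed through the numbers of boxes on the diagonals, give the exponent
  and the factor \<open>\<psi>\<close> of \<open>h(T)\<close> (\<open>theta_value\<close>).

  The third fact is the deepest, and is proved without the representation theory of the Brauer
  algebra.  At an integer parameter \<open>N\<close> the algebra acts on functions of colourings of the strands by
  \<open>N\<close> colours.  Let \<open>\<epsilon>\<close> join strands \<open>n\<close> and \<open>n + 1\<close>, and let \<open>P\<close> be the product over the contents.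
  The series \<open>f\<close> in \<open>\<epsilon> (t / (1 - t x\<^sub>n)) \<epsilon> E\<^sub>U = f \<epsilon> E\<^sub>U\<close> satisfies a recursion in \<open>n\<close>
  (\<open>closed_by_Suc\<close>), which the contents satisfy as well (\<open>corner_step\<close>); hence \<open>f\<close> is a rational
  function whose poles correspond to the contents, and \<open>\<epsilon> P(x\<^sub>n)\<^sup>2 E\<^sub>U \<epsilon> = 0\<close>
  (\<open>closed_by_pp_square\<close>).  Multiplied by \<open>E\<^sub>U\<close>, the left-hand side becomes over the reals a
  partial trace of the square of a self-adjoint operator, so \<open>E\<^sub>U P(x\<^sub>n) = 0\<close> (\<open>closure_positive\<close>).  Up to
  normalization, the coefficients of this element of the generic algebra are polynomials in \<open>\<omega>\<close>, which
  are determined by their values at all large integers \<open>N\<close>, so the relation holds generically (\<open>spec_vanish\<close>).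
\<close>

section \<open>Linear operators on function spaces\<close>

text \<open>Linear operators form a ring under composition. Working with them instead of with
  elements of the Brauer algebra has the advantage that the Brauer algebra and its action on
  colourings, which live on different spaces, are instances of the same relations in the same kind
  of ring.\<close>

typedef (overloaded) ('x, 'k::field) lop =
  "{A :: ('x \<Rightarrow> 'k) \<Rightarrow> 'x \<Rightarrow> 'k. \<forall>c F G. A (\<lambda>x. c * F x + G x) = (\<lambda>x. c * A F x + A G x)}"
  morphisms ap Lop
  by (rule exI[of _ "\<lambda>F. F"]) simp

setup_lifting type_definition_lop

instantiation lop :: (type, field) ring_1
begin

lift_definition zero_lop :: "('a, 'b) lop" is "\<lambda>F x. 0" by simp
lift_definition one_lop :: "('a, 'b) lop" is "\<lambda>F. F" by simp
lift_definition plus_lop :: "('a, 'b) lop \<Rightarrow> ('a, 'b) lop \<Rightarrow> ('a, 'b) lop"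
  is "\<lambda>A B F x. A F x + B F x" by (simp add: algebra_simps)
lift_definition minus_lop :: "('a, 'b) lop \<Rightarrow> ('a, 'b) lop \<Rightarrow> ('a, 'b) lop"
  is "\<lambda>A B F x. A F x - B F x" by (simp add: algebra_simps)
lift_definition uminus_lop :: "('a, 'b) lop \<Rightarrow> ('a, 'b) lop"
  is "\<lambda>A F x. - A F x" by (simp add: algebra_simps)
lift_definition times_lop :: "('a, 'b) lop \<Rightarrow> ('a, 'b) lop \<Rightarrow> ('a, 'b) lop"
  is "\<lambda>A B F. A (B F)" by simp

instance
proof
  fix a b c :: "('a, 'b) lop"
  show "(a * b) * c = a * (b * c)" by transfer simp
  show "1 * a = a" "a * 1 = a" by (transfer; simp)+
  show "(a + b) + c = a + (b + c)" "a + b = b + a" "0 + a = a" "- a + a = 0" "a - b = a + - b"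
    by (transfer; simp add: algebra_simps fun_eq_iff)+
  show "(a + b) * c = a * c + b * c" by transfer simp
  show "a * (b + c) = a * b + a * c"
  proof (transfer, goal_cases)
    case (1 a b c)
    have "a (\<lambda>x. 1 * b F x + c F x) = (\<lambda>x. 1 * a (b F) x + a (c F) x)" for F
      using 1(1) by blast
    then show ?case by (simp add: fun_eq_iff)
  qed
  show "(0::('a, 'b) lop) \<noteq> 1"
  proof
    assume "(0::('a, 'b) lop) = 1"
    then have "(\<lambda>(F::'a \<Rightarrow> 'b) (x::'a). 0) = (\<lambda>F. F)" by transfer
    then have "(\<lambda>(x::'a). 0) = (\<lambda>x. (1::'b))" by metis
    then show False by (simp add: fun_eq_iff)
  qed
qed

end

lift_definition sc :: "'k \<Rightarrow> ('x, 'k::field) lop" is "\<lambda>c F x. c * F x"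
  by (simp add: algebra_simps)

lemma sc_add: "sc (a + b) = sc a + sc b" by transfer (simp add: algebra_simps fun_eq_iff)
lemma sc_mult: "sc (a * b) = sc a * sc b" by transfer (simp add: algebra_simps fun_eq_iff)
lemma sc_1: "sc 1 = 1" by transfer (simp add: fun_eq_iff)
lemma sc_central: "sc c * A = A * sc c"
proof (transfer, goal_cases)
  case (1 c A)
  have "A (\<lambda>x. 0) = (\<lambda>x. 0)"
    using 1[THEN spec, THEN spec, THEN spec, of "-1" "\<lambda>x. 0" "\<lambda>x. 0"] by (simp add: fun_eq_iff)
  then show ?case
    using 1[THEN spec, THEN spec, THEN spec, of c _ "\<lambda>x. 0"] by (simp add: fun_eq_iff)
qed

lemma ap_plus: "ap (A + B) F x = ap A F x + ap B F x" by transfer simp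
lemma ap_minus: "ap (A - B) F x = ap A F x - ap B F x" by transfer simp
lemma ap_uminus: "ap (- A) F x = - ap A F x" by transfer simp
lemma ap_zero: "ap 0 F x = 0" by transfer simp
lemma ap_one: "ap 1 F = F" by transfer simp
lemma ap_times: "ap (A * B) F = ap A (ap B F)" by transfer simp
lemma ap_sc: "ap (sc c) F x = c * F x" by transfer simp
lemmas ap_simps = ap_plus ap_minus ap_uminus ap_zero ap_one ap_times ap_sc

lemma ap_sum: "ap (\<Sum>i\<in>I. A i) F x = (\<Sum>i\<in>I. ap (A i) F x)"
  by (induction I rule: infinite_finite_induct) (simp_all add: ap_simps)

lemma ap_lin: "ap A (\<lambda>x. c * F x + G x) = (\<lambda>x. c * ap A F x + ap A G x)"
  by transfer simp

lemma ap_arg_0: "ap A (\<lambda>x. 0) = (\<lambda>x. 0)"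
  using ap_lin[of A "-1" "\<lambda>x. 0" "\<lambda>x. 0"] by (simp add: fun_eq_iff)

lemma ap_scale: "ap A (\<lambda>x. c * F x) = (\<lambda>x. c * ap A F x)"
  using ap_lin[of A c F "\<lambda>x. 0"] by (simp add: ap_arg_0)

lemma ap_arg_add: "ap A (\<lambda>x. F x + G x) = (\<lambda>x. ap A F x + ap A G x)"
  using ap_lin[of A 1 F G] by simp

lemma ap_arg_sum: "ap A (\<lambda>x. \<Sum>i\<in>I. F i x) = (\<lambda>x. \<Sum>i\<in>I. ap A (F i) x)"
  by (induction I rule: infinite_finite_induct) (simp_all add: ap_arg_0 ap_arg_add)

lemma lop_eqI: "(\<And>F x. ap A F x = ap B F x) \<Longrightarrow> A = B"
  by (metis ap_inject ext)

section \<open>Brauer relations\<close>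

text \<open>The relations between transpositions and their partners \<open>e i j\<close> (drawn as
  a cap and a cup) that are used below, for strands from a set \<open>I\<close>. The map
  \<open>c\<close> embeds the scalars centrally, and \<open>w\<close> is the value of a closed
  loop. Both the generic Brauer algebra and its action on colourings satisfy them.\<close>

locale brauer_relations =
  fixes c :: "'k::field \<Rightarrow> 'a::ring_1" and w :: 'k and I :: "nat set"
    and s e :: "nat \<Rightarrow> nat \<Rightarrow> 'a"
  assumes c_add: "c (a + b) = c a + c b" and c_mult: "c (a * b) = c a * c b" and c_1: "c 1 = 1"
    and c_central: "c a * X = X * c a"
    and two: "(2::'k) \<noteq> 0"
    and s_sym: "s i j = s j i" and e_sym: "e i j = e j i"
    and ss: "i \<in> I \<Longrightarrow> j \<in> I \<Longrightarrow> i \<noteq> j \<Longrightarrow> s i j * s i j = 1"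
    and ee: "i \<in> I \<Longrightarrow> j \<in> I \<Longrightarrow> i \<noteq> j \<Longrightarrow> e i j * e i j = c w * e i j"
    and se: "i \<in> I \<Longrightarrow> j \<in> I \<Longrightarrow> i \<noteq> j \<Longrightarrow> s i j * e i j = e i j"
    and es: "i \<in> I \<Longrightarrow> j \<in> I \<Longrightarrow> i \<noteq> j \<Longrightarrow> e i j * s i j = e i j"
    and ss3: "i \<in> I \<Longrightarrow> j \<in> I \<Longrightarrow> k \<in> I \<Longrightarrow> i \<noteq> j \<Longrightarrow> j \<noteq> k \<Longrightarrow> i \<noteq> k \<Longrightarrow>
        s i j * s j k = s i k * s i j"
    and se3: "i \<in> I \<Longrightarrow> j \<in> I \<Longrightarrow> k \<in> I \<Longrightarrow> i \<noteq> j \<Longrightarrow> j \<noteq> k \<Longrightarrow> i \<noteq> k \<Longrightarrow>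
        s i j * e j k = e i k * s i j"
    and ee3: "i \<in> I \<Longrightarrow> j \<in> I \<Longrightarrow> k \<in> I \<Longrightarrow> i \<noteq> j \<Longrightarrow> j \<noteq> k \<Longrightarrow> i \<noteq> k \<Longrightarrow>
        e i j * e j k = e i j * s i k"
    and ss4: "i \<in> I \<Longrightarrow> j \<in> I \<Longrightarrow> k \<in> I \<Longrightarrow> l \<in> I \<Longrightarrow> distinct [i, j, k, l] \<Longrightarrow>
        s i j * s k l = s k l * s i j"
    and se4: "i \<in> I \<Longrightarrow> j \<in> I \<Longrightarrow> k \<in> I \<Longrightarrow> l \<in> I \<Longrightarrow> distinct [i, j, k, l] \<Longrightarrow>
        s i j * e k l = e k l * s i j"
    and ee4: "i \<in> I \<Longrightarrow> j \<in> I \<Longrightarrow> k \<in> I \<Longrightarrow> l \<in> I \<Longrightarrow> distinct [i, j, k, l] \<Longrightarrow>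
        e i j * e k l = e k l * e i j"
begin

lemma c_0: "c 0 = 0"
  using c_add[of 0 0] by simp

lemma c_minus: "c (- a) = - c a"
  using c_add[of a "- a"] by (simp add: c_0 eq_neg_iff_add_eq_0 add.commute)

lemma c_diff: "c (a - b) = c a - c b"
  using c_add[of a "- b"] by (simp add: c_minus)

lemma ee3': "i \<in> I \<Longrightarrow> j \<in> I \<Longrightarrow> k \<in> I \<Longrightarrow> i \<noteq> j \<Longrightarrow> j \<noteq> k \<Longrightarrow> i \<noteq> k \<Longrightarrow>
        e i j * e j k = s i k * e j k"
  using ee3[of i j k] se3[of i k j] by (simp add: e_sym[of k j])

text \<open>\<open>x r\<close> is the \<open>r\<close>-th Jucys--Murphy element; \<open>jj i
  r\<close> is a summand of it.\<close>

definition jj :: "nat \<Rightarrow> nat \<Rightarrow> 'a" where "jj i r = s i r - e i r"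

lemma jj_sym: "jj i r = jj r i"
  unfolding jj_def by (subst s_sym, subst e_sym) (rule refl)

definition x :: "nat \<Rightarrow> 'a" where
  "x r = c ((w - 1) / 2) + (\<Sum>i\<in>{1..<r}. jj i r)"

definition commutes :: "'a \<Rightarrow> 'a \<Rightarrow> bool" where "commutes a b \<longleftrightarrow> a * b = b * a"

lemma commutes_sym: "commutes a b \<Longrightarrow> commutes b a" by (simp add: commutes_def)
lemma commutes_add: "commutes a b \<Longrightarrow> commutes a d \<Longrightarrow> commutes a (b + d)"
  by (simp add: commutes_def algebra_simps)
lemma commutes_diff: "commutes a b \<Longrightarrow> commutes a d \<Longrightarrow> commutes a (b - d)"
  by (simp add: commutes_def algebra_simps)
lemma commutes_mult: "commutes a b \<Longrightarrow> commutes a d \<Longrightarrow> commutes a (b * d)"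
  by (metis commutes_def mult.assoc)
lemma commutes_c: "commutes a (c k)" by (simp add: commutes_def c_central)
lemma commutes_1: "commutes a 1" by (simp add: commutes_def)
lemma commutes_0: "commutes a 0" by (simp add: commutes_def)
lemma commutes_sum: "(\<And>i. i \<in> J \<Longrightarrow> commutes a (f i)) \<Longrightarrow> commutes a (sum f J)"
  by (induction J rule: infinite_finite_induct) (simp_all add: commutes_0 commutes_add)
lemmas commutes_intros = commutes_add commutes_diff commutes_mult commutes_c commutes_1 commutes_0

lemma commutes_prod_list:
  "(\<And>y. y \<in> set ys \<Longrightarrow> commutes a y) \<Longrightarrow> commutes a (prod_list ys)"
  by (induction ys) (simp_all add: commutes_intros)

text \<open>Conjugation by \<open>s i j\<close> permutes the summands of \<open>x n\<close>.
  Together with the analogue for \<open>e i j\<close>, where the two affected summands are killed,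
  this shows that \<open>x n\<close> commutes with everything on the first \<open>n - 1\<close>
  strands, in particular with the smaller Jucys--Murphy elements.\<close>

lemma s_x_commutes:
  assumes "1 \<le> i" "i < j" "j < n" "{1..n} \<subseteq> I"
  shows "commutes (s i j) (x n)"
proof -
  have I: "i \<in> I" "j \<in> I" "n \<in> I" using assms by auto
  have 1: "commutes (s i j) (jj k n)" if "k \<in> {1..<n} - {i, j}" for k
  proof -
    have "k \<in> I" using that assms by auto
    then show ?thesis using that assms I ss4[of i j k n] se4[of i j k n]
      unfolding commutes_def jj_def by (auto simp: algebra_simps)
  qed
  have 2: "s i j * jj i n = jj j n * s i j" "s i j * jj j n = jj i n * s i j"
    using assms I ss3[of i j n] ss3[of j i n] se3[of i j n] se3[of j i n] s_sym[of i j]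
    unfolding jj_def by (simp_all add: algebra_simps)
  have "(\<Sum>k\<in>{1..<n}. jj k n) = jj i n + (jj j n + (\<Sum>k\<in>{1..<n} - {i, j}. jj k n))"
    using assms
    by (subst sum.remove[of _ i], simp, simp, subst sum.remove[of _ j], simp, simp)
       (simp add: Diff_insert2[symmetric] insert_commute)
  then have "x n = c ((w - 1) / 2) + ((jj i n + jj j n) + (\<Sum>k\<in>{1..<n} - {i, j}. jj k n))"
    by (simp add: x_def add.assoc)
  moreover have "commutes (s i j) (jj i n + jj j n)"
    unfolding commutes_def using 2 by (simp add: algebra_simps)
  ultimately show ?thesis
    by (auto intro!: commutes_intros commutes_sum 1)
qed

lemma e_kills:
  assumes "i \<in> I" "j \<in> I" "n \<in> I" "distinct [i, j, n]"
  shows "e i j * (jj i n + jj j n) = 0" "(jj i n + jj j n) * e i j = 0"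
  using assms ee3[of i j n] ee3[of j i n] ee3'[of n i j] ee3'[of n j i] e_sym s_sym
  unfolding jj_def by (simp_all add: algebra_simps)

lemma e_x_commutes:
  assumes "1 \<le> i" "i < j" "j < n" "{1..n} \<subseteq> I"
  shows "commutes (e i j) (x n)"
proof -
  have I: "i \<in> I" "j \<in> I" "n \<in> I" using assms by auto
  have 1: "commutes (e i j) (jj k n)" if "k \<in> {1..<n} - {i, j}" for k
  proof -
    have "k \<in> I" using that assms by auto
    then show ?thesis using that assms I ee4[of i j k n] se4[of k n i j]
      unfolding commutes_def jj_def by (auto simp: algebra_simps)
  qed
  have "(\<Sum>k\<in>{1..<n}. jj k n) = jj i n + (jj j n + (\<Sum>k\<in>{1..<n} - {i, j}. jj k n))"
    using assms
    by (subst sum.remove[of _ i], simp, simp, subst sum.remove[of _ j], simp, simp)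
       (simp add: Diff_insert2[symmetric] insert_commute)
  then have "x n = c ((w - 1) / 2) + ((jj i n + jj j n) + (\<Sum>k\<in>{1..<n} - {i, j}. jj k n))"
    by (simp add: x_def add.assoc)
  moreover have "commutes (e i j) (jj i n + jj j n)"
    unfolding commutes_def using e_kills[of i j n] I assms by simp
  ultimately show ?thesis
    by (auto intro!: commutes_intros commutes_sum 1)
qed

lemma x_x_commutes:
  assumes "r < n" "{1..n} \<subseteq> I"
  shows "commutes (x n) (x r)"
proof -
  have "commutes (x n) (jj i r)" if "i \<in> {1..<r}" for i
    unfolding jj_def using that assms
    by (intro commutes_diff commutes_sym[OF s_x_commutes] commutes_sym[OF e_x_commutes]) auto
  then show ?thesis
    unfolding x_def[of r] by (intro commutes_add commutes_c commutes_sum)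
qed

lemma x_Suc:
  assumes "1 \<le> n" "{1..Suc n} \<subseteq> I"
  shows "x (Suc n) = s n (Suc n) * x n * s n (Suc n) + s n (Suc n) - e n (Suc n)"
proof -
  let ?s = "s n (Suc n)"
  have I: "n \<in> I" "Suc n \<in> I" using assms by auto
  have "?s * jj k n * ?s = jj k (Suc n)" if "k \<in> {1..<n}" for k
  proof -
    have "k \<in> I" using that assms by auto
    then have "?s * s k n = s k (Suc n) * ?s" "?s * e k n = e k (Suc n) * ?s"
      using that I ss3[of "Suc n" n k] se3[of "Suc n" n k] s_sym e_sym by force+
    then have "?s * jj k n * ?s = jj k (Suc n) * (?s * ?s)"
      unfolding jj_def by (simp add: algebra_simps)
    then show ?thesis using ss[of n "Suc n"] I by simp
  qed
  moreover have "?s * c k * ?s = c k" for k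
  proof -
    have "?s * c k * ?s = c k * (?s * ?s)" by (simp only: c_central[symmetric] mult.assoc)
    then show ?thesis using ss[of n "Suc n"] I by simp
  qed
  ultimately have "?s * x n * ?s = c ((w - 1) / 2) + (\<Sum>k\<in>{1..<n}. jj k (Suc n))"
    unfolding x_def by (simp add: algebra_simps sum_distrib_left sum_distrib_right)
  moreover have "(\<Sum>k\<in>{1..<Suc n}. jj k (Suc n)) = (\<Sum>k\<in>{1..<n}. jj k (Suc n)) + jj n (Suc n)"
    using assms by simp
  ultimately show ?thesis
    unfolding x_def by (simp add: jj_def algebra_simps)
qed

lemma e_x_x:
  assumes "1 \<le> n" "{1..Suc n} \<subseteq> I"
  shows "e n (Suc n) * (x n + x (Suc n)) = 0" "(x n + x (Suc n)) * e n (Suc n) = 0"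
proof -
  let ?e = "e n (Suc n)"
  have I: "n \<in> I" "Suc n \<in> I" using assms by auto
  have split: "x n + x (Suc n) =
      c (w - 1) + (\<Sum>k\<in>{1..<n}. jj n k + jj (Suc n) k) + jj n (Suc n)"
  proof -
    have "c ((w - 1) / 2) + c ((w - 1) / 2) = c (w - 1)"
    proof -
      have "(w - 1) / 2 + (w - 1) / 2 = w - 1"
        using two by (metis add_divide_distrib mult_2 nonzero_mult_div_cancel_left)
      then show ?thesis by (metis c_add)
    qed
    moreover have "(\<Sum>k\<in>{1..<n}. jj k n) + (\<Sum>k\<in>{1..<n}. jj k (Suc n)) =
        (\<Sum>k\<in>{1..<n}. jj n k + jj (Suc n) k)"
      unfolding sum.distrib[symmetric] by (intro sum.cong refl arg_cong2[of _ _ _ _ "(+)"] jj_sym)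
    moreover have "(\<Sum>k\<in>{1..<Suc n}. jj k (Suc n)) = (\<Sum>k\<in>{1..<n}. jj k (Suc n)) + jj n (Suc n)"
      using assms by simp
    ultimately show ?thesis
      unfolding x_def by (simp add: add_ac)
  qed
  have z: "?e * (jj n k + jj (Suc n) k) = 0" "(jj n k + jj (Suc n) k) * ?e = 0"
    if "k \<in> {1..<n}" for k
    using that assms I e_kills[of n "Suc n" k] by (auto simp: subset_eq)
  let ?S = "\<Sum>k\<in>{1..<n}. jj n k + jj (Suc n) k"
  have 1: "?e * (c (w - 1) + jj n (Suc n)) = 0" "(c (w - 1) + jj n (Suc n)) * ?e = 0"
    using ee[of n "Suc n"] es[of n "Suc n"] se[of n "Suc n"] I
    unfolding jj_def c_diff c_1 distrib_left distrib_right left_diff_distrib right_diff_distrib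
      c_central[of w, symmetric, of ?e] by simp_all
  have 2: "?e * ?S = 0" "?S * ?e = 0"
    unfolding sum_distrib_left sum_distrib_right by (rule sum.neutral, use z in blast)+
  have "?e * (x n + x (Suc n)) = ?e * (c (w - 1) + jj n (Suc n)) + ?e * ?S"
    unfolding split distrib_left by (simp only: add_ac)
  then show "?e * (x n + x (Suc n)) = 0" by (simp only: 1 2 add_0_left)
  have "(x n + x (Suc n)) * ?e = (c (w - 1) + jj n (Suc n)) * ?e + ?S * ?e"
    unfolding split distrib_right by (simp only: add_ac)
  then show "(x n + x (Suc n)) * ?e = 0" by (simp only: 1 2 add_0_left)
qed

end

section \<open>The Yang--Baxter equation\<close>

lemma one_div_cancel: "z \<noteq> 0 \<Longrightarrow> 1 / z * z = (1::'k::field)"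
  by simp

lemma unitarity_coeff:
  fixes a z b k b' w :: "'k::field"
  assumes "a * z = 1" "b * (z - k) = 1" "b' * (- z - k) = 1" "w = 2 * k + 2"
  shows "b + b' - a * b' + b * a + w * b * b' = 0"
  using assms by algebra

lemma yang_baxter_coeffs:
  fixes y z k w a1 a2 a3 b1 b2 b3 :: "'k::field"
  assumes "a1 * y = -1" "a2 * (y + z) = -1" "a3 * z = -1"
    "b1 * (y - k) = 1" "b2 * (y + z - k) = 1" "b3 * (z - k) = 1" "w = 2 * k + 2"
  shows "a1 * a2 + a2 * a3 - a1 * a3 = 0"
    "a2 * b3 + a1 * a2 * b3 + b1 * b3 + a2 * b1 + a2 * a3 * b1 + a2 * b1 * b3 * w
      + b1 * b2 * b3 - a1 * a3 * b2 = 0"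
    "a3 * b2 - b1 * b2 - a3 * b1 = 0"
    "b2 * b3 + a1 * b3 - a1 * b2 = 0"
  using assms by algebra+

context brauer_relations
begin

definition scl :: "'k \<Rightarrow> 'a \<Rightarrow> 'a" where "scl k X = c k * X"

lemma scl_left: "scl k X * Y = scl k (X * Y)" by (simp add: scl_def mult.assoc)
lemma scl_right: "X * scl k Y = scl k (X * Y)"
  unfolding scl_def by (metis c_central mult.assoc)
lemma scl_scl: "scl a (scl b X) = scl (a * b) X" by (simp add: scl_def c_mult mult.assoc)
lemma scl_add: "scl (a + b) X = scl a X + scl b X" by (simp add: scl_def c_add algebra_simps)
lemma scl_diff: "scl (a - b) X = scl a X - scl b X" by (simp add: scl_def c_diff algebra_simps)
lemma scl_plus: "scl a (X + Y) = scl a X + scl a Y" by (simp add: scl_def algebra_simps)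
lemma scl_minus: "scl a (X - Y) = scl a X - scl a Y" by (simp add: scl_def algebra_simps)
lemma scl_0: "scl 0 X = 0" by (simp add: scl_def c_0)
lemma scl_0_right: "scl a 0 = 0" by (simp add: scl_def)
lemma scl_1: "scl 1 X = X" by (simp add: scl_def c_1)
lemma scl_uminus: "scl (- a) X = - scl a X" by (simp add: scl_def c_minus)

text \<open>The Yang--Baxter equation for three strands, with the coefficients of the factors
  \<open>1 + a s + b e\<close> as unknowns. Expanding both sides leaves the four commutators
  below, so the equation holds as soon as four scalar identities do. Here \<open>P\<close>,
  \<open>Q\<close>, \<open>R\<close> are the three transpositions and \<open>A\<close>,
  \<open>B\<close>, \<open>C\<close> the corresponding cap-cup elements.\<close>

lemma ybe_aux:
  fixes P Q R A B C :: 'a and a1 a2 a3 b1 b2 b3 :: 'k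
  assumes
    pairs: "P * P = 1"
      "P * R = Q * P"
      "P * A = A"
      "P * B = C * B"
      "P * C = B * C"
      "Q * Q = 1"
      "Q * R = P * Q"
      "Q * A = C * A"
      "Q * B = B"
      "Q * C = A * C"
      "R * P = P * Q"
      "R * Q = Q * P"
      "R * R = 1"
      "R * A = B * A"
      "R * B = A * B"
      "R * C = C"
      "A * P = A"
      "A * Q = A * C"
      "A * R = A * B"
      "A * A = scl w (A)"
      "B * P = B * C"
      "B * Q = B"
      "B * R = B * A"
      "B * B = scl w (B)"
      "C * P = C * B"
      "C * Q = C * A"
      "C * R = C"
      "C * C = scl w (C)"
    and coeffs: "a1 * a2 + a2 * a3 - a1 * a3 = 0"
      "a2 * b3 + a1 * a2 * b3 + b1 * b3 + a2 * b1 + a2 * a3 * b1 + a2 * b1 * b3 * w + b1 * b2 * b3 - a1 * a3 * b2 = 0"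
      "a3 * b2 - b1 * b2 - a3 * b1 = 0"
      "b2 * b3 + a1 * b3 - a1 * b2 = 0"
  shows "(1 + scl a1 P + scl b1 A) * ((1 + scl a2 Q + scl b2 B) * (1 + scl a3 R + scl b3 C)) =
    (1 + scl a3 R + scl b3 C) * ((1 + scl a2 Q + scl b2 B) * (1 + scl a1 P + scl b1 A))"
proof -
  note pair_simps = pairs scl_left scl_right mult_1_left mult_1_right
  have trip1:
    "P * (P * Q) = Q"
    "Q * (P * Q) = R"
    "R * (P * Q) = P"
    "A * (P * Q) = A * C"
    "B * (P * Q) = B * A"
    "C * (P * Q) = C * B"
    "P * (Q * P) = R"
    "Q * (Q * P) = P"
    "R * (Q * P) = Q"
    "A * (Q * P) = A * B"
    "B * (Q * P) = B * C"
    "C * (Q * P) = C * A"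
    "P * (A * C) = A * C"
    "Q * (A * C) = C"
    "A * (A * C) = scl w (A * C)"
    "B * (A * C) = B * C"
    "Q * (C * A) = A"
    "R * (C * A) = C * A"
    "B * (C * A) = B * A"
    "C * (C * A) = scl w (C * A)"
    "P * (A * B) = A * B"
    "R * (A * B) = B"
    "A * (A * B) = scl w (A * B)"
    "C * (A * B) = C * B"
    "Q * (B * A) = B * A"
    "R * (B * A) = A"
    "B * (B * A) = scl w (B * A)"
    "C * (B * A) = C * A"
    "P * (B * C) = C"
    "Q * (B * C) = B * C"
    "A * (B * C) = A * C"
    "B * (B * C) = scl w (B * C)"
    "P * (C * B) = B"
    "R * (C * B) = C * B"
    "A * (C * B) = A * B"
    "C * (C * B) = scl w (C * B)"
  proof -
    have "P * (P * Q) = (P * P) * Q" unfolding mult.assoc by (simp only: pairs)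
    then show "P * (P * Q) = Q" by (simp only: pair_simps)
    have "Q * (P * Q) = (Q * Q) * R" unfolding mult.assoc by (simp only: pairs)
    then show "Q * (P * Q) = R" by (simp only: pair_simps)
    have "R * (P * Q) = (R * R) * P" unfolding mult.assoc by (simp only: pairs)
    then show "R * (P * Q) = P" by (simp only: pair_simps)
    have "A * (P * Q) = (A * P) * Q" unfolding mult.assoc by (simp only: pairs)
    then show "A * (P * Q) = A * C" by (simp only: pair_simps)
    have "B * (P * Q) = (B * Q) * R" unfolding mult.assoc by (simp only: pairs)
    then show "B * (P * Q) = B * A" by (simp only: pair_simps)
    have "C * (P * Q) = (C * R) * P" unfolding mult.assoc by (simp only: pairs)
    then show "C * (P * Q) = C * B" by (simp only: pair_simps)
    have "P * (Q * P) = (P * P) * R" unfolding mult.assoc by (simp only: pairs)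
    then show "P * (Q * P) = R" by (simp only: pair_simps)
    have "Q * (Q * P) = (Q * Q) * P" unfolding mult.assoc by (simp only: pairs)
    then show "Q * (Q * P) = P" by (simp only: pair_simps)
    have "R * (Q * P) = (R * R) * Q" unfolding mult.assoc by (simp only: pairs)
    then show "R * (Q * P) = Q" by (simp only: pair_simps)
    have "A * (Q * P) = (A * P) * R" unfolding mult.assoc by (simp only: pairs)
    then show "A * (Q * P) = A * B" by (simp only: pair_simps)
    have "B * (Q * P) = (B * Q) * P" unfolding mult.assoc by (simp only: pairs)
    then show "B * (Q * P) = B * C" by (simp only: pair_simps)
    have "C * (Q * P) = (C * R) * Q" unfolding mult.assoc by (simp only: pairs)
    then show "C * (Q * P) = C * A" by (simp only: pair_simps)
    have "P * (A * C) = (P * A) * Q" unfolding mult.assoc by (simp only: pairs)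
    then show "P * (A * C) = A * C" by (simp only: pair_simps)
    have "Q * (A * C) = (Q * Q) * C" unfolding mult.assoc by (simp only: pairs)
    then show "Q * (A * C) = C" by (simp only: pair_simps)
    have "A * (A * C) = (A * A) * Q" unfolding mult.assoc by (simp only: pairs)
    then show "A * (A * C) = scl w (A * C)" by (simp only: pair_simps)
    have "B * (A * C) = (B * Q) * C" unfolding mult.assoc by (simp only: pairs)
    then show "B * (A * C) = B * C" by (simp only: pair_simps)
    have "Q * (C * A) = (Q * Q) * A" unfolding mult.assoc by (simp only: pairs)
    then show "Q * (C * A) = A" by (simp only: pair_simps)
    have "R * (C * A) = (R * C) * Q" unfolding mult.assoc by (simp only: pairs)
    then show "R * (C * A) = C * A" by (simp only: pair_simps)
    have "B * (C * A) = (B * Q) * A" unfolding mult.assoc by (simp only: pairs)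
    then show "B * (C * A) = B * A" by (simp only: pair_simps)
    have "C * (C * A) = (C * C) * Q" unfolding mult.assoc by (simp only: pairs)
    then show "C * (C * A) = scl w (C * A)" by (simp only: pair_simps)
    have "P * (A * B) = (P * A) * R" unfolding mult.assoc by (simp only: pairs)
    then show "P * (A * B) = A * B" by (simp only: pair_simps)
    have "R * (A * B) = (R * R) * B" unfolding mult.assoc by (simp only: pairs)
    then show "R * (A * B) = B" by (simp only: pair_simps)
    have "A * (A * B) = (A * A) * R" unfolding mult.assoc by (simp only: pairs)
    then show "A * (A * B) = scl w (A * B)" by (simp only: pair_simps)
    have "C * (A * B) = (C * R) * B" unfolding mult.assoc by (simp only: pairs)
    then show "C * (A * B) = C * B" by (simp only: pair_simps)
    have "Q * (B * A) = (Q * B) * R" unfolding mult.assoc by (simp only: pairs)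
    then show "Q * (B * A) = B * A" by (simp only: pair_simps)
    have "R * (B * A) = (R * R) * A" unfolding mult.assoc by (simp only: pairs)
    then show "R * (B * A) = A" by (simp only: pair_simps)
    have "B * (B * A) = (B * B) * R" unfolding mult.assoc by (simp only: pairs)
    then show "B * (B * A) = scl w (B * A)" by (simp only: pair_simps)
    have "C * (B * A) = (C * R) * A" unfolding mult.assoc by (simp only: pairs)
    then show "C * (B * A) = C * A" by (simp only: pair_simps)
    have "P * (B * C) = (P * P) * C" unfolding mult.assoc by (simp only: pairs)
    then show "P * (B * C) = C" by (simp only: pair_simps)
    have "Q * (B * C) = (Q * B) * P" unfolding mult.assoc by (simp only: pairs)
    then show "Q * (B * C) = B * C" by (simp only: pair_simps)
    have "A * (B * C) = (A * P) * C" unfolding mult.assoc by (simp only: pairs)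
    then show "A * (B * C) = A * C" by (simp only: pair_simps)
    have "B * (B * C) = (B * B) * P" unfolding mult.assoc by (simp only: pairs)
    then show "B * (B * C) = scl w (B * C)" by (simp only: pair_simps)
    have "P * (C * B) = (P * P) * B" unfolding mult.assoc by (simp only: pairs)
    then show "P * (C * B) = B" by (simp only: pair_simps)
    have "R * (C * B) = (R * C) * P" unfolding mult.assoc by (simp only: pairs)
    then show "R * (C * B) = C * B" by (simp only: pair_simps)
    have "A * (C * B) = (A * P) * B" unfolding mult.assoc by (simp only: pairs)
    then show "A * (C * B) = A * B" by (simp only: pair_simps)
    have "C * (C * B) = (C * C) * P" unfolding mult.assoc by (simp only: pairs)
    then show "C * (C * B) = scl w (C * B)" by (simp only: pair_simps)
  qed
  have trip2:
    "R * (A * C) = B * C"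
    "C * (A * C) = C"
    "P * (C * A) = B * A"
    "A * (C * A) = A"
    "Q * (A * B) = C * B"
    "B * (A * B) = B"
    "P * (B * A) = C * A"
    "A * (B * A) = A"
    "R * (B * C) = A * C"
    "C * (B * C) = C"
    "Q * (C * B) = A * B"
    "B * (C * B) = B"
  proof -
    have "R * (A * C) = (R * Q) * C" unfolding mult.assoc by (simp only: pairs)
    also have "\<dots> = (Q * P) * C" by (simp only: pairs)
    also have "\<dots> = Q * (B * C)" unfolding mult.assoc by (simp only: pairs)
    finally show "R * (A * C) = B * C" by (simp only: pair_simps trip1)
    have "C * (A * C) = (C * Q) * C" unfolding mult.assoc by (simp only: pairs)
    also have "\<dots> = (Q * A) * C" by (simp only: pairs)
    also have "\<dots> = Q * (A * C)" unfolding mult.assoc by (simp only: pairs)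
    finally show "C * (A * C) = C" by (simp only: pair_simps trip1)
    have "P * (C * A) = (P * Q) * A" unfolding mult.assoc by (simp only: pairs)
    also have "\<dots> = (R * P) * A" by (simp only: pairs)
    also have "\<dots> = R * (A)" unfolding mult.assoc by (simp only: pairs)
    finally show "P * (C * A) = B * A" by (simp only: pair_simps trip1)
    have "A * (C * A) = (A * Q) * A" unfolding mult.assoc by (simp only: pairs)
    also have "\<dots> = (Q * C) * A" by (simp only: pairs)
    also have "\<dots> = Q * (C * A)" unfolding mult.assoc by (simp only: pairs)
    finally show "A * (C * A) = A" by (simp only: pair_simps trip1)
    have "Q * (A * B) = (Q * R) * B" unfolding mult.assoc by (simp only: pairs)
    also have "\<dots> = (R * P) * B" by (simp only: pairs)
    also have "\<dots> = R * (C * B)" unfolding mult.assoc by (simp only: pairs)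
    finally show "Q * (A * B) = C * B" by (simp only: pair_simps trip1)
    have "B * (A * B) = (B * R) * B" unfolding mult.assoc by (simp only: pairs)
    also have "\<dots> = (R * A) * B" by (simp only: pairs)
    also have "\<dots> = R * (A * B)" unfolding mult.assoc by (simp only: pairs)
    finally show "B * (A * B) = B" by (simp only: pair_simps trip1)
    have "P * (B * A) = (P * R) * A" unfolding mult.assoc by (simp only: pairs)
    also have "\<dots> = (R * Q) * A" by (simp only: pairs)
    also have "\<dots> = R * (C * A)" unfolding mult.assoc by (simp only: pairs)
    finally show "P * (B * A) = C * A" by (simp only: pair_simps trip1)
    have "A * (B * A) = (A * R) * A" unfolding mult.assoc by (simp only: pairs)
    also have "\<dots> = (R * B) * A" by (simp only: pairs)
    also have "\<dots> = R * (B * A)" unfolding mult.assoc by (simp only: pairs)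
    finally show "A * (B * A) = A" by (simp only: pair_simps trip1)
    have "R * (B * C) = (R * P) * C" unfolding mult.assoc by (simp only: pairs)
    also have "\<dots> = (Q * R) * C" by (simp only: pairs)
    also have "\<dots> = Q * (C)" unfolding mult.assoc by (simp only: pairs)
    finally show "R * (B * C) = A * C" by (simp only: pair_simps trip1)
    have "C * (B * C) = (C * P) * C" unfolding mult.assoc by (simp only: pairs)
    also have "\<dots> = (P * B) * C" by (simp only: pairs)
    also have "\<dots> = P * (B * C)" unfolding mult.assoc by (simp only: pairs)
    finally show "C * (B * C) = C" by (simp only: pair_simps trip1)
    have "Q * (C * B) = (Q * P) * B" unfolding mult.assoc by (simp only: pairs)
    also have "\<dots> = (R * Q) * B" by (simp only: pairs)
    also have "\<dots> = R * (B)" unfolding mult.assoc by (simp only: pairs)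
    finally show "Q * (C * B) = A * B" by (simp only: pair_simps trip1)
    have "B * (C * B) = (B * P) * B" unfolding mult.assoc by (simp only: pairs)
    also have "\<dots> = (P * C) * B" by (simp only: pairs)
    also have "\<dots> = P * (C * B)" unfolding mult.assoc by (simp only: pairs)
    finally show "B * (C * B) = B" by (simp only: pair_simps trip1)
  qed
  let ?L = "(1 + scl a1 P + scl b1 A) * ((1 + scl a2 Q + scl b2 B) * (1 + scl a3 R + scl b3 C))"
  let ?R = "(1 + scl a3 R + scl b3 C) * ((1 + scl a2 Q + scl b2 B) * (1 + scl a1 P + scl b1 A))"
  have "?L - ?R = scl (a1 * a2 + a2 * a3 - a1 * a3) (P * Q - Q * P) + scl (a2 * b3 + a1 * a2 * b3 + b1 * b3 + a2 * b1 + a2 * a3 * b1 + a2 * b1 * b3 * w + b1 * b2 * b3 - a1 * a3 * b2) (A * C - C * A)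
     + scl (a3 * b2 - b1 * b2 - a3 * b1) (B * A - A * B) + scl (b2 * b3 + a1 * b3 - a1 * b2) (B * C - C * B)"
    by (simp only: distrib_left distrib_right mult_1_left mult_1_right scl_left scl_right scl_scl scl_plus
        scl_minus scl_add scl_diff pairs trip1 trip2 mult_ac) (simp add: mult_ac)
  then show ?thesis unfolding coeffs by (simp add: scl_0)
qed

text \<open>The rational solution of the Yang--Baxter equation for the Brauer algebra. With the
  shift \<open>kap\<close> it is also unitary, \<open>rho_rho_inverse\<close>.\<close>

definition kap :: 'k where "kap = w / 2 - 1"

definition rho :: "nat \<Rightarrow> nat \<Rightarrow> 'k \<Rightarrow> 'a" where
  "rho i j z = 1 - scl (1 / z) (s i j) + scl (1 / (z - kap)) (e i j)"

lemma rho_sym: "rho i j z = rho j i z"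
  unfolding rho_def by (subst s_sym, subst e_sym) (rule refl)

lemma w_kap: "w = 2 * kap + 2"
  using two by (simp add: kap_def right_diff_distrib)

lemma rho_rho_inverse:
  assumes "i \<in> I" "j \<in> I" "i \<noteq> j" "z \<noteq> 0" "z \<noteq> kap" "z \<noteq> - kap"
  shows "rho i j z * rho i j (- z) = c (1 - 1 / z\<^sup>2)"
proof -
  define a where "a = 1 / z"
  define b where "b = 1 / (z - kap)"
  define b' where "b' = 1 / (- z - kap)"
  have R: "rho i j z = 1 - scl a (s i j) + scl b (e i j)"
    "rho i j (- z) = 1 + scl a (s i j) + scl b' (e i j)"
    by (simp_all add: rho_def a_def b_def b'_def scl_uminus)
  have "rho i j z * rho i j (- z) =
      scl (1 - a * a) 1 + scl (b + b' - a * b' + b * a + w * b * b') (e i j)"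
    unfolding R
    by (simp only: distrib_left distrib_right left_diff_distrib right_diff_distrib mult_1_left mult_1_right
        scl_left scl_right scl_scl ss[OF assms(1-3)] ee[OF assms(1-3)] se[OF assms(1-3)] es[OF assms(1-3)]
        scl_def[of w, symmetric] scl_plus scl_minus scl_add scl_diff scl_1)
       (simp add: algebra_simps)
  moreover have "b + b' - a * b' + b * a + w * b * b' = 0"
  proof -
    have "- z - kap \<noteq> 0"
    proof
      assume "- z - kap = 0"
      then have "- z = kap" by (simp only: right_minus_eq)
      then have "z = - kap" by (simp only: minus_minus flip: \<open>- z = kap\<close>)
      then show False using assms(6) by contradiction
    qed
    then have "b' * (- z - kap) = 1" unfolding b'_def by (rule one_div_cancel)
    moreover have "a * z = 1" unfolding a_def using assms(4) by (rule one_div_cancel)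
    moreover have "z - kap \<noteq> 0" using assms(5) by simp
    then have "b * (z - kap) = 1" unfolding b_def by (rule one_div_cancel)
    ultimately show ?thesis using w_kap by (intro unitarity_coeff)
  qed
  ultimately show ?thesis by (simp add: scl_def c_0 a_def power2_eq_square)
qed

lemma yang_baxter:
  assumes "i \<in> I" "j \<in> I" "k \<in> I" "i \<noteq> j" "j \<noteq> k" "i \<noteq> k"
    and nz: "y \<noteq> 0" "z \<noteq> 0" "y + z \<noteq> 0" "y \<noteq> kap" "z \<noteq> kap" "y + z \<noteq> kap"
  shows "rho i j y * (rho i k (y + z) * rho j k z) = rho j k z * (rho i k (y + z) * rho i j y)"
proof -
  define a1 where "a1 = - (1 / y)"
  define a2 where "a2 = - (1 / (y + z))"
  define a3 where "a3 = - (1 / z)"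
  define b1 where "b1 = 1 / (y - kap)"
  define b2 where "b2 = 1 / (y + z - kap)"
  define b3 where "b3 = 1 / (z - kap)"
  have R: "rho i j y = 1 + scl a1 (s i j) + scl b1 (e i j)"
    "rho i k (y + z) = 1 + scl a2 (s i k) + scl b2 (e i k)"
    "rho j k z = 1 + scl a3 (s j k) + scl b3 (e j k)"
    by (simp_all add: rho_def a1_def a2_def a3_def b1_def b2_def b3_def scl_uminus)
  have nz': "y \<noteq> 0" "z \<noteq> 0" "y + z \<noteq> 0" "y - kap \<noteq> 0" "z - kap \<noteq> 0" "y + z - kap \<noteq> 0"
    using nz by auto
  note D = a1_def a2_def a3_def b1_def b2_def b3_def
  note sy = s_sym[of j i] s_sym[of k i] s_sym[of k j] e_sym[of j i] e_sym[of k i] e_sym[of k j]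
  have F: "s p q * s q r = s p r * s p q" "s p q * e q r = e p r * s p q"
    "e p q * e q r = e p q * s p r" "e p q * e q r = s p r * e q r"
    if "p \<in> I \<and> q \<in> I \<and> r \<in> I \<and> p \<noteq> q \<and> q \<noteq> r \<and> p \<noteq> r" for p q r
    using that ss3 se3 ee3 ee3' by blast+
  have m: "i \<in> I \<and> j \<in> I \<and> k \<in> I \<and> i \<noteq> j \<and> j \<noteq> k \<and> i \<noteq> k"
    "i \<in> I \<and> k \<in> I \<and> j \<in> I \<and> i \<noteq> k \<and> k \<noteq> j \<and> i \<noteq> j"
    "j \<in> I \<and> i \<in> I \<and> k \<in> I \<and> j \<noteq> i \<and> i \<noteq> k \<and> j \<noteq> k"
    "j \<in> I \<and> k \<in> I \<and> i \<in> I \<and> j \<noteq> k \<and> k \<noteq> i \<and> j \<noteq> i"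
    "k \<in> I \<and> i \<in> I \<and> j \<in> I \<and> k \<noteq> i \<and> i \<noteq> j \<and> k \<noteq> j"
    "k \<in> I \<and> j \<in> I \<and> i \<in> I \<and> k \<noteq> j \<and> j \<noteq> i \<and> k \<noteq> i"
    using assms by auto
  note G = F[OF m(1), unfolded sy] F[OF m(2), unfolded sy] F[OF m(3), unfolded sy]
    F[OF m(4), unfolded sy] F[OF m(5), unfolded sy] F[OF m(6), unfolded sy]
  note H = ss[OF assms(1,2,4)] ss[OF assms(1,3,6)] ss[OF assms(2,3,5)]
    se[OF assms(1,2,4)] se[OF assms(1,3,6)] se[OF assms(2,3,5)]
    es[OF assms(1,2,4)] es[OF assms(1,3,6)] es[OF assms(2,3,5)]
    ee[OF assms(1,2,4), folded scl_def] ee[OF assms(1,3,6), folded scl_def] ee[OF assms(2,3,5), folded scl_def]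
  have inv: "a1 * y = -1" "a2 * (y + z) = -1" "a3 * z = -1"
    "b1 * (y - kap) = 1" "b2 * (y + z - kap) = 1" "b3 * (z - kap) = 1"
    unfolding D mult_minus_left by (simp_all only: one_div_cancel[OF nz'(1)]
      one_div_cancel[OF nz'(2)] one_div_cancel[OF nz'(3)]
      one_div_cancel[OF nz'(4)] one_div_cancel[OF nz'(5)]
      one_div_cancel[OF nz'(6)])
  note coeffs = yang_baxter_coeffs[OF inv w_kap]
  show ?thesis unfolding R
    by (rule ybe_aux; (rule coeffs H | metis G))
qed

lemma commutes_rho:
  assumes "commutes Y (s i j)" "commutes Y (e i j)"
  shows "commutes Y (rho i j z)"
  unfolding rho_def scl_def by (intro commutes_intros assms)

lemma rho_commutes:
  assumes "i \<in> I" "j \<in> I" "k \<in> I" "l \<in> I" "distinct [i, j, k, l]"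
  shows "commutes (rho i j y) (rho k l z)"
proof -
  have "distinct [k, l, i, j]" using assms(5) by auto
  then have "commutes (s k l) (s i j)" "commutes (s k l) (e i j)"
    "commutes (e k l) (s i j)" "commutes (e k l) (e i j)"
    using ss4[OF assms] se4[OF assms] ee4[OF assms] se4[of k l i j] assms(1-4)
    by (simp_all add: commutes_def)
  then have "commutes (s k l) (rho i j y)" "commutes (e k l) (rho i j y)"
    by (simp_all add: commutes_rho)
  then show ?thesis by (rule commutes_rho[OF commutes_sym commutes_sym])
qed

end

section \<open>Fusion of one row of factors\<close>

lemma frac_cancel: "a \<noteq> 0 \<Longrightarrow> b \<noteq> 0 \<Longrightarrow> a / b * (1 / a * b) = (1::'k::field)"
  by simp

context brauer_relations
begin

lemma c_scl: "c k * Y = scl k Y" "Y * c k = scl k Y"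
  by (simp_all add: scl_def c_central)

lemmas scl_simps = scl_left scl_right scl_scl scl_add scl_diff scl_plus scl_minus scl_uminus scl_1

lemma s_conj_x:
  assumes "1 \<le> n" "{1..Suc n} \<subseteq> I"
  shows "s n (Suc n) * (s n (Suc n) * Y) = Y" "s n (Suc n) * s n (Suc n) = 1"
proof -
  have "n \<in> I" "Suc n \<in> I" using assms by auto
  then show "s n (Suc n) * s n (Suc n) = 1" using ss by simp
  then show "s n (Suc n) * (s n (Suc n) * Y) = Y" by (simp add: mult.assoc[symmetric])
qed

text \<open>An eigenvector equation for \<open>x n\<close> allows the first Jucys--Murphy element
  in the pair \<open>x n\<close>, \<open>x (Suc n)\<close> to be replaced by its eigenvalue on the
  left of a product. After that, \<open>x (Suc n)\<close> differs from the conjugate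
  \<open>x'\<close> only by \<open>s - e\<close>, and the identity reduces to the relations on two
  strands. It moves the two linear factors past one factor \<open>rho\<close>, exchanging \<open>x
  (Suc n)\<close> with \<open>x'\<close> and the sum of the spectral parameters with their
  difference.\<close>

lemma reflection_identity:
  assumes n: "1 \<le> n" "{1..Suc n} \<subseteq> I"
    and Ex: "E * x n = c g * E"
    and nz: "u + g - kap \<noteq> 0" "u + g \<noteq> 0" "u - g \<noteq> 0" "u - g - kap \<noteq> 0"
    and x'_def: "x' = s n (Suc n) * x n * s n (Suc n)"
  shows "E * (c u - x (Suc n)) * rho n (Suc n) (- g - u + kap) * (c u + x' - c kap) =
    E * (c u + x (Suc n) - c kap) * rho n (Suc n) (u - g) * (c u - x')"
proof -
  let ?s = "s n (Suc n)" and ?e = "e n (Suc n)" and ?X = "x (Suc n)" and ?x = "x n"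
  have I: "n \<in> I" "Suc n \<in> I" using n by auto
  have xX: "?X * ?x = ?x * ?X" using x_x_commutes[of n "Suc n"] n by (simp add: commutes_def)
  have sx': "?s * x' = ?x * ?s" unfolding x'_def by (simp add: mult.assoc s_conj_x[OF n])
  have X: "?X = x' + ?s - ?e" unfolding x'_def by (rule x_Suc[OF n])
  have ex: "?X * ?e = - (?x * ?e)"
    using e_x_x(2)[OF n] by (simp add: distrib_right eq_neg_iff_add_eq_0 add.commute)
  have Ex': "E * ?x = scl g E" using Ex by (simp add: c_scl)
  have EXx: "E * ?X * ?x = scl g (E * ?X)"
    by (simp add: mult.assoc xX) (simp add: mult.assoc[symmetric] Ex' scl_left)
  have EXsx: "E * ?X * ?s * x' = scl g (E * ?X * ?s)" "E * ?s * x' = scl g (E * ?s)"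
    by (simp_all add: mult.assoc sx') (simp_all add: mult.assoc[symmetric] EXx Ex' scl_left)
  have EXe: "E * ?X * ?e = - scl g (E * ?e)"
    by (simp add: mult.assoc ex) (simp add: mult.assoc[symmetric] Ex' scl_left)
  define a where "a = u + g - kap"
  define b where "b = u + g"
  define p where "p = u - g"
  define q where "q = u - g - kap"
  have 1: "E * (c u - ?X) * ?s * (c u + x' - c kap) = scl a (E * (c u - ?X) * ?s)"
    by (simp add: distrib_left distrib_right left_diff_distrib right_diff_distrib EXsx a_def
        c_scl scl_simps) (simp add: algebra_simps)
  have 2: "E * (c u + ?X - c kap) * ?s * (c u - x') = scl p (E * (c u + ?X - c kap) * ?s)"
    by (simp add: distrib_left distrib_right left_diff_distrib right_diff_distrib EXsx p_def
        c_scl scl_simps) (simp add: algebra_simps)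
  have 3: "E * (c u - ?X) * ?e = scl b (E * ?e)"
    by (simp add: distrib_left distrib_right left_diff_distrib right_diff_distrib EXe b_def
        c_scl scl_simps)
  have 4: "E * (c u + ?X - c kap) * ?e = scl q (E * ?e)"
    by (simp add: distrib_left distrib_right left_diff_distrib right_diff_distrib EXe q_def
        c_scl scl_simps)
  have rL: "rho n (Suc n) (- g - u + kap) = 1 + scl (1 / a) ?s - scl (1 / b) ?e"
  proof -
    have "- g - u + kap = - a" "- g - u + kap - kap = - b" by (simp_all add: a_def b_def)
    then show ?thesis unfolding rho_def by (simp add: scl_uminus)
  qed
  have rR: "rho n (Suc n) (u - g) = 1 - scl (1 / p) ?s + scl (1 / q) ?e"
    unfolding rho_def by (simp add: p_def q_def)
  have "E * (c u - ?X) * rho n (Suc n) (- g - u + kap) * (c u + x' - c kap) =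
      E * (c u - ?X) * (c u + x' - c kap) + scl (1 / a) (E * (c u - ?X) * ?s * (c u + x' - c kap))
      - scl (1 / b) (E * (c u - ?X) * ?e * (c u + x' - c kap))"
    unfolding rL distrib_left[of _ 1] right_diff_distrib[of _ "1 + _"] left_diff_distrib[of "_ + _"]
      distrib_right[of _ _ "c u + x' - c kap"]
    by (simp add: scl_left scl_right mult.assoc)
  also have "\<dots> = E * (c u - ?X) * (c u + x' - c kap) + E * (c u - ?X) * ?s - E * ?e * (c u + x' - c kap)"
    unfolding 1 3 using nz by (simp add: scl_left scl_scl scl_1 a_def b_def)
  also have "\<dots> = E * (c u + ?X - c kap) * (c u - x') - E * (c u + ?X - c kap) * ?s + E * ?e * (c u - x')"
    unfolding X
    by (simp add: distrib_left distrib_right left_diff_distrib right_diff_distrib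
        c_scl scl_simps mult.assoc)
       (simp add: algebra_simps)
  also have "\<dots> = E * (c u + ?X - c kap) * (c u - x')
      - scl (1 / p) (E * (c u + ?X - c kap) * ?s * (c u - x'))
      + scl (1 / q) (E * (c u + ?X - c kap) * ?e * (c u - x'))"
    unfolding 2 4 using nz by (simp add: scl_left scl_scl scl_1 p_def q_def)
  also have "\<dots> = E * (c u + ?X - c kap) * rho n (Suc n) (u - g) * (c u - x')"
    unfolding rR distrib_left[of _ "_ - _"] right_diff_distrib[of _ 1] distrib_right[of "_ - _"]
      left_diff_distrib[of "_ * 1"]
    by (simp add: scl_left scl_right mult.assoc)
  finally show ?thesis .
qed

lemma x_gen_commutes:
  assumes "r < i" "r < j" "i \<noteq> j" "i \<in> I" "j \<in> I" "{1..r} \<subseteq> I"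
  shows "commutes (x r) (s i j)" "commutes (x r) (e i j)"
proof -
  have "commutes (s i j) (jj k r)" "commutes (e i j) (jj k r)" if k: "k \<in> {1..<r}" for k
  proof -
    have "k \<in> I" "r \<in> I" "distinct [i, j, k, r]" "distinct [k, r, i, j]" using assms k by auto
    then show "commutes (s i j) (jj k r)" "commutes (e i j) (jj k r)"
      unfolding jj_def commutes_def
      using ss4[of i j k r] se4[of i j k r] se4[of k r i j] ee4[of i j k r] assms
      by (simp_all add: left_diff_distrib right_diff_distrib)
  qed
  then show "commutes (x r) (s i j)" "commutes (x r) (e i j)"
    unfolding x_def by (auto intro!: commutes_sym[OF commutes_add] commutes_c commutes_sum)
qed

text \<open>\<open>newt u X L\<close> is Newton's form of the resolvent of \<open>X\<close> at
  \<open>u\<close>: if \<open>X\<close> satisfies the polynomial with roots \<open>L\<close>, it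
  is the inverse of \<open>u - X\<close>, by \<open>newt_resolvent\<close>. Unlike that inverse,
  it is defined for every \<open>X\<close>, its denominators are visible, and the root at the end
  of the list occurs in one summand only, by \<open>newt_append1\<close>.\<close>

definition pp :: "'a \<Rightarrow> 'k list \<Rightarrow> 'a" where
  "pp X L = prod_list (map (\<lambda>a. X - c a) L)"

fun newt :: "'k \<Rightarrow> 'a \<Rightarrow> 'k list \<Rightarrow> 'a" where
  "newt u X [] = 0"
| "newt u X (a # L) = scl (1 / (u - a)) (1 + (X - c a) * newt u X L)"

lemma pp_simps: "pp X [] = 1" "pp X (a # L) = (X - c a) * pp X L" "pp X (L @ M) = pp X L * pp X M"
  by (simp_all add: pp_def)

lemma commutes_pp: "commutes Y X \<Longrightarrow> commutes Y (pp X L)"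
  by (induction L) (auto simp: pp_simps intro!: commutes_intros)

lemma commutes_newt: "commutes Y X \<Longrightarrow> commutes Y (newt u X L)"
  by (induction L) (auto simp: scl_def intro!: commutes_intros)

lemma newt_resolvent:
  assumes "\<And>a. a \<in> set L \<Longrightarrow> u \<noteq> a"
  shows "(c u - X) * newt u X L = 1 - scl (prod_list (map (\<lambda>a. 1 / (u - a)) L)) (pp X L)"
  using assms
proof (induction L)
  case Nil
  show ?case by (simp add: pp_simps scl_1)
next
  case (Cons a L)
  have "commutes X X" by (simp add: commutes_def)
  then have "commutes X (c u - X)" by (intro commutes_diff commutes_c)
  then have "commutes (c u - X) (X - c a)" by (intro commutes_diff commutes_c) (rule commutes_sym)
  then have comm: "(c u - X) * (X - c a) = (X - c a) * (c u - X)" by (simp add: commutes_def)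
  have "(c u - X) * newt u X (a # L) =
      scl (1 / (u - a)) ((c u - X) + (c u - X) * (X - c a) * newt u X L)"
    by (simp add: scl_right distrib_left mult.assoc)
  also have "(c u - X) * (X - c a) * newt u X L = (X - c a) * ((c u - X) * newt u X L)"
    by (simp only: comm mult.assoc)
  also have "\<dots> = (X - c a) - scl (prod_list (map (\<lambda>a. 1 / (u - a)) L)) (pp X (a # L))"
    using Cons by (simp add: pp_simps right_diff_distrib scl_right)
  also have "c u - X + ((X - c a) - scl (prod_list (map (\<lambda>a. 1 / (u - a)) L)) (pp X (a # L))) =
      c (u - a) - scl (prod_list (map (\<lambda>a. 1 / (u - a)) L)) (pp X (a # L))"
    by (simp add: c_diff)
  also have "scl (1 / (u - a)) \<dots> = 1 - scl (prod_list (map (\<lambda>a. 1 / (u - a)) (a # L))) (pp X (a # L))"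
  proof -
    have "scl (1 / (u - a)) (c (u - a)) = 1"
      using Cons.prems[of a] by (simp add: scl_def c_mult[symmetric] c_1)
    then show ?thesis by (simp only: scl_minus scl_scl list.map prod_list.Cons)
  qed
  finally show ?case .
qed

lemma newt_append1:
  "newt u X (L @ [a]) = newt u X L + scl (prod_list (map (\<lambda>a. 1 / (u - a)) L) / (u - a)) (pp X L)"
proof (induction L)
  case Nil
  show ?case by (simp add: pp_simps)
next
  case (Cons b L)
  then show ?case
    by (simp add: pp_simps distrib_left scl_plus scl_scl scl_right add.assoc)
qed

text \<open>The products that define the idempotents: \<open>L r\<close> lists the contents which
  do not occur at step \<open>r\<close>, \<open>k r\<close> is the normalization, and
  \<open>p\<close> is the unit, or a projection that acts as the unit.\<close>

primrec EE :: "'a \<Rightarrow> (nat \<Rightarrow> 'k) \<Rightarrow> (nat \<Rightarrow> 'k list) \<Rightarrow> nat \<Rightarrow> 'a" where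
  "EE p k L 0 = p"
| "EE p k L (Suc r) = scl (k (Suc r)) (EE p k L r * pp (x (Suc r)) (L (Suc r)))"

lemma EE_commutes:
  assumes "commutes Y p" "\<And>i. i \<in> {1..r} \<Longrightarrow> commutes Y (x i)"
  shows "commutes Y (EE p k L r)"
  using assms(2)
  by (induction r) (auto simp: scl_def intro!: commutes_intros commutes_pp assms(1))

text \<open>All factors that involve strand \<open>t\<close> and a strand up to \<open>m\<close>,
  in the order in which the sorted product contains them; \<open>u\<close> is the parameter of
  strand \<open>t\<close>.\<close>

primrec BB :: "nat \<Rightarrow> nat \<Rightarrow> (nat \<Rightarrow> 'k) \<Rightarrow> 'k \<Rightarrow> 'a" where
  "BB 0 t z u = 1"
| "BB (Suc m) t z u =
    rho (Suc m) t (- z (Suc m) - u + kap) * BB m t z u * rho (Suc m) t (z (Suc m) - u)"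

lemma commutes_refl: "commutes Y Y" by (simp add: commutes_def)

lemma EE_commutes_gen:
  assumes "r < i" "r < j" "i \<noteq> j" "i \<in> I" "j \<in> I" "{1..r} \<subseteq> I"
    and "commutes (s i j) p" "commutes (e i j) p"
  shows "commutes (s i j) (EE p k L r)" "commutes (e i j) (EE p k L r)"
proof -
  have "commutes (s i j) (x l)" "commutes (e i j) (x l)" if "l \<in> {1..r}" for l
    using x_gen_commutes[of l i j] that assms by (auto intro: commutes_sym simp: subset_eq)
  then show "commutes (s i j) (EE p k L r)" "commutes (e i j) (EE p k L r)"
    by (auto intro!: EE_commutes assms)
qed

lemma EE_commutes_x:
  assumes "r \<le> n" "{1..n} \<subseteq> I" "commutes (x n) p"
  shows "commutes (x n) (EE p k L r)"
proof (rule EE_commutes)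
  fix i assume "i \<in> {1..r}"
  then show "commutes (x n) (x i)"
    using x_x_commutes[of i n] assms by (cases "i = n") (auto simp: commutes_def)
qed fact

lemma s_conj_rho:
  assumes "i \<in> I" "n \<in> I" "t \<in> I" "distinct [i, n, t]"
  shows "s n t * rho i n y * s n t = rho i t y"
proof -
  have "s n t * s i n = s i t * s n t" "s n t * e i n = e i t * s n t"
    using ss3[of t n i] se3[of t n i] assms s_sym[of t n] s_sym[of n i] s_sym[of t i]
      e_sym[of n i] e_sym[of t i] by simp_all
  then have "s n t * rho i n y = rho i t y * s n t"
    unfolding rho_def
    by (simp add: left_diff_distrib right_diff_distrib distrib_left distrib_right scl_left scl_right)
  then show ?thesis using ss[of n t] assms by (simp add: mult.assoc)
qed

text \<open>A row of factors attached to strand \<open>n\<close> may be moved to strand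
  \<open>t\<close>. This is what makes an induction on the length of the row possible: the inner
  part of the row belonging to strand \<open>t\<close> is a conjugate of the row belonging to
  strand \<open>n\<close>.\<close>

lemma s_conj_BB:
  assumes "n \<in> I" "t \<in> I" "n \<noteq> t" "m < n" "m < t" "{1..m} \<subseteq> I"
  shows "s n t * BB m n z u * s n t = BB m t z u"
  using assms(4-6)
proof (induction m)
  case 0
  show ?case using ss[of n t] assms by simp
next
  case (Suc m)
  let ?s = "s n t"
  have "Suc m \<in> I" using Suc.prems by auto
  then have r: "?s * rho (Suc m) n y * ?s = rho (Suc m) t y" for y
    using Suc.prems assms by (intro s_conj_rho) auto
  have IH: "?s * BB m n z u * ?s = BB m t z u" using Suc by (intro Suc.IH) (auto simp: subset_eq)
  have ss1: "Y * ?s * (?s * Z) = Y * Z" for Y Z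
    using ss[of n t] assms by (simp add: mult.assoc) (simp add: mult.assoc[symmetric])
  have "?s * BB (Suc m) n z u * ?s =
    (?s * rho (Suc m) n (- z (Suc m) - u + kap) * ?s) * ((?s * BB m n z u * ?s) *
      (?s * rho (Suc m) n (z (Suc m) - u) * ?s))"
    by (simp add: mult.assoc ss1 ss assms) (simp add: mult.assoc[symmetric] ss1[unfolded mult.assoc[symmetric]])
  also have "\<dots> = BB (Suc m) t z u"
    unfolding r IH by (simp only: BB.simps mult.assoc)
  finally show ?case .
qed

primrec phi :: "(nat \<Rightarrow> 'k) \<Rightarrow> 'k \<Rightarrow> nat \<Rightarrow> 'k" where
  "phi z u 0 = (u - (w - 1) / 2) / (u + (w - 1) / 2 - kap)"
| "phi z u (Suc r) = phi z u r * (1 - 1 / (u - z (Suc r))\<^sup>2)"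

text \<open>In the inductive step, the outermost two factors of the row surround a conjugate of a
  shorter row, to which the induction hypothesis applies; the reflection identity then transports
  the linear factor \<open>u + x - kap\<close> to the outside. The two factors that then meet are
  inverse to each other up to the scalar \<open>1 - 1 / (u - z)^2\<close>, which explains the
  recursion for \<open>phi\<close>. The elements \<open>x'\<close>, \<open>G\<close> and
  \<open>P\<close> in the proof are the conjugates of \<open>x\<close>, of its resolvent and of
  its minimal polynomial by the last transposition.\<close>

theorem idempotent_fusion:
  assumes I: "{1..Suc r} \<subseteq> I"
    and p: "\<And>i j. i \<in> I \<Longrightarrow> j \<in> I \<Longrightarrow> i \<noteq> j \<Longrightarrow> commutes (s i j) p \<and> commutes (e i j) p"
    and L1: "L' 1 = [(w - 1) / 2]"
    and min: "\<And>m. m \<le> r \<Longrightarrow> EE p k L m * pp (x (Suc m)) (L' (Suc m)) = 0"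
    and eig: "\<And>m. 1 \<le> m \<Longrightarrow> m \<le> r \<Longrightarrow> EE p k L m * x m = c (z m) * EE p k L m"
    and nL: "\<And>m a. m \<le> Suc r \<Longrightarrow> 1 \<le> m \<Longrightarrow> a \<in> set (L' m) \<Longrightarrow> u \<noteq> a"
    and nz: "u + (w - 1) / 2 - kap \<noteq> 0"
      "\<And>m. 1 \<le> m \<Longrightarrow> m \<le> r \<Longrightarrow> u + z m - kap \<noteq> 0 \<and> u + z m \<noteq> 0 \<and> u - z m \<noteq> 0 \<and>
        u - z m - kap \<noteq> 0 \<and> u - z m + kap \<noteq> 0"
  shows "EE p k L r * BB r (Suc r) z u =
    scl (phi z u r) (EE p k L r * (c u + x (Suc r) - c kap) * newt u (x (Suc r)) (L' (Suc r)))"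
  using I min eig nL nz(2)
proof (induction r)
  case 0
  let ?a = "(w - 1) / 2"
  have "u \<noteq> ?a" using 0(4)[of 1 "(w - 1) / 2"] L1 by simp
  then have ne: "u - ?a \<noteq> 0" by (simp only: right_minus_eq not_False_eq_True)
  have "x (Suc 0) = c ?a" by (simp add: x_def)
  moreover have "p * (c u + c ?a - c kap) * newt u (c ?a) [?a] =
      scl (1 / (u - ?a) * (u + ?a - kap)) p"
    by (simp only: c_add[symmetric] c_diff[symmetric] newt.simps mult_zero_right add_0_right
        c_scl scl_left scl_right scl_scl mult_1_right)
  moreover have "phi z u 0 * (1 / (u - ?a) * (u + ?a - kap)) = 1"
    unfolding phi.simps using frac_cancel[OF ne nz(1)] .
  ultimately show ?case using L1 by (simp add: scl_scl scl_1 del: phi.simps newt.simps)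
next
  case (Suc m)
  let ?n = "Suc m" let ?t = "Suc (Suc m)"
  let ?s = "s ?n ?t" let ?X = "x ?t" let ?EV = "EE p k L m" let ?EU = "EE p k L ?n"
  define q where "q = scl (k ?n) (pp (x ?n) (L ?n))"
  define x' where "x' = ?s * x ?n * ?s"
  define G where "G = ?s * newt u (x ?n) (L' ?n) * ?s"
  define P where "P = ?s * pp (x ?n) (L' ?n) * ?s"
  define S where "S = rho ?n ?t (- z ?n - u + kap)"
  define R where "R = rho ?n ?t (z ?n - u)"
  define R' where "R' = rho ?n ?t (u - z ?n)"
  define B' where "B' = BB m ?t z u"
  define g where "g = z ?n"
  have ind: "?n \<in> I" "?t \<in> I" "1 \<le> ?n" "{1..Suc ?n} \<subseteq> I" "{1..m} \<subseteq> I" "{1..?n} \<subseteq> I"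
    using Suc.prems(1) by auto
  have nzg: "u + g - kap \<noteq> 0" "u + g \<noteq> 0" "u - g \<noteq> 0" "u - g - kap \<noteq> 0" "u - g + kap \<noteq> 0"
    using Suc.prems(5)[of ?n] by (auto simp: g_def)
  note s1 = s_conj_x[OF ind(3,4)]
  have x_p: "commutes (x l) p" if "{1..l} \<subseteq> I" for l
  proof -
    have "commutes p (jj i l)" if "i \<in> {1..<l}" for i
      using p[of i l] that \<open>{1..l} \<subseteq> I\<close> unfolding jj_def
      by (intro commutes_diff) (auto simp: subset_eq intro: commutes_sym)
    then show ?thesis unfolding x_def by (intro commutes_sym[of p] commutes_add commutes_c commutes_sum)
  qed
  have EVs: "commutes ?EV ?s" "commutes ?EV (e ?n ?t)"
    by (rule commutes_sym, rule EE_commutes_gen, use ind p in auto)+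
  have EVx: "commutes ?EV (x ?n)" "commutes ?EV ?X"
    using EE_commutes_x[of m ?n p k L] EE_commutes_x[of m ?t p k L] x_p[of ?n] x_p[of ?t] ind
    by (auto intro: commutes_sym)
  have EUX: "commutes ?EU ?X"
    using EE_commutes_x[of ?n ?t p k L] x_p[of ?t] ind by (auto intro: commutes_sym)
  have EU: "?EU = q * ?EV"
    using commutes_pp[OF EVx(1), of "L ?n"]
    by (simp add: q_def commutes_def scl_left scl_right)
  have conjE: "?EV * (?s * Y * ?s) = ?s * (?EV * Y) * ?s" for Y
    using EVs(1) unfolding commutes_def by (metis mult.assoc)
  have IH: "?EV * BB m ?n z u = scl (phi z u m) (?EV * (c u + x ?n - c kap) * newt u (x ?n) (L' ?n))"
  proof (rule Suc.IH)
    show "{1..Suc m} \<subseteq> I" using ind by simp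
    show "EE p k L l * pp (x (Suc l)) (L' (Suc l)) = 0" if "l \<le> m" for l
      using Suc.prems(2)[of l] that by simp
    show "EE p k L l * x l = c (z l) * EE p k L l" if "1 \<le> l" "l \<le> m" for l
      using Suc.prems(3)[of l] that by simp
    show "u \<noteq> a" if "l \<le> Suc m" "1 \<le> l" "a \<in> set (L' l)" for l a
      by (rule Suc.prems(4)[of l a]) (use that in simp_all)
    show "u + z l - kap \<noteq> 0 \<and> u + z l \<noteq> 0 \<and> u - z l \<noteq> 0 \<and> u - z l - kap \<noteq> 0 \<and> u - z l + kap \<noteq> 0"
      if "1 \<le> l" "l \<le> m" for l
      using Suc.prems(5)[of l] that by simp
  qed
  have EB': "?EV * B' = scl (phi z u m) (?EV * ((c u + x' - c kap) * G))"
  proof -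
    have B': "B' = ?s * BB m ?n z u * ?s"
      unfolding B'_def using ind by (intro s_conj_BB[symmetric]) auto
    have 1: "?s * (c u + x ?n - c kap) = (c u + x' - c kap) * ?s"
      unfolding x'_def
      by (simp add: distrib_left distrib_right left_diff_distrib right_diff_distrib c_central mult.assoc s1)
    have "?EV * B' = scl (phi z u m) (?s * ?EV * ((c u + x ?n - c kap) * newt u (x ?n) (L' ?n)) * ?s)"
      unfolding B' conjE IH by (simp add: scl_left scl_right mult.assoc)
    also have "?s * ?EV = ?EV * ?s" using EVs(1) by (simp add: commutes_def)
    also have "?EV * ?s * ((c u + x ?n - c kap) * newt u (x ?n) (L' ?n)) * ?s =
        ?EV * (?s * (c u + x ?n - c kap)) * newt u (x ?n) (L' ?n) * ?s"
      by (simp only: mult.assoc)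
    also have "\<dots> = ?EV * ((c u + x' - c kap) * G)"
      unfolding 1 G_def by (simp only: mult.assoc)
    finally show ?thesis .
  qed
  define kk where "kk = prod_list (map (\<lambda>a. 1 / (u - a)) (L' ?n))"
  have res: "(c u - x') * G = 1 - scl kk P"
  proof -
    have 1: "(c u - x') * ?s = ?s * (c u - x ?n)"
      unfolding x'_def
      by (simp add: distrib_left distrib_right left_diff_distrib right_diff_distrib c_central mult.assoc s1)
    have "(c u - x') * G = ((c u - x') * ?s) * newt u (x ?n) (L' ?n) * ?s"
      unfolding G_def by (simp only: mult.assoc)
    also have "\<dots> = ?s * ((c u - x ?n) * newt u (x ?n) (L' ?n)) * ?s"
      unfolding 1 by (simp only: mult.assoc)
    also have "(c u - x ?n) * newt u (x ?n) (L' ?n) = 1 - scl kk (pp (x ?n) (L' ?n))"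
      unfolding kk_def using Suc.prems(4)[of ?n] by (intro newt_resolvent) auto
    also have "?s * \<dots> * ?s = 1 - scl kk P"
      by (simp add: P_def right_diff_distrib left_diff_distrib scl_left scl_right s1)
    finally show ?thesis .
  qed
  have EVP: "?EV * P = 0"
    unfolding P_def conjE using Suc.prems(2)[of m] by simp
  have rho_c: "commutes ?EV (rho ?n ?t y)" for y
    using EVs by (rule commutes_rho)
  have key: "?EU * (c u - ?X) * S * (c u + x' - c kap) = ?EU * (c u + ?X - c kap) * R' * (c u - x')"
    unfolding S_def R'_def
    using ind nzg Suc.prems(3)[of ?n] unfolding g_def[symmetric]
    by (intro reflection_identity) (auto simp: x'_def)
  have RR: "R' * R = c (1 - 1 / (u - g)\<^sup>2)"
  proof -
    have "u - g \<noteq> - kap" using nzg(5) by (metis eq_neg_iff_add_eq_0)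
    then have "rho ?n ?t (u - g) * rho ?n ?t (- (u - g)) = c (1 - 1 / (u - g)\<^sup>2)"
      using ind nzg by (intro rho_rho_inverse) auto
    then show ?thesis unfolding R_def R'_def g_def by simp
  qed
  have "?EU * (c u - ?X) * BB ?n ?t z u = q * (?EV * ((c u - ?X) * S)) * B' * R"
    unfolding EU by (simp add: S_def B'_def R_def mult.assoc)
  also have "?EV * ((c u - ?X) * S) = ((c u - ?X) * S) * ?EV"
    using commutes_mult[OF commutes_diff[OF commutes_c EVx(2)] rho_c] unfolding S_def commutes_def by blast
  also have "q * ((c u - ?X) * S * ?EV) * B' * R = q * ((c u - ?X) * S * (?EV * B')) * R"
    by (simp only: mult.assoc)
  also have "\<dots> = scl (phi z u m) (q * ((c u - ?X) * S * ?EV) * ((c u + x' - c kap) * G) * R)"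
    unfolding EB' by (simp only: scl_left scl_right mult.assoc)
  also have "(c u - ?X) * S * ?EV = ?EV * ((c u - ?X) * S)"
    using commutes_mult[OF commutes_diff[OF commutes_c EVx(2)] rho_c] unfolding S_def commutes_def by simp
  also have "q * (?EV * ((c u - ?X) * S)) * ((c u + x' - c kap) * G) * R =
      (?EU * (c u - ?X) * S * (c u + x' - c kap)) * G * R"
    unfolding EU by (simp only: mult.assoc)
  also have "\<dots> = ?EU * (c u + ?X - c kap) * R' * ((c u - x') * G) * R"
    unfolding key by (simp only: mult.assoc)
  also have "\<dots> = ?EU * (c u + ?X - c kap) * (R' * R) - scl kk (q * (?EV * ((c u + ?X - c kap) * R')) * P * R)"
    unfolding res EU
    by (simp add: right_diff_distrib left_diff_distrib scl_left scl_right mult.assoc)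
  also have "?EV * ((c u + ?X - c kap) * R') = ((c u + ?X - c kap) * R') * ?EV"
    using commutes_mult[OF commutes_diff[OF commutes_add[OF commutes_c EVx(2)] commutes_c] rho_c]
    unfolding R'_def commutes_def by blast
  also have "q * ((c u + ?X - c kap) * R' * ?EV) * P * R = q * ((c u + ?X - c kap) * R') * (?EV * P) * R"
    by (simp only: mult.assoc)
  also have "\<dots> = 0" unfolding EVP by simp
  finally have main: "?EU * (c u - ?X) * BB ?n ?t z u =
      scl (phi z u ?n) (?EU * (c u + ?X - c kap))"
    unfolding RR by (simp add: scl_0_right c_scl(2) scl_scl g_def)
  define GX where "GX = newt u ?X (L' ?t)"
  have cG: "commutes ?EU GX" "commutes ?X GX" "commutes (c u) GX"
    unfolding GX_def using EUX
    by (auto intro: commutes_newt commutes_sym[OF commutes_c] commutes_refl)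
  have "GX * (c u - ?X) = (c u - ?X) * GX"
    using commutes_diff[OF commutes_sym[OF cG(3)] commutes_sym[OF cG(2)]] by (simp add: commutes_def)
  also have "\<dots> = 1 - scl (prod_list (map (\<lambda>a. 1 / (u - a)) (L' ?t))) (pp ?X (L' ?t))"
    unfolding GX_def using Suc.prems(4)[of ?t] by (intro newt_resolvent) auto
  finally have GX: "?EU * (GX * (c u - ?X)) = ?EU"
    using Suc.prems(2)[of ?n] by (simp add: right_diff_distrib scl_right scl_0_right)
  have "?EU * BB ?n ?t z u = ?EU * (GX * (c u - ?X)) * BB ?n ?t z u" by (simp only: GX)
  also have "\<dots> = (?EU * GX) * (c u - ?X) * BB ?n ?t z u" by (simp only: mult.assoc)
  also have "?EU * GX = GX * ?EU" using cG(1) by (simp add: commutes_def)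
  also have "GX * ?EU * (c u - ?X) * BB ?n ?t z u = GX * (?EU * (c u - ?X) * BB ?n ?t z u)"
    by (simp only: mult.assoc)
  also have "\<dots> = scl (phi z u ?n) (GX * (?EU * (c u + ?X - c kap)))"
    unfolding main by (simp only: scl_right)
  also have "GX * (?EU * (c u + ?X - c kap)) = ?EU * (c u + ?X - c kap) * GX"
  proof -
    have "commutes GX (?EU * (c u + ?X - c kap))"
      using cG by (intro commutes_intros) (auto intro: commutes_sym)
    then show ?thesis by (simp add: commutes_def)
  qed
  finally show ?case unfolding GX_def .
qed

subsection \<open>Sorting the triangular products\<close>

text \<open>The product over all pairs \<open>i < j\<close>, ordered by the larger index first.\<close>

primrec tri :: "(nat \<Rightarrow> nat \<Rightarrow> 'a) \<Rightarrow> nat \<Rightarrow> 'a" where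
  "tri f 0 = 1"
| "tri f (Suc n) = tri f n * prod_list (map (\<lambda>i. f i (Suc n)) [1..<Suc n])"

lemma tri_commutes:
  assumes "\<And>i j. 1 \<le> i \<Longrightarrow> i < j \<Longrightarrow> j \<le> n \<Longrightarrow> commutes Y (f i j)"
  shows "commutes Y (tri f n)"
  using assms
proof (induction n)
  case (Suc n)
  have "commutes Y (prod_list (map (\<lambda>i. f i (Suc n)) [1..<Suc n]))"
    using Suc.prems by (intro commutes_prod_list) (auto simp del: upt_Suc)
  then show ?case using Suc unfolding tri.simps by (intro commutes_mult) auto
qed (simp add: commutes_1)

lemma prod_list_interchange:
  assumes "\<And>i j. a \<le> i \<Longrightarrow> i < j \<Longrightarrow> j < b \<Longrightarrow> commutes (G i) (F j)"
  shows "prod_list (map (\<lambda>i. F i * G i) [a..<b]) =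
    prod_list (map F [a..<b]) * prod_list (map G [a..<b])"
  using assms
proof (induction b)
  case (Suc b)
  show ?case
  proof (cases "a \<le> b")
    case True
    have "commutes (F b) (prod_list (map G [a..<b]))"
      using Suc.prems by (intro commutes_prod_list) (auto intro: commutes_sym)
    then have "prod_list (map F [a..<b]) * (F b * prod_list (map G [a..<b])) * G b =
        prod_list (map F [a..<b]) * (prod_list (map G [a..<b]) * F b) * G b"
      by (simp add: commutes_def)
    then show ?thesis using Suc True by (simp add: mult.assoc)
  qed simp
qed simp

text \<open>The lexicographic order may be replaced by the order by the larger index, since
  factors on disjoint pairs commute; the proof moves the last column of factors to the right.\<close>

lemma lex_product:
  assumes "\<And>i j k l. {i, j, k, l} \<subseteq> {1..n} \<Longrightarrow> distinct [i, j, k, l] \<Longrightarrow> i < j \<Longrightarrow> k < l \<Longrightarrow>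
    commutes (f i j) (f k l)"
  shows "prod_list (map (\<lambda>(i, j). f i j) (lex_pairs n)) = tri f n"
proof -
  have "prod_list (map (\<lambda>i. prod_list (map (f i) [Suc i..<Suc n])) [1..<Suc n]) = tri f n"
    using assms
  proof (induction n)
    case (Suc n)
    have "prod_list (map (\<lambda>i. prod_list (map (f i) [Suc i..<Suc (Suc n)])) [1..<Suc (Suc n)]) =
        prod_list (map (\<lambda>i. prod_list (map (f i) [Suc i..<Suc n]) * f i (Suc n)) [1..<Suc n])"
    proof -
      have "[1..<Suc (Suc n)] = [1..<Suc n] @ [Suc n]" by simp
      moreover have "map (\<lambda>i. prod_list (map (f i) [Suc i..<Suc (Suc n)])) [1..<Suc n] =
          map (\<lambda>i. prod_list (map (f i) [Suc i..<Suc n]) * f i (Suc n)) [1..<Suc n]"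
      proof (rule map_cong[OF refl])
        fix i assume "i \<in> set [1..<Suc n]"
        then have "[Suc i..<Suc (Suc n)] = [Suc i..<Suc n] @ [Suc n]" by auto
        then show "prod_list (map (f i) [Suc i..<Suc (Suc n)]) =
            prod_list (map (f i) [Suc i..<Suc n]) * f i (Suc n)" by simp
      qed
      ultimately show ?thesis by (simp only: map_append prod_list.append) simp
    qed
    also have "\<dots> = prod_list (map (\<lambda>i. prod_list (map (f i) [Suc i..<Suc n])) [1..<Suc n]) *
        prod_list (map (\<lambda>i. f i (Suc n)) [1..<Suc n])"
    proof (rule prod_list_interchange)
      fix i j :: nat assume ij: "1 \<le> i" "i < j" "j < Suc n"
      show "commutes (f i (Suc n)) (prod_list (map (f j) [Suc j..<Suc n]))"
        using ij by (intro commutes_prod_list) (auto intro!: Suc.prems simp del: upt_Suc)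
    qed
    also have "\<dots> = tri f (Suc n)"
      by (subst Suc.IH) (auto intro!: Suc.prems)
    finally show ?case .
  qed simp
  moreover have "lex_pairs n = concat (map (\<lambda>i. map (Pair i) [Suc i..<Suc n]) [1..<Suc n])"
  proof -
    let ?l = "\<lambda>m. concat (map (\<lambda>i. map (Pair i) [Suc i..<Suc n]) [m..<Suc n])"
    have "sorted (?l m) \<and> distinct (?l m) \<and> set (?l m) = {(i, j). m \<le> i \<and> i < j \<and> j \<le> n}" if "m \<le> Suc n" for m
      using that
    proof (induction m rule: inc_induct)
      case (step m)
      have "?l m = map (Pair m) [Suc m..<Suc n] @ ?l (Suc m)"
        using step.hyps by (simp add: upt_conv_Cons del: upt_Suc)
      moreover have "sorted (map (Pair m) [Suc m..<Suc n])"
        by (simp add: sorted_map sorted_wrt_upt less_eq_prod_def del: upt_Suc)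
      moreover have "distinct (map (Pair m) [Suc m..<Suc n])"
        by (simp add: distinct_map inj_on_def del: upt_Suc)
      moreover have h: "set (map (Pair m) [Suc m..<Suc n]) = {(i, j). i = m \<and> i < j \<and> j \<le> n}"
        by auto
      moreover have "\<forall>a\<in>set (map (Pair m) [Suc m..<Suc n]). \<forall>b\<in>set (?l (Suc m)). a \<le> b"
        unfolding h conjunct2[OF conjunct2[OF step.IH]] by (auto simp: less_eq_prod_def)
      moreover have "set (map (Pair m) [Suc m..<Suc n]) \<inter> set (?l (Suc m)) = {}"
        unfolding h conjunct2[OF conjunct2[OF step.IH]] by auto
      moreover have "{(i, j). i = m \<and> i < j \<and> j \<le> n} \<union> {(i, j). Suc m \<le> i \<and> i < j \<and> j \<le> n} =
          {(i, j). m \<le> i \<and> i < j \<and> j \<le> n}"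
        by auto
      ultimately show ?case using step.IH
        by (simp only: sorted_append distinct_append set_append simp_thms)
    qed auto
    from this[of 1] show ?thesis
      unfolding lex_pairs_def
      by (metis (no_types, lifting) le_add1 plus_1_eq_Suc sorted_list_of_set.idem_if_sorted_distinct)
  qed
  moreover have "prod_list (map (\<lambda>(i, j). f i j) (concat (map (\<lambda>i. map (Pair i) [Suc i..<Suc n]) xs))) =
      prod_list (map (\<lambda>i. prod_list (map (f i) [Suc i..<Suc n])) xs)" for xs
    by (induction xs) (simp_all add: comp_def del: upt_Suc)
  ultimately show ?thesis by simp
qed

text \<open>The row of a strand \<open>t\<close> consists of a descending part with the parameters
  \<open>- z i - z t + kap\<close> (\<open>RS\<close>) and an ascending part with the parameters
  \<open>z i - z t\<close> (\<open>FR\<close>). In the first triangular product the former appears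
  in ascending order (\<open>FS\<close>).\<close>

primrec RS :: "nat \<Rightarrow> nat \<Rightarrow> (nat \<Rightarrow> 'k) \<Rightarrow> 'a" where
  "RS 0 t z = 1"
| "RS (Suc m) t z = rho (Suc m) t (- z (Suc m) - z t + kap) * RS m t z"

primrec FS :: "nat \<Rightarrow> nat \<Rightarrow> (nat \<Rightarrow> 'k) \<Rightarrow> 'a" where
  "FS 0 t z = 1"
| "FS (Suc m) t z = FS m t z * rho (Suc m) t (- z (Suc m) - z t + kap)"

primrec FR :: "nat \<Rightarrow> nat \<Rightarrow> (nat \<Rightarrow> 'k) \<Rightarrow> 'a" where
  "FR 0 t z = 1"
| "FR (Suc m) t z = FR m t z * rho (Suc m) t (z (Suc m) - z t)"

lemma BB_RS_FR: "BB m t z (z t) = RS m t z * FR m t z"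
  by (induction m) (simp_all add: mult.assoc)

lemma FS_prod: "FS m t z = prod_list (map (\<lambda>i. rho i t (- z i - z t + kap)) [1..<Suc m])"
  by (induction m) simp_all

lemma FR_prod: "FR m t z = prod_list (map (\<lambda>i. rho i t (z i - z t)) [1..<Suc m])"
  by (induction m) simp_all

context
  fixes z :: "nat \<Rightarrow> 'k" and n :: nat
  assumes z: "\<And>i j. i \<in> {1..n} \<Longrightarrow> j \<in> {1..n} \<Longrightarrow> i \<noteq> j \<Longrightarrow>
      z i + z j \<noteq> 0 \<and> z i + z j \<noteq> kap \<and> z i - z j \<noteq> 0 \<and> z i - z j \<noteq> kap"
    and nI: "{1..n} \<subseteq> I"
begin

text \<open>A Yang--Baxter move on strands \<open>i\<close>, \<open>m\<close>, \<open>t\<close>: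
  the parameters of the three factors add up because \<open>(- z i - z t + kap) + (z i - z m) = -
  z m - z t + kap\<close>.\<close>

lemma RS_FR:
  assumes "k < m" "m < t" "t \<le> n"
  shows "RS k t z * rho m t (- z m - z t + kap) * FR k m z =
    FR k m z * rho m t (- z m - z t + kap) * RS k t z"
  using assms(1)
proof (induction k)
  case (Suc k)
  let ?k = "Suc k" let ?S = "rho m t (- z m - z t + kap)"
  let ?Sk = "rho ?k t (- z ?k - z t + kap)" let ?Rk = "rho ?k m (z ?k - z m)"
  have I: "?k \<in> I" "m \<in> I" "t \<in> I" "?k \<in> {1..n}" "m \<in> {1..n}" "t \<in> {1..n}"
    using Suc.prems assms(2,3) nI by auto
  have ne: "?k \<noteq> m" "m \<noteq> t" "?k \<noteq> t" using Suc.prems assms by auto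
  have cFR: "commutes ?Sk (FR k m z)"
    unfolding FR_prod using Suc.prems assms I nI ne
    by (intro commutes_prod_list) (auto intro!: rho_commutes simp del: upt_Suc)
  have cRS: "commutes ?Rk (RS k t z)"
  proof -
    have "l \<le> k \<Longrightarrow> commutes ?Rk (RS l t z)" for l
      using Suc.prems assms I nI ne
      by (induction l) (auto intro!: commutes_intros rho_commutes)
    then show ?thesis by simp
  qed
  have yb: "?Sk * (?S * ?Rk) = ?Rk * (?S * ?Sk)"
  proof -
    have "rho t ?k (- z ?k - z t + kap) * (rho t m ((- z ?k - z t + kap) + (z ?k - z m)) * rho ?k m (z ?k - z m)) =
      rho ?k m (z ?k - z m) * (rho t m ((- z ?k - z t + kap) + (z ?k - z m)) * rho t ?k (- z ?k - z t + kap))"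
    proof (rule yang_baxter)
      have a: "- z i - z j + kap \<noteq> 0" "- z i - z j + kap \<noteq> kap" if "z i + z j \<noteq> 0 \<and> z i + z j \<noteq> kap" for i j
      proof -
        have "- z i - z j = - (z i + z j)" by simp
        then show "- z i - z j + kap \<noteq> 0" "- z i - z j + kap \<noteq> kap"
          using that by (metis add_diff_cancel_right' diff_0 eq_iff_diff_eq_0 minus_diff_eq uminus_add_conv_diff,
            metis add_cancel_left_left neg_equal_0_iff_equal)
      qed
      have b: "(- z ?k - z t + kap) + (z ?k - z m) = - z t - z m + kap" by simp
      show "- z ?k - z t + kap \<noteq> 0" "- z ?k - z t + kap \<noteq> kap"
        using a[of ?k t] z[of ?k t] I ne by blast+
      show "- z ?k - z t + kap + (z ?k - z m) \<noteq> 0" "- z ?k - z t + kap + (z ?k - z m) \<noteq> kap"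
        unfolding b using a[of t m] z[of t m] I ne by blast+
      show "z ?k - z m \<noteq> 0" "z ?k - z m \<noteq> kap"
        using z[of ?k m] I ne by blast+
    qed (use I ne in auto)
    moreover have "(- z ?k - z t + kap) + (z ?k - z m) = - z m - z t + kap" by simp
    ultimately show ?thesis by (simp only: rho_sym[of t])
  qed
  have "RS ?k t z * ?S * FR ?k m z = ?Sk * (RS k t z * ?S * FR k m z) * ?Rk"
    by (simp add: mult.assoc)
  also have "\<dots> = (?Sk * FR k m z) * ?S * (RS k t z * ?Rk)"
    using Suc by (simp add: mult.assoc)
  also have "\<dots> = FR k m z * (?Sk * (?S * ?Rk)) * RS k t z"
    using cFR cRS by (simp add: commutes_def mult.assoc)
  also have "\<dots> = FR ?k m z * ?S * RS ?k t z"
    unfolding yb by (simp add: mult.assoc)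
  finally show ?case .
qed simp

text \<open>Passing through the second triangular product reverses the order of the row, one
  column at a time.\<close>

lemma FS_tri:
  assumes "m < t" "t \<le> n"
  shows "FS m t z * tri (\<lambda>i j. rho i j (z i - z j)) m = tri (\<lambda>i j. rho i j (z i - z j)) m * RS m t z"
  using assms(1)
proof (induction m)
  case (Suc m)
  let ?T = "tri (\<lambda>i j. rho i j (z i - z j))" let ?m = "Suc m"
  let ?S = "rho ?m t (- z ?m - z t + kap)"
  have "commutes ?S (?T m)"
    using Suc.prems assms nI by (intro tri_commutes) (auto intro!: rho_commutes simp: subset_eq)
  then have ST: "?S * ?T m = ?T m * ?S" by (simp only: commutes_def)
  have "FS ?m t z * ?T ?m = FS m t z * (?S * ?T m) * FR m ?m z"
    unfolding FR_prod by (simp only: FS.simps tri.simps mult.assoc)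
  also have "\<dots> = (FS m t z * ?T m) * ?S * FR m ?m z"
    unfolding ST by (simp only: mult.assoc)
  also have "\<dots> = ?T m * (RS m t z * ?S * FR m ?m z)"
    using Suc by (simp add: mult.assoc)
  also have "\<dots> = ?T m * (FR m ?m z * ?S * RS m t z)"
    using RS_FR[of m ?m t] Suc.prems assms by simp
  also have "\<dots> = ?T ?m * RS ?m t z"
    unfolding FR_prod by (simp add: mult.assoc del: upt_Suc)
  finally show ?case .
qed simp

theorem triangular_factorization:
  "m \<le> n \<Longrightarrow> tri (\<lambda>i j. rho i j (- z i - z j + kap)) m * tri (\<lambda>i j. rho i j (z i - z j)) m =
    prod_list (map (\<lambda>r. BB (r - 1) r z (z r)) [1..<Suc m])"
proof (induction m)
  case (Suc m)
  let ?S = "tri (\<lambda>i j. rho i j (- z i - z j + kap))" let ?R = "tri (\<lambda>i j. rho i j (z i - z j))"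
  have "?S (Suc m) * ?R (Suc m) = ?S m * (FS m (Suc m) z * ?R m) * FR m (Suc m) z"
    unfolding FS_prod FR_prod by (simp add: mult.assoc del: upt_Suc)
  also have "\<dots> = (?S m * ?R m) * BB m (Suc m) z (z (Suc m))"
    using Suc.prems by (simp add: FS_tri BB_RS_FR mult.assoc)
  finally show ?case using Suc by simp
qed simp

end

end

section \<open>The partial closure of the resolvent\<close>

unbundle fps_syntax

text \<open>The resolvent of \<open>X\<close> as a formal power series in \<open>t = 1 /
  u\<close>.\<close>

definition geo :: "'a::ring_1 \<Rightarrow> 'a fps" where "geo X = Abs_fps (\<lambda>k. X ^ k)"

lemma geo_nth: "geo X $ k = X ^ k" by (simp add: geo_def)

lemma geo_inverse:
  "geo X * (1 - fps_X * fps_const X) = 1" "(1 - fps_X * fps_const X) * geo X = 1"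
proof -
  have 1: "fps_const X * geo X = geo X * fps_const X"
    by (rule fps_ext) (simp add: geo_nth power_commutes)
  have 2: "geo X = 1 + fps_X * (geo X * fps_const X)"
  proof (rule fps_ext)
    fix k show "geo X $ k = (1 + fps_X * (geo X * fps_const X)) $ k"
      by (cases k) (simp_all add: geo_nth power_commutes)
  qed
  have 3: "geo X = 1 + geo X * (fps_X * fps_const X)"
  proof -
    have "fps_X * (geo X * fps_const X) = geo X * (fps_X * fps_const X)"
      by (metis fps_mult_fps_X_commute mult.assoc)
    then show ?thesis using 2 by metis
  qed
  show "geo X * (1 - fps_X * fps_const X) = 1"
    unfolding right_diff_distrib diff_eq_eq mult_1_right by (rule 3)
  show "(1 - fps_X * fps_const X) * geo X = 1"
    unfolding left_diff_distrib diff_eq_eq mult_1_left mult.assoc 1 by (rule 2)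
qed

lemma geo_intertwine: "A * Y = Y * B \<Longrightarrow> geo A * fps_const Y = fps_const Y * geo B"
proof (rule fps_ext)
  fix k assume A: "A * Y = Y * B"
  have "A ^ k * Y = Y * B ^ k"
    by (induction k) (simp_all add: mult.assoc, simp add: mult.assoc[symmetric] A)
  then show "(geo A * fps_const Y) $ k = (fps_const Y * geo B) $ k" by (simp add: geo_nth)
qed

text \<open>The recursion for the closed resolvent, as an identity in an arbitrary ring. In the
  application \<open>V\<close> and \<open>W\<close> are \<open>t / (1 - t x)\<close> and \<open>t
  / (1 + t x)\<close> for the \<open>n\<close>-th Jucys--Murphy element \<open>x\<close>, and
  \<open>Y\<close> is the resolvent of the next one. The equations \<open>Y1\<close> and
  \<open>Y2\<close> are the resolvent form of the relation between consecutive Jucys--Murphy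
  elements, and \<open>eY\<close> says that \<open>e\<close> changes the sign of the argument. On
  the idempotent \<open>EU\<close> the elements \<open>V\<close> and \<open>W\<close> act by the
  scalars \<open>vg\<close> and \<open>wg\<close>, and \<open>z\<close> is the closure on the
  previous level.\<close>

lemma closure_step_ring:
  fixes s e s' e' V W Y EU EV q z vg wg :: "'b::ring_1"
  assumes s: "s * s = 1" "s * e = e" "e * s = e"
    and e': "e' * e * e' = e'" "e' * s * e' = e'" "e' * s * V * s * e' = e' * (e * V * e) * e'"
    and comm: "V * Y = Y * V" "e' * V = V * e'" "W * e' = e' * W" "W * V = V * W"
    and Y1: "Y = s * V * s + s * V * s * (s - e) * Y" and Y2: "Y = s * V * s + Y * (s - e) * (s * V * s)"
    and eY: "e * Y = e * W" "Y * e = W * e"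
    and EV: "EV * e' = e' * EV" "EV * (e * V * e) = z * (EV * e)" "EV * Y = Y * EV" "EV * V = V * EV"
      "EV * W = W * EV" "EV * s = s * EV"
    and EU: "EU = q * EV" "EU * V = vg * EU" "EU * W = wg * EU"
    and central: "\<And>F. z * F = F * z" "\<And>F. vg * F = F * vg" "\<And>F. wg * F = F * wg"
  shows "(1 - vg * vg) * (EU * e' * Y * e') =
    (z + vg * vg - vg * vg * wg - (1 - vg + z) * wg * wg) * (EU * e')"
proof -
  have a: "s * Y = V * s + V * Y - V * e * W"
  proof -
    have "s * Y = s * (s * V * s) + s * (s * V * s * (s - e) * Y)" by (subst Y1) (rule distrib_left)
    also have "s * (s * V * s) = (s * s) * V * s" by (simp only: mult.assoc)
    also have "s * (s * V * s * (s - e) * Y) = (s * s) * V * (s * (s - e)) * Y" by (simp only: mult.assoc)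
    also have "s * (s - e) = 1 - e" by (simp add: right_diff_distrib s)
    finally show ?thesis by (simp add: s right_diff_distrib left_diff_distrib mult.assoc eY)
  qed
  have b: "Y = s * V * s + V * s * V + Y * V * V - V * e * W * V - s * V * e * W"
  proof -
    have "s * V * s * (s - e) * Y = s * V * (s * (s - e)) * Y" by (simp only: mult.assoc)
    also have "s * (s - e) = 1 - e" by (simp add: right_diff_distrib s)
    also have "s * V * (1 - e) * Y = s * (V * Y) - s * V * (e * Y)"
      by (simp add: right_diff_distrib left_diff_distrib mult.assoc)
    also have "s * (V * Y) = s * Y * V" by (simp only: comm mult.assoc)
    also have "\<dots> = V * s * V + Y * V * V - V * e * W * V"
      unfolding a by (simp add: left_diff_distrib distrib_right comm)
    finally have "s * V * s * (s - e) * Y =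
        V * s * V + Y * V * V - V * e * W * V - s * V * e * W"
      by (simp only: eY mult.assoc)
    moreover have "Y = s * V * s + s * V * s * (s - e) * Y" by (rule Y1)
    ultimately have "Y = s * V * s + (V * s * V + Y * V * V - V * e * W * V - s * V * e * W)" by simp
    then show ?thesis by (simp only: add_diff_eq add.assoc)
  qed
  have d: "EV * (s * V * e) = (1 - V + z) * W * (EV * e)"
  proof -
    have "W * e = s * V * s * e + Y * ((s - e) * (s * V * s)) * e"
      using arg_cong[OF Y2, of "\<lambda>u. u * e"] eY by (simp add: distrib_right mult.assoc)
    also have "Y * ((s - e) * (s * V * s)) * e = Y * ((s * s) * V * (s * e)) - Y * ((e * s) * V * (s * e))"
      by (simp add: right_diff_distrib left_diff_distrib mult.assoc)
    also have "s * V * s * e = s * V * e" by (simp add: mult.assoc s)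
    finally have "W * e = s * V * e + (Y * (V * e) - Y * (e * V * e))"
      by (simp add: s mult.assoc)
    also have "Y * (V * e) = V * W * e" using comm(1) eY by (metis mult.assoc)
    finally have "s * V * e = W * e - V * W * e + Y * (e * V * e)" by simp
    then have "EV * (s * V * e) = EV * W * e - EV * V * W * e + EV * Y * (e * V * e)"
      by (simp add: distrib_left right_diff_distrib mult.assoc)
    also have "EV * Y * (e * V * e) = Y * (EV * (e * V * e))" unfolding EV(3) by (simp only: mult.assoc)
    also have "\<dots> = z * EV * (Y * e)" unfolding EV(2) by (metis EV(3) central(1) mult.assoc)
    also have "\<dots> = z * W * EV * e" unfolding eY by (metis EV(5) mult.assoc)
    also have "EV * W * e = W * EV * e" by (simp only: EV)
    also have "EV * V * W * e = V * W * EV * e" by (metis EV(4) EV(5) mult.assoc)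
    finally show ?thesis by (simp add: left_diff_distrib distrib_right mult.assoc)
  qed
  have EUV: "EU * (V * F) = vg * (EU * F)" "EU * (W * F) = wg * (EU * F)" for F
    using EU(2,3) by (simp_all add: mult.assoc[symmetric])
  have e'V: "e' * (V * F) = V * (e' * F)" "e' * (W * F) = W * (e' * F)" for F
    using comm(2,3) by (metis mult.assoc)+
  have cen: "EU * (vg * F) = vg * (EU * F)" "EU * (wg * F) = wg * (EU * F)" "EU * (z * F) = z * (EU * F)" for F
    using central by (metis mult.assoc)+
  have "EU * e' * Y * e' = EU * (e' * (s * V * s + V * s * V + Y * V * V - V * e * W * V - s * V * e * W) * e')"
    using b by (simp only: mult.assoc)
  also have "\<dots> = EU * (e' * s * V * s * e') + EU * (e' * V * s * V * e') + EU * (e' * Y * V * V * e')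
      - EU * (e' * V * e * W * V * e') - EU * (e' * s * V * e * W * e')"
    by (simp add: distrib_left distrib_right left_diff_distrib right_diff_distrib mult.assoc)
  also have "EU * (e' * s * V * s * e') = z * (EU * e')"
  proof -
    have "EU * (e' * s * V * s * e') = q * (EV * e') * (e * V * e) * e'"
      unfolding e' EU by (simp only: mult.assoc)
    also have "\<dots> = q * e' * (EV * (e * V * e)) * e'" unfolding EV(1) by (simp only: mult.assoc)
    also have "\<dots> = q * e' * (z * (EV * e)) * e'" unfolding EV(2) by (rule refl)
    also have "\<dots> = z * (q * (e' * EV) * e * e')" using central(1) by (metis mult.assoc)
    also have "\<dots> = z * (EU * (e' * e * e'))" unfolding EV(1)[symmetric] EU by (simp only: mult.assoc)
    finally show ?thesis by (simp only: e')
  qed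
  also have "EU * (e' * V * s * V * e') = vg * vg * (EU * e')"
  proof -
    have "e' * V * s * V * e' = V * (e' * s * e') * V" by (simp only: mult.assoc e'V comm(2)[symmetric])
    also have "\<dots> = V * (V * e')" unfolding e'(2) by (simp only: mult.assoc comm(2))
    finally show ?thesis by (simp only: EUV mult.assoc)
  qed
  also have "EU * (e' * Y * V * V * e') = vg * vg * (EU * e' * Y * e')"
  proof -
    have "e' * Y * V * V * e' = V * (V * (e' * Y * e'))"
      by (simp only: mult.assoc comm(1)[symmetric] e'V comm(2)[symmetric])
    then show ?thesis by (simp only: EUV mult.assoc)
  qed
  also have "EU * (e' * V * e * W * V * e') = vg * vg * wg * (EU * e')"
  proof -
    have "e' * V * e * W * V * e' = V * (e' * e * e') * W * V"
      by (metis comm(2,3) mult.assoc)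
    also have "\<dots> = V * (W * (V * e'))" unfolding e' by (metis comm(2,3) mult.assoc)
    finally show ?thesis by (simp only: EUV mult.assoc) (metis central(2) mult.assoc)
  qed
  also have "EU * (e' * s * V * e * W * e') = (1 - vg + z) * wg * wg * (EU * e')"
  proof -
    have "EU * (e' * s * V * e * W * e') = q * (EV * e') * (s * V * e) * W * e'"
      unfolding EU by (simp only: mult.assoc)
    also have "\<dots> = q * e' * (EV * (s * V * e)) * W * e'" unfolding EV(1) by (simp only: mult.assoc)
    also have "\<dots> = q * (e' * ((1 - V + z) * W)) * EV * e * W * e'" unfolding d by (simp only: mult.assoc)
    also have "e' * ((1 - V + z) * W) = (1 - V + z) * W * e'"
      by (simp add: distrib_left distrib_right left_diff_distrib right_diff_distrib mult.assoc
          e'V comm(3)[symmetric]) (metis central(1) comm(3) mult.assoc)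
    also have "q * ((1 - V + z) * W * e') * EV * e * W * e' = q * ((1 - V + z) * W) * (EV * e') * e * (W * e')"
      unfolding EV(1) by (simp only: mult.assoc)
    also have "\<dots> = q * ((1 - V + z) * W * EV) * (e' * e * e') * W" unfolding comm(3) by (simp only: mult.assoc)
    also have "(1 - V + z) * W * EV = EV * ((1 - V + z) * W)"
      using EV(4,5) central(1)
      by (simp add: distrib_left distrib_right left_diff_distrib right_diff_distrib) (metis mult.assoc)
    also have "q * (EV * ((1 - V + z) * W)) * (e' * e * e') * W = EU * ((1 - V + z) * (W * (W * e')))"
      unfolding e' EU by (metis comm(3) mult.assoc)
    also have "\<dots> = wg * (wg * (EU * e')) - vg * (wg * (wg * (EU * e'))) + z * (wg * (wg * (EU * e')))"
      by (simp add: left_diff_distrib right_diff_distrib distrib_right distrib_left mult.assoc EUV cen)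
    also have "\<dots> = (1 - vg + z) * wg * wg * (EU * e')"
      by (simp add: left_diff_distrib distrib_right mult.assoc)
    finally show ?thesis .
  qed
  finally have "EU * e' * Y * e' - vg * vg * (EU * e' * Y * e') =
    z * (EU * e') + vg * vg * (EU * e') - vg * vg * wg * (EU * e') - (1 - vg + z) * wg * wg * (EU * e')"
    by (simp add: algebra_simps)
  then show ?thesis by (simp add: left_diff_distrib distrib_right mult.assoc)
qed

text \<open>The polynomial with the roots \<open>L\<close>, reversed so that it becomes a unit in
  the ring of power series in \<open>1 / u\<close>.\<close>

definition dprod :: "'k::field list \<Rightarrow> 'k fps" where
  "dprod L = prod_list (map (\<lambda>a. 1 - fps_const a * fps_X) L)"

lemma dprod_simps: "dprod [] = 1" "dprod (a # L) = (1 - fps_const a * fps_X) * dprod L"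
  "dprod (L @ M) = dprod L * dprod M"
  by (simp_all add: dprod_def)

lemma linear_mult_nth:
  fixes f :: "'k::field fps"
  shows "((1 - fps_const a * fps_X) * f) $ m = f $ m - (if m = 0 then 0 else a * f $ (m - 1))"
proof -
  have "(1 - fps_const a * fps_X) * f = f - fps_const a * (fps_X * f)"
    by (simp add: left_diff_distrib mult.assoc)
  then show ?thesis by simp
qed

lemma dprod_nth_large: "length L < m \<Longrightarrow> dprod L $ m = 0"
proof (induction L arbitrary: m)
  case (Cons a L)
  then show ?case by (simp add: dprod_simps linear_mult_nth)
qed (simp add: dprod_simps)

lemma dprod_uminus_nth: "dprod (map uminus L) $ m = (- 1) ^ m * dprod L $ m"
proof (induction L arbitrary: m)
  case Nil
  show ?case by (cases m) (simp_all add: dprod_simps)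
next
  case (Cons a L)
  show ?case
    unfolding list.map dprod_simps linear_mult_nth Cons.IH
    by (cases m) (simp_all add: algebra_simps)
qed

lemma dprod_nonzero: "dprod L \<noteq> 0"
proof -
  have "dprod L $ 0 = 1" by (induction L) (simp_all add: dprod_simps linear_mult_nth)
  then show ?thesis by auto
qed

definition half :: "'k::field fps" where "half = fps_const (1 / 2) * fps_X"

lemma half_half:
  assumes "(2::'k::field) \<noteq> 0"
  shows "half + half = (fps_X :: 'k fps)"
proof -
  have "(1 / 2 :: 'k) + 1 / 2 = 1"
    using assms unfolding add_divide_distrib[symmetric] one_add_one by simp
  then have "fps_const (1 / 2) + fps_const (1 / 2) = (1 :: 'k fps)" by (simp only: fps_const_add fps_const_1_eq_1)
  then show ?thesis unfolding half_def distrib_right[symmetric] by simp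
qed

text \<open>The closed form of the closure \<open>f\<close>, with \<open>half = t / 2\<close>: up
  to a shift, it is the quotient of the reversed polynomials with the roots \<open>- a\<close> and
  \<open>a\<close>. This form is preserved by the recursion.\<close>

definition balanced :: "'k::field list \<Rightarrow> 'k fps \<Rightarrow> bool" where
  "balanced L f \<longleftrightarrow> (f + 1 - half) * dprod L = (1 + half) * dprod (map uminus L)"

text \<open>By definition, \<open>f * dprod L\<close> is \<open>(1 + half) * dprod (map uminus L)
  - (1 - half) * dprod L\<close>. This is a polynomial of degree at most \<open>length L +
  1\<close>, and its coefficient in that degree is half the sum of the leading coefficients of the
  two products, which are opposite since the length is odd.\<close>

lemma balanced_vanish:
  assumes "balanced L f" "odd (length L)" "length L < m"
  shows "(f * dprod L) $ m = 0"
proof -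
  have "(f * dprod L) $ m = ((f + 1 - half) * dprod L) $ m - dprod L $ m + (half * dprod L) $ m"
    by (simp add: algebra_simps)
  also have "\<dots> = dprod (map uminus L) $ m + (half * dprod (map uminus L)) $ m - dprod L $ m
      + (half * dprod L) $ m"
    using assms(1) unfolding balanced_def by (simp add: algebra_simps)
  also have "\<dots> = 1 / 2 * (dprod (map uminus L) $ (m - 1) + dprod L $ (m - 1))"
    using assms(3) by (simp add: half_def mult.assoc dprod_nth_large algebra_simps)
  also have "dprod (map uminus L) $ (m - 1) + dprod L $ (m - 1) = 0"
  proof (cases "m - 1 = length L")
    case True
    then show ?thesis using assms(2) by (simp add: dprod_uminus_nth)
  next
    case False
    then show ?thesis using assms(3) by (simp add: dprod_nth_large)
  qed
  finally show ?thesis by simp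
qed

lemma step_identities:
  fixes t h G u v f f' :: "'b::idom"
  assumes "h + h = t" "v * (1 - G * t) = t" "u * (1 + G * t) = t"
  shows "2 * (u * v) = 2 * (h * (u + v))"
    "(1 - v * v) * (1 - G * t) ^ 2 = (1 - G * t - t) * (1 - G * t + t)"
    "(1 - u * u) * (1 + G * t) ^ 2 = (1 + G * t - t) * (1 + G * t + t)"
proof -
  have "(h + h) * (u + v) = (v * (1 - G * t)) * u + (u * (1 + G * t)) * v"
    unfolding assms by (simp add: distrib_left)
  then show "2 * (u * v) = 2 * (h * (u + v))" by (simp add: algebra_simps)
  have sq: "(1 - p * p) * q ^ 2 = (q - p * q) * (q + p * q)" for p q :: 'b
    by (simp add: algebra_simps power2_eq_square)
  show "(1 - v * v) * (1 - G * t) ^ 2 = (1 - G * t - t) * (1 - G * t + t)"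
    unfolding sq assms(2) ..
  show "(1 - u * u) * (1 + G * t) ^ 2 = (1 + G * t - t) * (1 + G * t + t)"
    unfolding sq assms(3) ..
qed

text \<open>In terms of \<open>f + 1 - t / 2\<close> the recursion is multiplicative; here
  \<open>h = t / 2\<close>, and \<open>u\<close> and \<open>v\<close> are \<open>t / (1 + G
  t)\<close> and \<open>t / (1 - G t)\<close>.\<close>

lemma step_transfer:
  fixes h u v f f' :: "'b::idom"
  assumes "u * v = h * (u + v)" "f' * (1 - v * v) = f + v * v - v * v * u - (1 - v + f) * u * u"
  shows "(f' + 1 - h) * (1 - v * v) = (f + 1 - h) * (1 - u * u)"
  using assms by algebra

lemma initial_identity:
  fixes h t a :: "'b::idom"
  assumes "h + h = t"
  shows "(a + a + 1) * t + (1 - h) * (1 - a * t) = (1 + h) * (1 + a * t)"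
  unfolding assms[symmetric] by (simp add: algebra_simps)

text \<open>The relation between the contents \<open>L\<close> before and \<open>L'\<close> after
  a step with content \<open>g\<close>, without denominators: the content of the box itself is
  replaced by \<open>- g\<close>, and on each of the two neighbouring diagonals a corner appears
  or disappears.\<close>

definition content_step :: "'k::field \<Rightarrow> 'k list \<Rightarrow> 'k list \<Rightarrow> bool" where
  "content_step g L L' \<longleftrightarrow>
    dprod L' * dprod (map uminus L) * dprod [g, g, - (g + 1), - (g - 1)] =
    dprod L * dprod (map uminus L') * dprod [- g, - g, g + 1, g - 1]"

lemma geo_fps: "geo g * (1 - fps_const g * fps_X) = (1 :: 'k::field fps)"
  using geo_inverse(1)[of g] by (simp add: mult.commute)

lemma balanced_step:
  fixes f f' :: "'k::field fps"
  assumes two: "(2::'k) \<noteq> 0" and bal: "balanced L f" and step: "content_step g L L'"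
    and f': "f' * (1 - (fps_X * geo g) * (fps_X * geo g)) = f + (fps_X * geo g) * (fps_X * geo g)
        - (fps_X * geo g) * (fps_X * geo g) * (fps_X * geo (- g))
        - (1 - fps_X * geo g + f) * (fps_X * geo (- g)) * (fps_X * geo (- g))"
  shows "balanced L' f'"
proof -
  define t where "t = (fps_X :: 'k fps)"
  define G where "G = fps_const g"
  define v where "v = t * geo g"
  define u where "u = t * geo (- g)"
  define h where "h = (half :: 'k fps)"
  have ht: "h + h = t"
    unfolding h_def t_def using two by (rule half_half)
  have v: "v * (1 - G * t) = t"
    unfolding v_def t_def G_def by (simp only: mult.assoc mult_1_right geo_fps)
  have u: "u * (1 + G * t) = t"
  proof -
    have "1 - fps_const (- g) * fps_X = 1 + fps_const g * (fps_X :: 'k fps)"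
      by (simp flip: fps_const_neg)
    then show ?thesis
      unfolding u_def t_def G_def using geo_fps[of "- g"] by (simp only: mult.assoc mult_1_right)
  qed
  note ids = step_identities[OF ht v u]
  have "(2 :: 'k fps) \<noteq> 0"
  proof
    assume "(2 :: 'k fps) = 0"
    then have "(2 :: 'k fps) $ 0 = 0" by simp
    then show False using two by (simp add: fps_numeral_nth)
  qed
  then have uv: "u * v = h * (u + v)" using ids(1) by (simp only: mult_cancel_left simp_thms)
  have "f' * (1 - v * v) = f + v * v - v * v * u - (1 - v + f) * u * u"
    using f' unfolding v_def u_def t_def .
  then have fv: "(f' + 1 - h) * (1 - v * v) = (f + 1 - h) * (1 - u * u)"
    by (rule step_transfer[OF uv])
  have d: "dprod [g, g, - (g + 1), - (g - 1)] = (1 - G * t) ^ 2 * ((1 + G * t - t) * (1 + G * t + t))"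
    "dprod [- g, - g, g + 1, g - 1] = (1 + G * t) ^ 2 * ((1 - G * t - t) * (1 - G * t + t))"
    unfolding dprod_simps G_def t_def
    by (simp_all add: power2_eq_square algebra_simps flip: fps_const_add fps_const_sub fps_const_neg)
  have "(f' + 1 - h) * dprod [- g, - g, g + 1, g - 1] = (f + 1 - h) * dprod [g, g, - (g + 1), - (g - 1)]"
  proof -
    have "(f' + 1 - h) * ((1 - v * v) * (1 - G * t) ^ 2) * (1 + G * t) ^ 2 =
        (f + 1 - h) * ((1 - u * u) * (1 + G * t) ^ 2) * (1 - G * t) ^ 2"
    proof -
      have "X * (Y * P) * Q = (X * Y) * (P * Q)" "X * (Y * P) * Q = (X * Y) * (Q * P)" for X Y P Q :: "'k fps"
        by (simp_all only: mult_ac)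
      then show ?thesis using fv by metis
    qed
    then show ?thesis unfolding d ids(2,3) by (simp only: mult_ac)
  qed
  then have "(f' + 1 - h) * dprod L' * (dprod L * dprod [- g, - g, g + 1, g - 1]) =
      ((f + 1 - h) * dprod L) * (dprod L' * dprod [g, g, - (g + 1), - (g - 1)])"
  proof -
    assume *: "(f' + 1 - h) * dprod [- g, - g, g + 1, g - 1] = (f + 1 - h) * dprod [g, g, - (g + 1), - (g - 1)]"
    have "(f' + 1 - h) * dprod L' * (dprod L * dprod [- g, - g, g + 1, g - 1]) =
        ((f' + 1 - h) * dprod [- g, - g, g + 1, g - 1]) * (dprod L * dprod L')" by (simp only: mult_ac)
    then show ?thesis unfolding * by (simp only: mult_ac)
  qed
  also have "(f + 1 - h) * dprod L = (1 + h) * dprod (map uminus L)"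
    using bal unfolding balanced_def h_def[symmetric] .
  also have "(1 + h) * dprod (map uminus L) * (dprod L' * dprod [g, g, - (g + 1), - (g - 1)]) =
      (1 + h) * (dprod L' * dprod (map uminus L) * dprod [g, g, - (g + 1), - (g - 1)])"
    by (simp only: mult_ac)
  also have "\<dots> = (1 + h) * dprod (map uminus L') * (dprod L * dprod [- g, - g, g + 1, g - 1])"
    using step unfolding content_step_def by (simp only: mult_ac)
  finally show ?thesis
    unfolding balanced_def h_def[symmetric] by (simp add: dprod_nonzero)
qed

context brauer_relations
begin

definition lift :: "'k fps \<Rightarrow> 'a fps" where "lift f = Abs_fps (\<lambda>k. c (f $ k))"

lemma c_sum: "c (sum f J) = (\<Sum>j\<in>J. c (f j))"
  by (induction J rule: infinite_finite_induct) (simp_all add: c_0 c_add)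

lemma lift_nth: "lift f $ k = c (f $ k)" by (simp add: lift_def)

lemma lift_simps: "lift (f + g) = lift f + lift g" "lift (f - g) = lift f - lift g"
  "lift (f * g) = lift f * lift g" "lift 1 = 1" "lift fps_X = fps_X" "lift (fps_const a) = fps_const (c a)"
  by (rule fps_ext; simp add: lift_nth c_add c_diff fps_mult_nth c_sum c_mult c_0 c_1 fps_X_def)+

lemma lift_central: "lift f * F = F * lift f"
proof (rule fps_ext)
  fix k
  have "(\<Sum>i=0..k. lift f $ i * F $ (k - i)) = (\<Sum>i=0..k. F $ i * lift f $ (k - i))"
    by (subst sum.atLeastAtMost_rev) (auto intro!: sum.cong simp: lift_nth c_central)
  then show "(lift f * F) $ k = (F * lift f) $ k" by (simp add: fps_mult_nth)
qed

lemma geo_eigen: "E * X = c g * E \<Longrightarrow> fps_const E * geo X = lift (geo g) * fps_const E"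
proof (rule fps_ext)
  fix k assume E: "E * X = c g * E"
  have "E * X ^ k = c (g ^ k) * E"
    by (induction k) (simp_all add: c_1 c_mult mult.assoc[symmetric] E power_commutes[symmetric] del: power_Suc add: power_Suc2,
      simp add: mult.assoc E)
  then show "(fps_const E * geo X) $ k = (lift (geo g) * fps_const E) $ k" by (simp add: geo_nth lift_nth)
qed

text \<open>Closing the last strand of the resolvent of a Jucys--Murphy element leads to the
  strands before it; the condition says that the result acts on \<open>E\<close> by the scalar
  series \<open>f\<close>.\<close>

definition closed_by :: "nat \<Rightarrow> 'a \<Rightarrow> 'k fps \<Rightarrow> bool" where
  "closed_by r E f \<longleftrightarrow> fps_const E * (fps_const (e (Suc r) (r + 2)) * (fps_X * geo (x (Suc r))) *
      fps_const (e (Suc r) (r + 2))) = lift f * fps_const (E * e (Suc r) (r + 2))"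

lemma temperley_lieb_relations:
  assumes "i \<in> I" "j \<in> I" "k \<in> I" "distinct [i, j, k]"
  shows "e j k * e i j * e j k = e j k" "e j k * s i j * e j k = e j k"
    "e j k * s i j = e j k * e i j * s j k" "s i j * e j k = s j k * e i j * e j k"
proof -
  have ne: "i \<noteq> j" "j \<noteq> k" "i \<noteq> k" "k \<noteq> j" "j \<noteq> i" "k \<noteq> i" using assms by auto
  note I = assms(1-3)
  have a: "e i j * e j k = s i k * e j k" using ee3'[OF I ne(1-3)] .
  have b: "e j k * e i j = e j k * s i k"
    using ee3[of k j i] I ne e_sym[of k j] e_sym[of j i] s_sym[of k i] by simp
  have c': "s i k * e j k = e i j * s i k"
    using se3[of i k j] I ne e_sym[of k j] by simp
  have "e j k * e i j * e j k = e j k * (s i k * e j k)" unfolding mult.assoc a by simp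
  also have "\<dots> = e j k * e i j * s i k" unfolding c' by (simp add: mult.assoc)
  also have "\<dots> = e j k * s i k * s i k" unfolding b by simp
  finally show 1: "e j k * e i j * e j k = e j k" using ss[of i k] I ne by (simp add: mult.assoc)
  have "s i k * s k j = s k j * s i j"
    using ss3[of i k j] ss3[of k j i] I ne s_sym[of i k] s_sym[of i j] s_sym[of j i] s_sym[of k i] by metis
  then have "s i k * s j k = s j k * s i j" using s_sym[of k j] by simp
  then have "e j k * e i j * s j k = e j k * s j k * s i j" unfolding b by (simp add: mult.assoc)
  then show 2: "e j k * s i j = e j k * e i j * s j k" using es[of j k] I ne by simp
  show "e j k * s i j * e j k = e j k"
    unfolding 2 mult.assoc se[OF I(2,3) ne(2)] using 1 by (simp add: mult.assoc)
  have "s j k * s i k = s i j * s j k"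
    using ss3[of i j k] ss3[of j k i] I ne s_sym[of i k] s_sym[of i j] s_sym[of j i] s_sym[of k i] by metis
  then have "s j k * e i j * e j k = s i j * s j k * e j k" unfolding mult.assoc a by (simp add: mult.assoc[symmetric])
  then show "s i j * e j k = s j k * e i j * e j k" using se[of j k] I ne by (simp add: mult.assoc)
qed

lemma pow_step: "X ^ j * ((X - c a) * Z) = X ^ Suc j * Z - c a * (X ^ j * Z)"
proof -
  have "X ^ j * (c a * Z) = c a * (X ^ j * Z)"
    by (simp only: c_scl(1) scl_right)
  then show ?thesis
    by (simp only: left_diff_distrib right_diff_distrib power_Suc2 mult.assoc)
qed

lemma commutes_power: "commutes a b \<Longrightarrow> commutes a (b ^ k)"
  by (induction k) (simp_all only: power_0 power_Suc commutes_1 commutes_mult)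

text \<open>This is \<open>closure_step_ring\<close> for \<open>V\<close>, \<open>W\<close> and
  \<open>Y\<close> as described there; the equations for \<open>Y\<close> follow from
  \<open>x_Suc\<close>.\<close>

lemma closed_by_Suc:
  fixes f f' :: "'k fps"
  assumes I: "{1..r + 3} \<subseteq> I"
    and EV: "closed_by r EV f" "commutes EV (s (Suc r) (r + 2))" "commutes EV (e (Suc r) (r + 2))"
      "commutes EV (e (r + 2) (r + 3))" "commutes EV (x (Suc r))" "commutes EV (x (r + 2))"
    and EU: "EU = q * EV" "EU * x (Suc r) = c g * EU"
    and f': "f' * (1 - (fps_X * geo g) * (fps_X * geo g)) = f + (fps_X * geo g) * (fps_X * geo g)
        - (fps_X * geo g) * (fps_X * geo g) * (fps_X * geo (- g))
        - (1 - fps_X * geo g + f) * (fps_X * geo (- g)) * (fps_X * geo (- g))"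
  shows "closed_by (Suc r) EU f'"
proof -
  let ?n = "Suc r" and ?m = "r + 2" and ?l = "r + 3"
  let ?K = "fps_const :: 'a \<Rightarrow> 'a fps" and ?T = "fps_X :: 'a fps"
  define s0 where "s0 = s ?n ?m"
  define e0 where "e0 = e ?n ?m"
  define s1 where "s1 = s ?m ?l"
  define e1 where "e1 = e ?m ?l"
  define V where "V = ?T * geo (x ?n)"
  define W where "W = ?T * geo (- x ?n)"
  define Y where "Y = ?T * geo (x ?m)"
  define vg where "vg = fps_X * geo g"
  define wg where "wg = fps_X * geo (- g)"
  have ind: "?n \<in> I" "?m \<in> I" "?l \<in> I" "distinct [?n, ?m, ?l]" using I by auto
  note TL = temperley_lieb_relations[OF ind, folded s0_def e0_def s1_def e1_def]
  have T: "?T * F = F * ?T" for F by (rule fps_mult_fps_X_commute)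
  have lcV: "V * ?K B = ?K B * (?T * geo A)" if "x ?n * B = B * A" for A B
    unfolding V_def using geo_intertwine[OF that] T by (metis mult.assoc)
  have comm_geo: "?K B * (?T * geo A) = ?T * geo A * ?K B" if "commutes B A" for A B
    using geo_intertwine[of A B A] that T unfolding commutes_def by (metis mult.assoc)
  have geo_comm: "geo A * geo B = geo B * geo A" if "commutes A B" for A B
  proof (rule fps_ext)
    fix k
    have p: "A ^ i * B ^ j = B ^ j * A ^ i" for i j
    proof -
      have "A * B ^ j = B ^ j * A" for j
        by (induction j) (use that in \<open>auto simp: commutes_def mult.assoc[symmetric]\<close>, metis mult.assoc)
      then show ?thesis by (induction i) (auto simp: mult.assoc[symmetric], metis mult.assoc)
    qed
    show "(geo A * geo B) $ k = (geo B * geo A) $ k"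
      unfolding fps_mult_nth
      by (subst sum.atLeastAtMost_rev) (auto intro!: sum.cong simp: geo_nth p)
  qed
  have TT: "(?T * geo A) * (?T * geo B) = (?T * geo B) * (?T * geo A)" if "commutes A B" for A B
    using geo_comm[OF that] T by (metis mult.assoc)
  have xX: "commutes (x ?n) (x ?m)"
    by (rule commutes_sym, rule x_x_commutes) (use I in auto)
  have x_e1: "commutes (x ?n) s1" "commutes (x ?n) e1"
    unfolding s1_def e1_def using I by (auto intro!: x_gen_commutes)
  have neg: "commutes A (- B)" if "commutes A B" for A B using that by (simp add: commutes_def)
  have ss0: "s0 * s0 = 1" "s0 * e0 = e0" "e0 * s0 = e0" "s1 * s1 = 1"
    unfolding s0_def e0_def s1_def using ind ss se es by auto
  have n1: "1 \<le> ?n" "{1..Suc ?n} \<subseteq> I" using I by auto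
  have x_m: "x ?m = s0 * x ?n * s0 + (s0 - e0)"
    using x_Suc[OF n1] by (simp add: s0_def e0_def)
  have exx: "e0 * (x ?n + x ?m) = 0" "(x ?n + x ?m) * e0 = 0"
    using e_x_x[OF n1] by (simp_all add: e0_def)
  define x' where "x' = s0 * x ?n * s0"
  have V': "?K s0 * V * ?K s0 = ?T * geo x'"
  proof -
    have "x ?n * s0 = s0 * x'" unfolding x'_def by (simp add: mult.assoc[symmetric] ss0)
    from lcV[OF this] have "?K s0 * V * ?K s0 = (?K s0 * ?K s0) * (?T * geo x')"
      by (simp only: mult.assoc)
    then show ?thesis by (simp add: fps_const_mult ss0)
  qed
  have res: "geo x' * (1 - ?T * ?K (x ?m)) = 1 - geo x' * ?T * (?K s0 - ?K e0)"
    "(1 - ?T * ?K (x ?m)) * geo x' = 1 - (?K s0 - ?K e0) * (?T * geo x')"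
  proof -
    have split: "1 - ?T * ?K (x ?m) = (1 - ?T * ?K x') - ?T * (?K s0 - ?K e0)"
      unfolding x_m x'_def by (simp add: right_diff_distrib distrib_left flip: fps_const_add fps_const_sub)
    show "geo x' * (1 - ?T * ?K (x ?m)) = 1 - geo x' * ?T * (?K s0 - ?K e0)"
      unfolding split right_diff_distrib[of "geo x'"] geo_inverse by (simp only: mult.assoc)
    show "(1 - ?T * ?K (x ?m)) * geo x' = 1 - (?K s0 - ?K e0) * (?T * geo x')"
      unfolding split left_diff_distrib[of "1 - ?T * ?K x'"] geo_inverse T[of "?K s0 - ?K e0"] by (simp only: mult.assoc)
  qed
  have Y1: "Y = ?K s0 * V * ?K s0 + ?K s0 * V * ?K s0 * (?K s0 - ?K e0) * Y"
  proof -
    have "geo x' = geo x' * ((1 - ?T * ?K (x ?m)) * geo (x ?m))" unfolding geo_inverse by simp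
    also have "\<dots> = geo (x ?m) - geo x' * ?T * (?K s0 - ?K e0) * geo (x ?m)"
      unfolding mult.assoc[symmetric] res by (simp add: left_diff_distrib)
    finally have "geo (x ?m) = geo x' + geo x' * ?T * (?K s0 - ?K e0) * geo (x ?m)"
      by (metis diff_add_cancel)
    then have "?T * geo (x ?m) = ?T * geo x' + ?T * (geo x' * ?T * (?K s0 - ?K e0) * geo (x ?m))"
      by (metis distrib_left)
    also have "?T * (geo x' * ?T * (?K s0 - ?K e0) * geo (x ?m)) = ?T * geo x' * (?K s0 - ?K e0) * (?T * geo (x ?m))"
      by (metis T mult.assoc)
    finally show ?thesis unfolding V' Y_def .
  qed
  have Y2: "Y = ?K s0 * V * ?K s0 + Y * (?K s0 - ?K e0) * (?K s0 * V * ?K s0)"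
  proof -
    have "geo x' = (geo (x ?m) * (1 - ?T * ?K (x ?m))) * geo x'" unfolding geo_inverse by simp
    also have "\<dots> = geo (x ?m) - geo (x ?m) * (?K s0 - ?K e0) * (?T * geo x')"
      unfolding mult.assoc res(2)[unfolded mult.assoc] by (simp add: right_diff_distrib mult.assoc)
    finally have "geo (x ?m) = geo x' + geo (x ?m) * (?K s0 - ?K e0) * (?T * geo x')"
      by (metis diff_add_cancel)
    then have "?T * geo (x ?m) = ?T * geo x' + ?T * (geo (x ?m) * (?K s0 - ?K e0) * (?T * geo x'))"
      by (metis distrib_left)
    also have "?T * (geo (x ?m) * (?K s0 - ?K e0) * (?T * geo x')) = ?T * geo (x ?m) * (?K s0 - ?K e0) * (?T * geo x')"
      by (simp only: mult.assoc)
    finally show ?thesis unfolding V' Y_def .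
  qed
  have pw: "e0 * x ?m ^ k = e0 * (- x ?n) ^ k" "x ?m ^ k * e0 = (- x ?n) ^ k * e0" for k
  proof -
    have a: "e0 * x ?m = - (e0 * x ?n)" "x ?m * e0 = - (x ?n * e0)"
      using exx by (simp_all add: distrib_left distrib_right eq_neg_iff_add_eq_0 add.commute)
    have b: "commutes (x ?m) ((- x ?n) ^ k)" for k
      by (intro commutes_power neg commutes_sym[OF xX])
    show "e0 * x ?m ^ k = e0 * (- x ?n) ^ k"
    proof (induction k)
      case (Suc k)
      have "e0 * x ?m ^ Suc k = e0 * x ?m ^ k * x ?m" by (simp add: power_Suc2 mult.assoc del: power_Suc)
      also have "\<dots> = e0 * ((- x ?n) ^ k * x ?m)" using Suc by (simp add: mult.assoc)
      also have "(- x ?n) ^ k * x ?m = x ?m * (- x ?n) ^ k" using b by (simp add: commutes_def)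
      also have "e0 * (x ?m * (- x ?n) ^ k) = (e0 * x ?m) * (- x ?n) ^ k" by (simp only: mult.assoc)
      also have "\<dots> = e0 * (- x ?n) ^ Suc k" unfolding a by (simp add: mult.assoc)
      finally show ?case .
    qed simp
    show "x ?m ^ k * e0 = (- x ?n) ^ k * e0"
    proof (induction k)
      case (Suc k)
      have "x ?m ^ Suc k * e0 = x ?m * ((- x ?n) ^ k * e0)" using Suc by (simp add: mult.assoc)
      also have "\<dots> = ((- x ?n) ^ k * x ?m) * e0" using b by (simp add: commutes_def mult.assoc[symmetric])
      also have "\<dots> = (- x ?n) ^ k * (x ?m * e0)" by (simp only: mult.assoc)
      also have "\<dots> = (- x ?n) ^ Suc k * e0" unfolding a power_Suc2 by (simp add: mult.assoc)
      finally show ?case .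
    qed simp
  qed
  have "?K e0 * geo (x ?m) = ?K e0 * geo (- x ?n)" "geo (x ?m) * ?K e0 = geo (- x ?n) * ?K e0"
    by (rule fps_ext, simp only: geo_nth fps_mult_left_const_nth fps_mult_right_const_nth pw)+
  then have eY: "?K e0 * Y = ?K e0 * W" "Y * ?K e0 = W * ?K e0"
    unfolding Y_def W_def by (simp_all only: mult.assoc) (metis T mult.assoc)
  have eVe: "?K e1 * ?K s0 * V * ?K s0 * ?K e1 = ?K e1 * (?K e0 * V * ?K e0) * ?K e1"
  proof -
    have "?K e1 * ?K s0 = ?K e1 * ?K e0 * ?K s1" "?K s0 * ?K e1 = ?K s1 * ?K e0 * ?K e1"
      using TL(3,4) by (simp_all add: fps_const_mult)
    then have "(?K e1 * ?K s0) * V * (?K s0 * ?K e1) =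
        (?K e1 * ?K e0 * ?K s1) * V * (?K s1 * ?K e0 * ?K e1)" by (simp only:)
    then have "?K e1 * ?K s0 * V * ?K s0 * ?K e1 = ?K e1 * ?K e0 * (?K s1 * V * ?K s1) * ?K e0 * ?K e1"
      by (simp only: mult.assoc)
    also have "?K s1 * V = V * ?K s1"
      unfolding V_def using x_e1 by (intro comm_geo) (rule commutes_sym)
    also have "V * ?K s1 * ?K s1 = V" by (simp add: mult.assoc fps_const_mult ss0)
    finally show ?thesis by (simp only: mult.assoc)
  qed
  have EVz: "?K EV * (?K e0 * V * ?K e0) = lift f * (?K EV * ?K e0)"
    using EV(1) unfolding closed_by_def V_def e0_def by (simp add: fps_const_mult)
  have EUx: "?K EU * V = lift vg * ?K EU" "?K EU * W = lift wg * ?K EU"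
  proof -
    have "EU * (- x ?n) = c (- g) * EU" using EU(2) by (simp add: c_minus)
    from geo_eigen[OF this] geo_eigen[OF EU(2)]
    show "?K EU * V = lift vg * ?K EU" "?K EU * W = lift wg * ?K EU"
      unfolding V_def W_def vg_def wg_def lift_simps by (metis T mult.assoc)+
  qed
  have main: "(1 - lift vg * lift vg) * (?K EU * ?K e1 * Y * ?K e1) =
    (lift f + lift vg * lift vg - lift vg * lift vg * lift wg - (1 - lift vg + lift f) * lift wg * lift wg) *
    (?K EU * ?K e1)"
  proof (rule closure_step_ring[where s = "?K s0" and e = "?K e0" and V = V and W = W and EV = "?K EV" and q = "?K q"])
    show "?K EV * Y = Y * ?K EV" "?K EV * V = V * ?K EV" "?K EV * W = W * ?K EV"
      unfolding Y_def V_def W_def using EV by (auto intro!: comm_geo neg)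
    show "?K e1 * V = V * ?K e1" "W * ?K e1 = ?K e1 * W"
      unfolding V_def W_def using x_e1
      by (auto intro!: comm_geo comm_geo[symmetric] neg intro: commutes_sym)
    show "V * Y = Y * V" "W * V = V * W"
      unfolding V_def W_def Y_def using xX
      by (auto intro!: TT neg intro: commutes_sym simp: commutes_def)
    show "?K EV * ?K e1 = ?K e1 * ?K EV" "?K EV * ?K s0 = ?K s0 * ?K EV"
      using EV by (simp_all add: fps_const_mult commutes_def e1_def s0_def)
    show "?K s0 * ?K s0 = 1" "?K s0 * ?K e0 = ?K e0" "?K e0 * ?K s0 = ?K e0"
      "?K e1 * ?K e0 * ?K e1 = ?K e1" "?K e1 * ?K s0 * ?K e1 = ?K e1" "?K EU = ?K q * ?K EV"
      using TL(1,2) EU(1) by (simp_all only: fps_const_mult ss0 fps_const_1_eq_1)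
    show "?K e1 * ?K s0 * V * ?K s0 * ?K e1 = ?K e1 * (?K e0 * V * ?K e0) * ?K e1" by (rule eVe)
    show "?K EV * (?K e0 * V * ?K e0) = lift f * (?K EV * ?K e0)" by (rule EVz)
  qed (rule Y1 Y2 eY EUx lift_central)+
  have nz: "(1 - vg * vg) $ 0 \<noteq> 0" by (simp add: vg_def)
  have "lift (1 - vg * vg) * (?K EU * ?K e1 * Y * ?K e1) = lift (f' * (1 - vg * vg)) * (?K EU * ?K e1)"
    unfolding f'[folded vg_def wg_def] lift_simps using main by simp
  then have "lift (inverse (1 - vg * vg)) * (lift (1 - vg * vg) * (?K EU * ?K e1 * Y * ?K e1)) =
      lift (inverse (1 - vg * vg)) * (lift (f' * (1 - vg * vg)) * (?K EU * ?K e1))" by simp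
  then have "lift (inverse (1 - vg * vg) * (1 - vg * vg)) * (?K EU * ?K e1 * Y * ?K e1) =
      lift (inverse (1 - vg * vg) * (f' * (1 - vg * vg))) * (?K EU * ?K e1)"
    by (simp only: lift_simps mult.assoc)
  moreover have "inverse (1 - vg * vg) * (1 - vg * vg) = 1" using nz by (rule inverse_mult_eq_1)
  moreover have "inverse (1 - vg * vg) * (f' * (1 - vg * vg)) = f' * (inverse (1 - vg * vg) * (1 - vg * vg))"
    by (simp only: mult_ac)
  ultimately have "?K EU * ?K e1 * Y * ?K e1 = lift f' * (?K EU * ?K e1)"
    by (simp only: lift_simps mult_1_left mult_1_right)
  moreover have "Suc r + 2 = ?l" "Suc (Suc r) = ?m" by simp_all
  ultimately show ?thesis
    unfolding closed_by_def Y_def e1_def by (simp only: fps_const_mult[symmetric] mult.assoc)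
qed

lemma closed_by_nth:
  assumes "closed_by r E f"
  shows "E * (e (Suc r) (r + 2) * x (Suc r) ^ k * e (Suc r) (r + 2)) =
    c (f $ Suc k) * (E * e (Suc r) (r + 2))"
proof -
  have "(fps_const E * (fps_const (e (Suc r) (r + 2)) * (fps_X * geo (x (Suc r))) *
      fps_const (e (Suc r) (r + 2)))) $ Suc k = (lift f * fps_const (E * e (Suc r) (r + 2))) $ Suc k"
    using assms by (simp only: closed_by_def)
  then show ?thesis by (simp add: geo_nth lift_nth mult.assoc)
qed

text \<open>Multiplication by \<open>dprod L\<close> corresponds to multiplication of the
  resolvent by the polynomial with roots \<open>L\<close>, up to a shift of the coefficients.\<close>

lemma closed_by_pp:
  assumes "closed_by r E f"
  shows "E * (e (Suc r) (r + 2) * (x (Suc r) ^ j * pp (x (Suc r)) L) * e (Suc r) (r + 2)) =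
    c ((f * dprod L) $ (j + length L + 1)) * (E * e (Suc r) (r + 2))"
proof (induction L arbitrary: j)
  case Nil
  show ?case using closed_by_nth[OF assms] by (simp add: pp_simps dprod_simps)
next
  case (Cons a L)
  let ?X = "x (Suc r)" and ?e = "e (Suc r) (r + 2)"
  have 1: "?X ^ j * pp ?X (a # L) = ?X ^ Suc j * pp ?X L - c a * (?X ^ j * pp ?X L)"
    unfolding pp_simps by (rule pow_step)
  have 2: "E * (?e * (?X ^ j * pp ?X (a # L)) * ?e) =
      E * (?e * (?X ^ Suc j * pp ?X L) * ?e) - c a * (E * (?e * (?X ^ j * pp ?X L) * ?e))"
  proof -
    have "E * (?e * (c a * (?X ^ j * pp ?X L)) * ?e) = c a * (E * (?e * (?X ^ j * pp ?X L) * ?e))"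
      by (simp only: c_scl(1) scl_left scl_right)
    then show ?thesis unfolding 1 by (simp add: left_diff_distrib right_diff_distrib)
  qed
  have "f * dprod (a # L) = (1 - fps_const a * fps_X) * (f * dprod L)"
    by (simp add: dprod_simps mult_ac)
  then show ?case
    unfolding 2 Cons.IH by (simp add: linear_mult_nth c_diff c_mult left_diff_distrib mult.assoc)
qed

text \<open>One factor \<open>pp\<close> multiplies \<open>f\<close> by \<open>dprod L\<close>,
  whose coefficients beyond \<open>length L\<close> vanish by \<open>balanced_vanish\<close>; the
  powers of \<open>x\<close> in the other factor only refer to those coefficients.\<close>

lemma closed_by_pp_square:
  assumes "closed_by r E f" "balanced L f" "odd (length L)"
  shows "E * (e (Suc r) (r + 2) * (pp (x (Suc r)) L * pp (x (Suc r)) L) * e (Suc r) (r + 2)) = 0"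
proof -
  let ?X = "x (Suc r)" and ?e = "e (Suc r) (r + 2)"
  have "E * (?e * (?X ^ j * (pp ?X M * pp ?X L)) * ?e) = 0" for M j
  proof (induction M arbitrary: j)
    case Nil
    show ?case using closed_by_pp[OF assms(1)] balanced_vanish[OF assms(2,3)]
      by (simp add: pp_simps c_0)
  next
    case (Cons a M)
    have 1: "?X ^ j * (pp ?X (a # M) * pp ?X L) =
        ?X ^ Suc j * (pp ?X M * pp ?X L) - c a * (?X ^ j * (pp ?X M * pp ?X L))"
      unfolding pp_simps mult.assoc by (rule pow_step)
    have "E * (?e * (c a * (?X ^ j * (pp ?X M * pp ?X L))) * ?e) =
        c a * (E * (?e * (?X ^ j * (pp ?X M * pp ?X L)) * ?e))"
      by (simp only: c_scl(1) scl_left scl_right)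
    then show ?case
      unfolding 1 left_diff_distrib right_diff_distrib by (simp only: Cons.IH mult_zero_right diff_self)
  qed
  from this[of 0 L] show ?thesis by simp
qed

lemma closed_by_0:
  assumes "1 \<in> I" "2 \<in> I" "commutes p (e 1 2)"
  shows "closed_by 0 p (fps_const w * (fps_X * geo ((w - 1) / 2)))"
proof -
  have x1: "x 1 = c ((w - 1) / 2)" by (simp add: x_def)
  have c_pow: "c a ^ k = c (a ^ k)" for a k by (induction k) (simp_all add: c_1 c_mult)
  have e: "e (Suc 0) 2 * e (Suc 0) 2 = c w * e (Suc 0) 2"
    using ee[of 1 2] assms by simp
  have "p * (e (Suc 0) 2 * c a * e (Suc 0) 2) = c (w * a) * (p * e (Suc 0) 2)" for a
    by (simp only: c_scl scl_left scl_right scl_scl e) (simp only: mult.commute)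
  then show ?thesis
    unfolding closed_by_def
    by (intro fps_ext) (auto simp: geo_nth lift_nth x1[simplified] c_pow c_0 mult.assoc numeral_2_eq_2)
qed

lemma balanced_0:
  assumes "a = (w - 1) / 2"
  shows "balanced [a] (fps_const w * (fps_X * geo a))"
proof -
  let ?t = "fps_X :: 'k fps"
  have g: "geo a * dprod [a] = 1" using geo_fps[of a] by (simp add: dprod_simps)
  have ht: "half + half = ?t"
    using two by (rule half_half)
  have "a * 2 = w - 1" using assms two by simp
  then have w: "w = 2 * a + 1" by (metis diff_add_cancel mult.commute)
  have "(fps_const w * (?t * geo a) + 1 - half) * dprod [a] =
      fps_const w * ?t * (geo a * dprod [a]) + (1 - half) * dprod [a]"
    by (simp add: algebra_simps)
  also have "\<dots> = fps_const w * ?t + (1 - half) * (1 - fps_const a * ?t)"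
    unfolding g by (simp add: dprod_simps)
  also have "\<dots> = (1 + half) * (1 + fps_const a * ?t)"
  proof -
    have "fps_const w = fps_const a + fps_const a + 1" 
      unfolding w mult_2 by (simp only: fps_const_add[symmetric] fps_const_1_eq_1)
    then show ?thesis using initial_identity[OF ht, of "fps_const a"] by (simp only:)
  qed
  finally have main: "(fps_const w * (?t * geo a) + 1 - half) * dprod [a] = (1 + half) * (1 + fps_const a * ?t)" .
  moreover have "dprod (map uminus [a]) = 1 + fps_const a * ?t"
    by (simp add: dprod_simps flip: fps_const_neg)
  ultimately show ?thesis unfolding balanced_def by (simp only:)
qed

end

section \<open>The action on colourings\<close>

text \<open>A colouring assigns one of \<open>N\<close> colours to every strand; colours are the
  numbers below \<open>N\<close>. A transposition permutes the colours of the strands, and the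
  cap-cup element forgets the common colour of two strands and sums over a new one, so that a
  closed loop counts the colours. \<open>Pop N\<close> projects to the functions supported on the
  colourings by \<open>N\<close> colours.\<close>

definition valid :: "nat \<Rightarrow> (nat \<Rightarrow> nat) \<Rightarrow> bool" where "valid N f \<longleftrightarrow> (\<forall>k. f k < N)"

lemma valid_upd: "valid N f \<Longrightarrow> c < N \<Longrightarrow> valid N (f(i := c))"
  by (simp add: valid_def)

lemma valid_swap: "valid N (f \<circ> transpose i j) \<longleftrightarrow> valid N f"
  unfolding valid_def comp_def by (metis transpose_involutory)

lift_definition Sop :: "nat \<Rightarrow> nat \<Rightarrow> (nat \<Rightarrow> nat, real) lop"
  is "\<lambda>i j F f. F (f \<circ> transpose i j)" by simp

lift_definition Cop :: "nat \<Rightarrow> nat \<Rightarrow> nat \<Rightarrow> (nat \<Rightarrow> nat, real) lop"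
  is "\<lambda>N i j F f. if valid N f \<and> f i = f j then \<Sum>c<N. F (f(i := c, j := c)) else 0"
  by (auto simp: fun_eq_iff sum.distrib sum_distrib_left)

lift_definition Pop :: "nat \<Rightarrow> (nat \<Rightarrow> nat, real) lop"
  is "\<lambda>N F f. if valid N f then F f else 0" by (auto simp: fun_eq_iff)

lemma ap_Sop: "ap (Sop i j) F f = F (f \<circ> transpose i j)" by (simp add: Sop.rep_eq)
lemma ap_Cop: "ap (Cop N i j) F f =
    (if valid N f \<and> f i = f j then \<Sum>c<N. F (f(i := c, j := c)) else 0)"
  by (simp add: Cop.rep_eq)
lemma ap_Pop: "ap (Pop N) F f = (if valid N f then F f else 0)" by (simp add: Pop.rep_eq)

interpretation col: brauer_relations sc "real N" UNIV Sop "Cop N" for N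
proof
  fix i j k l :: nat
  show "(2::real) \<noteq> 0" by simp
  show "Sop i j = Sop j i" by (rule lop_eqI) (simp add: ap_Sop transpose_commute)
  show "Cop N i j = Cop N j i"
    by (rule lop_eqI, cases "i = j") (auto simp: ap_Cop fun_upd_twist intro!: sum.cong)
  { assume ij: "i \<noteq> j"
    show "Sop i j * Sop i j = 1"
      by (rule lop_eqI) (simp add: ap_times ap_Sop ap_one comp_assoc)
    show "Cop N i j * Cop N i j = sc (real N) * Cop N i j"
    proof (rule lop_eqI)
      fix F :: "(nat \<Rightarrow> nat) \<Rightarrow> real" and f :: "nat \<Rightarrow> nat"
      show "ap (Cop N i j * Cop N i j) F f = ap (sc (real N) * Cop N i j) F f"
      proof (cases "valid N f \<and> f i = f j")
        case True
        then have "ap (Cop N i j * Cop N i j) F f = (\<Sum>c<N. \<Sum>c<N. F (f(i := c, j := c)))"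
          using ij by (auto simp: ap_times ap_Cop valid_upd fun_upd_twist intro!: sum.cong)
        then show ?thesis using True by (simp add: ap_times ap_Cop ap_sc)
      qed (auto simp: ap_times ap_Cop ap_sc)
    qed
    have a: "(f \<circ> transpose i j)(i := c, j := c) = f(i := c, j := c)"
      "f(i := c, j := c) \<circ> transpose i j = f(i := c, j := c)" for f :: "nat \<Rightarrow> nat" and c
      by (auto simp: fun_eq_iff transpose_def)
    have b: "(f \<circ> transpose i j) i = f j" "(f \<circ> transpose i j) j = f i" for f :: "nat \<Rightarrow> nat"
      by (simp_all add: transpose_def)
    show "Sop i j * Cop N i j = Cop N i j"
      by (rule lop_eqI) (simp only: ap_times ap_Sop ap_Cop valid_swap a b eq_commute[of "_ j"])
    show "Cop N i j * Sop i j = Cop N i j"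
      by (rule lop_eqI) (simp only: ap_times ap_Sop ap_Cop valid_swap a)
  }
  { assume ne: "i \<noteq> j" "j \<noteq> k" "i \<noteq> k"
    show "Sop i j * Sop j k = Sop i k * Sop i j"
    proof (rule lop_eqI)
      fix F :: "(nat \<Rightarrow> nat) \<Rightarrow> real" and f :: "nat \<Rightarrow> nat"
      have "f \<circ> transpose i j \<circ> transpose j k = f \<circ> transpose i k \<circ> transpose i j"
        using ne by (auto simp: fun_eq_iff transpose_def)
      then show "ap (Sop i j * Sop j k) F f = ap (Sop i k * Sop i j) F f"
        by (simp only: ap_times ap_Sop)
    qed
    show "Sop i j * Cop N j k = Cop N i k * Sop i j"
    proof (rule lop_eqI)
      fix F :: "(nat \<Rightarrow> nat) \<Rightarrow> real" and f :: "nat \<Rightarrow> nat"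
      have "(f \<circ> transpose i j)(j := c, k := c) = f(i := c, k := c) \<circ> transpose i j" for c
        using ne by (auto simp: fun_eq_iff transpose_def)
      moreover have "(f \<circ> transpose i j) j = f i" "(f \<circ> transpose i j) k = f k"
        using ne by (auto simp: transpose_def)
      ultimately show "ap (Sop i j * Cop N j k) F f = ap (Cop N i k * Sop i j) F f"
        by (simp only: ap_times ap_Sop ap_Cop valid_swap)
    qed
    show "Cop N i j * Cop N j k = Cop N i j * Sop i k"
    proof (rule lop_eqI)
      fix F :: "(nat \<Rightarrow> nat) \<Rightarrow> real" and f :: "nat \<Rightarrow> nat"
      show "ap (Cop N i j * Cop N j k) F f = ap (Cop N i j * Sop i k) F f"
      proof (cases "valid N f \<and> f i = f j")
        case True
        then have fk: "f k < N" by (simp add: valid_def)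
        have "ap (Cop N i j * Cop N j k) F f =
            (\<Sum>c<N. if c = f k then \<Sum>c'<N. F (f(i := c, j := c, j := c', k := c')) else 0)"
          using True ne by (auto simp: ap_times ap_Cop valid_upd intro!: sum.cong)
        also have "\<dots> = (\<Sum>c'<N. F (f(i := f k, j := c', k := c')))"
          using fk by (simp add: sum.delta)
        also have "\<dots> = (\<Sum>c<N. F (f(i := c, j := c) \<circ> transpose i k))"
          using ne by (intro sum.cong refl arg_cong[of _ _ F]) (auto simp: fun_eq_iff transpose_def)
        finally show ?thesis using True by (simp add: ap_times ap_Sop ap_Cop)
      qed (auto simp: ap_times ap_Cop)
    qed
  }
  assume "distinct [i, j, k, l]"
  then have ne: "i \<noteq> j" "i \<noteq> k" "i \<noteq> l" "j \<noteq> k" "j \<noteq> l" "k \<noteq> l"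
    "j \<noteq> i" "k \<noteq> i" "l \<noteq> i" "k \<noteq> j" "l \<noteq> j" "l \<noteq> k" by auto
  show "Sop i j * Sop k l = Sop k l * Sop i j"
  proof (rule lop_eqI)
    fix F :: "(nat \<Rightarrow> nat) \<Rightarrow> real" and f :: "nat \<Rightarrow> nat"
    have "f \<circ> transpose i j \<circ> transpose k l = f \<circ> transpose k l \<circ> transpose i j"
      using ne by (auto simp: fun_eq_iff transpose_def)
    then show "ap (Sop i j * Sop k l) F f = ap (Sop k l * Sop i j) F f"
      by (simp only: ap_times ap_Sop)
  qed
  show "Sop i j * Cop N k l = Cop N k l * Sop i j"
  proof (rule lop_eqI)
    fix F :: "(nat \<Rightarrow> nat) \<Rightarrow> real" and f :: "nat \<Rightarrow> nat"
    have "(f \<circ> transpose i j)(k := c, l := c) = f(k := c, l := c) \<circ> transpose i j" for c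
      using ne by (auto simp: fun_eq_iff transpose_def)
    moreover have "(f \<circ> transpose i j) k = f k" "(f \<circ> transpose i j) l = f l"
      using ne by (auto simp: transpose_def)
    ultimately show "ap (Sop i j * Cop N k l) F f = ap (Cop N k l * Sop i j) F f"
      by (simp only: ap_times ap_Sop ap_Cop valid_swap)
  qed
  show "Cop N i j * Cop N k l = Cop N k l * Cop N i j"
  proof (rule lop_eqI)
    fix F :: "(nat \<Rightarrow> nat) \<Rightarrow> real" and f :: "nat \<Rightarrow> nat"
    have u: "f(i := c, j := c, k := d, l := d) = f(k := d, l := d, i := c, j := c)" for c d
      using ne by (auto simp: fun_eq_iff)
    show "ap (Cop N i j * Cop N k l) F f = ap (Cop N k l * Cop N i j) F f"
    proof (cases "valid N f \<and> f i = f j \<and> f k = f l")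
      case True
      then have "ap (Cop N i j * Cop N k l) F f = (\<Sum>c<N. \<Sum>d<N. F (f(i := c, j := c, k := d, l := d)))"
        "ap (Cop N k l * Cop N i j) F f = (\<Sum>d<N. \<Sum>c<N. F (f(k := d, l := d, i := c, j := c)))"
        using ne by (auto simp: ap_times ap_Cop valid_upd intro!: sum.cong)
      then show ?thesis unfolding u by (simp only:) (rule sum.swap)
    next
      case False
      then show ?thesis using ne by (auto simp: ap_times ap_Cop)
    qed
  qed
qed (rule sc_add sc_mult sc_1 sc_central)+
lemma col_unfold: "col.jj N i r = Sop i r - Cop N i r" by (simp add: col.jj_def)

definition over :: "nat \<Rightarrow> (nat \<Rightarrow> nat) \<Rightarrow> (nat \<Rightarrow> nat) \<Rightarrow> nat \<Rightarrow> nat" where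
  "over n f g = (\<lambda>k. if k \<in> {1..n} then g k else f k)"

lemma valid_over: "valid N f \<Longrightarrow> valid N g \<Longrightarrow> valid N (over n f g)"
  by (simp add: valid_def over_def)

text \<open>The operators that see and change only the colours of the first \<open>n\<close>
  strands. The formulation through pairs of functions is closed under composition without any
  reference to kernels.\<close>

definition local_op :: "nat \<Rightarrow> nat \<Rightarrow> (nat \<Rightarrow> nat, real) lop \<Rightarrow> bool" where
  "local_op N n A \<longleftrightarrow> (\<forall>F F' f f'. valid N f \<longrightarrow> valid N f' \<longrightarrow> (\<forall>k\<in>{1..n}. f k = f' k) \<longrightarrow>
    (\<forall>g. valid N g \<longrightarrow> F (over n f g) = F' (over n f' g)) \<longrightarrow> ap A F f = ap A F' f')"

lemma over_self: "(\<forall>k\<in>{1..n}. f k = f' k) \<Longrightarrow> over n f' f = f'"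
  by (auto simp: over_def fun_eq_iff)

lemma local_op_D0:
  assumes "\<forall>k\<in>{1..n}. f k = f' k" "valid N f" "\<forall>g. valid N g \<longrightarrow> F (over n f g) = F' (over n f' g)"
  shows "F f = F' f'"
  using assms(3)[rule_format, OF assms(2)] over_self[OF assms(1)] over_self[of n f f] by simp

lemma local_op_I:
  assumes "\<And>F F' f f'. valid N f \<Longrightarrow> valid N f' \<Longrightarrow> (\<forall>k\<in>{1..n}. f k = f' k) \<Longrightarrow>
    (\<forall>g. valid N g \<longrightarrow> F (over n f g) = F' (over n f' g)) \<Longrightarrow> ap A F f = ap A F' f'"
  shows "local_op N n A"
  unfolding local_op_def using assms by blast

lemma local_op_D:
  assumes "local_op N n A" "valid N f" "valid N f'" "\<forall>k\<in>{1..n}. f k = f' k"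
    "\<forall>g. valid N g \<longrightarrow> F (over n f g) = F' (over n f' g)"
  shows "ap A F f = ap A F' f'"
  using assms unfolding local_op_def by blast

lemma local_op_simple:
  "local_op N n 0" "local_op N n 1" "local_op N n (sc a)" "local_op N n (Pop N)"
proof -
  show "local_op N n 0" by (rule local_op_I) (simp add: ap_simps)
  have eq: "F f = F' f'" if "valid N f" "\<forall>k\<in>{1..n}. f k = f' k"
    "\<forall>g. valid N g \<longrightarrow> F (over n f g) = F' (over n f' g)" for F F' :: "(nat \<Rightarrow> nat) \<Rightarrow> real" and f f'
    using local_op_D0[of n f f' N F F'] that by blast
  show "local_op N n 1" "local_op N n (sc a)" "local_op N n (Pop N)"
    unfolding local_op_def ap_simps ap_Pop using eq by (intro allI impI; simp)+
qed

lemma local_op_add: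
  assumes "local_op N n A" "local_op N n B"
  shows "local_op N n (A + B)"
proof (rule local_op_I)
  fix F F' :: "(nat \<Rightarrow> nat) \<Rightarrow> real" and f f'
  assume *: "valid N f" "valid N f'" "\<forall>k\<in>{1..n}. f k = f' k"
    "\<forall>g. valid N g \<longrightarrow> F (over n f g) = F' (over n f' g)"
  show "ap (A + B) F f = ap (A + B) F' f'"
    unfolding ap_simps local_op_D[OF assms(1) *] local_op_D[OF assms(2) *] ..
qed

lemma local_op_diff:
  assumes "local_op N n A" "local_op N n B"
  shows "local_op N n (A - B)"
proof (rule local_op_I)
  fix F F' :: "(nat \<Rightarrow> nat) \<Rightarrow> real" and f f'
  assume *: "valid N f" "valid N f'" "\<forall>k\<in>{1..n}. f k = f' k"
    "\<forall>g. valid N g \<longrightarrow> F (over n f g) = F' (over n f' g)"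
  show "ap (A - B) F f = ap (A - B) F' f'"
    unfolding ap_simps local_op_D[OF assms(1) *] local_op_D[OF assms(2) *] ..
qed

lemma local_op_mult:
  assumes A: "local_op N n A" and B: "local_op N n B"
  shows "local_op N n (A * B)"
  unfolding local_op_def ap_times
proof (intro allI impI)
  fix F F' :: "(nat \<Rightarrow> nat) \<Rightarrow> real" and f f'
  assume *: "valid N f" "valid N f'" "\<forall>k\<in>{1..n}. f k = f' k"
    "\<forall>g. valid N g \<longrightarrow> F (over n f g) = F' (over n f' g)"
  have "ap B F (over n f g) = ap B F' (over n f' g)" if "valid N g" for g
  proof (rule local_op_D[OF B])
    have "over n (over n h g) g' = over n h g'" for h g' by (auto simp: over_def)
    then show "\<forall>g'. valid N g' \<longrightarrow> F (over n (over n f g) g') = F' (over n (over n f' g) g')"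
      using *(4) by simp
  qed (use * that in \<open>auto simp: valid_over, auto simp: over_def\<close>)
  then show "ap A (ap B F) f = ap A (ap B F') f'"
    by (intro local_op_D[OF A *(1-3)]) blast
qed

lemma local_op_gen:
  assumes "i \<in> {1..n}" "j \<in> {1..n}"
  shows "local_op N n (Sop i j)" "local_op N n (Cop N i j)"
proof -
  show "local_op N n (Sop i j)"
    unfolding local_op_def ap_Sop
  proof (intro allI impI)
    fix F F' :: "(nat \<Rightarrow> nat) \<Rightarrow> real" and f f'
    assume *: "valid N f" "valid N f'" "\<forall>k\<in>{1..n}. f k = f' k"
      "\<forall>g. valid N g \<longrightarrow> F (over n f g) = F' (over n f' g)"
    have "over n f (f \<circ> transpose i j) = f \<circ> transpose i j"
      "over n f' (f \<circ> transpose i j) = f' \<circ> transpose i j"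
      using assms *(3) by (auto simp: over_def fun_eq_iff transpose_def)
    then show "F (f \<circ> transpose i j) = F' (f' \<circ> transpose i j)"
      using *(4)[rule_format, of "f \<circ> transpose i j"] *(1) by (simp add: valid_swap)
  qed
  show "local_op N n (Cop N i j)"
    unfolding local_op_def ap_Cop
  proof (intro allI impI)
    fix F F' :: "(nat \<Rightarrow> nat) \<Rightarrow> real" and f f'
    assume *: "valid N f" "valid N f'" "\<forall>k\<in>{1..n}. f k = f' k"
      "\<forall>g. valid N g \<longrightarrow> F (over n f g) = F' (over n f' g)"
    have "F (f(i := c, j := c)) = F' (f'(i := c, j := c))" if "c < N" for c
    proof -
      have "over n f (f(i := c, j := c)) = f(i := c, j := c)"
        "over n f' (f(i := c, j := c)) = f'(i := c, j := c)"
        using assms *(3) by (auto simp: over_def fun_eq_iff)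
      then show ?thesis
        using *(4)[rule_format, of "f(i := c, j := c)"] *(1) that by (simp add: valid_upd)
    qed
    moreover have "f i = f' i" "f j = f' j" using *(3) assms by auto
    ultimately show "(if valid N f \<and> f i = f j then \<Sum>c<N. F (f(i := c, j := c)) else 0) =
      (if valid N f' \<and> f' i = f' j then \<Sum>c<N. F' (f'(i := c, j := c)) else 0)"
      using * by simp
  qed
qed

lemma local_op_sum: "(\<And>i. i \<in> J \<Longrightarrow> local_op N n (A i)) \<Longrightarrow> local_op N n (sum A J)"
  by (induction J rule: infinite_finite_induct) (simp_all add: local_op_simple local_op_add)

lemma local_op_x: "r \<le> n \<Longrightarrow> local_op N n (col.x N r)"
  unfolding col.x_def col_unfold
  by (intro local_op_add local_op_sum local_op_diff local_op_gen local_op_simple) auto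

lemma local_op_pp: "local_op N n X \<Longrightarrow> local_op N n (col.pp X L)"
  by (induction L) (auto simp: col.pp_simps intro!: local_op_mult local_op_diff local_op_simple)

lemma local_op_EE: "r \<le> n \<Longrightarrow> local_op N n (col.EE N (Pop N) k L r)"
proof (induction r)
  case 0
  show ?case by (simp add: local_op_simple)
next
  case (Suc r)
  then show ?case
    unfolding col.EE.simps col.scl_def by (intro local_op_mult local_op_pp local_op_x local_op_simple) auto
qed

text \<open>Operators on the first \<open>m\<close> strands preserve the functions on a slice,
  where the other strands have prescribed colours. A slice is finite, so that it carries the
  standard inner product, for which all generators are self-adjoint.\<close>

definition slice :: "nat \<Rightarrow> nat \<Rightarrow> (nat \<Rightarrow> nat) \<Rightarrow> (nat \<Rightarrow> nat) set" where
  "slice N m f0 = {f. valid N f \<and> (\<forall>k. k \<notin> {1..m} \<longrightarrow> f k = f0 k)}"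

lemma finite_slice: "finite (slice N m f0)"
proof -
  have "slice N m f0 \<subseteq> (\<lambda>g. over m f0 g) ` ({1..m} \<rightarrow>\<^sub>E {..<N})"
  proof
    fix f assume f: "f \<in> slice N m f0"
    then have "f = over m f0 (restrict f {1..m})"
      by (auto simp: slice_def over_def fun_eq_iff)
    moreover have "restrict f {1..m} \<in> {1..m} \<rightarrow>\<^sub>E {..<N}"
      using f by (auto simp: slice_def valid_def)
    ultimately show "f \<in> (\<lambda>g. over m f0 g) ` ({1..m} \<rightarrow>\<^sub>E {..<N})" by blast
  qed
  then show ?thesis by (rule finite_subset) (intro finite_imageI finite_PiE; simp)
qed

definition selfadj :: "nat \<Rightarrow> nat \<Rightarrow> (nat \<Rightarrow> nat, real) lop \<Rightarrow> bool" where
  "selfadj N m A \<longleftrightarrow> (\<forall>f0 F G. (\<Sum>f\<in>slice N m f0. ap A F f * G f) = (\<Sum>f\<in>slice N m f0. F f * ap A G f))"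

lemma selfadj_add: "selfadj N m A \<Longrightarrow> selfadj N m B \<Longrightarrow> selfadj N m (A + B)"
  unfolding selfadj_def by (simp add: ap_simps distrib_left distrib_right sum.distrib)

lemma selfadj_diff: "selfadj N m A \<Longrightarrow> selfadj N m B \<Longrightarrow> selfadj N m (A - B)"
  unfolding selfadj_def by (simp add: ap_simps left_diff_distrib right_diff_distrib sum_subtractf)

lemma selfadj_simple: "selfadj N m (sc a)" "selfadj N m (Pop N)" "selfadj N m 1"
  unfolding selfadj_def by (auto simp: ap_simps ap_Pop slice_def intro!: sum.cong)

lemma selfadj_mult: "selfadj N m A \<Longrightarrow> selfadj N m B \<Longrightarrow> A * B = B * A \<Longrightarrow> selfadj N m (A * B)"
  unfolding selfadj_def by (metis ap_times)

lemma selfadj_sum: "(\<And>i. i \<in> J \<Longrightarrow> selfadj N m (A i)) \<Longrightarrow> selfadj N m (sum A J)"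
proof (induction J rule: infinite_finite_induct)
  case empty
  show ?case by (simp add: selfadj_def ap_simps)
next
  case (infinite J)
  then show ?case by (simp add: selfadj_def ap_simps)
qed (simp add: selfadj_add)

lemma selfadj_gen:
  assumes ij: "i \<in> {1..m}" "j \<in> {1..m}" "i \<noteq> j"
  shows "selfadj N m (Sop i j)" "selfadj N m (Cop N i j)"
proof -
  show "selfadj N m (Sop i j)"
    unfolding selfadj_def ap_Sop
  proof (intro allI)
    fix f0 and F G :: "(nat \<Rightarrow> nat) \<Rightarrow> real"
    have img: "f \<circ> transpose i j \<in> slice N m f0" if "f \<in> slice N m f0" for f
      using that ij by (auto simp: slice_def valid_swap transpose_def)
    have inv: "f \<circ> transpose i j \<circ> transpose i j = f" for f :: "nat \<Rightarrow> nat" by (simp add: comp_assoc)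
    show "(\<Sum>f\<in>slice N m f0. F (f \<circ> transpose i j) * G f) = (\<Sum>f\<in>slice N m f0. F f * G (f \<circ> transpose i j))"
      by (rule sum.reindex_bij_witness[of _ "\<lambda>f. f \<circ> transpose i j" "\<lambda>f. f \<circ> transpose i j"])
         (simp_all only: img inv)
  qed
  show "selfadj N m (Cop N i j)"
    unfolding selfadj_def
  proof (intro allI)
    fix f0 and F G :: "(nat \<Rightarrow> nat) \<Rightarrow> real"
    define M where "M f f' = (f i = f j \<and> f' i = f' j \<and> (\<forall>k. k \<noteq> i \<and> k \<noteq> j \<longrightarrow> f k = f' k))" for f f' :: "nat \<Rightarrow> nat"
    have C: "ap (Cop N i j) H f = (\<Sum>f'\<in>slice N m f0. if M f f' then H f' else 0)"
      if f: "f \<in> slice N m f0" for H :: "(nat \<Rightarrow> nat) \<Rightarrow> real" and f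
    proof (cases "f i = f j")
      case True
      have inj: "inj_on (\<lambda>c. f(i := c, j := c)) {..<N}"
        by (rule inj_onI) (metis fun_upd_same)
      have img: "(\<lambda>c. f(i := c, j := c)) ` {..<N} = {f'\<in>slice N m f0. M f f'}"
      proof (intro equalityI subsetI)
        fix f' assume "f' \<in> {f'\<in>slice N m f0. M f f'}"
        then have "f' = f(i := f' i, j := f' i)" "f' i < N"
          using True by (auto simp: M_def slice_def valid_def fun_eq_iff)
        then show "f' \<in> (\<lambda>c. f(i := c, j := c)) ` {..<N}" by blast
      qed (use f ij True in \<open>auto simp: M_def slice_def valid_upd\<close>)
      have "(\<Sum>f'\<in>slice N m f0. if M f f' then H f' else 0) = (\<Sum>f'\<in>{f'\<in>slice N m f0. M f f'}. H f')"
        by (rule sum.inter_filter[symmetric]) (rule finite_slice)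
      also have "\<dots> = (\<Sum>c<N. H (f(i := c, j := c)))"
        unfolding img[symmetric] by (subst sum.reindex[OF inj]) simp
      finally show ?thesis using True f by (simp add: ap_Cop slice_def)
    qed (simp add: ap_Cop M_def)
    have sym: "M f f' = M f' f" for f f' by (auto simp: M_def)
    have "(\<Sum>f\<in>slice N m f0. ap (Cop N i j) F f * G f) =
        (\<Sum>f\<in>slice N m f0. \<Sum>f'\<in>slice N m f0. if M f f' then F f' * G f else 0)"
      by (intro sum.cong refl) (auto simp: C sum_distrib_right intro!: sum.cong)
    also have "\<dots> = (\<Sum>f'\<in>slice N m f0. \<Sum>f\<in>slice N m f0. if M f' f then F f' * G f else 0)"
      by (subst sum.swap) (simp only: sym)
    also have "\<dots> = (\<Sum>f\<in>slice N m f0. F f * ap (Cop N i j) G f)"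
      by (intro sum.cong refl) (auto simp: C sum_distrib_left intro!: sum.cong)
    finally show "(\<Sum>f\<in>slice N m f0. ap (Cop N i j) F f * G f) = (\<Sum>f\<in>slice N m f0. F f * ap (Cop N i j) G f)" .
  qed
qed

lemma selfadj_x: "r \<le> m \<Longrightarrow> selfadj N m (col.x N r)"
  unfolding col.x_def col_unfold
  by (intro selfadj_add selfadj_sum selfadj_diff selfadj_gen selfadj_simple) auto

lemma selfadj_pp:
  assumes "selfadj N m X"
  shows "selfadj N m (col.pp X L)"
proof (induction L)
  case Nil
  show ?case by (simp add: col.pp_simps selfadj_simple)
next
  case (Cons a L)
  have "col.commutes (X - sc a) (col.pp X L)"
  proof (rule col.commutes_pp, rule col.commutes_sym)
    show "col.commutes X (X - sc a)"
      by (intro col.commutes_diff col.commutes_c col.commutes_refl)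
  qed
  then show ?case
    using Cons assms unfolding col.pp_simps
    by (intro selfadj_mult selfadj_diff selfadj_simple) (auto simp: col.commutes_def)
qed

lemma Pop_gen: "col.commutes (Sop i j) (Pop N)" "i \<noteq> j \<Longrightarrow> col.commutes (Cop N i j) (Pop N)"
  "Pop N * Pop N = Pop N"
  unfolding col.commutes_def
  by (rule lop_eqI; simp add: ap_times ap_Sop ap_Cop ap_Pop valid_swap valid_upd cong: if_cong)+

lemma Pop_x: "col.commutes (col.x N r) (Pop N)"
proof (rule col.commutes_sym)
  have "col.commutes (Pop N) (col.jj N i r)" if "i \<in> {1..<r}" for i
    using that unfolding col_unfold by (intro col.commutes_diff col.commutes_sym[OF Pop_gen(1)] col.commutes_sym[OF Pop_gen(2)]) auto
  then show "col.commutes (Pop N) (col.x N r)"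
    unfolding col.x_def by (intro col.commutes_add col.commutes_c col.commutes_sum) auto
qed

text \<open>Let \<open>Y\<close> be given by a matrix on the colourings of the first
  \<open>n\<close> strands. Closing the last strand of \<open>Y Y\<close> gives a partial trace of
  the product of \<open>Y\<close> and its transpose; its diagonal entries are sums of squares of
  entries of \<open>Y\<close>. If they vanish, so does \<open>Y\<close>.\<close>

lemma closure_positive:
  assumes n: "1 \<le> n" and Y: "local_op N n Y" "selfadj N (Suc n) Y" "Pop N * Y = Y"
    and zero: "Cop N n (Suc n) * (Y * Y) * Cop N n (Suc n) = 0"
  shows "Y = 0"
proof -
  let ?e = "Cop N n (Suc n)"
  have e: "selfadj N (Suc n) ?e" using n by (intro selfadj_gen) auto
  have 1: "ap Y (ap ?e K) f0 = 0" if f0: "valid N f0" for K f0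
  proof -
    let ?S = "slice N (Suc n) f0" and ?G = "ap Y (ap ?e K)"
    have "(\<Sum>f\<in>?S. ?G f * ?G f) = (\<Sum>f\<in>?S. ap ?e K f * ap Y ?G f)"
      using Y(2) unfolding selfadj_def by blast
    also have "\<dots> = (\<Sum>f\<in>?S. K f * ap ?e (ap Y ?G) f)"
      using e unfolding selfadj_def by blast
    also have "ap ?e (ap Y ?G) = ap (?e * (Y * Y) * ?e) K" by (simp only: ap_times)
    also have "(\<Sum>f\<in>?S. K f * ap (?e * (Y * Y) * ?e) K f) = 0" unfolding zero by (simp add: ap_simps)
    finally have "\<forall>f\<in>?S. ?G f * ?G f = 0"
      using sum_nonneg_eq_0_iff[OF finite_slice, where f = "\<lambda>f. ?G f * ?G f"] by simp
    moreover have "f0 \<in> ?S" using f0 by (simp add: slice_def)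
    ultimately show ?thesis by simp
  qed
  show ?thesis
  proof (rule lop_eqI)
    fix F :: "(nat \<Rightarrow> nat) \<Rightarrow> real" and f
    show "ap Y F f = ap 0 F f"
    proof (cases "valid N f")
      case False
      have "ap (Pop N * Y) F f = 0" using False by (simp add: ap_times ap_Pop)
      then show ?thesis by (simp add: Y(3) ap_simps)
    next
      case True
      let ?Fa = "\<lambda>a h. if h n = a then F h else 0"
      have "ap Y F f = ap Y (\<lambda>h. \<Sum>a<N. ?Fa a h) f"
      proof (rule local_op_D[OF Y(1) True True])
        show "\<forall>g. valid N g \<longrightarrow> F (over n f g) = (\<Sum>a<N. ?Fa a (over n f g))"
          using valid_over[OF True, of _ n] by (simp add: valid_def)
      qed simp
      also have "\<dots> = (\<Sum>a<N. ap Y (?Fa a) f)" by (simp only: ap_arg_sum)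
      also have "\<dots> = 0"
      proof (rule sum.neutral, rule ballI)
        fix a assume a: "a \<in> {..<N}"
        let ?f' = "f(Suc n := a)"
        let ?K = "\<lambda>h. if h n = a then F (h(Suc n := f (Suc n))) else 0"
        have v': "valid N ?f'" using True a by (simp add: valid_upd)
        have "ap Y (?Fa a) f = ap Y (ap ?e ?K) ?f'"
        proof (rule local_op_D[OF Y(1) True v'])
          show "\<forall>g. valid N g \<longrightarrow> ?Fa a (over n f g) = ap ?e ?K (over n ?f' g)"
          proof (intro allI impI)
            fix g assume g: "valid N g"
            let ?h = "over n ?f' g"
            have h: "?h n = g n" "?h (Suc n) = a" "over n f g n = g n" using n by (auto simp: over_def)
            have "?K (?h(n := c, Suc n := c)) = (if c = a then F (?h(n := a, Suc n := f (Suc n))) else 0)" for c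
              by auto
            then have "(\<Sum>c<N. ?K (?h(n := c, Suc n := c))) = F (?h(n := a, Suc n := f (Suc n)))"
              using a by (simp only: sum.delta finite_lessThan if_True)
            moreover have "?h(n := a, Suc n := f (Suc n)) = over n f g" if "g n = a"
              using that n by (auto simp: over_def fun_eq_iff)
            ultimately show "?Fa a (over n f g) = ap ?e ?K ?h"
              unfolding ap_Cop using h valid_over[OF v' g, of n] by simp
          qed
        qed simp
        then show "ap Y (?Fa a) f = 0" using 1[OF v'] by simp
      qed
      finally show ?thesis by (simp add: ap_simps)
    qed
  qed
qed

text \<open>An induction on \<open>r\<close> in which the closure of the resolvent is determined
  along with the vanishing. The vanishing at \<open>r\<close> yields that the next idempotent is
  an eigenvector for \<open>x (Suc r)\<close>, which is what the recursion for the closure needs.\<close>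

theorem colour_minimal:
  fixes L L' :: "nat \<Rightarrow> real list" and g :: "nat \<Rightarrow> real"
  assumes L1: "L' 1 = [(real N - 1) / 2]"
    and L': "\<And>r. r \<le> R \<Longrightarrow> odd (length (L' (Suc r)))"
    and L: "\<And>r. r < R \<Longrightarrow> L' (Suc r) = L (Suc r) @ [g (Suc r)]"
    and step: "\<And>r. r < R \<Longrightarrow> content_step (g (Suc r)) (L' (Suc r)) (L' (Suc (Suc r)))"
  shows "r \<le> R \<Longrightarrow> col.EE N (Pop N) (\<lambda>_. 1) L r * col.pp (col.x N (Suc r)) (L' (Suc r)) = 0"
proof -
  let ?E = "col.EE N (Pop N) (\<lambda>_. 1) L"
  let ?x = "col.x N"
  have Ex: "col.commutes (?x n) (?E r)" if "r \<le> n" for r n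
    using that by (intro col.EE_commutes_x Pop_x) auto
  have PE: "Pop N * ?E r = ?E r" for r
    by (induction r) (simp_all add: Pop_gen(3) col.scl_right mult.assoc[symmetric])
  have Es: "selfadj N m (?E r)" if "r \<le> m" for r m
    using that
  proof (induction r)
    case 0
    show ?case by (simp add: selfadj_simple)
  next
    case (Suc r)
    have "col.commutes (?E r) (col.pp (?x (Suc r)) (L (Suc r)))"
      by (intro col.commutes_pp col.commutes_sym[OF Ex]) simp
    then show ?case
      using Suc by (auto simp: col.scl_1 col.commutes_def intro!: selfadj_mult selfadj_pp selfadj_x)
  qed
  have min: "?E r * col.pp (?x (Suc r)) (L' (Suc r)) = 0"
    if "col.closed_by N r (?E r) f" "balanced (L' (Suc r)) f" "r \<le> R" for r f
  proof -
    let ?Y = "?E r * col.pp (?x (Suc r)) (L' (Suc r))" and ?P = "col.pp (?x (Suc r)) (L' (Suc r))"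
    let ?e = "Cop N (Suc r) (r + 2)"
    have EP: "col.commutes (?E r) ?P" by (intro col.commutes_pp col.commutes_sym[OF Ex]) simp
    have Ee: "col.commutes ?e (?E r)" by (rule col.EE_commutes_gen) (auto intro: Pop_gen)
    have "?E r * (?e * (?P * ?P) * ?e) = 0"
      using col.closed_by_pp_square[OF that(1,2) L'[OF that(3)]] .
    then have "?E r * (?E r * (?e * (?P * ?P) * ?e)) = 0" by simp
    moreover have "?E r * (?E r * (?e * (?P * ?P) * ?e)) = ?e * (?Y * ?Y) * ?e"
    proof -
      have c: "?E r * ?e = ?e * ?E r" "?E r * ?P = ?P * ?E r" using EP Ee by (auto simp: col.commutes_def)
      then have c': "?E r * (?e * Z) = ?e * (?E r * Z)" "?P * (?E r * Z) = ?E r * (?P * Z)" for Z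
        by (simp_all add: mult.assoc[symmetric])
      show ?thesis by (simp only: mult.assoc c')
    qed
    ultimately have zero: "?e * (?Y * ?Y) * ?e = 0" by simp
    show ?thesis
    proof (rule closure_positive[of "Suc r" N])
      show "local_op N (Suc r) ?Y"
        by (intro local_op_mult local_op_EE local_op_pp local_op_x) auto
      show "selfadj N (Suc (Suc r)) ?Y"
        using EP by (auto intro!: selfadj_mult Es selfadj_pp selfadj_x simp: col.commutes_def)
      show "Pop N * ?Y = ?Y" by (simp add: mult.assoc[symmetric] PE)
      show "Cop N (Suc r) (Suc (Suc r)) * (?Y * ?Y) * Cop N (Suc r) (Suc (Suc r)) = 0"
        using zero by simp
    qed simp
  qed
  have "\<exists>f. col.closed_by N r (?E r) f \<and> balanced (L' (Suc r)) f" if "r \<le> R" for r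
    using that
  proof (induction r)
    case 0
    have "col.closed_by N 0 (Pop N) (fps_const (real N) * (fps_X * geo ((real N - 1) / 2)))"
      by (rule col.closed_by_0) (simp_all add: col.commutes_sym[OF Pop_gen(2)])
    moreover have "balanced [(real N - 1) / 2] (fps_const (real N) * (fps_X * geo ((real N - 1) / 2)))"
      by (rule col.balanced_0) simp
    ultimately show ?case using L1 by auto
  next
    case (Suc r)
    then obtain f where f: "col.closed_by N r (?E r) f" "balanced (L' (Suc r)) f" by auto
    let ?g = "g (Suc r)"
    define q where "q = col.pp (?x (Suc r)) (L (Suc r))"
    define v where "v = (fps_X * geo ?g :: real fps)"
    define u where "u = (fps_X * geo (- ?g) :: real fps)"
    define f' where "f' = inverse (1 - v * v) * (f + v * v - v * v * u - (1 - v + f) * u * u)"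
    have "(1 - v * v) $ 0 \<noteq> 0" by (simp add: v_def)
    then have "inverse (1 - v * v) * (1 - v * v) = 1" by (rule inverse_mult_eq_1)
    then have f': "f' * (1 - v * v) = f + v * v - v * v * u - (1 - v + f) * u * u"
      unfolding f'_def by (simp add: mult_ac)
    have qE: "col.commutes (?E r) q"
      unfolding q_def by (intro col.commutes_pp col.commutes_sym[OF Ex]) simp
    have EU: "?E (Suc r) = q * ?E r"
      using qE by (simp add: q_def col.scl_1 col.commutes_def)
    have "?E r * (q * (?x (Suc r) - sc ?g)) = 0"
      using min[OF f] Suc.prems L[of r] by (simp add: q_def col.pp_simps)
    then have "?E (Suc r) * (?x (Suc r) - sc ?g) = 0"
      by (simp add: q_def col.scl_1 mult.assoc)
    then have eig: "?E (Suc r) * ?x (Suc r) = sc ?g * ?E (Suc r)"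
      unfolding right_diff_distrib sc_central[of ?g] by simp
    have "col.closed_by N (Suc r) (?E (Suc r)) f'"
    proof (rule col.closed_by_Suc[OF _ f(1) _ _ _ _ _ EU eig])
      show "col.commutes (?E r) (Sop (Suc r) (r + 2))" "col.commutes (?E r) (Cop N (Suc r) (r + 2))"
        "col.commutes (?E r) (Cop N (r + 2) (r + 3))"
        by (rule col.commutes_sym, rule col.EE_commutes_gen; auto intro: Pop_gen)+
      show "col.commutes (?E r) (?x (Suc r))" "col.commutes (?E r) (?x (r + 2))"
        by (rule col.commutes_sym, rule Ex, simp)+
    qed (use f' in \<open>simp_all add: u_def v_def\<close>)
    moreover have "balanced (L' (Suc (Suc r))) f'"
      by (rule balanced_step[OF _ f(2) step[of r]]) (use f' Suc.prems in \<open>simp_all add: u_def v_def\<close>)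
    ultimately show ?case by blast
  qed
  then show "r \<le> R \<Longrightarrow> ?E r * col.pp (?x (Suc r)) (L' (Suc r)) = 0"
    using min by blast
qed

section \<open>Composition of diagrams\<close>

subsection \<open>Orbits of two involutions\<close>

text \<open>Edges of the two stacked diagrams are two involutions on the dots, and a component of
  the stacked graph is an orbit under both. Walking from a fixed point \<open>x\<close> of
  \<open>p2\<close> by \<open>p1\<close>, \<open>p2\<close>, \<open>p1\<close>, ... either
  involution undoes its own step, so that the walk cannot return to itself before it reaches a
  fixed point; the orbit is a path with exactly one further end.\<close>

lemma involution_orbit_end:
  fixes p1 p2 :: "'v \<Rightarrow> 'v"
  assumes inv: "\<And>v. p1 (p1 v) = v" "\<And>v. p2 (p2 v) = v"
    and V: "finite V" "x \<in> V" "\<And>v. v \<in> V \<Longrightarrow> p1 v \<in> V" "\<And>v. v \<in> V \<Longrightarrow> p2 v \<in> V"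
    and x: "p2 x = x" "p1 x \<noteq> x"
  shows "\<exists>!z. z \<noteq> x \<and> (x, z) \<in> {(a, b). b = p1 a \<or> b = p2 a}\<^sup>* \<and> (p1 z = z \<or> p2 z = z)"
proof -
  define q where "q v = p1 (p2 v)" for v
  have qinj: "q a = q b \<Longrightarrow> a = b" for a b unfolding q_def by (metis inv)
  have qk_inj: "(q ^^ k) a = (q ^^ k) b \<Longrightarrow> a = b" for k a b
    by (induction k) (auto dest: qinj)
  have qV: "(q ^^ k) x \<in> V" for k by (induction k) (auto simp: q_def V)
  have "\<exists>k>0. (q ^^ k) x = x"
  proof -
    have "\<not> inj_on (\<lambda>k. (q ^^ k) x) (UNIV :: nat set)"
      using V(1) qV by (meson finite_imageD finite_subset image_subset_iff infinite_UNIV_nat)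
    then obtain a b where "a < b" "(q ^^ a) x = (q ^^ b) x"
      unfolding inj_on_def by (metis linorder_neqE_nat)
    then have "(q ^^ a) x = (q ^^ a) ((q ^^ (b - a)) x)"
      by (metis add_diff_inverse_nat comp_apply funpow_add less_imp_not_less)
    then have "x = (q ^^ (b - a)) x" by (rule qk_inj)
    then show ?thesis using \<open>a < b\<close> by (metis zero_less_diff)
  qed
  define L where "L = (LEAST k. k > 0 \<and> (q ^^ k) x = x)"
  have L: "L > 0" "(q ^^ L) x = x"
    using LeastI_ex[OF \<open>\<exists>k>0. (q ^^ k) x = x\<close>] unfolding L_def by blast+
  have L_min: "k = 0 \<or> L \<le> k" if "(q ^^ k) x = x" for k
    using that Least_le[of "\<lambda>k. k > 0 \<and> (q ^^ k) x = x" k] unfolding L_def by auto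
  have dist: "a = b" if "a < L" "b < L" "(q ^^ a) x = (q ^^ b) x" for a b
  proof -
    have *: "a = b" if "a \<le> b" "b < L" "(q ^^ a) x = (q ^^ b) x" for a b
    proof -
      have "(q ^^ a) x = (q ^^ a) ((q ^^ (b - a)) x)"
        using that by (metis comp_apply funpow_add le_add_diff_inverse)
      then have "(q ^^ (b - a)) x = x" using qk_inj by metis
      then show ?thesis using L_min[of "b - a"] that by auto
    qed
    show ?thesis using that *[of a b] *[of b a] by (cases "a \<le> b") auto
  qed
  have q_mod: "(q ^^ (k + L)) x = (q ^^ k) x" for k by (simp add: funpow_add L)
  have refl: "(q ^^ k) (p2 ((q ^^ k) v)) = p2 v" for k v
  proof (induction k arbitrary: v)
    case (Suc k)
    have "(q ^^ Suc k) (p2 ((q ^^ Suc k) v)) = (q ^^ k) (q (p2 (q ((q ^^ k) v))))"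
      by (simp add: funpow_swap1)
    also have "q (p2 (q u)) = p2 u" for u by (simp add: q_def inv)
    finally show ?case using Suc by simp
  qed simp
  have p2q: "p2 ((q ^^ k) x) = (q ^^ (L - k)) x" if "k \<le> L" for k
  proof -
    have "(q ^^ k) (p2 ((q ^^ k) x)) = (q ^^ k) ((q ^^ (L - k)) x)"
      using refl[of k x] x(1) L(2) that by (metis comp_apply funpow_add le_add_diff_inverse)
    then show ?thesis by (rule qk_inj)
  qed
  have p1q: "p1 ((q ^^ k) x) = (q ^^ (L - k + 1)) x" if "k \<le> L" for k
    using p2q[OF that] by (metis Suc_eq_plus1 comp_apply funpow.simps(2) inv(2) q_def)
  have red: "\<exists>k<L. (q ^^ m) x = (q ^^ k) x" for m
  proof (induction m rule: less_induct)
    case (less m)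
    show ?case
    proof (cases "m < L")
      case False
      then have "(q ^^ m) x = (q ^^ (m - L)) x" using q_mod[of "m - L"] by simp
      then show ?thesis using less[of "m - L"] L(1) False by auto
    qed auto
  qed
  have orbit: "(x, z) \<in> {(a, b). b = p1 a \<or> b = p2 a}\<^sup>* \<longleftrightarrow> (\<exists>k<L. z = (q ^^ k) x)" for z
  proof
    assume "(x, z) \<in> {(a, b). b = p1 a \<or> b = p2 a}\<^sup>*"
    then show "\<exists>k<L. z = (q ^^ k) x"
    proof (induction rule: rtrancl_induct)
      case base
      show ?case using L(1) by (intro exI[of _ 0]) simp
    next
      case (step y z)
      then obtain k where k: "k < L" "y = (q ^^ k) x" by blast
      have "z = (q ^^ (L - k + 1)) x \<or> z = (q ^^ (L - k)) x"
        using step(2) p1q[of k] p2q[of k] k by auto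
      then show ?case using red by metis
    qed
  next
    have "(x, (q ^^ k) x) \<in> {(a, b). b = p1 a \<or> b = p2 a}\<^sup>*" for k
    proof (induction k)
      case (Suc k)
      have ab: "((q ^^ k) x, p2 ((q ^^ k) x)) \<in> {(a, b). b = p1 a \<or> b = p2 a}"
        "(p2 ((q ^^ k) x), q ((q ^^ k) x)) \<in> {(a, b). b = p1 a \<or> b = p2 a}"
        by (auto simp: q_def)
      show ?case using rtrancl_into_rtrancl[OF rtrancl_into_rtrancl[OF Suc ab(1)] ab(2)] by simp
    qed simp
    then show "\<exists>k<L. z = (q ^^ k) x \<Longrightarrow> (x, z) \<in> {(a, b). b = p1 a \<or> b = p2 a}\<^sup>*" by blast
  qed
  have "L \<noteq> 1"
  proof
    assume "L = 1"
    then have "q x = x" using L(2) by simp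
    then show False using x by (simp add: q_def)
  qed
  then have L2: "L \<ge> 2" using L(1) by simp
  have fixed: "(p1 ((q ^^ k) x) = (q ^^ k) x \<or> p2 ((q ^^ k) x) = (q ^^ k) x) \<longleftrightarrow> 2 * k = L \<or> 2 * k = L + 1"
    if k: "0 < k" "k < L" for k
  proof -
    have a: "p2 ((q ^^ k) x) = (q ^^ k) x \<longleftrightarrow> 2 * k = L"
      using k p2q[of k] dist[of "L - k" k] by auto
    have "p1 ((q ^^ k) x) = (q ^^ k) x \<longleftrightarrow> 2 * k = L + 1"
    proof (cases "k = 1")
      case True
      then have "p1 ((q ^^ k) x) = x" using p1q[of k] L L2 by simp
      moreover have "(q ^^ k) x \<noteq> x" using L_min[of k] k by auto
      ultimately show ?thesis using True L2 by auto
    next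
      case False
      then have lt: "L - k + 1 < L" using k by linarith
      have eq: "p1 ((q ^^ k) x) = (q ^^ (L - k + 1)) x" using p1q[of k] k(2) by (simp only: less_imp_le)
      have "(q ^^ (L - k + 1)) x = (q ^^ k) x \<longleftrightarrow> L - k + 1 = k"
        using dist[OF lt k(2)] by metis
      then show ?thesis unfolding eq using k by linarith
    qed
    then show ?thesis using a by blast
  qed
  define k0 where "k0 = (L + 1) div 2"
  have k0: "0 < k0" "k0 < L" "2 * k0 = L \<or> 2 * k0 = L + 1" using L2 unfolding k0_def by presburger+
  show ?thesis
  proof (rule ex1I[of _ "(q ^^ k0) x"])
    show "(q ^^ k0) x \<noteq> x \<and> (x, (q ^^ k0) x) \<in> {(a, b). b = p1 a \<or> b = p2 a}\<^sup>* \<and>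
      (p1 ((q ^^ k0) x) = (q ^^ k0) x \<or> p2 ((q ^^ k0) x) = (q ^^ k0) x)"
      using L_min[of k0] k0 orbit fixed[of k0] by auto
  next
    fix z assume z: "z \<noteq> x \<and> (x, z) \<in> {(a, b). b = p1 a \<or> b = p2 a}\<^sup>* \<and> (p1 z = z \<or> p2 z = z)"
    then obtain k where k: "k < L" "z = (q ^^ k) x" using orbit by blast
    have "0 < k" using z k by (cases k) auto
    then have "2 * k = L \<or> 2 * k = L + 1" using fixed[of k] z k by blast
    then have "k = k0" using k0(3) by presburger
    then show "z = (q ^^ k0) x" using k by simp
  qed
qed

subsection \<open>Partners\<close>

lemma finite_dots: "finite (dots n)" by (simp add: dots_def)

lemma diagrams_subset: "diagrams n \<subseteq> Pow (Pow (dots n))"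
  by (auto simp: diagrams_def)

lemma finite_diagrams: "finite (diagrams n)"
  by (rule finite_subset[OF diagrams_subset]) (simp add: finite_dots)

lemma diagram_edge:
  assumes "d \<in> diagrams n" "x \<in> dots n"
  shows "\<exists>!y. {x, y} \<in> d \<and> x \<noteq> y"
proof -
  have A: "\<forall>e\<in>d. e \<subseteq> dots n \<and> card e = 2" "\<forall>x\<in>dots n. \<exists>!e. e \<in> d \<and> x \<in> e"
    using assms(1) unfolding diagrams_def by simp_all
  obtain e where e: "e \<in> d \<and> x \<in> e" and u: "\<forall>e'. e' \<in> d \<and> x \<in> e' \<longrightarrow> e' = e"
    using bspec[OF A(2) assms(2)] by (elim ex1E)
  obtain a b where ab: "e = {a, b}" "a \<noteq> b" using A(1) e by (meson card_2_iff)
  obtain y where y: "e = {x, y}" "x \<noteq> y"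
  proof (cases "x = a")
    case True
    then show thesis using that ab by blast
  next
    case False
    then have "x = b" using ab e by simp
    then show thesis using that[of a] ab by (simp add: insert_commute)
  qed
  show ?thesis
  proof (rule ex1I[of _ y])
    show "{x, y} \<in> d \<and> x \<noteq> y" using e y by simp
  next
    fix z assume z: "{x, z} \<in> d \<and> x \<noteq> z"
    then have "{x, z} = {x, y}" using u y by simp
    then show "z = y" using y(2) by (auto simp: doubleton_eq_iff)
  qed
qed

text \<open>A diagram on \<open>n\<close> strands is the same as an involution without fixed
  points on its dots.\<close>

definition partner :: "diagram \<Rightarrow> dot \<Rightarrow> dot" where
  "partner d x = (THE y. {x, y} \<in> d \<and> x \<noteq> y)"

lemma partner:
  assumes "d \<in> diagrams n" "x \<in> dots n"
  shows "{x, partner d x} \<in> d" "partner d x \<noteq> x" "partner d x \<in> dots n"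
    "{x, y} \<in> d \<Longrightarrow> x \<noteq> y \<Longrightarrow> y = partner d x"
proof -
  have *: "{x, partner d x} \<in> d \<and> x \<noteq> partner d x"
    unfolding partner_def by (rule theI'[OF diagram_edge[OF assms]])
  then show "{x, partner d x} \<in> d" "partner d x \<noteq> x" by auto
  have "\<forall>e\<in>d. e \<subseteq> dots n" using assms(1) unfolding diagrams_def by blast
  then show "partner d x \<in> dots n" using * by blast
  show "y = partner d x" if "{x, y} \<in> d" "x \<noteq> y"
    using ex1E[OF diagram_edge[OF assms], of "y = partner d x"] * that by metis
qed

lemma partner_partner:
  assumes "d \<in> diagrams n" "x \<in> dots n"
  shows "partner d (partner d x) = x"
proof -
  have "{partner d x, x} \<in> d" using partner(1)[OF assms] by (subst insert_commute)
  from partner(4)[OF assms(1) partner(3)[OF assms] this partner(2)[OF assms]] show ?thesis by (rule sym)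
qed

lemma edge_cases:
  assumes "d \<in> diagrams n" "e \<in> d"
  obtains x where "x \<in> dots n" "e = {x, partner d x}"
proof -
  have "card e = 2" "e \<subseteq> dots n" using assms unfolding diagrams_def by auto
  then obtain a b where ab: "e = {a, b}" "a \<noteq> b" "a \<in> dots n" by (metis card_2_iff insert_subset)
  then have "{a, b} \<in> d" using assms(2) by simp
  from partner(4)[OF assms(1) ab(3) this ab(2)] ab(1,3) show thesis by (intro that[of a]) simp_all
qed

subsection \<open>The stacked graph\<close>

definition adj :: "dot set set \<Rightarrow> (dot \<times> dot) set" where
  "adj G = {(x, y). \<exists>e\<in>G. x \<in> e \<and> y \<in> e}"

lemma connected_adj: "connected_dots G = (adj G)\<^sup>*"
  by (simp add: connected_dots_def adj_def)

lemma connected_sym: "(x, y) \<in> connected_dots G \<Longrightarrow> (y, x) \<in> connected_dots G"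
proof -
  have "sym (adj G)" by (auto simp: adj_def sym_def)
  then show "(x, y) \<in> connected_dots G \<Longrightarrow> (y, x) \<in> connected_dots G"
    unfolding connected_adj by (meson sym_rtrancl symD)
qed

lemma connected_trans: "(x, y) \<in> connected_dots G \<Longrightarrow> (y, z) \<in> connected_dots G \<Longrightarrow> (x, z) \<in> connected_dots G"
  unfolding connected_adj by (rule rtrancl_trans)

lemma connected_refl: "(x, x) \<in> connected_dots G" unfolding connected_adj by simp

definition inner :: "dot \<Rightarrow> dot" where "inner v = (if fst v = Mid then (Bot, snd v) else v)"
definition inner' :: "dot \<Rightarrow> dot" where "inner' v = (if fst v = Mid then (Top, snd v) else v)"

text \<open>The involutions induced by the upper and the lower diagram on the dots of the stacked
  graph, extended by the identity. The outer dots are fixed by one of them, the dots of the middle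
  row by none.\<close>

definition p_up :: "nat \<Rightarrow> diagram \<Rightarrow> dot \<Rightarrow> dot" where
  "p_up n d v = (if fst v \<noteq> Bot \<and> snd v \<in> {1..n} then upper_dot (partner d (inner v)) else v)"
definition p_lo :: "nat \<Rightarrow> diagram \<Rightarrow> dot \<Rightarrow> dot" where
  "p_lo n d v = (if fst v \<noteq> Top \<and> snd v \<in> {1..n} then lower_dot (partner d (inner' v)) else v)"

lemma inner_upper: "x \<in> dots n \<Longrightarrow> inner (upper_dot x) = x \<and> fst (upper_dot x) \<noteq> Bot \<and> snd (upper_dot x) \<in> {1..n}"
  by (cases x) (auto simp: dots_def inner_def)

lemma inner'_lower: "x \<in> dots n \<Longrightarrow> inner' (lower_dot x) = x \<and> fst (lower_dot x) \<noteq> Top \<and> snd (lower_dot x) \<in> {1..n}"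
  by (cases x) (auto simp: dots_def inner'_def)

lemma upper_inner: "fst v \<noteq> Bot \<Longrightarrow> snd v \<in> {1..n} \<Longrightarrow> upper_dot (inner v) = v \<and> inner v \<in> dots n"
  by (cases v, cases "fst v") (auto simp: dots_def inner_def)

lemma lower_inner': "fst v \<noteq> Top \<Longrightarrow> snd v \<in> {1..n} \<Longrightarrow> lower_dot (inner' v) = v \<and> inner' v \<in> dots n"
  by (cases v, cases "fst v") (auto simp: dots_def inner'_def)

context
  fixes n :: nat and d1 d2 :: diagram
  assumes d1: "d1 \<in> diagrams n" and d2: "d2 \<in> diagrams n"
begin

lemma p_up_range: "fst v \<noteq> Bot \<Longrightarrow> snd v \<in> {1..n} \<Longrightarrow>
    fst (p_up n d1 v) \<noteq> Bot \<and> snd (p_up n d1 v) \<in> {1..n} \<and> p_up n d1 v \<noteq> v \<and> p_up n d1 (p_up n d1 v) = v"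
proof -
  assume v: "fst v \<noteq> Bot" "snd v \<in> {1..n}"
  note u = upper_inner[OF v]
  note p = partner[OF d1 conjunct2[OF u]]
  note i = inner_upper[OF p(3)]
  have 1: "p_up n d1 v = upper_dot (partner d1 (inner v))" using v by (simp add: p_up_def)
  have 2: "p_up n d1 (upper_dot (partner d1 (inner v))) = upper_dot (partner d1 (partner d1 (inner v)))"
    using i by (simp add: p_up_def)
  have 3: "p_up n d1 (p_up n d1 v) = v"
    unfolding 1 2 partner_partner[OF d1 conjunct2[OF u]] using u by blast
  have 4: "fst (p_up n d1 v) \<noteq> Bot \<and> snd (p_up n d1 v) \<in> {1..n}" unfolding 1 using i by blast
  have 5: "p_up n d1 v \<noteq> v"
  proof
    assume "p_up n d1 v = v"
    then have "partner d1 (inner v) = inner v" using i unfolding 1 by simp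
    then show False using p(2) by contradiction
  qed
  show ?thesis using 3 4 5 by blast
qed

lemma p_lo_range: "fst v \<noteq> Top \<Longrightarrow> snd v \<in> {1..n} \<Longrightarrow>
    fst (p_lo n d2 v) \<noteq> Top \<and> snd (p_lo n d2 v) \<in> {1..n} \<and> p_lo n d2 v \<noteq> v \<and> p_lo n d2 (p_lo n d2 v) = v"
proof -
  assume v: "fst v \<noteq> Top" "snd v \<in> {1..n}"
  note u = lower_inner'[OF v]
  note p = partner[OF d2 conjunct2[OF u]]
  note i = inner'_lower[OF p(3)]
  have 1: "p_lo n d2 v = lower_dot (partner d2 (inner' v))" using v by (simp add: p_lo_def)
  have 2: "p_lo n d2 (lower_dot (partner d2 (inner' v))) = lower_dot (partner d2 (partner d2 (inner' v)))"
    using i by (simp add: p_lo_def)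
  have 3: "p_lo n d2 (p_lo n d2 v) = v"
    unfolding 1 2 partner_partner[OF d2 conjunct2[OF u]] using u by blast
  have 4: "fst (p_lo n d2 v) \<noteq> Top \<and> snd (p_lo n d2 v) \<in> {1..n}" unfolding 1 using i by blast
  have 5: "p_lo n d2 v \<noteq> v"
  proof
    assume "p_lo n d2 v = v"
    then have "partner d2 (inner' v) = inner' v" using i unfolding 1 by simp
    then show False using p(2) by contradiction
  qed
  show ?thesis using 3 4 5 by blast
qed

lemma p_up_inv: "p_up n d1 (p_up n d1 v) = v"
  using p_up_range[of v] by (cases "fst v \<noteq> Bot \<and> snd v \<in> {1..n}") (auto simp: p_up_def)

lemma p_lo_inv: "p_lo n d2 (p_lo n d2 v) = v"
  using p_lo_range[of v] by (cases "fst v \<noteq> Top \<and> snd v \<in> {1..n}") (auto simp: p_lo_def)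

lemma stack_adj:
  "(x, y) \<in> adj (stack d1 d2) \<Longrightarrow> y = x \<or> y = p_up n d1 x \<or> y = p_lo n d2 x"
proof -
  assume "(x, y) \<in> adj (stack d1 d2)"
  then obtain e where e: "e \<in> stack d1 d2" "x \<in> e" "y \<in> e" by (auto simp: adj_def)
  from e(1) consider e' where "e' \<in> d1" "e = upper_dot ` e'" | e' where "e' \<in> d2" "e = lower_dot ` e'"
    by (auto simp: stack_def)
  then show ?thesis
  proof cases
    case 1
    then obtain z where z: "z \<in> dots n" "e' = {z, partner d1 z}" using edge_cases[OF d1] by metis
    have "e = {upper_dot z, p_up n d1 (upper_dot z)}"
      using inner_upper[OF z(1)] 1 z by (simp add: p_up_def)
    moreover have "p_up n d1 (p_up n d1 (upper_dot z)) = upper_dot z" by (rule p_up_inv)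
    ultimately show ?thesis using e(2,3) by auto
  next
    case 2
    then obtain z where z: "z \<in> dots n" "e' = {z, partner d2 z}" using edge_cases[OF d2] by metis
    have "e = {lower_dot z, p_lo n d2 (lower_dot z)}"
      using inner'_lower[OF z(1)] 2 z by (simp add: p_lo_def)
    moreover have "p_lo n d2 (p_lo n d2 (lower_dot z)) = lower_dot z" by (rule p_lo_inv)
    ultimately show ?thesis using e(2,3) by auto
  qed
qed

lemma stack_adj':
  "(x, p_up n d1 x) \<in> connected_dots (stack d1 d2)" "(x, p_lo n d2 x) \<in> connected_dots (stack d1 d2)"
proof -
  show "(x, p_up n d1 x) \<in> connected_dots (stack d1 d2)"
  proof (cases "fst x \<noteq> Bot \<and> snd x \<in> {1..n}")
    case True
    then have "upper_dot ` {inner x, partner d1 (inner x)} \<in> stack d1 d2" "upper_dot (inner x) = x"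
      using partner(1)[OF d1, of "inner x"] upper_inner[of x n] unfolding stack_def by blast+
    then have "(x, p_up n d1 x) \<in> adj (stack d1 d2)"
      using True unfolding adj_def p_up_def by auto
    then show ?thesis by (auto simp: connected_adj)
  qed (auto simp: p_up_def connected_refl)
  show "(x, p_lo n d2 x) \<in> connected_dots (stack d1 d2)"
  proof (cases "fst x \<noteq> Top \<and> snd x \<in> {1..n}")
    case True
    then have "lower_dot ` {inner' x, partner d2 (inner' x)} \<in> stack d1 d2" "lower_dot (inner' x) = x"
      using partner(1)[OF d2, of "inner' x"] lower_inner'[of x n] unfolding stack_def by blast+
    then have "(x, p_lo n d2 x) \<in> adj (stack d1 d2)"
      using True unfolding adj_def p_lo_def by auto
    then show ?thesis by (auto simp: connected_adj)
  qed (auto simp: p_lo_def connected_refl)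
qed

lemma stack_connected:
  "connected_dots (stack d1 d2) = {(a, b). b = p_up n d1 a \<or> b = p_lo n d2 a}\<^sup>*" (is "_ = ?R\<^sup>*")
proof (rule subset_antisym)
  have "adj (stack d1 d2) \<subseteq> ?R\<^sup>*" using stack_adj by blast
  then show "connected_dots (stack d1 d2) \<subseteq> ?R\<^sup>*" unfolding connected_adj by (rule rtrancl_subset_rtrancl)
  have "?R \<subseteq> (adj (stack d1 d2))\<^sup>*" using stack_adj' unfolding connected_adj by auto
  then show "?R\<^sup>* \<subseteq> connected_dots (stack d1 d2)" unfolding connected_adj by (rule rtrancl_subset_rtrancl)
qed

lemma connected_range:
  assumes "(x, y) \<in> connected_dots (stack d1 d2)" "x \<noteq> y"
  shows "snd x \<in> {1..n} \<and> snd y \<in> {1..n}"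
proof -
  have 1: "snd a \<in> {1..n} \<longrightarrow> snd b \<in> {1..n}" "snd a \<notin> {1..n} \<longrightarrow> b = a"
    if "b = p_up n d1 a \<or> b = p_lo n d2 a" for a b
  proof -
    have "(snd a \<in> {1..n} \<longrightarrow> snd (p_up n d1 a) \<in> {1..n}) \<and> (snd a \<notin> {1..n} \<longrightarrow> p_up n d1 a = a)"
    proof (cases "fst a \<noteq> Bot \<and> snd a \<in> {1..n}")
      case True
      then show ?thesis using p_up_range[of a] by blast
    next
      case False
      then have "p_up n d1 a = a" by (auto simp: p_up_def)
      then show ?thesis by simp
    qed
    moreover have "(snd a \<in> {1..n} \<longrightarrow> snd (p_lo n d2 a) \<in> {1..n}) \<and> (snd a \<notin> {1..n} \<longrightarrow> p_lo n d2 a = a)"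
    proof (cases "fst a \<noteq> Top \<and> snd a \<in> {1..n}")
      case True
      then show ?thesis using p_lo_range[of a] by blast
    next
      case False
      then have "p_lo n d2 a = a" by (auto simp: p_lo_def)
      then show ?thesis by simp
    qed
    ultimately show "snd a \<in> {1..n} \<longrightarrow> snd b \<in> {1..n}" "snd a \<notin> {1..n} \<longrightarrow> b = a"
      using that by blast+
  qed
  have "(snd x \<in> {1..n} \<longrightarrow> snd y \<in> {1..n}) \<and> (snd x \<notin> {1..n} \<longrightarrow> y = x)"
    using assms(1) unfolding stack_connected
  proof (induction rule: rtrancl_induct)
    case (step y z)
    then have "z = p_up n d1 y \<or> z = p_lo n d2 y" by blast
    from 1[OF this] step.IH show ?case by metis
  qed simp
  then show ?thesis using assms(2) by auto
qed

text \<open>A component containing an outer dot is a path by \<open>involution_orbit_end\<close>;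
  its other end is fixed by one of the involutions, hence again an outer dot.\<close>

lemma connected_partner:
  assumes "fst x \<noteq> Mid" "snd x \<in> {1..n}"
  shows "\<exists>!y. y \<noteq> x \<and> (x, y) \<in> connected_dots (stack d1 d2) \<and> fst y \<noteq> Mid"
proof -
  let ?V = "UNIV \<times> {1..n} :: dot set"
  have "finite (UNIV :: row set)"
  proof -
    have "(UNIV :: row set) = {Top, Mid, Bot}" using row.exhaust by auto
    then show ?thesis by (metis finite.emptyI finite.insertI)
  qed
  then have fin: "finite ?V" by simp
  have V: "p_up n d1 v \<in> ?V" "p_lo n d2 v \<in> ?V" if v: "v \<in> ?V" for v
  proof -
    show "p_up n d1 v \<in> ?V"
    proof (cases "fst v = Bot")
      case True
      then have "p_up n d1 v = v" by (simp add: p_up_def)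
      then show ?thesis using v by simp
    qed (use p_up_range[of v] v in \<open>simp add: mem_Times_iff\<close>)
    show "p_lo n d2 v \<in> ?V"
    proof (cases "fst v = Top")
      case True
      then have "p_lo n d2 v = v" by (simp add: p_lo_def)
      then show ?thesis using v by simp
    qed (use p_lo_range[of v] v in \<open>simp add: mem_Times_iff\<close>)
  qed
  have fixed: "(p_up n d1 v = v \<or> p_lo n d2 v = v) \<longleftrightarrow> fst v \<noteq> Mid" if v: "v \<in> ?V" for v
  proof -
    have sv: "snd v \<in> {1..n}" using v by (simp add: mem_Times_iff)
    show ?thesis
    proof (cases "fst v")
      case Top
      then have "p_lo n d2 v = v" by (simp add: p_lo_def)
      then show ?thesis using Top by simp
    next
      case Mid
      then have "p_up n d1 v \<noteq> v" "p_lo n d2 v \<noteq> v"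
        using p_up_range[of v] p_lo_range[of v] sv by simp_all
      then show ?thesis using Mid by simp
    next
      case Bot
      then have "p_up n d1 v = v" by (simp add: p_up_def)
      then show ?thesis using Bot by simp
    qed
  qed
  have xV: "x \<in> ?V" using assms by (simp add: mem_Times_iff)
  have "\<exists>!z. z \<noteq> x \<and> (x, z) \<in> connected_dots (stack d1 d2) \<and> (p_up n d1 z = z \<or> p_lo n d2 z = z)"
  proof (cases "fst x = Top")
    case True
    show ?thesis unfolding stack_connected
      using involution_orbit_end[OF p_up_inv p_lo_inv fin xV V] True assms p_up_range[of x]
      by (simp add: p_lo_def)
  next
    case False
    then have "fst x = Bot" using assms(1) by (cases "fst x") auto
    then have "\<exists>!z. z \<noteq> x \<and> (x, z) \<in> {(a, b). b = p_lo n d2 a \<or> b = p_up n d1 a}\<^sup>* \<and>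
        (p_lo n d2 z = z \<or> p_up n d1 z = z)"
      using involution_orbit_end[OF p_lo_inv p_up_inv fin xV V(2,1)] assms p_lo_range[of x]
      by (simp add: p_up_def)
    moreover have "{(a, b). b = p_lo n d2 a \<or> b = p_up n d1 a} = {(a, b). b = p_up n d1 a \<or> b = p_lo n d2 a}"
      by auto
    ultimately have E: "\<exists>!z. z \<noteq> x \<and> (x, z) \<in> connected_dots (stack d1 d2) \<and>
        (p_lo n d2 z = z \<or> p_up n d1 z = z)"
      unfolding stack_connected by (simp only:)
    have iff: "(z \<noteq> x \<and> (x, z) \<in> connected_dots (stack d1 d2) \<and> (p_up n d1 z = z \<or> p_lo n d2 z = z)) =
      (z \<noteq> x \<and> (x, z) \<in> connected_dots (stack d1 d2) \<and> (p_lo n d2 z = z \<or> p_up n d1 z = z))" for z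
      by blast
    show ?thesis unfolding iff by (rule E)
  qed
  moreover have "(z \<noteq> x \<and> (x, z) \<in> connected_dots (stack d1 d2) \<and> (p_up n d1 z = z \<or> p_lo n d2 z = z)) \<longleftrightarrow>
      (z \<noteq> x \<and> (x, z) \<in> connected_dots (stack d1 d2) \<and> fst z \<noteq> Mid)" for z
    using connected_range[of x z] fixed[of z] by (auto simp: mem_Times_iff)
  ultimately show ?thesis by simp
qed

lemma compose_in_diagrams: "compose d1 d2 \<in> diagrams n"
proof -
  have ends: "x \<in> dots n" if "fst x \<noteq> Mid" "snd x \<in> {1..n}" for x
    using that by (cases x, cases "fst x") (auto simp: dots_def)
  have compD: "\<exists>a b. e = {a, b} \<and> a \<noteq> b \<and> fst a \<noteq> Mid \<and> fst b \<noteq> Mid \<and>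
      (a, b) \<in> connected_dots (stack d1 d2)" if "e \<in> compose d1 d2" for e
    using that unfolding compose_def mem_Collect_eq by assumption
  have "e \<subseteq> dots n \<and> card e = 2" if e: "e \<in> compose d1 d2" for e
  proof -
    obtain a b where ab: "e = {a, b}" "a \<noteq> b" "fst a \<noteq> Mid" "fst b \<noteq> Mid"
      "(a, b) \<in> connected_dots (stack d1 d2)" using compD[OF e] by (elim exE conjE) (rule that)
    then show ?thesis
      using connected_range[OF ab(5,2)] ends[OF ab(3)] ends[OF ab(4)] by simp
  qed
  moreover have "\<exists>!e. e \<in> compose d1 d2 \<and> x \<in> e" if x: "x \<in> dots n" for x
  proof -
    have x': "fst x \<noteq> Mid" "snd x \<in> {1..n}" using x by (auto simp: dots_def)
    from connected_partner[OF x'] obtain y where y: "y \<noteq> x" "(x, y) \<in> connected_dots (stack d1 d2)" "fst y \<noteq> Mid"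
      and u: "\<And>z. z \<noteq> x \<Longrightarrow> (x, z) \<in> connected_dots (stack d1 d2) \<Longrightarrow> fst z \<noteq> Mid \<Longrightarrow> z = y"
      by (elim ex1E) blast
    show ?thesis
    proof (rule ex1I[of _ "{x, y}"])
      have "{x, y} \<in> compose d1 d2" using y x'(1) unfolding compose_def by blast
      then show "{x, y} \<in> compose d1 d2 \<and> x \<in> {x, y}" by simp
    next
      fix e assume "e \<in> compose d1 d2 \<and> x \<in> e"
      then have e: "e \<in> compose d1 d2" "x \<in> e" by simp_all
      obtain a b where ab: "e = {a, b}" "a \<noteq> b" "fst a \<noteq> Mid" "fst b \<noteq> Mid"
        "(a, b) \<in> connected_dots (stack d1 d2)" using compD[OF e(1)] by (elim exE conjE) (rule that)
      show "e = {x, y}"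
      proof (cases "x = a")
        case True
        have "b = y" using ab True by (intro u) simp_all
        then show ?thesis using ab(1) True by simp
      next
        case False
        then have x: "x = b" using e(2) ab(1) by simp
        have "a = y" using ab x connected_sym[OF ab(5)] by (intro u) simp_all
        then show ?thesis using ab(1) x by (simp add: insert_commute)
      qed
    qed
  qed
  ultimately show ?thesis unfolding diagrams_def by blast
qed

end

subsection \<open>Counting colourings of the middle row\<close>

text \<open>The colours of the dots of a diagram whose top row is coloured by \<open>f\<close> and
  whose bottom row is coloured by \<open>g\<close>, and those of the stacked graph of two diagrams
  with \<open>h\<close> in the middle row.\<close>

fun pair_col :: "(nat \<Rightarrow> nat) \<Rightarrow> (nat \<Rightarrow> nat) \<Rightarrow> dot \<Rightarrow> nat" where
  "pair_col f g (q, i) = (if q = Bot then g i else f i)"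

fun triple_col :: "(nat \<Rightarrow> nat) \<Rightarrow> (nat \<Rightarrow> nat) \<Rightarrow> (nat \<Rightarrow> nat) \<Rightarrow> dot \<Rightarrow> nat" where
  "triple_col f h g (q, i) = (case q of Top \<Rightarrow> f i | Mid \<Rightarrow> h i | Bot \<Rightarrow> g i)"

definition compat :: "diagram \<Rightarrow> (nat \<Rightarrow> nat) \<Rightarrow> (nat \<Rightarrow> nat) \<Rightarrow> bool" where
  "compat d f g \<longleftrightarrow> (\<forall>e\<in>d. \<forall>x\<in>e. \<forall>y\<in>e. pair_col f g x = pair_col f g y)"

text \<open>The colourings of the middle row that are compatible with both diagrams. Functions are
  extensional in order to make this set finite.\<close>

definition mids :: "nat \<Rightarrow> nat \<Rightarrow> diagram \<Rightarrow> diagram \<Rightarrow> (nat \<Rightarrow> nat) \<Rightarrow> (nat \<Rightarrow> nat) \<Rightarrow> (nat \<Rightarrow> nat) set" where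
  "mids N n d1 d2 f g = {h \<in> {1..n} \<rightarrow>\<^sub>E {..<N}. compat d1 f h \<and> compat d2 h g}"

lemma compat_edge:
  assumes "compat d f g" "{x, y} \<in> d"
  shows "pair_col f g x = pair_col f g y"
proof -
  have "\<forall>a\<in>{x, y}. \<forall>b\<in>{x, y}. pair_col f g a = pair_col f g b"
    using assms(1)[unfolded compat_def] assms(2) by (rule bspec)
  then have "\<forall>b\<in>{x, y}. pair_col f g x = pair_col f g b" by (rule bspec) (rule insertI1)
  then show ?thesis by (rule bspec) (rule insertI2[OF singletonI])
qed

lemma composeD:
  assumes "e \<in> compose d1 d2"
  obtains a b where "e = {a, b}" "a \<noteq> b" "fst a \<noteq> Mid" "fst b \<noteq> Mid"
    "(a, b) \<in> connected_dots (stack d1 d2)"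
  using assms unfolding compose_def mem_Collect_eq by (elim exE conjE) (rule that)

lemma constant_connected:
  fixes t :: "dot \<Rightarrow> nat"
  shows "(\<forall>e\<in>G. \<forall>x\<in>e. \<forall>y\<in>e. t x = t y) \<longleftrightarrow> (\<forall>(x, y)\<in>connected_dots G. t x = t y)"
proof
  assume a: "\<forall>e\<in>G. \<forall>x\<in>e. \<forall>y\<in>e. t x = t y"
  have "t x = t y" if "(x, y) \<in> (adj G)\<^sup>*" for x y
    using that
  proof (induction rule: rtrancl_induct)
    case (step y z)
    then obtain e where "e \<in> G" "y \<in> e" "z \<in> e" unfolding adj_def by blast
    then have "t y = t z" using a by blast
    then show ?case using step.IH by simp
  qed simp
  then show "\<forall>(x, y)\<in>connected_dots G. t x = t y" unfolding connected_adj by blast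
next
  assume a: "\<forall>(x, y)\<in>connected_dots G. t x = t y"
  show "\<forall>e\<in>G. \<forall>x\<in>e. \<forall>y\<in>e. t x = t y"
  proof (intro ballI)
    fix e x y assume "e \<in> G" "x \<in> e" "y \<in> e"
    then have "(x, y) \<in> adj G" unfolding adj_def by blast
    then have "(x, y) \<in> connected_dots G" unfolding connected_adj by (rule r_into_rtrancl)
    then show "t x = t y" using a by blast
  qed
qed

lemma compat_mids:
  assumes d1: "d1 \<in> diagrams n" and d2: "d2 \<in> diagrams n"
  shows "compat d1 f h \<and> compat d2 h g \<longleftrightarrow>
    (\<forall>(x, y)\<in>connected_dots (stack d1 d2). triple_col f h g x = triple_col f h g y)"
proof -
  have r: "fst x \<noteq> Mid" if "e \<in> d" "x \<in> e" "d \<in> diagrams n" for e x d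
  proof -
    have "\<forall>e\<in>d. e \<subseteq> dots n \<and> card e = 2" using that(3) unfolding diagrams_def by simp
    then have "x \<in> dots n" using that(1,2) by blast
    then show ?thesis by (auto simp: dots_def)
  qed
  have u: "pair_col f h x = triple_col f h g (upper_dot x)" "pair_col h g x = triple_col f h g (lower_dot x)"
    if "fst x \<noteq> Mid" for x using that by (cases x, cases "fst x", auto)+
  have 1: "compat d1 f h \<and> compat d2 h g \<longleftrightarrow>
      (\<forall>e\<in>stack d1 d2. \<forall>x\<in>e. \<forall>y\<in>e. triple_col f h g x = triple_col f h g y)"
    unfolding compat_def stack_def using r[OF _ _ d1] r[OF _ _ d2] u by (auto simp: ball_Un)
  then show ?thesis unfolding constant_connected .
qed

lemma compat_compose:
  assumes d1: "d1 \<in> diagrams n" and d2: "d2 \<in> diagrams n"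
  shows "compat (compose d1 d2) f g \<longleftrightarrow> (\<forall>x y. fst x \<noteq> Mid \<and> fst y \<noteq> Mid \<and>
    (x, y) \<in> connected_dots (stack d1 d2) \<longrightarrow> triple_col f h g x = triple_col f h g y)"
proof -
  have t: "pair_col f g x = triple_col f h g x" if "fst x \<noteq> Mid" for x
    using that by (cases x, cases "fst x") auto
  show ?thesis
  proof
    assume c: "compat (compose d1 d2) f g"
    show "\<forall>x y. fst x \<noteq> Mid \<and> fst y \<noteq> Mid \<and> (x, y) \<in> connected_dots (stack d1 d2) \<longrightarrow>
      triple_col f h g x = triple_col f h g y"
    proof (intro allI impI, elim conjE)
      fix x y assume xy: "fst x \<noteq> Mid" "fst y \<noteq> Mid" "(x, y) \<in> connected_dots (stack d1 d2)"
      show "triple_col f h g x = triple_col f h g y"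
      proof (cases "x = y")
        case False
        then have "{x, y} \<in> compose d1 d2" using xy unfolding compose_def by blast
        then have "pair_col f g x = pair_col f g y" by (rule compat_edge[OF c])
        then show ?thesis using t xy by simp
      qed simp
    qed
  next
    assume a: "\<forall>x y. fst x \<noteq> Mid \<and> fst y \<noteq> Mid \<and> (x, y) \<in> connected_dots (stack d1 d2) \<longrightarrow>
      triple_col f h g x = triple_col f h g y"
    show "compat (compose d1 d2) f g"
      unfolding compat_def
    proof (intro ballI)
      fix e x y assume "e \<in> compose d1 d2" "x \<in> e" "y \<in> e"
      then obtain v v' where v: "e = {v, v'}" "fst v \<noteq> Mid" "fst v' \<noteq> Mid"
        "(v, v') \<in> connected_dots (stack d1 d2)" by (elim composeD)
      have "triple_col f h g v = triple_col f h g v'" using a v(2-4) by blast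
      then have "pair_col f g v = pair_col f g v'" using t[OF v(2)] t[OF v(3)] by simp
      then show "pair_col f g x = pair_col f g y" using v(1) \<open>x \<in> e\<close> \<open>y \<in> e\<close> by auto
    qed
  qed
qed

text \<open>A colouring of the stacked graph is a function that is constant on the components. The
  outer colours determine it on the components which meet the outer rows, and this is consistent
  if and only if the outer colouring is compatible with the composition; on each closed loop the
  colour is free.\<close>

theorem card_mids:
  assumes d1: "d1 \<in> diagrams n" and d2: "d2 \<in> diagrams n"
    and fg: "\<And>i. i \<in> {1..n} \<Longrightarrow> f i < N" "\<And>i. i \<in> {1..n} \<Longrightarrow> g i < N"
  shows "card (mids N n d1 d2 f g) = (if compat (compose d1 d2) f g then N ^ loops n d1 d2 else 0)"
proof (cases "compat (compose d1 d2) f g")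
  case False
  have "mids N n d1 d2 f g = {}"
    using False compat_compose[OF d1 d2] compat_mids[OF d1 d2] unfolding mids_def by fast
  then show ?thesis using False by simp
next
  case True
  let ?R = "connected_dots (stack d1 d2)"
  define cls where "cls v = ?R `` {v}" for v
  define CC where "CC = {C. C \<subseteq> {Mid} \<times> UNIV \<and> (\<exists>i\<in>{1..n}. C = cls (Mid, i))}"
  have cls_eq: "cls x = cls y" if "(x, y) \<in> ?R" for x y
    using that connected_sym connected_trans unfolding cls_def by blast
  have cls_D: "(x, y) \<in> ?R" if "cls x = cls y" for x y
    using that connected_refl[of y] unfolding cls_def by blast
  have CC_fin: "finite CC"
    by (rule finite_subset[of _ "(\<lambda>i. cls (Mid, i)) ` {1..n}"]) (auto simp: CC_def)
  define val where "val k v = (if cls v \<in> CC then k (cls v)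
    else triple_col f (\<lambda>_. 0) g (SOME y. fst y \<noteq> Mid \<and> y \<in> cls v))" for k :: "dot set \<Rightarrow> nat" and v
  define Phi where "Phi k = restrict (\<lambda>i. val k (Mid, i)) {1..n}" for k
  define idx where "idx C = (SOME i. i \<in> {1..n} \<and> C = cls (Mid, i))" for C
  define Psi where "Psi h = restrict (\<lambda>C. h (idx C)) CC" for h :: "nat \<Rightarrow> nat"
  have idx: "idx C \<in> {1..n} \<and> C = cls (Mid, idx C)" if "C \<in> CC" for C
  proof -
    have "\<exists>i. i \<in> {1..n} \<and> C = cls (Mid, i)" using that by (auto simp: CC_def)
    then show ?thesis unfolding idx_def by (rule someI_ex)
  qed
  have tm: "triple_col f h g x = triple_col f h' g x" if "fst x \<noteq> Mid" for x h h'
    using that by (cases x, cases "fst x") auto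
  have comp: "triple_col f h g x = triple_col f h' g y"
    if "fst x \<noteq> Mid" "fst y \<noteq> Mid" "(x, y) \<in> ?R" for x y h h'
    using True compat_compose[OF d1 d2, of f g h] that tm by metis
  have rep: "fst y \<noteq> Mid \<and> (v, y) \<in> ?R"
    if "y = (SOME y. fst y \<noteq> Mid \<and> y \<in> cls v)" "cls v \<notin> CC" "fst v \<noteq> Mid \<or> snd v \<in> {1..n}" for v y
  proof -
    have "\<exists>y. fst y \<noteq> Mid \<and> y \<in> cls v"
    proof (cases "fst v = Mid")
      case True
      then have "\<not> cls v \<subseteq> {Mid} \<times> UNIV" using that(2,3) unfolding CC_def by (cases v) auto
      then obtain y where "y \<in> cls v" "y \<notin> {Mid} \<times> UNIV" by blast
      then show ?thesis by (cases y) auto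
    next
      case False
      then show ?thesis by (intro exI[of _ v]) (simp add: cls_def connected_refl)
    qed
    then have "fst y \<noteq> Mid \<and> y \<in> cls v" unfolding that(1) by (rule someI_ex)
    then show ?thesis by (simp add: cls_def)
  qed
  have val_top: "val k v = triple_col f h g v" if "fst v \<noteq> Mid" for k v h
  proof -
    have "v \<in> cls v" by (simp add: cls_def connected_refl)
    then have "cls v \<notin> CC" using that unfolding CC_def by (cases v) auto
    then show ?thesis using rep[OF refl, of v] comp that unfolding val_def by metis
  qed
  have val_cls: "val k x = val k y" if "(x, y) \<in> ?R" for k x y
    unfolding val_def cls_eq[OF that] by (rule refl)
  have val_Phi: "triple_col f (Phi k) g v = val k v" if "fst v \<noteq> Mid \<or> snd v \<in> {1..n}" for k v
  proof (cases "fst v = Mid")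
    case True
    then show ?thesis using that by (cases v) (auto simp: Phi_def)
  qed (use val_top in metis)
  have Phi_mem: "Phi k \<in> mids N n d1 d2 f g" if k: "k \<in> CC \<rightarrow>\<^sub>E {..<N}" for k
  proof -
    have "triple_col f (Phi k) g x = triple_col f (Phi k) g y" if "(x, y) \<in> ?R" for x y
    proof (cases "x = y")
      case False
      then show ?thesis using connected_range[OF d1 d2 that] val_Phi val_cls[OF that] by simp
    qed simp
    moreover have "val k (Mid, i) < N" if i: "i \<in> {1..n}" for i
    proof (cases "cls (Mid, i) \<in> CC")
      case True
      then show ?thesis using k by (auto simp: val_def PiE_iff)
    next
      case False
      let ?y = "SOME y. fst y \<noteq> Mid \<and> y \<in> cls (Mid, i)"
      have y: "fst ?y \<noteq> Mid" "((Mid, i), ?y) \<in> ?R" using rep[OF refl False] i by auto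
      have "(Mid, i) \<noteq> ?y"
      proof
        assume "(Mid, i) = ?y"
        then have "fst ?y = Mid" by (metis fst_conv)
        then show False using y(1) by contradiction
      qed
      from connected_range[OF d1 d2 y(2) this] have "snd ?y \<in> {1..n}" by blast
      then have "triple_col f (\<lambda>_. 0) g ?y < N"
        using fg y(1) by (cases ?y, cases "fst ?y") auto
      then show ?thesis using False by (simp add: val_def)
    qed
    ultimately show ?thesis
      unfolding mids_def compat_mids[OF d1 d2] Phi_def by auto
  qed
  have "bij_betw Phi (CC \<rightarrow>\<^sub>E {..<N}) (mids N n d1 d2 f g)"
  proof (rule bij_betwI[of _ _ _ Psi])
    show "Phi \<in> (CC \<rightarrow>\<^sub>E {..<N}) \<rightarrow> mids N n d1 d2 f g" using Phi_mem by blast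
    show "Psi \<in> mids N n d1 d2 f g \<rightarrow> (CC \<rightarrow>\<^sub>E {..<N})"
      using idx unfolding Psi_def mids_def by (auto simp: PiE_iff extensional_def)
  next
    fix k assume k: "k \<in> CC \<rightarrow>\<^sub>E {..<N}"
    show "Psi (Phi k) = k"
    proof
      fix C show "Psi (Phi k) C = k C"
      proof (cases "C \<in> CC")
        case True
        then show ?thesis using idx[OF True] by (simp add: Psi_def Phi_def val_def)
      next
        case False
        then show ?thesis using k by (simp add: Psi_def PiE_iff extensional_def)
      qed
    qed
  next
    fix h assume h: "h \<in> mids N n d1 d2 f g"
    then have hc: "triple_col f h g x = triple_col f h g y" if "(x, y) \<in> ?R" for x y
      using that unfolding mids_def compat_mids[OF d1 d2] by blast
    show "Phi (Psi h) = h"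
    proof
      fix i show "Phi (Psi h) i = h i"
      proof (cases "i \<in> {1..n}")
        case i: True
        show ?thesis
        proof (cases "cls (Mid, i) \<in> CC")
          case True
          have "((Mid, i), (Mid, idx (cls (Mid, i)))) \<in> ?R"
            using idx[OF True] by (intro cls_D) auto
          then have "h i = h (idx (cls (Mid, i)))" using hc by fastforce
          then show ?thesis using True i by (simp add: Phi_def val_def Psi_def)
        next
          case False
          let ?y = "SOME y. fst y \<noteq> Mid \<and> y \<in> cls (Mid, i)"
          have y: "fst ?y \<noteq> Mid" "((Mid, i), ?y) \<in> ?R" using rep[OF refl False] i by auto
          then have "h i = triple_col f (\<lambda>_. 0) g ?y" using hc[OF y(2)] tm[OF y(1), of h] by simp
          then show ?thesis using False i by (simp add: Phi_def val_def)
        qed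
      next
        case False
        then show ?thesis using h unfolding Phi_def mids_def by (auto simp: PiE_iff extensional_def)
      qed
    qed
  qed
  then have "card (mids N n d1 d2 f g) = card (CC \<rightarrow>\<^sub>E {..<N})" by (simp add: bij_betw_same_card)
  also have "\<dots> = N ^ card CC" using CC_fin by (simp add: card_PiE)
  also have "CC = {C. C \<subseteq> {Mid} \<times> UNIV \<and> (\<exists>i\<in>{1..n}. C = connected_dots (stack d1 d2) `` {(Mid, i)})}"
    by (simp add: CC_def cls_def)
  finally show ?thesis using True by (simp add: loops_def)
qed

lemma compat_const: "d \<in> diagrams n \<Longrightarrow> compat d (\<lambda>_. 0) (\<lambda>_. 0)"
proof -
  have "pair_col (\<lambda>_. 0) (\<lambda>_. 0) x = 0" for x by (cases x) auto
  then show ?thesis by (simp add: compat_def)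
qed

definition two_coloured :: "(nat \<Rightarrow> nat) \<Rightarrow> bool" where "two_coloured f \<longleftrightarrow> (\<forall>i. f i < 2)"

text \<open>Two colours suffice to recognize a diagram: give one colour to the two ends of an edge
  and the other colour to all other dots.\<close>

lemma diagram_eqI:
  assumes d: "d \<in> diagrams n" and d': "d' \<in> diagrams n"
    and c: "\<And>f g. two_coloured f \<Longrightarrow> two_coloured g \<Longrightarrow> compat d f g \<Longrightarrow> compat d' f g"
  shows "d = d'"
proof -
  have p: "partner d' x = partner d x" if x: "x \<in> dots n" for x
  proof (rule ccontr)
    assume ne: "partner d' x \<noteq> partner d x"
    define F where "F v = (if v = x \<or> v = partner d x then 0 else 1 :: nat)" for v
    define f where "f i = F (Top, i)" for i
    define g where "g i = F (Bot, i)" for i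
    have F: "pair_col f g v = F v" if "v \<in> dots n" for v
      using that by (cases v) (auto simp: dots_def f_def g_def)
    have "compat d f g"
      unfolding compat_def
    proof (intro ballI)
      fix e y z assume e: "e \<in> d" "y \<in> e" "z \<in> e"
      then obtain v where v: "v \<in> dots n" "e = {v, partner d v}" using edge_cases[OF d] by metis
      have "F v = F (partner d v)"
        using partner_partner[OF d v(1)] partner_partner[OF d x] unfolding F_def by metis
      then have "pair_col f g v = pair_col f g (partner d v)"
        by (simp only: F[OF v(1)] F[OF partner(3)[OF d v(1)]])
      then show "pair_col f g y = pair_col f g z" using e(2,3) unfolding v(2) by auto
    qed
    then have "compat d' f g" by (intro c) (auto simp: two_coloured_def f_def g_def F_def)
    then have "pair_col f g x = pair_col f g (partner d' x)"
      using partner(1)[OF d' x] by (rule compat_edge)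
    then have "F x = F (partner d' x)" using F[OF x] F[OF partner(3)[OF d' x]] by simp
    then show False using ne partner(2)[OF d' x] by (auto simp: F_def split: if_splits)
  qed
  have sub: "a \<subseteq> b" if a: "a \<in> diagrams n" and b: "b \<in> diagrams n"
    and ab: "\<And>x. x \<in> dots n \<Longrightarrow> partner a x = partner b x" for a b
  proof
    fix e assume "e \<in> a"
    then obtain v where "v \<in> dots n" "e = {v, partner a v}" using edge_cases[OF a] by metis
    then show "e \<in> b" using partner(1)[OF b] ab by metis
  qed
  show ?thesis using sub[OF d d'] sub[OF d' d] p by auto
qed

text \<open>Counting colourings by two colours determines the product of two diagrams together
  with its number of loops, since the number is a power of two exactly for the compatible
  colourings. This reduces identities between products of diagrams to identities between operators
  on colourings.\<close>

lemma compose_cong: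
  assumes d: "d1 \<in> diagrams n" "d2 \<in> diagrams n" "a \<in> diagrams n"
    and c: "\<And>f g. two_coloured f \<Longrightarrow> two_coloured g \<Longrightarrow>
      2 ^ k * card (mids 2 n d1 d2 f g) = 2 ^ m * (if compat a f g then 1 else 0)"
  shows "compose d1 d2 = a" "k + loops n d1 d2 = m"
proof -
  have *: "2 ^ k * (if compat (compose d1 d2) f g then 2 ^ loops n d1 d2 else 0) =
      2 ^ m * (if compat a f g then 1 else 0 :: nat)" if "two_coloured f" "two_coloured g" for f g
    using c[OF that] card_mids[OF d(1,2), of f 2 g] that unfolding two_coloured_def by simp
  note cd = compose_in_diagrams[OF d(1,2)]
  have "compat (compose d1 d2) f g \<longleftrightarrow> compat a f g" if "two_coloured f" "two_coloured g" for f g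
    using *[OF that] by (auto split: if_splits)
  then show "compose d1 d2 = a" by (intro diagram_eqI[OF cd d(3)]) auto
  have "2 ^ (k + loops n d1 d2) = (2 :: nat) ^ m"
    using *[of "\<lambda>_. 0" "\<lambda>_. 0"] compat_const[OF cd] compat_const[OF d(3)]
    by (simp add: two_coloured_def power_add)
  then show "k + loops n d1 d2 = m" by simp
qed

lemma sum_mids:
  assumes "d1 \<in> diagrams n" "d2 \<in> diagrams n" "\<And>i. i \<in> {1..n} \<Longrightarrow> f i < N" "\<And>i. i \<in> {1..n} \<Longrightarrow> g i < N"
  shows "(\<Sum>h\<in>{1..n} \<rightarrow>\<^sub>E {..<N}. of_bool (compat d1 f h) * of_bool (compat d2 h g)) =
    N ^ loops n d1 d2 * of_bool (compat (compose d1 d2) f g)"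
proof -
  have "(\<Sum>h\<in>{1..n} \<rightarrow>\<^sub>E {..<N}. of_bool (compat d1 f h) * of_bool (compat d2 h g)) =
      card (mids N n d1 d2 f g)"
    unfolding mids_def by (simp add: sum_of_bool_eq finite_PiE Int_def flip: of_bool_conj)
  then show ?thesis using card_mids[OF assms(1,2), of f N g] assms(3,4) by simp
qed

text \<open>Both sides of associativity count the pairs of colourings of the two middle rows.\<close>

theorem compose_assoc:
  assumes d: "d1 \<in> diagrams n" "d2 \<in> diagrams n" "d3 \<in> diagrams n"
  shows "compose (compose d1 d2) d3 = compose d1 (compose d2 d3)"
    "loops n d1 d2 + loops n (compose d1 d2) d3 = loops n d2 d3 + loops n d1 (compose d2 d3)"
proof -
  note c12 = compose_in_diagrams[OF d(1,2)] and c23 = compose_in_diagrams[OF d(2,3)]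
  let ?P = "{1..n} \<rightarrow>\<^sub>E {..<2::nat}"
  let ?b = "\<lambda>d f g. of_bool (compat d f g) :: nat"
  have *: "2 ^ loops n d1 d2 * card (mids 2 n (compose d1 d2) d3 f g) =
      2 ^ (loops n d2 d3 + loops n d1 (compose d2 d3)) * (if compat (compose d1 (compose d2 d3)) f g then 1 else 0)"
    if fg: "two_coloured f" "two_coloured g" for f g
  proof -
    have P: "h i < 2" if "h \<in> ?P" "i \<in> {1..n}" for h i using that by (auto simp: PiE_iff)
    have f2: "f i < 2" "g i < 2" for i using fg by (simp_all add: two_coloured_def)
    have "2 ^ loops n d1 d2 * card (mids 2 n (compose d1 d2) d3 f g) =
        2 ^ loops n d1 d2 * (\<Sum>h'\<in>?P. ?b (compose d1 d2) f h' * ?b d3 h' g)"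
      unfolding mids_def by (simp add: sum_of_bool_eq finite_PiE Int_def flip: of_bool_conj)
    also have "\<dots> = (\<Sum>h'\<in>?P. (2 ^ loops n d1 d2 * ?b (compose d1 d2) f h') * ?b d3 h' g)"
      by (simp only: sum_distrib_left mult.assoc)
    also have "\<dots> = (\<Sum>h'\<in>?P. (\<Sum>h\<in>?P. ?b d1 f h * ?b d2 h h') * ?b d3 h' g)"
      by (intro sum.cong refl arg_cong2[of _ _ _ _ "(*)"] sum_mids[symmetric] d f2 P)
    also have "\<dots> = (\<Sum>h\<in>?P. ?b d1 f h * (\<Sum>h'\<in>?P. ?b d2 h h' * ?b d3 h' g))"
      unfolding sum_distrib_left sum_distrib_right by (subst sum.swap) (simp only: mult.assoc)
    also have "\<dots> = (\<Sum>h\<in>?P. ?b d1 f h * (2 ^ loops n d2 d3 * ?b (compose d2 d3) h g))"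
      by (intro sum.cong refl arg_cong2[of _ _ _ _ "(*)"] sum_mids d f2 P)
    also have "\<dots> = 2 ^ loops n d2 d3 * (\<Sum>h\<in>?P. ?b d1 f h * ?b (compose d2 d3) h g)"
      unfolding sum_distrib_left by (intro sum.cong refl) (simp only: mult_ac)
    also have "(\<Sum>h\<in>?P. ?b d1 f h * ?b (compose d2 d3) h g) =
        2 ^ loops n d1 (compose d2 d3) * ?b (compose d1 (compose d2 d3)) f g"
      by (intro sum_mids d c23 f2)
    finally show ?thesis by (simp add: power_add mult.assoc)
  qed
  show "compose (compose d1 d2) d3 = compose d1 (compose d2 d3)"
    "loops n d1 d2 + loops n (compose d1 d2) d3 = loops n d2 d3 + loops n d1 (compose d2 d3)"
    by (rule compose_cong[OF c12 d(3) compose_in_diagrams[OF d(1) c23] *]; assumption)+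
qed

section \<open>The Brauer algebra\<close>

subsection \<open>Associativity and the left regular representation\<close>

lemma brauer_mult_basis:
  "brauer_mult n w a b d = (\<Sum>d1\<in>diagrams n. \<Sum>d2\<in>diagrams n.
    (a d1 * b d2 * w ^ loops n d1 d2) * brauer_basis (compose d1 d2) d)"
  unfolding brauer_mult_def brauer_basis_def by (intro sum.cong refl) auto

lemma sum_basis:
  assumes "p \<in> diagrams n"
  shows "(\<Sum>e\<in>diagrams n. brauer_basis p e * h e) = (h p :: 'k::field)"
proof -
  have "(\<Sum>e\<in>diagrams n. brauer_basis p e * h e) = (\<Sum>e\<in>diagrams n. if e = p then h e else 0)"
    by (intro sum.cong refl) (simp add: brauer_basis_def)
  then show ?thesis using assms finite_diagrams by simp
qed

lemma brauer_mult_assoc: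
  fixes a b c :: "'k::field brauer"
  shows "brauer_mult n w (brauer_mult n w a b) c = brauer_mult n w a (brauer_mult n w b c)"
proof
  fix d
  let ?D = "diagrams n"
  have "brauer_mult n w (brauer_mult n w a b) c d =
      (\<Sum>d3\<in>?D. \<Sum>e\<in>?D. brauer_mult n w a b e * (c d3 * w ^ loops n e d3 * brauer_basis (compose e d3) d))"
    by (subst brauer_mult_basis, subst sum.swap) (simp only: mult.assoc)
  also have "\<dots> = (\<Sum>d3\<in>?D. \<Sum>d1\<in>?D. \<Sum>d2\<in>?D. a d1 * b d2 * w ^ loops n d1 d2 *
      (\<Sum>e\<in>?D. brauer_basis (compose d1 d2) e * (c d3 * w ^ loops n e d3 * brauer_basis (compose e d3) d)))"
  proof (rule sum.cong[OF refl])
    fix d3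
    let ?h = "\<lambda>e. c d3 * w ^ loops n e d3 * brauer_basis (compose e d3) d"
    have "(\<Sum>e\<in>?D. brauer_mult n w a b e * ?h e) =
        (\<Sum>e\<in>?D. \<Sum>d1\<in>?D. \<Sum>d2\<in>?D. a d1 * b d2 * w ^ loops n d1 d2 * (brauer_basis (compose d1 d2) e * ?h e))"
      unfolding brauer_mult_basis[of n w a b] sum_distrib_right by (simp only: mult.assoc)
    also have "\<dots> = (\<Sum>d1\<in>?D. \<Sum>d2\<in>?D. \<Sum>e\<in>?D. a d1 * b d2 * w ^ loops n d1 d2 * (brauer_basis (compose d1 d2) e * ?h e))"
      by (subst sum.swap) (intro sum.cong refl sum.swap)
    finally show "(\<Sum>e\<in>?D. brauer_mult n w a b e * ?h e) = (\<Sum>d1\<in>?D. \<Sum>d2\<in>?D. a d1 * b d2 * w ^ loops n d1 d2 *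
        (\<Sum>e\<in>?D. brauer_basis (compose d1 d2) e * ?h e))"
      by (simp only: sum_distrib_left)
  qed
  also have "\<dots> = (\<Sum>d3\<in>?D. \<Sum>d1\<in>?D. \<Sum>d2\<in>?D. a d1 * b d2 * c d3 *
      w ^ (loops n d1 d2 + loops n (compose d1 d2) d3) * brauer_basis (compose (compose d1 d2) d3) d)"
    by (intro sum.cong refl) (simp add: sum_basis compose_in_diagrams power_add)
  finally have L: "brauer_mult n w (brauer_mult n w a b) c d =
      (\<Sum>d1\<in>?D. \<Sum>d2\<in>?D. \<Sum>d3\<in>?D. a d1 * b d2 * c d3 *
      w ^ (loops n d1 d2 + loops n (compose d1 d2) d3) * brauer_basis (compose (compose d1 d2) d3) d)"
    by (simp only:) (subst sum.swap, intro sum.cong refl sum.swap)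
  have "brauer_mult n w a (brauer_mult n w b c) d =
      (\<Sum>d1\<in>?D. \<Sum>e\<in>?D. brauer_mult n w b c e * (a d1 * w ^ loops n d1 e * brauer_basis (compose d1 e) d))"
    by (subst brauer_mult_basis) (intro sum.cong refl, simp only: mult_ac)
  also have "\<dots> = (\<Sum>d1\<in>?D. \<Sum>d2\<in>?D. \<Sum>d3\<in>?D. b d2 * c d3 * w ^ loops n d2 d3 *
      (\<Sum>e\<in>?D. brauer_basis (compose d2 d3) e * (a d1 * w ^ loops n d1 e * brauer_basis (compose d1 e) d)))"
  proof (rule sum.cong[OF refl])
    fix d1
    let ?h = "\<lambda>e. a d1 * w ^ loops n d1 e * brauer_basis (compose d1 e) d"
    have "(\<Sum>e\<in>?D. brauer_mult n w b c e * ?h e) =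
        (\<Sum>e\<in>?D. \<Sum>d2\<in>?D. \<Sum>d3\<in>?D. b d2 * c d3 * w ^ loops n d2 d3 * (brauer_basis (compose d2 d3) e * ?h e))"
      unfolding brauer_mult_basis[of n w b c] sum_distrib_right by (simp only: mult.assoc)
    also have "\<dots> = (\<Sum>d2\<in>?D. \<Sum>d3\<in>?D. \<Sum>e\<in>?D. b d2 * c d3 * w ^ loops n d2 d3 * (brauer_basis (compose d2 d3) e * ?h e))"
      by (subst sum.swap) (intro sum.cong refl sum.swap)
    finally show "(\<Sum>e\<in>?D. brauer_mult n w b c e * ?h e) = (\<Sum>d2\<in>?D. \<Sum>d3\<in>?D. b d2 * c d3 * w ^ loops n d2 d3 *
        (\<Sum>e\<in>?D. brauer_basis (compose d2 d3) e * ?h e))"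
      by (simp only: sum_distrib_left)
  qed
  also have "\<dots> = (\<Sum>d1\<in>?D. \<Sum>d2\<in>?D. \<Sum>d3\<in>?D. a d1 * b d2 * c d3 *
      w ^ (loops n d1 d2 + loops n (compose d1 d2) d3) * brauer_basis (compose (compose d1 d2) d3) d)"
    by (intro sum.cong refl)
       (simp add: sum_basis compose_in_diagrams compose_assoc, simp add: power_add mult_ac)
  finally show "brauer_mult n w (brauer_mult n w a b) c d = brauer_mult n w a (brauer_mult n w b c) d"
    using L by simp
qed

text \<open>Functions on all sets of edges contain junk outside the diagrams; the Brauer algebra
  consists of the supported functions.\<close>

definition supported :: "nat \<Rightarrow> 'k::field brauer \<Rightarrow> bool" where
  "supported n a \<longleftrightarrow> (\<forall>d. d \<notin> diagrams n \<longrightarrow> a d = 0)"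

lemma brauer_mult_supported: "supported n (brauer_mult n w a b)"
  unfolding supported_def brauer_mult_def
  by (auto intro!: sum.neutral dest: compose_in_diagrams)

lemma brauer_mult_basis2:
  assumes "d1 \<in> diagrams n" "d2 \<in> diagrams n"
  shows "brauer_mult n w (brauer_basis d1) (brauer_basis d2) =
    (\<lambda>d. w ^ loops n d1 d2 * brauer_basis (compose d1 d2) d)"
proof
  fix d
  have "brauer_mult n w (brauer_basis d1) (brauer_basis d2) d =
    (\<Sum>x\<in>diagrams n. brauer_basis d1 x * (\<Sum>y\<in>diagrams n. brauer_basis d2 y *
      (w ^ loops n x y * brauer_basis (compose x y) d)))"
    unfolding brauer_mult_basis sum_distrib_left by (simp only: mult.assoc)
  then show "brauer_mult n w (brauer_basis d1) (brauer_basis d2) d = w ^ loops n d1 d2 * brauer_basis (compose d1 d2) d"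
    by (simp add: sum_basis assms)
qed

lemma brauer_mult_lin_right:
  "brauer_mult n w a (\<lambda>x. c * F x + G x) = (\<lambda>x. c * brauer_mult n w a F x + brauer_mult n w a G x)"
proof
  fix x
  have "brauer_mult n w a (\<lambda>x. c * F x + G x) x = (\<Sum>d1\<in>diagrams n. \<Sum>d2\<in>diagrams n.
     c * ((a d1 * F d2 * w ^ loops n d1 d2) * brauer_basis (compose d1 d2) x) +
     (a d1 * G d2 * w ^ loops n d1 d2) * brauer_basis (compose d1 d2) x)"
    unfolding brauer_mult_basis by (intro sum.cong refl) (simp add: algebra_simps)
  then show "brauer_mult n w a (\<lambda>x. c * F x + G x) x = c * brauer_mult n w a F x + brauer_mult n w a G x"
    unfolding brauer_mult_basis by (simp only: sum.distrib sum_distrib_left)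
qed

lemma brauer_mult_lin_left:
  "brauer_mult n w (\<lambda>x. c * F x + G x) a = (\<lambda>x. c * brauer_mult n w F a x + brauer_mult n w G a x)"
proof
  fix x
  have "brauer_mult n w (\<lambda>x. c * F x + G x) a x = (\<Sum>d1\<in>diagrams n. \<Sum>d2\<in>diagrams n.
     c * ((F d1 * a d2 * w ^ loops n d1 d2) * brauer_basis (compose d1 d2) x) +
     (G d1 * a d2 * w ^ loops n d1 d2) * brauer_basis (compose d1 d2) x)"
    unfolding brauer_mult_basis by (intro sum.cong refl) (simp add: algebra_simps)
  then show "brauer_mult n w (\<lambda>x. c * F x + G x) a x = c * brauer_mult n w F a x + brauer_mult n w G a x"
    unfolding brauer_mult_basis by (simp only: sum.distrib sum_distrib_left)
qed

lemma brauer_mult_zero: "brauer_mult n w (\<lambda>_. 0) F = (\<lambda>_. 0)" "brauer_mult n w F (\<lambda>_. 0) = (\<lambda>_. 0)"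
  by (rule ext, simp add: brauer_mult_basis)+

lift_definition Lop :: "nat \<Rightarrow> 'k::field \<Rightarrow> 'k brauer \<Rightarrow> (diagram, 'k) lop"
  is "\<lambda>n w a F. brauer_mult n w a F" by (simp add: brauer_mult_lin_right)

lift_definition Pn :: "nat \<Rightarrow> (diagram, 'k::field) lop"
  is "\<lambda>n F d. if d \<in> diagrams n then F d else 0" by (simp add: fun_eq_iff)

lemma ap_Lop: "ap (Lop n w a) F = brauer_mult n w a F" by (simp add: Lop.rep_eq)
lemma ap_Pn: "ap (Pn n) F d = (if d \<in> diagrams n then F d else 0)" by (simp add: Pn.rep_eq)

lemma supported_Pn: "supported n (ap (Pn n) F)" by (simp add: supported_def ap_Pn)
lemma Pn_supported: "supported n F \<Longrightarrow> ap (Pn n) F = F" by (auto simp: supported_def ap_Pn)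

lemma brauer_mult_cong:
  "(\<And>d. d \<in> diagrams n \<Longrightarrow> F d = G d) \<Longrightarrow> brauer_mult n w a F = brauer_mult n w a G"
  unfolding brauer_mult_def by (intro ext sum.cong refl) simp

lemma Lop_mult: "Lop n w a * Lop n w b = Lop n w (brauer_mult n w a b)"
  by (rule lop_eqI) (simp add: ap_times ap_Lop brauer_mult_assoc)

lemma Pn_Lop: "Pn n * Lop n w a = Lop n w a" "Lop n w a * Pn n = Lop n w a" "Pn n * Pn n = (Pn n :: (diagram, 'k::field) lop)"
proof -
  show "Pn n * Lop n w a = Lop n w a"
    by (rule lop_eqI) (simp only: ap_times ap_Lop Pn_supported[OF brauer_mult_supported])
  show "Lop n w a * Pn n = Lop n w a"
  proof (rule lop_eqI)
    fix F d
    have "brauer_mult n w a (ap (Pn n) F) = brauer_mult n w a F"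
      by (rule brauer_mult_cong) (simp add: ap_Pn)
    then show "ap (Lop n w a * Pn n) F d = ap (Lop n w a) F d" by (simp add: ap_times ap_Lop)
  qed
  show "Pn n * Pn n = (Pn n :: (diagram, 'k) lop)"
    by (rule lop_eqI) (simp add: ap_times ap_Pn)
qed

subsection \<open>The generating diagrams and their kernels\<close>

definition one_diag :: "nat \<Rightarrow> diagram" where "one_diag n = {{(Top, k), (Bot, k)} | k. k \<in> {1..n}}"
definition s_diag :: "nat \<Rightarrow> nat \<Rightarrow> nat \<Rightarrow> diagram" where
  "s_diag n i j = {{(Top, k), (Bot, Transposition.transpose i j k)} | k. k \<in> {1..n}}"
definition e_diag :: "nat \<Rightarrow> nat \<Rightarrow> nat \<Rightarrow> diagram" where
  "e_diag n i j = {{(Top, i), (Top, j)}, {(Bot, i), (Bot, j)}} \<union> {{(Top, k), (Bot, k)} | k. k \<in> {1..n} - {i, j}}"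

lemma elem_diag: "brauer_one n = brauer_basis (one_diag n)" "s_elem n i j = brauer_basis (s_diag n i j)"
  "eps_elem n i j = brauer_basis (e_diag n i j)"
  by (simp_all add: brauer_one_def one_diag_def s_elem_def s_diag_def eps_elem_def e_diag_def)

lemma diagrams_I:
  assumes "\<And>e. e \<in> d \<Longrightarrow> e \<subseteq> dots n \<and> card e = 2"
    "\<And>k. k \<in> {1..n} \<Longrightarrow> \<exists>!e. e \<in> d \<and> (Top, k) \<in> e" "\<And>k. k \<in> {1..n} \<Longrightarrow> \<exists>!e. e \<in> d \<and> (Bot, k) \<in> e"
  shows "d \<in> diagrams n"
proof -
  have "\<exists>!e. e \<in> d \<and> x \<in> e" if "x \<in> dots n" for x
    using that assms(2)[of "snd x"] assms(3)[of "snd x"] by (cases x) (auto simp: dots_def)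
  then show ?thesis unfolding diagrams_def using assms(1) by simp
qed

lemma transpose_range: "i \<in> {1..n} \<Longrightarrow> j \<in> {1..n} \<Longrightarrow> k \<in> {1..n} \<Longrightarrow> transpose i j k \<in> {1..n}"
  by (simp add: transpose_def)

lemma s_diag_in: "i \<in> {1..n} \<Longrightarrow> j \<in> {1..n} \<Longrightarrow> s_diag n i j \<in> diagrams n"
proof (rule diagrams_I)
  assume ij: "i \<in> {1..n}" "j \<in> {1..n}"
  show "e \<subseteq> dots n \<and> card e = 2" if e: "e \<in> s_diag n i j" for e
  proof -
    obtain k where "k \<in> {1..n}" "e = {(Top, k), (Bot, transpose i j k)}"
      using e unfolding s_diag_def by blast
    then show ?thesis using transpose_range[OF ij, of k] by (simp add: dots_def)
  qed
  show "\<exists>!e. e \<in> s_diag n i j \<and> (Top, k) \<in> e" if "k \<in> {1..n}" for k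
    by (rule ex1I[of _ "{(Top, k), (Bot, transpose i j k)}"]) (use that in \<open>auto simp: s_diag_def\<close>)
  show "\<exists>!e. e \<in> s_diag n i j \<and> (Bot, k) \<in> e" if k: "k \<in> {1..n}" for k
  proof (rule ex1I[of _ "{(Top, transpose i j k), (Bot, k)}"])
    have "{(Top, transpose i j k), (Bot, transpose i j (transpose i j k))} \<in> s_diag n i j"
      unfolding s_diag_def using transpose_range[OF ij k] by blast
    then show "{(Top, transpose i j k), (Bot, k)} \<in> s_diag n i j \<and> (Bot, k) \<in> {(Top, transpose i j k), (Bot, k)}"
      by simp
  next
    fix e assume "e \<in> s_diag n i j \<and> (Bot, k) \<in> e"
    then obtain l where "e = {(Top, l), (Bot, transpose i j l)}" "k = transpose i j l"
      unfolding s_diag_def by auto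
    then show "e = {(Top, transpose i j k), (Bot, k)}" by simp
  qed
qed

lemma one_diag_s: "one_diag n = s_diag n i i"
  by (simp add: one_diag_def s_diag_def)

lemma one_diag_in: "one_diag n \<in> diagrams n"
proof (rule diagrams_I)
  show "e \<subseteq> dots n \<and> card e = 2" if "e \<in> one_diag n" for e
    using that by (auto simp: one_diag_def dots_def)
  show "\<exists>!e. e \<in> one_diag n \<and> (Top, k) \<in> e" "\<exists>!e. e \<in> one_diag n \<and> (Bot, k) \<in> e" if "k \<in> {1..n}" for k
    by (rule ex1I[of _ "{(Top, k), (Bot, k)}"]; use that in \<open>auto simp: one_diag_def\<close>)+
qed

lemma e_diag_in:
  assumes ij: "i \<in> {1..n}" "j \<in> {1..n}" "i \<noteq> j"
  shows "e_diag n i j \<in> diagrams n"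
proof (rule diagrams_I)
  show "e \<subseteq> dots n \<and> card e = 2" if "e \<in> e_diag n i j" for e
    using that ij by (auto simp: e_diag_def dots_def)
  show "\<exists>!e. e \<in> e_diag n i j \<and> (Top, k) \<in> e" if k: "k \<in> {1..n}" for k
  proof (cases "k = i \<or> k = j")
    case True
    then show ?thesis
      by (intro ex1I[of _ "{(Top, i), (Top, j)}"]) (auto simp: e_diag_def)
  next
    case False
    then show ?thesis using k
      by (intro ex1I[of _ "{(Top, k), (Bot, k)}"]) (auto simp: e_diag_def)
  qed
  show "\<exists>!e. e \<in> e_diag n i j \<and> (Bot, k) \<in> e" if k: "k \<in> {1..n}" for k
  proof (cases "k = i \<or> k = j")
    case True
    then show ?thesis
      by (intro ex1I[of _ "{(Bot, i), (Bot, j)}"]) (auto simp: e_diag_def)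
  next
    case False
    then show ?thesis using k
      by (intro ex1I[of _ "{(Top, k), (Bot, k)}"]) (auto simp: e_diag_def)
  qed
qed

lemma compat_restrict:
  assumes "d \<in> diagrams n" "\<And>k. k \<in> {1..n} \<Longrightarrow> f k = f' k" "\<And>k. k \<in> {1..n} \<Longrightarrow> g k = g' k"
  shows "compat d f g \<longleftrightarrow> compat d f' g'"
proof -
  have "\<forall>e\<in>d. e \<subseteq> dots n \<and> card e = 2" using assms(1) unfolding diagrams_def by simp
  moreover have "pair_col f g x = pair_col f' g' x" if "x \<in> dots n" for x
    using that assms(2,3) by (cases x) (auto simp: dots_def)
  ultimately show ?thesis unfolding compat_def by (intro ball_cong refl) (auto simp: subset_eq)
qed

lemma compat_diag:
  "compat (one_diag n) f g \<longleftrightarrow> (\<forall>k\<in>{1..n}. f k = g k)"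
  "compat (s_diag n i j) f g \<longleftrightarrow> (\<forall>k\<in>{1..n}. f k = g (transpose i j k))"
  "compat (e_diag n i j) f g \<longleftrightarrow> f i = f j \<and> g i = g j \<and> (\<forall>k\<in>{1..n} - {i, j}. f k = g k)"
proof -
  have two: "(\<forall>x\<in>{a, b}. \<forall>y\<in>{a, b}. t x = t y) \<longleftrightarrow> t a = t b" for t :: "dot \<Rightarrow> nat" and a b by auto
  show "compat (one_diag n) f g \<longleftrightarrow> (\<forall>k\<in>{1..n}. f k = g k)"
    "compat (s_diag n i j) f g \<longleftrightarrow> (\<forall>k\<in>{1..n}. f k = g (transpose i j k))"
    "compat (e_diag n i j) f g \<longleftrightarrow> f i = f j \<and> g i = g j \<and> (\<forall>k\<in>{1..n} - {i, j}. f k = g k)"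
    unfolding compat_def one_diag_def s_diag_def e_diag_def
    by (simp_all only: ball_Un ball_simps Setcompr_eq_image Collect_mem_eq two pair_col.simps row.distinct if_False if_True refl) auto
qed

text \<open>The kernel of the action of a diagram on colourings: the matrix entry between the
  colourings \<open>f\<close> and \<open>g\<close> of the two rows.\<close>

definition K :: "nat \<Rightarrow> diagram \<Rightarrow> (nat \<Rightarrow> nat) \<Rightarrow> (nat \<Rightarrow> nat) \<Rightarrow> real" where
  "K N d g f = (if valid N f \<and> compat d f g then 1 else 0)"

text \<open>Composition with a generator acts on kernels by the corresponding operator on
  colourings. So relations between generators on colourings can be transported to diagrams.\<close>

lemma card_mids_s:
  assumes d: "d \<in> diagrams n" and ij: "i \<in> {1..n}" "j \<in> {1..n}" and f: "valid N f"
  shows "real (card (mids N n (s_diag n i j) d f g)) = ap (Sop i j) (K N d g) f"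
proof -
  let ?h = "restrict (f \<circ> transpose i j) {1..n}"
  have "mids N n (s_diag n i j) d f g = (if compat d (f \<circ> transpose i j) g then {?h} else {})"
  proof -
    have A: "h = ?h" if h: "h \<in> {1..n} \<rightarrow>\<^sub>E {..<N}" and fh: "\<forall>k\<in>{1..n}. f k = h (transpose i j k)" for h
    proof
      fix k
      show "h k = ?h k"
      proof (cases "k \<in> {1..n}")
        case True
        then have "f (transpose i j k) = h k"
          using bspec[OF fh transpose_range[OF ij True]] by simp
        then show ?thesis using True by simp
      next
        case False
        then show ?thesis using PiE_arb[OF h False] by (simp only: restrict_apply if_False)
      qed
    qed
    have B: "?h \<in> {1..n} \<rightarrow>\<^sub>E {..<N}" using f by (simp add: valid_def)
    have C: "\<forall>k\<in>{1..n}. f k = ?h (transpose i j k)" using transpose_range[OF ij] by simp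
    have D: "compat d ?h g \<longleftrightarrow> compat d (f \<circ> transpose i j) g" by (rule compat_restrict[OF d]) simp_all
    have "h \<in> mids N n (s_diag n i j) d f g \<longleftrightarrow> h = ?h \<and> compat d (f \<circ> transpose i j) g" for h
    proof
      assume h: "h \<in> mids N n (s_diag n i j) d f g"
      then have "h = ?h" using A unfolding mids_def compat_diag by blast
      moreover have "compat d h g" using h unfolding mids_def by blast
      ultimately show "h = ?h \<and> compat d (f \<circ> transpose i j) g" using D by metis
    next
      assume h: "h = ?h \<and> compat d (f \<circ> transpose i j) g"
      then have "?h \<in> mids N n (s_diag n i j) d f g" using B C D unfolding mids_def compat_diag by blast
      then show "h \<in> mids N n (s_diag n i j) d f g" using h by (simp only:)
    qed
    then show ?thesis by (cases "compat d (f \<circ> transpose i j) g") (simp_all only: set_eq_iff if_True if_False singleton_iff empty_iff simp_thms)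
  qed
  then show ?thesis using f by (simp add: ap_Sop K_def valid_swap)
qed

lemma card_mids_e:
  assumes d: "d \<in> diagrams n" and ij: "i \<in> {1..n}" "j \<in> {1..n}" "i \<noteq> j" and f: "valid N f"
  shows "real (card (mids N n (e_diag n i j) d f g)) = ap (Cop N i j) (K N d g) f"
proof (cases "f i = f j")
  case False
  then show ?thesis by (simp add: mids_def compat_diag ap_Cop)
next
  case True
  let ?u = "\<lambda>c. f(i := c, j := c)"
  let ?h = "\<lambda>c. restrict (?u c) {1..n}"
  have "mids N n (e_diag n i j) d f g = ?h ` {c. c < N \<and> compat d (?u c) g}"
  proof (intro equalityI subsetI)
    fix h assume "h \<in> mids N n (e_diag n i j) d f g"
    then have h: "h \<in> {1..n} \<rightarrow>\<^sub>E {..<N}" "h i = h j" "\<forall>k\<in>{1..n} - {i, j}. f k = h k" "compat d h g"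
      by (auto simp: mids_def compat_diag)
    have eq: "h = ?h (h i)"
    proof
      fix k show "h k = ?h (h i) k"
        using h(1-3) by (cases "k \<in> {1..n}") (auto simp: PiE_iff extensional_def)
    qed
    have "compat d (?u (h i)) g \<longleftrightarrow> compat d h g"
      by (rule compat_restrict[OF d]) (use h(2,3) in auto)
    moreover have "h i < N" using h(1) ij by (auto simp: PiE_iff)
    ultimately show "h \<in> ?h ` {c. c < N \<and> compat d (?u c) g}" using eq h(4) by blast
  next
    fix h assume "h \<in> ?h ` {c. c < N \<and> compat d (?u c) g}"
    then obtain c where c: "c < N" "compat d (?u c) g" "h = ?h c" by auto
    have "compat d (?h c) g \<longleftrightarrow> compat d (?u c) g" by (rule compat_restrict[OF d]) auto
    then show "h \<in> mids N n (e_diag n i j) d f g"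
      using c f ij True by (auto simp: mids_def compat_diag valid_def)
  qed
  moreover have "inj_on ?h {c. c < N \<and> compat d (?u c) g}"
  proof (rule inj_onI)
    fix a b assume "?h a = ?h b"
    then have "?h a j = ?h b j" by simp
    then show "a = b" using ij by simp
  qed
  ultimately have "card (mids N n (e_diag n i j) d f g) = card {c. c < N \<and> compat d (?u c) g}"
    by (simp add: card_image)
  also have "real \<dots> = (\<Sum>c<N. if compat d (?u c) g then 1 else 0)"
  proof -
    have "{c. c < N \<and> compat d (?u c) g} = {c \<in> {..<N}. compat d (?u c) g}" by auto
    then have "real (card {c. c < N \<and> compat d (?u c) g}) = (\<Sum>c\<in>{c \<in> {..<N}. compat d (?u c) g}. 1)"
      by (simp only: sum_constant mult_1_right)
    also have "\<dots> = (\<Sum>c<N. if compat d (?u c) g then 1 else 0)"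
      by (rule sum.inter_filter[OF finite_lessThan])
    finally show ?thesis .
  qed
  also have "\<dots> = (\<Sum>c<N. K N d g (?u c))"
  proof (rule sum.cong[OF refl])
    fix c assume "c \<in> {..<N}"
    then have "valid N (?u c)" using f by (simp add: valid_def)
    then show "(if compat d (?u c) g then 1 else 0) = K N d g (?u c)" unfolding K_def by (simp only: simp_thms)
  qed
  finally show ?thesis using True f by (simp add: ap_Cop)
qed

lemma K_s:
  assumes ij: "i \<in> {1..n}" "j \<in> {1..n}"
  shows "K N (s_diag n i j) g = ap (Sop i j) (K N (one_diag n) g)"
proof
  fix f
  have "(\<forall>k\<in>{1..n}. f k = g (transpose i j k)) \<longleftrightarrow> (\<forall>k\<in>{1..n}. f (transpose i j k) = g k)"
    using transpose_range[OF ij] by (metis transpose_involutory)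
  then show "K N (s_diag n i j) g f = ap (Sop i j) (K N (one_diag n) g) f"
    by (simp add: K_def ap_Sop compat_diag valid_swap)
qed

lemma K_e:
  assumes ij: "i \<in> {1..n}" "j \<in> {1..n}" "i \<noteq> j" and g: "valid N g"
  shows "K N (e_diag n i j) g = ap (Cop N i j) (K N (one_diag n) g)"
proof
  fix f
  show "K N (e_diag n i j) g f = ap (Cop N i j) (K N (one_diag n) g) f"
  proof (cases "valid N f \<and> f i = f j")
    case True
    have "K N (one_diag n) g (f(i := c, j := c)) =
        (if c = g i then if g i = g j \<and> (\<forall>k\<in>{1..n} - {i, j}. f k = g k) then 1 else 0 else 0)" if "c < N" for c
    proof -
      have v: "valid N (f(i := c, j := c))" using that True by (simp add: valid_def)
      have "(\<forall>k\<in>{1..n}. (f(i := c, j := c)) k = g k) \<longleftrightarrow>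
          c = g i \<and> g i = g j \<and> (\<forall>k\<in>{1..n} - {i, j}. f k = g k)" (is "?L \<longleftrightarrow> ?R")
      proof
        assume L: ?L
        have "c = g i" "c = g j" using bspec[OF L ij(1)] bspec[OF L ij(2)] ij(3) by simp_all
        moreover have "f k = g k" if "k \<in> {1..n} - {i, j}" for k
          using bspec[OF L, of k] that by simp
        ultimately show ?R by simp
      next
        assume R: ?R
        show ?L
        proof
          fix k assume "k \<in> {1..n}"
          then show "(f(i := c, j := c)) k = g k"
            using R by (cases "k = i \<or> k = j") auto
        qed
      qed
      then show ?thesis using v unfolding K_def compat_diag by (simp only: simp_thms split: if_split) blast
    qed
    then have "ap (Cop N i j) (K N (one_diag n) g) f =
        (\<Sum>c<N. if c = g i then if g i = g j \<and> (\<forall>k\<in>{1..n} - {i, j}. f k = g k) then 1 else 0 else 0)"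
      using True by (simp add: ap_Cop)
    also have "\<dots> = (if g i = g j \<and> (\<forall>k\<in>{1..n} - {i, j}. f k = g k) then 1 else 0)"
      using g by (simp add: valid_def)
    finally show ?thesis using True by (simp add: K_def compat_diag)
  qed (auto simp: K_def compat_diag ap_Cop)
qed

subsection \<open>The defining relations\<close>

lemma valid_2: "two_coloured f \<longleftrightarrow> valid 2 f" by (simp add: two_coloured_def valid_def)

lemma mult_eqI:
  assumes d: "a \<in> diagrams n" "b \<in> diagrams n" "c \<in> diagrams n" "d \<in> diagrams n"
    and eq: "\<And>f g. valid 2 f \<Longrightarrow> valid 2 g \<Longrightarrow> real (card (mids 2 n a b f g)) = real (card (mids 2 n c d f g))"
  shows "brauer_mult n w (brauer_basis a) (brauer_basis b) = brauer_mult n w (brauer_basis c) (brauer_basis d)"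
proof -
  note cd = compose_in_diagrams[OF d(3,4)]
  have *: "2 ^ 0 * card (mids 2 n a b f g) = 2 ^ loops n c d * (if compat (compose c d) f g then 1 else 0)"
    if "two_coloured f" "two_coloured g" for f g
    using eq[of f g] that card_mids[OF d(3,4), of f 2 g] by (simp add: valid_2 valid_def)
  show ?thesis
    unfolding brauer_mult_basis2[OF d(1,2)] brauer_mult_basis2[OF d(3,4)]
    using compose_cong[OF d(1,2) cd *] by simp
qed

lemma mult_basisI:
  assumes d: "a \<in> diagrams n" "b \<in> diagrams n" "c \<in> diagrams n"
    and eq: "\<And>f g. valid 2 f \<Longrightarrow> valid 2 g \<Longrightarrow> real (card (mids 2 n a b f g)) = 2 ^ m * K 2 c g f"
  shows "brauer_mult n w (brauer_basis a) (brauer_basis b) = (\<lambda>d. w ^ m * brauer_basis c d)"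
proof -
  have *: "2 ^ 0 * card (mids 2 n a b f g) = 2 ^ m * (if compat c f g then 1 else 0)"
    if "two_coloured f" "two_coloured g" for f g
  proof -
    have "real (card (mids 2 n a b f g)) = real (2 ^ m * (if compat c f g then 1 else 0))"
      using eq[of f g] that by (simp add: valid_2 K_def)
    then show ?thesis by (simp only: of_nat_eq_iff) simp
  qed
  show ?thesis
    unfolding brauer_mult_basis2[OF d(1,2)] using compose_cong[OF d * ] by simp
qed

lemma mult_basis_unit:
  assumes n: "1 \<le> n" and d: "d \<in> diagrams n"
  shows "brauer_mult n w (brauer_basis (one_diag n)) (brauer_basis d) = brauer_basis d"
    "brauer_mult n w (brauer_basis d) (brauer_basis (one_diag n)) = brauer_basis d"
proof -
  have "brauer_mult n w (brauer_basis (one_diag n)) (brauer_basis d) = (\<lambda>x. w ^ 0 * brauer_basis d x)"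
  proof (rule mult_basisI[OF one_diag_in d d])
    fix f g :: "nat \<Rightarrow> nat" assume f: "valid 2 f"
    have "real (card (mids 2 n (s_diag n 1 1) d f g)) = ap (Sop 1 1) (K 2 d g) f"
      using n f by (intro card_mids_s[OF d]) auto
    then show "real (card (mids 2 n (one_diag n) d f g)) = 2 ^ 0 * K 2 d g f"
      by (simp add: one_diag_s[of n 1] ap_Sop)
  qed
  then show "brauer_mult n w (brauer_basis (one_diag n)) (brauer_basis d) = brauer_basis d" by simp
  have "brauer_mult n w (brauer_basis d) (brauer_basis (one_diag n)) = (\<lambda>x. w ^ 0 * brauer_basis d x)"
  proof (rule mult_basisI[OF d one_diag_in d])
    fix f g :: "nat \<Rightarrow> nat" assume f: "valid 2 f" and g: "valid 2 g"
    let ?h = "restrict g {1..n}"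
    have A: "h = ?h" if h: "h \<in> {1..n} \<rightarrow>\<^sub>E {..<2}" and hg: "\<forall>k\<in>{1..n}. h k = g k" for h
    proof
      fix k show "h k = ?h k"
      proof (cases "k \<in> {1..n}")
        case True
        then show ?thesis using bspec[OF hg True] by (simp only: restrict_apply if_True)
      next
        case False
        then show ?thesis using PiE_arb[OF h False] by (simp only: restrict_apply if_False)
      qed
    qed
    have B: "?h \<in> {1..n} \<rightarrow>\<^sub>E {..<2}" using g by (simp add: valid_def)
    have C: "\<forall>k\<in>{1..n}. ?h k = g k" by simp
    have D: "compat d f ?h \<longleftrightarrow> compat d f g" by (rule compat_restrict[OF d]) simp_all
    have "h \<in> mids 2 n d (one_diag n) f g \<longleftrightarrow> h = ?h \<and> compat d f g" for h
    proof
      assume h: "h \<in> mids 2 n d (one_diag n) f g"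
      then have "h = ?h" using A unfolding mids_def compat_diag by blast
      moreover have "compat d f h" using h unfolding mids_def by blast
      ultimately show "h = ?h \<and> compat d f g" using D by metis
    next
      assume h: "h = ?h \<and> compat d f g"
      then have "?h \<in> mids 2 n d (one_diag n) f g" using B C D unfolding mids_def compat_diag by blast
      then show "h \<in> mids 2 n d (one_diag n) f g" using h by (simp only:)
    qed
    then have "mids 2 n d (one_diag n) f g = (if compat d f g then {?h} else {})"
      by (cases "compat d f g") (simp_all only: set_eq_iff if_True if_False singleton_iff empty_iff simp_thms)
    then show "real (card (mids 2 n d (one_diag n) f g)) = 2 ^ 0 * K 2 d g f"
      using f by (simp add: K_def)
  qed
  then show "brauer_mult n w (brauer_basis d) (brauer_basis (one_diag n)) = brauer_basis d" by simp
qed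

lemma expand_basis:
  assumes "supported n a"
  shows "a = (\<lambda>x. \<Sum>d\<in>diagrams n. a d * brauer_basis d x)"
proof
  fix x
  have "(\<Sum>d\<in>diagrams n. a d * brauer_basis d x) = (\<Sum>d\<in>diagrams n. if d = x then a d else 0)"
    by (intro sum.cong refl) (auto simp: brauer_basis_def)
  then show "a x = (\<Sum>d\<in>diagrams n. a d * brauer_basis d x)"
    using assms finite_diagrams[of n] by (simp add: supported_def)
qed

lemma brauer_mult_unit:
  assumes n: "1 \<le> n" and a: "supported n a"
  shows "brauer_mult n w (brauer_one n) a = a" "brauer_mult n w a (brauer_one n) = a"
proof -
  have "ap (Lop n w (brauer_one n)) a = (\<lambda>x. \<Sum>d\<in>diagrams n. a d * brauer_basis d x)"
    by (subst expand_basis[OF a])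
       (simp add: ap_arg_sum ap_scale ap_Lop elem_diag mult_basis_unit[OF n])
  then show "brauer_mult n w (brauer_one n) a = a" using expand_basis[OF a] by (simp add: ap_Lop)
  show "brauer_mult n w a (brauer_one n) = a"
  proof
    fix x
    have "brauer_mult n w a (brauer_one n) x =
      (\<Sum>d1\<in>diagrams n. a d1 * brauer_mult n w (brauer_basis d1) (brauer_one n) x)"
    proof -
      have "brauer_mult n w (brauer_basis d1) (brauer_one n) x =
        (\<Sum>d2\<in>diagrams n. brauer_one n d2 * w ^ loops n d1 d2 * brauer_basis (compose d1 d2) x)"
        if "d1 \<in> diagrams n" for d1
        using sum_basis[OF that, of "\<lambda>d1. \<Sum>d2\<in>diagrams n. brauer_one n d2 * w ^ loops n d1 d2 * brauer_basis (compose d1 d2) x"]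
        unfolding brauer_mult_basis by (simp add: sum_distrib_left mult.assoc)
      then show ?thesis unfolding brauer_mult_basis[of n w a] by (simp add: sum_distrib_left mult.assoc)
    qed
    also have "\<dots> = (\<Sum>d1\<in>diagrams n. a d1 * brauer_basis d1 x)"
      by (intro sum.cong refl) (simp add: elem_diag mult_basis_unit[OF n])
    also have "\<dots> = a x" using expand_basis[OF a] by metis
    finally show "brauer_mult n w a (brauer_one n) x = a x" .
  qed
qed

lemma Lop_one: "1 \<le> n \<Longrightarrow> Lop n w (brauer_one n) = Pn n"
proof (rule lop_eqI)
  fix F d assume n: "1 \<le> n"
  have "brauer_mult n w (brauer_one n) F = brauer_mult n w (brauer_one n) (ap (Pn n) F)"
    by (rule brauer_mult_cong) (simp add: ap_Pn)
  then show "ap (Lop n w (brauer_one n)) F d = ap (Pn n) F d"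
    using brauer_mult_unit(1)[OF n supported_Pn, of w F] by (simp add: ap_Lop)
qed

context
  fixes n i j k l :: nat and f g :: "nat \<Rightarrow> nat"
  assumes ij: "i \<in> {1..n}" "j \<in> {1..n}" "i \<noteq> j" and kl: "k \<in> {1..n}" "l \<in> {1..n}" "k \<noteq> l"
    and fg: "valid 2 f" "valid 2 g"
begin

lemma card_generators:
  "real (card (mids 2 n (s_diag n i j) (s_diag n k l) f g)) = ap (Sop i j * Sop k l) (K 2 (one_diag n) g) f"
  "real (card (mids 2 n (s_diag n i j) (e_diag n k l) f g)) = ap (Sop i j * Cop 2 k l) (K 2 (one_diag n) g) f"
  "real (card (mids 2 n (e_diag n i j) (s_diag n k l) f g)) = ap (Cop 2 i j * Sop k l) (K 2 (one_diag n) g) f"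
  "real (card (mids 2 n (e_diag n i j) (e_diag n k l) f g)) = ap (Cop 2 i j * Cop 2 k l) (K 2 (one_diag n) g) f"
  unfolding ap_times
  by (simp_all only: card_mids_s[OF s_diag_in[OF kl(1,2)] ij(1,2) fg(1)] card_mids_s[OF e_diag_in[OF kl] ij(1,2) fg(1)]
      card_mids_e[OF s_diag_in[OF kl(1,2)] ij fg(1)] card_mids_e[OF e_diag_in[OF kl] ij fg(1)]
      K_s[OF kl(1,2)] K_e[OF kl fg(2)])

end

text \<open>Left multiplication by the generators. The summand \<open>1 - Pn n\<close> makes
  \<open>Sn\<close> the identity on the unsupported functions, so that its square is the identity
  operator.\<close>

definition Sn :: "nat \<Rightarrow> 'k::field \<Rightarrow> nat \<Rightarrow> nat \<Rightarrow> (diagram, 'k) lop" where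
  "Sn n w i j = Lop n w (s_elem n i j) + 1 - Pn n"
definition Cn :: "nat \<Rightarrow> 'k::field \<Rightarrow> nat \<Rightarrow> nat \<Rightarrow> (diagram, 'k) lop" where
  "Cn n w i j = Lop n w (eps_elem n i j)"

lemma Sn_Cn_mult:
  "Sn n w i j * Sn n w k l = Lop n w (brauer_mult n w (s_elem n i j) (s_elem n k l)) + 1 - Pn n"
  "Sn n w i j * Cn n w k l = Lop n w (brauer_mult n w (s_elem n i j) (eps_elem n k l))"
  "Cn n w i j * Sn n w k l = Lop n w (brauer_mult n w (eps_elem n i j) (s_elem n k l))"
  "Cn n w i j * Cn n w k l = Lop n w (brauer_mult n w (eps_elem n i j) (eps_elem n k l))"
  unfolding Sn_def Cn_def
  by (simp_all add: distrib_left distrib_right left_diff_distrib right_diff_distrib Pn_Lop Lop_mult[symmetric])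

text \<open>Every relation is an identity between products of two generators. By
  \<open>mult_eqI\<close> and \<open>card_generators\<close> it follows from the same relation for
  the operators on colourings by two colours.\<close>

theorem brauer_algebra_relations:
  assumes two: "(2 :: 'k::field) \<noteq> 0"
  shows "brauer_relations sc (w :: 'k) {1..n} (Sn n w) (Cn n w)"
proof
  fix i j k l :: nat
  show "(2::'k) \<noteq> 0" by (rule two)
  show "Sn n w i j = Sn n w j i"
    unfolding Sn_def s_elem_def by (simp only: transpose_commute[of i j])
  show "Cn n w i j = Cn n w j i"
    unfolding Cn_def eps_elem_def by (simp only: insert_commute)
  { assume ij: "i \<in> {1..n}" "j \<in> {1..n}" "i \<noteq> j"
    note e = e_diag_in[OF ij] and s = s_diag_in[OF ij(1,2)]
    have "brauer_mult n w (brauer_basis (s_diag n i j)) (brauer_basis (s_diag n i j)) =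
        (\<lambda>d. w ^ 0 * brauer_basis (one_diag n) d)"
      by (rule mult_basisI[OF s s one_diag_in]) (simp add: card_generators[OF ij ij] col.ss ij ap_one)
    moreover have "1 \<le> n" using ij by auto
    ultimately show "Sn n w i j * Sn n w i j = 1"
      unfolding Sn_Cn_mult using Lop_one[of n w] by (simp add: elem_diag)
    have "brauer_mult n w (brauer_basis (e_diag n i j)) (brauer_basis (e_diag n i j)) =
        (\<lambda>d. w ^ 1 * brauer_basis (e_diag n i j) d)"
      by (rule mult_basisI[OF e e e])
         (simp only: card_generators[OF ij ij] col.ee ij UNIV_I not_False_eq_True ap_times ap_sc K_e[OF ij], simp)
    then show "Cn n w i j * Cn n w i j = sc w * Cn n w i j"
      unfolding Sn_Cn_mult unfolding Cn_def elem_diag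
      by (intro lop_eqI) (simp add: ap_Lop ap_times ap_sc brauer_mult_lin_left[of n w w _ "\<lambda>_. 0", simplified] brauer_mult_zero)
    have "brauer_mult n w (brauer_basis (s_diag n i j)) (brauer_basis (e_diag n i j)) =
        (\<lambda>d. w ^ 0 * brauer_basis (e_diag n i j) d)"
      by (rule mult_basisI[OF s e e]) (simp add: card_generators[OF ij ij] col.se ij K_e[OF ij])
    then show "Sn n w i j * Cn n w i j = Cn n w i j"
      unfolding Sn_Cn_mult unfolding Cn_def elem_diag by simp
    have "brauer_mult n w (brauer_basis (e_diag n i j)) (brauer_basis (s_diag n i j)) =
        (\<lambda>d. w ^ 0 * brauer_basis (e_diag n i j) d)"
      by (rule mult_basisI[OF e s e]) (simp add: card_generators[OF ij ij] col.es ij K_e[OF ij])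
    then show "Cn n w i j * Sn n w i j = Cn n w i j"
      unfolding Sn_Cn_mult unfolding Cn_def elem_diag by simp
  }
  { assume I: "i \<in> {1..n}" "j \<in> {1..n}" "k \<in> {1..n}" and ne: "i \<noteq> j" "j \<noteq> k" "i \<noteq> k"
    note ij = I(1,2) ne(1) and jk = I(2,3) ne(2) and ik = I(1,3) ne(3)
    note U = UNIV_I UNIV_I UNIV_I ne
    show "Sn n w i j * Sn n w j k = Sn n w i k * Sn n w i j"
      unfolding Sn_Cn_mult elem_diag
      by (subst mult_eqI[OF s_diag_in[OF ij(1,2)] s_diag_in[OF jk(1,2)] s_diag_in[OF ik(1,2)] s_diag_in[OF ij(1,2)]])
         (simp_all only: card_generators[OF ij jk] card_generators[OF ik ij] col.ss3[OF U])
    show "Sn n w i j * Cn n w j k = Cn n w i k * Sn n w i j"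
      unfolding Sn_Cn_mult elem_diag
      by (subst mult_eqI[OF s_diag_in[OF ij(1,2)] e_diag_in[OF jk] e_diag_in[OF ik] s_diag_in[OF ij(1,2)]])
         (simp_all only: card_generators[OF ij jk] card_generators[OF ik ij] col.se3[OF U])
    show "Cn n w i j * Cn n w j k = Cn n w i j * Sn n w i k"
      unfolding Sn_Cn_mult elem_diag
      by (subst mult_eqI[OF e_diag_in[OF ij] e_diag_in[OF jk] e_diag_in[OF ij] s_diag_in[OF ik(1,2)]])
         (simp_all only: card_generators[OF ij jk] card_generators[OF ij ik] col.ee3[OF U])
  }
  assume I: "i \<in> {1..n}" "j \<in> {1..n}" "k \<in> {1..n}" "l \<in> {1..n}" and d: "distinct [i, j, k, l]"
  then have ij: "i \<in> {1..n}" "j \<in> {1..n}" "i \<noteq> j" and kl: "k \<in> {1..n}" "l \<in> {1..n}" "k \<noteq> l" by auto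
  note U = UNIV_I UNIV_I UNIV_I UNIV_I d
  show "Sn n w i j * Sn n w k l = Sn n w k l * Sn n w i j"
    unfolding Sn_Cn_mult elem_diag
    by (subst mult_eqI[OF s_diag_in[OF ij(1,2)] s_diag_in[OF kl(1,2)] s_diag_in[OF kl(1,2)] s_diag_in[OF ij(1,2)]])
       (simp_all only: card_generators[OF ij kl] card_generators[OF kl ij] col.ss4[OF U])
  show "Sn n w i j * Cn n w k l = Cn n w k l * Sn n w i j"
    unfolding Sn_Cn_mult elem_diag
    by (subst mult_eqI[OF s_diag_in[OF ij(1,2)] e_diag_in[OF kl] e_diag_in[OF kl] s_diag_in[OF ij(1,2)]])
       (simp_all only: card_generators[OF ij kl] card_generators[OF kl ij] col.se4[OF U])
  show "Cn n w i j * Cn n w k l = Cn n w k l * Cn n w i j"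
    unfolding Sn_Cn_mult elem_diag
    by (subst mult_eqI[OF e_diag_in[OF ij] e_diag_in[OF kl] e_diag_in[OF kl] e_diag_in[OF ij]])
       (simp_all only: card_generators[OF ij kl] card_generators[OF kl ij] col.ee4[OF U])
qed (rule sc_add sc_mult sc_1 sc_central)+

subsection \<open>Elements and the operators of left multiplication by them\<close>

text \<open>\<open>A\<close> restricts to left multiplication by \<open>a\<close> on the Brauer
  algebra. This is the translation between operators and elements.\<close>

definition acts :: "nat \<Rightarrow> 'k::field \<Rightarrow> (diagram, 'k) lop \<Rightarrow> 'k brauer \<Rightarrow> bool" where
  "acts n w A a \<longleftrightarrow> supported n a \<and> (\<forall>F. supported n F \<longrightarrow> ap A F = brauer_mult n w a F)"

lemma supported_lin: "supported n a \<Longrightarrow> supported n b \<Longrightarrow> supported n (\<lambda>d. c * a d + b d)"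
  by (simp add: supported_def)

lemma acts_lin:
  assumes "acts n w A a" "acts n w B b"
  shows "acts n w (sc c * A + B) (\<lambda>d. c * a d + b d)"
  using assms unfolding acts_def by (auto simp: supported_lin brauer_mult_lin_left fun_eq_iff ap_simps)

lemma acts_scale: "acts n w A a \<Longrightarrow> acts n w (sc c * A) (\<lambda>d. c * a d)"
  using acts_lin[of n w A a 0 "\<lambda>_. 0" c]
  by (auto simp: acts_def supported_def brauer_mult_zero ap_simps fun_eq_iff)

lemma acts_add: "acts n w A a \<Longrightarrow> acts n w B b \<Longrightarrow> acts n w (A + B) (\<lambda>d. a d + b d)"
  using acts_lin[of n w A a B b 1] by (simp add: sc_1)

lemma acts_diff: "acts n w A a \<Longrightarrow> acts n w B b \<Longrightarrow> acts n w (A - B) (\<lambda>d. a d - b d)"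
proof -
  assume A: "acts n w A a" and B: "acts n w B b"
  have "sc (-1) * B = - B" by (rule lop_eqI) (simp add: ap_simps)
  then show ?thesis using acts_lin[OF B A, of "-1"] by (simp add: add.commute[of "- B"])
qed

lemma acts_mult:
  assumes "acts n w A a" "acts n w B b"
  shows "acts n w (A * B) (brauer_mult n w a b)"
  using assms brauer_mult_supported[of n w]
  unfolding acts_def by (simp add: ap_times brauer_mult_assoc)

lemma supported_basis: "d \<in> diagrams n \<Longrightarrow> supported n (brauer_basis d)"
  by (auto simp: supported_def brauer_basis_def)

lemma supported_one: "supported n (brauer_one n)"
  unfolding elem_diag(1) by (rule supported_basis[OF one_diag_in])

lemma acts_one: "1 \<le> n \<Longrightarrow> acts n w 1 (brauer_one n)" "1 \<le> n \<Longrightarrow> acts n w (Pn n) (brauer_one n)"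
  unfolding acts_def
  by (simp_all add: ap_simps brauer_mult_unit Pn_supported supported_one)

lemma acts_Sn:
  assumes "i \<in> {1..n}" "j \<in> {1..n}"
  shows "acts n w (Sn n w i j) (s_elem n i j)"
  unfolding acts_def Sn_def
  using supported_basis[OF s_diag_in[OF assms]]
  by (auto simp: elem_diag ap_simps ap_Lop Pn_supported fun_eq_iff)

lemma acts_Cn:
  assumes "i \<in> {1..n}" "j \<in> {1..n}" "i \<noteq> j"
  shows "acts n w (Cn n w i j) (eps_elem n i j)"
  unfolding acts_def Cn_def
  using supported_basis[OF e_diag_in[OF assms]] by (simp add: elem_diag ap_Lop)

lemma acts_one_vector: "1 \<le> n \<Longrightarrow> acts n w A a \<Longrightarrow> ap A (brauer_one n) = a"
proof -
  assume "1 \<le> n" "acts n w A a"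
  then have "ap A (brauer_one n) = brauer_mult n w a (brauer_one n)" "supported n a"
    by (simp_all add: acts_def supported_one)
  then show ?thesis using brauer_mult_unit(2)[OF \<open>1 \<le> n\<close>, of a w] by simp
qed

lemma acts_sum:
  assumes "\<And>i. i \<in> J \<Longrightarrow> acts n w (A i) (a i)"
  shows "acts n w (\<Sum>i\<in>J. A i) (\<lambda>d. \<Sum>i\<in>J. a i d)"
  using assms
proof (induction J rule: infinite_finite_induct)
  case (insert x J)
  then show ?case by (simp add: acts_add)
qed (simp_all add: acts_def supported_def brauer_mult_zero ap_simps fun_eq_iff)

text \<open>An operator that acts by the zero element need not vanish on functions without
  support.\<close>

lemma acts_zero_Pn: "acts n w A (\<lambda>_. 0) \<Longrightarrow> A * Pn n = 0"
  by (rule lop_eqI) (simp add: acts_def ap_times supported_Pn brauer_mult_zero ap_simps)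

locale brauer_alg =
  fixes n :: nat and w :: "'k::field"
  assumes n: "1 \<le> n" and two': "(2::'k) \<noteq> 0"

sublocale brauer_alg \<subseteq> br: brauer_relations sc w "{1..n}" "Sn n w" "Cn n w"
  by (rule brauer_algebra_relations[OF two'])

context brauer_alg
begin

lemma acts_x:
  assumes "r \<le> n"
  shows "acts n w (br.x r) (jm_elem n w r)"
proof -
  have "acts n w (br.jj i r) (\<lambda>d. s_elem n i r d - eps_elem n i r d)" if "i \<in> {1..<r}" for i
    unfolding br.jj_def using that assms by (intro acts_diff acts_Sn acts_Cn) auto
  then have "acts n w (\<Sum>i\<in>{1..<r}. br.jj i r) (\<lambda>d. \<Sum>i\<in>{1..<r}. s_elem n i r d - eps_elem n i r d)"
    by (rule acts_sum)
  from acts_lin[OF acts_one(1)[OF n, of w] this, of "(w - 1) / 2"] show ?thesis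
    unfolding br.x_def jm_elem_def by simp
qed

lemma acts_x_shift: "r \<le> n \<Longrightarrow> acts n w (br.x r - sc a) (\<lambda>d. jm_elem n w r d - a * brauer_one n d)"
  using acts_diff[OF acts_x acts_scale[OF acts_one(1)[OF n]]] by simp

lemma acts_pp:
  "r \<le> n \<Longrightarrow> acts n w (br.pp (br.x r) L) (brauer_prod n w (map (\<lambda>a d. jm_elem n w r d - a * brauer_one n d) L))"
proof (induction L)
  case Nil
  show ?case using acts_one(1)[OF n] by (simp add: br.pp_simps brauer_prod_def)
next
  case (Cons a L)
  then show ?case
    using acts_mult[OF acts_x_shift[of r a] Cons.IH] by (simp add: br.pp_simps brauer_prod_def)
qed

lemma Pn_gen: "i \<in> {1..n} \<Longrightarrow> j \<in> {1..n} \<Longrightarrow> i \<noteq> j \<Longrightarrow>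
    br.commutes (Sn n w i j) (Pn n) \<and> br.commutes (Cn n w i j) (Pn n)"
  unfolding br.commutes_def Sn_def Cn_def
  by (simp add: distrib_left distrib_right left_diff_distrib right_diff_distrib Pn_Lop)

end

subsection \<open>From colourings to the generic algebra\<close>

lemma const_simps: "const 0 = 0" "const 1 = 1" "const (a + b) = const a + const b" "const (a * b) = const a * const b"
  by (simp_all add: const_def single_add mult_single flip: Zero_fract_def One_fract_def)

lemma const_eq_0: "const a = 0 \<longleftrightarrow> a = 0"
proof -
  have "Fract x 1 = 0 \<longleftrightarrow> x = 0" for x :: upoly by (simp add: Zero_fract_def eq_fract)
  then show ?thesis unfolding const_def by (metis lookup_single_eq lookup_zero single_zero)
qed

lemma const_uminus: "const (- a) = - const a"
  using const_simps(3)[of a "- a"] by (simp add: const_simps eq_neg_iff_add_eq_0 add.commute)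

lemma const_diff: "const (a - b) = const a - const b"
  using const_simps(3)[of a "- b"] by (simp add: const_uminus)

lemma const_inj: "const a = const b \<longleftrightarrow> a = b"
  using const_eq_0[of "a - b"] by (simp add: const_diff)

lemma const_divide: "const (a / b) = const a / const b"
proof (cases "b = 0")
  case False
  then have "const (a / b) * const b = const a" by (simp flip: const_simps(4))
  then show ?thesis using False by (simp add: const_eq_0 eq_divide_eq)
qed (simp add: const_simps)

lemma const_of_nat: "const (of_nat k) = of_nat k"
  by (induction k) (simp_all add: const_simps)

lemma const_of_int: "const (of_int k) = of_int k"
  by (cases k rule: int_cases2) (simp_all add: const_of_nat const_uminus)

lemma const_numeral: "const (numeral k) = numeral k"
  using const_of_nat[of "numeral k"] by simp

lemma const_sum: "const (\<Sum>i\<in>J. f i) = (\<Sum>i\<in>J. const (f i))"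
  by (induction J rule: infinite_finite_induct) (simp_all add: const_simps)

lemma const_power: "const (a ^ k) = const a ^ k"
  by (induction k) (simp_all add: const_simps)

text \<open>Polynomials in the parameter with real coefficients as scalars; \<open>rp\<close> is
  their image in the field of rational functions of the variables \<open>u\<close>.\<close>

definition embed :: "real poly \<Rightarrow> scal" where "embed p = Fract (map_poly complex_of_real p) 1"

definition rp :: "real poly \<Rightarrow> ufun" where "rp p = const (embed p)"

lemma embed_add: "embed (p + q) = embed p + embed q"
proof -
  have "map_poly complex_of_real (p + q) = map_poly complex_of_real p + map_poly complex_of_real q"
    by (rule poly_eqI) (simp add: coeff_map_poly)
  then show ?thesis by (simp add: embed_def)
qed

lemma embed_mult: "embed (p * q) = embed p * embed q"
proof -
  have "map_poly complex_of_real (p * q) = map_poly complex_of_real p * map_poly complex_of_real q"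
    by (rule poly_eqI) (simp add: coeff_map_poly coeff_mult)
  then show ?thesis by (simp add: embed_def)
qed

lemma embed_0: "embed 0 = 0" by (simp add: embed_def Zero_fract_def)
lemma embed_1: "embed 1 = 1"
proof -
  have "map_poly complex_of_real 1 = 1" by (rule poly_eqI) (simp add: coeff_map_poly)
  then show ?thesis by (simp add: embed_def One_fract_def)
qed

lemma embed_X: "embed [:0, 1:] = omega"
proof -
  have "map_poly complex_of_real [:0, 1:] = [:0, 1:]"
    by (rule poly_eqI) (simp add: coeff_map_poly coeff_pCons split: nat.split)
  then show ?thesis by (simp add: embed_def omega_def)
qed

lemma embed_eq_0: "embed p = 0 \<Longrightarrow> p = 0"
  unfolding embed_def by (simp add: Zero_fract_def eq_fract) (metis coeff_map_poly map_poly_eq_0_iff of_real_eq_0_iff of_real_0)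

lemma embed_of_int: "embed (of_int k) = of_int k"
proof -
  have n: "embed (of_nat m) = of_nat m" for m by (induction m) (simp_all add: embed_0 embed_1 embed_add)
  have "embed (- p) = - embed p" for p
    using embed_add[of p "- p"] by (simp add: embed_0 eq_neg_iff_add_eq_0 add.commute)
  then show ?thesis by (cases k rule: int_cases2) (simp_all add: n)
qed

lemma linear_omega_nonzero: "a \<noteq> 0 \<or> b \<noteq> 0 \<Longrightarrow> of_int a * omega + of_int b \<noteq> 0"
proof
  assume ab: "a \<noteq> 0 \<or> b \<noteq> 0" and "of_int a * omega + of_int b = 0"
  then have "embed (of_int a * [:0, 1:] + of_int b) = 0" by (simp only: embed_add embed_mult embed_of_int embed_X)
  then have "of_int a * [:0, 1:] + of_int b = (0 :: real poly)" by (rule embed_eq_0)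
  then have "poly (of_int a * [:0, 1:] + of_int b) 0 = (0::real)" "poly (of_int a * [:0, 1:] + of_int b) 1 = (0::real)"
    by simp_all
  then show False using ab by simp
qed

lemma scal_of_int: "(of_int a :: scal) = 0 \<longleftrightarrow> a = 0"
  using linear_omega_nonzero[of 0 a] by auto

lemma scal_two: "(2::scal) \<noteq> 0"
  using scal_of_int[of 2] by simp

lemma ufun_two: "(2::ufun) \<noteq> 0"
  using scal_two const_eq_0[of 2] by (simp add: const_numeral)

lemma rp_add: "rp (p + q) = rp p + rp q" by (simp add: rp_def embed_add const_simps)
lemma rp_mult: "rp (p * q) = rp p * rp q" by (simp add: rp_def embed_mult const_simps)
lemma rp_0: "rp 0 = 0" by (simp add: rp_def embed_0 const_simps)
lemma rp_1: "rp 1 = 1" by (simp add: rp_def embed_1 const_simps)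
lemma rp_X: "rp [:0, 1:] = const omega" by (simp add: rp_def embed_X)
lemma rp_of_int: "rp (of_int k) = of_int k" by (simp add: rp_def embed_of_int const_of_int)

lemma rp_sum: "rp (\<Sum>i\<in>J. p i) = (\<Sum>i\<in>J. rp (p i))"
  by (induction J rule: infinite_finite_induct) (simp_all add: rp_0 rp_add)

lemma rp_power: "rp (p ^ k) = rp p ^ k"
  by (induction k) (simp_all add: rp_1 rp_mult)

lemma rp_uminus: "rp (- p) = - rp p"
  using rp_add[of p "- p"] by (simp add: rp_0 eq_neg_iff_add_eq_0 add.commute)

lemma rp_diff: "rp (p - q) = rp p - rp q"
  using rp_add[of p "- q"] by (simp add: rp_uminus)

lemma rp_half: "rp [:- (1/2), 1/2:] = (const omega - 1) / 2"
proof -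
  have "[:- (1/2), 1/2:] * 2 = ([:0, 1:] - 1 :: real poly)"
    by (simp add: one_pCons numeral_poly)
  then have "rp [:- (1/2), 1/2:] * rp 2 = const omega - 1" by (metis rp_mult rp_diff rp_X rp_1)
  moreover have "rp 2 = 2" using rp_of_int[of 2] by simp
  ultimately show ?thesis using ufun_two by (simp add: eq_divide_eq)
qed

text \<open>The coefficients of \<open>a\<close> are polynomials in the parameter whose values at
  \<open>N\<close> give the function \<open>h N g\<close>, as a combination of the columns
  \<open>g\<close> of the kernels of the diagrams. So \<open>h N\<close> is the specialization of
  \<open>a\<close> at the parameter \<open>N\<close> in the action on colourings.\<close>

definition spec :: "nat \<Rightarrow> ufun brauer \<Rightarrow> (nat \<Rightarrow> (nat \<Rightarrow> nat) \<Rightarrow> (nat \<Rightarrow> nat) \<Rightarrow> real) \<Rightarrow> bool" where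
  "spec n a h \<longleftrightarrow> (\<exists>p. (\<forall>d\<in>diagrams n. a d = rp (p d)) \<and>
    (\<forall>N g. valid N g \<longrightarrow> h N g = (\<lambda>f. \<Sum>d\<in>diagrams n. poly (p d) (real N) * K N d g f)))"

lemma spec_lin:
  assumes "spec n a h" "spec n b h'"
  shows "spec n (\<lambda>d. rp q * a d + b d) (\<lambda>N g f. poly q (real N) * h N g f + h' N g f)"
proof -
  obtain p where p: "\<forall>d\<in>diagrams n. a d = rp (p d)"
    "\<And>N g. valid N g \<Longrightarrow> h N g = (\<lambda>f. \<Sum>d\<in>diagrams n. poly (p d) (real N) * K N d g f)"
    using assms(1) unfolding spec_def by blast
  obtain p' where p': "\<forall>d\<in>diagrams n. b d = rp (p' d)"
    "\<And>N g. valid N g \<Longrightarrow> h' N g = (\<lambda>f. \<Sum>d\<in>diagrams n. poly (p' d) (real N) * K N d g f)"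
    using assms(2) unfolding spec_def by blast
  show ?thesis
    unfolding spec_def
  proof (intro exI[of _ "\<lambda>d. q * p d + p' d"] conjI ballI allI impI)
    fix d assume "d \<in> diagrams n"
    then show "rp q * a d + b d = rp (q * p d + p' d)" using p(1) p'(1) by (simp add: rp_add rp_mult)
  next
    fix N g assume g: "valid N g"
    show "(\<lambda>f. poly q (real N) * h N g f + h' N g f) =
      (\<lambda>f. \<Sum>d\<in>diagrams n. poly (q * p d + p' d) (real N) * K N d g f)"
      unfolding p(2)[OF g] p'(2)[OF g]
      by (simp add: sum_distrib_left sum.distrib distrib_right mult.assoc)
  qed
qed

text \<open>By the counting theorem, a product with a generator produces a factor
  \<open>omega\<close> for each loop, and a factor \<open>N\<close> in the action on colourings.\<close>

lemma spec_generator: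
  assumes a: "spec n a h" and d1: "d1 \<in> diagrams n"
    and cnt: "\<And>N d g f. d \<in> diagrams n \<Longrightarrow> valid N f \<Longrightarrow> real (card (mids N n d1 d f g)) = ap (G N) (K N d g) f"
    and inv: "\<And>N d g f. \<not> valid N f \<Longrightarrow> ap (G N) (K N d g) f = 0"
  shows "spec n (brauer_mult n (const omega) (brauer_basis d1) a) (\<lambda>N g. ap (G N) (h N g))"
proof -
  obtain p where p: "\<forall>d\<in>diagrams n. a d = rp (p d)"
    "\<And>N g. valid N g \<Longrightarrow> h N g = (\<lambda>f. \<Sum>d\<in>diagrams n. poly (p d) (real N) * K N d g f)"
    using a unfolding spec_def by blast
  let ?D = "diagrams n"
  define p' where "p' d = (\<Sum>d2\<in>?D. if compose d1 d2 = d then p d2 * [:0, 1:] ^ loops n d1 d2 else 0)" for d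
  have 1: "brauer_mult n (const omega) (brauer_basis d1) a d = rp (p' d)" for d
  proof -
    have "brauer_mult n (const omega) (brauer_basis d1) a d =
        (\<Sum>x\<in>?D. brauer_basis d1 x * (\<Sum>d2\<in>?D. if compose x d2 = d then a d2 * (const omega) ^ loops n x d2 else 0))"
      unfolding brauer_mult_def sum_distrib_left by (intro sum.cong refl) simp
    also have "\<dots> = (\<Sum>d2\<in>?D. if compose d1 d2 = d then a d2 * (const omega) ^ loops n d1 d2 else 0)"
      by (rule sum_basis[OF d1])
    also have "\<dots> = rp (p' d)"
      unfolding p'_def rp_sum by (intro sum.cong refl) (simp add: p(1) rp_mult rp_power rp_X rp_0)
    finally show ?thesis .
  qed
  have 2: "ap (G N) (h N g) f = (\<Sum>d\<in>?D. poly (p' d) (real N) * K N d g f)" if g: "valid N g" for N g f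
  proof (cases "valid N f")
    case False
    have "ap (G N) (h N g) f = (\<Sum>d\<in>?D. poly (p d) (real N) * ap (G N) (K N d g) f)"
      unfolding p(2)[OF g] by (simp add: ap_arg_sum ap_scale)
    then show ?thesis using False by (simp add: inv K_def)
  next
    case True
    have "ap (G N) (h N g) f = (\<Sum>d2\<in>?D. poly (p d2) (real N) * ap (G N) (K N d2 g) f)"
      unfolding p(2)[OF g] by (simp add: ap_arg_sum ap_scale)
    also have "\<dots> = (\<Sum>d2\<in>?D. poly (p d2) (real N) * (real N ^ loops n d1 d2 * K N (compose d1 d2) g f))"
    proof (intro sum.cong refl arg_cong2[of _ _ _ _ "(*)"])
      fix d2 assume d2: "d2 \<in> ?D"
      show "ap (G N) (K N d2 g) f = real N ^ loops n d1 d2 * K N (compose d1 d2) g f"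
        using cnt[OF d2 True, of g, symmetric] card_mids[OF d1 d2, of f N g] True g
        by (cases "compat (compose d1 d2) f g") (simp_all add: K_def valid_def)
    qed
    also have "\<dots> = (\<Sum>d2\<in>?D. \<Sum>d\<in>?D. if compose d1 d2 = d then poly (p d2) (real N) * (real N ^ loops n d1 d2 * K N d g f) else 0)"
      by (intro sum.cong refl) (simp add: finite_diagrams compose_in_diagrams[OF d1])
    also have "\<dots> = (\<Sum>d\<in>?D. \<Sum>d2\<in>?D. if compose d1 d2 = d then poly (p d2) (real N) * (real N ^ loops n d1 d2 * K N d g f) else 0)"
      by (rule sum.swap)
    also have "\<dots> = (\<Sum>d\<in>?D. poly (p' d) (real N) * K N d g f)"
      unfolding p'_def poly_sum sum_distrib_right
      by (intro sum.cong refl) (simp add: poly_power)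
    finally show ?thesis .
  qed
  show ?thesis
    unfolding spec_def using 1 2 by (intro exI[of _ p']) (auto simp: fun_eq_iff)
qed

lemma spec_Sn:
  assumes "i \<in> {1..n}" "j \<in> {1..n}" "spec n a h" "supported n a"
  shows "spec n (ap (Sn n (const omega) i j) a) (\<lambda>N g. ap (Sop i j) (h N g))"
proof -
  have "ap (Sn n (const omega) i j) a = brauer_mult n (const omega) (brauer_basis (s_diag n i j)) a"
    using acts_Sn[OF assms(1,2), of "const omega"] assms(4) by (simp add: acts_def elem_diag)
  then show ?thesis
    using spec_generator[OF assms(3) s_diag_in[OF assms(1,2)], of "\<lambda>N. Sop i j"]
      card_mids_s[OF _ assms(1,2)] by (simp add: ap_Sop K_def valid_swap)
qed

lemma spec_Cn:
  assumes "i \<in> {1..n}" "j \<in> {1..n}" "i \<noteq> j" "spec n a h" "supported n a"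
  shows "spec n (ap (Cn n (const omega) i j) a) (\<lambda>N g. ap (Cop N i j) (h N g))"
proof -
  have "ap (Cn n (const omega) i j) a = brauer_mult n (const omega) (brauer_basis (e_diag n i j)) a"
    using acts_Cn[OF assms(1-3), of "const omega"] assms(5) by (simp add: acts_def elem_diag)
  then show ?thesis
    using spec_generator[OF assms(4) e_diag_in[OF assms(1-3)], of "\<lambda>N. Cop N i j"]
      card_mids_e[OF _ assms(1-3)] by (simp add: ap_Cop)
qed

lemma spec_zero: "spec n (\<lambda>_. 0) (\<lambda>N g f. 0)"
  unfolding spec_def by (intro exI[of _ "\<lambda>_. 0"]) (simp add: rp_0)

lemma spec_one: "spec n (brauer_one n) (\<lambda>N g. K N (one_diag n) g)"
  unfolding spec_def
proof (intro exI[of _ "\<lambda>d. if d = one_diag n then 1 else 0"] conjI ballI allI impI)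
  fix d show "brauer_one n d = rp (if d = one_diag n then 1 else 0)"
    by (simp add: elem_diag brauer_basis_def rp_0 rp_1)
next
  fix N g
  show "K N (one_diag n) g = (\<lambda>f. \<Sum>d\<in>diagrams n. poly (if d = one_diag n then 1 else 0) (real N) * K N d g f)"
  proof
    fix f
    have "(\<Sum>d\<in>diagrams n. poly (if d = one_diag n then 1 else 0) (real N) * K N d g f) =
      (\<Sum>d\<in>diagrams n. if d = one_diag n then K N d g f else 0)"
      by (intro sum.cong refl) simp
    then show "K N (one_diag n) g f = (\<Sum>d\<in>diagrams n. poly (if d = one_diag n then 1 else 0) (real N) * K N d g f)"
      using one_diag_in finite_diagrams by simp
  qed
qed

lemma spec_x:
  assumes r: "r \<le> n" and a: "spec n a h" "supported n a" and n: "1 \<le> n"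
  shows "spec n (ap (brauer_relations.x sc (const omega) (Sn n (const omega)) (Cn n (const omega)) r - sc (rp q)) a)
    (\<lambda>N g. ap (col.x N r - sc (poly q (real N))) (h N g))"
proof -
  interpret br: brauer_alg n "const omega" by (rule brauer_alg.intro[OF n ufun_two])
  have sum: "spec n (ap (\<Sum>i\<in>J. br.br.jj i r) a) (\<lambda>N g. ap (\<Sum>i\<in>J. col.jj N i r) (h N g))"
    if "finite J" "J \<subseteq> {1..<r}" for J
    using that
  proof (induction J rule: finite_induct)
    case empty
    show ?case using spec_zero by (simp add: ap_simps)
  next
    case (insert i J)
    then have i: "i \<in> {1..n}" "r \<in> {1..n}" "i \<noteq> r" using r by auto
    have "spec n (\<lambda>d. rp (-1) * ap (Cn n (const omega) i r) a d + ap (Sn n (const omega) i r) a d)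
      (\<lambda>N g f. poly (-1) (real N) * ap (Cop N i r) (h N g) f + ap (Sop i r) (h N g) f)"
      by (rule spec_lin[OF spec_Cn[OF i a] spec_Sn[OF i(1,2) a]])
    from spec_lin[OF this insert.IH, of 1] insert show ?case
      by (simp add: br.br.jj_def col.jj_def ap_simps ap_sum rp_1 rp_uminus fun_eq_iff algebra_simps)
  qed
  from spec_lin[OF a(1) sum[of "{1..<r}"], of "[:- (1/2), 1/2:] - q"]
  have "spec n (\<lambda>d. rp ([:- (1/2), 1/2:] - q) * a d + ap (\<Sum>i\<in>{1..<r}. br.br.jj i r) a d)
    (\<lambda>N g f. poly ([:- (1/2), 1/2:] - q) (real N) * h N g f + ap (\<Sum>i\<in>{1..<r}. col.jj N i r) (h N g) f)" by simp
  moreover have "(\<lambda>d. rp ([:- (1/2), 1/2:] - q) * a d + ap (\<Sum>i\<in>{1..<r}. br.br.jj i r) a d) =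
      ap (br.br.x r - sc (rp q)) a"
    by (rule ext) (simp add: br.br.x_def ap_simps rp_diff rp_half ufun_two left_diff_distrib)
  moreover have "(\<lambda>N g f. poly ([:- (1/2), 1/2:] - q) (real N) * h N g f + ap (\<Sum>i\<in>{1..<r}. col.jj N i r) (h N g) f) =
      (\<lambda>N g. ap (col.x N r - sc (poly q (real N))) (h N g))"
    by (intro ext) (simp add: col.x_def ap_simps algebra_simps add_divide_distrib diff_divide_distrib)
  ultimately show ?thesis by simp
qed

text \<open>Given a diagram, colour its edges with pairwise different colours. Any other diagram
  is incompatible with this colouring, so its coefficient at \<open>N\<close> can be read off;
  hence it vanishes for all large \<open>N\<close>, and a polynomial with infinitely many roots is
  zero.\<close>

lemma spec_vanish:
  assumes a: "spec n a h" "supported n a" and h: "\<And>N g f. valid N g \<Longrightarrow> valid N f \<Longrightarrow> h N g f = 0"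
  shows "a = (\<lambda>_. 0)"
proof
  fix d0
  show "a d0 = 0"
  proof (cases "d0 \<in> diagrams n")
    case False
    then show ?thesis using a(2) by (simp add: supported_def)
  next
    case d0: True
    obtain p where p: "\<forall>d\<in>diagrams n. a d = rp (p d)"
      "\<And>N g. valid N g \<Longrightarrow> h N g = (\<lambda>f. \<Sum>d\<in>diagrams n. poly (p d) (real N) * K N d g f)"
      using a(1) unfolding spec_def by blast
    have "finite d0" using d0 diagrams_subset[of n] finite_dots[of n] by (meson PowD finite_Pow_iff finite_subset subsetD)
    then obtain col :: "dot set \<Rightarrow> nat" where col: "inj_on col d0" "col ` d0 = {..<card d0}"
      using ex_bij_betw_finite_nat[of d0] by (metis atLeast0LessThan bij_betw_def)
    \<comment> \<open>Every dot is coloured by the number of the edge of \<open>d0\<close> on which it lies.\<close>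
    define F where "F x = (if x \<in> dots n then col {x, partner d0 x} else 0)" for x
    define f where "f i = F (Top, i)" for i
    define g where "g i = F (Bot, i)" for i
    have Fb: "F x < N" if "card d0 < N" for x N
    proof (cases "x \<in> dots n")
      case True
      then have "col {x, partner d0 x} \<in> {..<card d0}" using col(2) partner(1)[OF d0 True] by blast
      then show ?thesis using True that by (simp add: F_def)
    qed (use that in \<open>simp add: F_def\<close>)
    have pc: "pair_col f g x = F x" if "x \<in> dots n" for x
      using that by (cases x) (auto simp: dots_def f_def g_def)
    have compat: "compat d f g \<longleftrightarrow> d = d0" if d: "d \<in> diagrams n" for d
    proof
      assume c: "compat d f g"
      have pp: "partner d x = partner d0 x" if x: "x \<in> dots n" for x
      proof -
        have "F x = F (partner d x)"
          using compat_edge[OF c partner(1)[OF d x]] pc[OF x] pc[OF partner(3)[OF d x]] by simp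
        then have "col {x, partner d0 x} = col {partner d x, partner d0 (partner d x)}"
          using x partner(3)[OF d x] by (simp add: F_def)
        then have "{x, partner d0 x} = {partner d x, partner d0 (partner d x)}"
          using col(1) partner(1)[OF d0 x] partner(1)[OF d0 partner(3)[OF d x]] by (meson inj_onD)
        then show ?thesis using partner(2)[OF d x] by (metis doubleton_eq_iff)
      qed
      show "d = d0"
      proof (intro equalityI subsetI)
        fix e assume "e \<in> d"
        then obtain x where "x \<in> dots n" "e = {x, partner d x}" using edge_cases[OF d] by metis
        then show "e \<in> d0" using partner(1)[OF d0] pp by metis
      next
        fix e assume "e \<in> d0"
        then obtain x where "x \<in> dots n" "e = {x, partner d0 x}" using edge_cases[OF d0] by metis
        then show "e \<in> d" using partner(1)[OF d] pp by metis
      qed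
    next
      assume "d = d0"
      have "compat d0 f g"
        unfolding compat_def
      proof (intro ballI)
        fix e y z assume e: "e \<in> d0" "y \<in> e" "z \<in> e"
        then obtain x where x: "x \<in> dots n" "e = {x, partner d0 x}" using edge_cases[OF d0] by metis
        have "F (partner d0 x) = F x"
          using x(1) partner(3)[OF d0 x(1)] partner_partner[OF d0 x(1)] by (simp add: F_def insert_commute)
        then have "pair_col f g (partner d0 x) = pair_col f g x"
          by (simp only: pc[OF x(1)] pc[OF partner(3)[OF d0 x(1)]])
        then show "pair_col f g y = pair_col f g z" using e(2,3) unfolding x(2) by auto
      qed
      then show "compat d f g" using \<open>d = d0\<close> by simp
    qed
    have "poly (p d0) (real N) = 0" if N: "card d0 < N" for N
    proof -
      have v: "valid N f" "valid N g" using Fb[OF N] by (simp_all add: valid_def f_def g_def)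
      have "0 = (\<Sum>d\<in>diagrams n. poly (p d) (real N) * K N d g f)"
        using h[OF v(2,1)] p(2)[OF v(2)] by simp
      also have "\<dots> = (\<Sum>d\<in>diagrams n. if d = d0 then poly (p d) (real N) else 0)"
        using v by (intro sum.cong refl) (simp add: K_def compat)
      also have "\<dots> = poly (p d0) (real N)" using d0 finite_diagrams by simp
      finally show ?thesis by simp
    qed
    then have "real ` {card d0<..} \<subseteq> {y. poly (p d0) y = 0}" by auto
    moreover have "infinite (real ` {card d0<..})"
      by (simp add: finite_image_iff inj_on_def infinite_Ioi)
    ultimately have "p d0 = 0" using poly_roots_finite[of "p d0"] finite_subset by blast
    then show ?thesis using p(1) d0 by (simp add: rp_0)
  qed
qed

section \<open>Addable and removable boxes along an updown tableau\<close>

text \<open>Extend a diagram to the plane by all positions with a nonpositive coordinate. Then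
  every diagonal is a ray, and \<open>thr D k\<close> is the row in which the ray on diagonal
  \<open>k\<close> ends. Consecutive rays interlace, and corners are visible from three
  consecutive ends; no case distinction on the sign of \<open>k\<close> is needed.\<close>

definition thr :: "box set \<Rightarrow> int \<Rightarrow> int" where
  "thr D k = int (card {b \<in> D. diag b = k}) + max 0 (- k)"

lemma downward_segment:
  fixes S :: "int set"
  assumes "finite S" "\<And>i. i \<in> S \<Longrightarrow> m < i" "\<And>i. i \<in> S \<Longrightarrow> m < i - 1 \<Longrightarrow> i - 1 \<in> S"
  shows "i \<in> S \<longleftrightarrow> m < i \<and> i \<le> m + int (card S)"
proof (cases "S = {}")
  case False
  define M where "M = Max S"
  have M: "M \<in> S" using False assms(1) by (simp add: M_def)
  have down: "m < j \<longrightarrow> j \<in> S" if "j \<le> M" for j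
    using that
  proof (induction j rule: int_le_induct)
    case base show ?case using M by simp
  next
    case (step j) then show ?case using assms(3)[of j] by auto
  qed
  have "S = {m<..M}" using down assms(1,2) by (auto simp: M_def)
  then show ?thesis using assms(2)[OF M] by simp
qed simp

lemma thr_ge: "0 \<le> thr D k" "- k \<le> thr D k" "max 0 (- k) \<le> thr D k"
  by (auto simp: thr_def)

lemma young_mem:
  "young_diagram D \<Longrightarrow> (a, b) \<in> D \<Longrightarrow> 1 \<le> a' \<Longrightarrow> a' \<le> a \<Longrightarrow> 1 \<le> b' \<Longrightarrow> b' \<le> b \<Longrightarrow> (a', b') \<in> D"
  unfolding young_diagram_def by fastforce

lemma young_pos: "young_diagram D \<Longrightarrow> (a, b) \<in> D \<Longrightarrow> 1 \<le> a \<and> 1 \<le> b"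
  unfolding young_diagram_def by fastforce

lemma youngI:
  assumes "finite D" "\<And>a b. (a, b) \<in> D \<Longrightarrow> 1 \<le> a \<and> 1 \<le> b"
    "\<And>a b a' b'. (a, b) \<in> D \<Longrightarrow> 1 \<le> a' \<Longrightarrow> a' \<le> a \<Longrightarrow> 1 \<le> b' \<Longrightarrow> b' \<le> b \<Longrightarrow> (a', b') \<in> D"
  shows "young_diagram D"
  unfolding young_diagram_def
proof (intro conjI ballI, fact, clarify, intro conjI ballI)
  fix a b assume ab: "(a, b) \<in> D"
  show "1 \<le> a" "1 \<le> b" using assms(2)[OF ab] by auto
  fix a' b' assume "a' \<in> {1..a}" "b' \<in> {1..b}"
  then show "(a', b') \<in> D" using assms(3)[OF ab] by auto
qed

lemma young_finite: "young_diagram D \<Longrightarrow> finite D"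
  by (simp add: young_diagram_def)

lemma mem_thr_int:
  assumes D: "young_diagram D" and i: "1 \<le> i" "1 \<le> i + k"
  shows "(nat i, nat (i + k)) \<in> D \<longleftrightarrow> i \<le> thr D k"
proof -
  define S where "S = {i. 1 \<le> i \<and> 1 \<le> i + k \<and> (nat i, nat (i + k)) \<in> D}"
  have bij: "bij_betw (\<lambda>i. (nat i, nat (i + k))) S {b \<in> D. diag b = k}"
  proof (rule bij_betw_imageI)
    show "inj_on (\<lambda>i. (nat i, nat (i + k))) S" by (auto simp: inj_on_def S_def)
    show "(\<lambda>i. (nat i, nat (i + k))) ` S = {b \<in> D. diag b = k}"
    proof (intro equalityI subsetI)
      fix b assume "b \<in> {b \<in> D. diag b = k}"
      moreover obtain a c where "b = (a, c)" by (cases b)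
      ultimately have b: "b = (a, c)" "(a, c) \<in> D" "int c - int a = k" by (auto simp: diag_def)
      then have "int a \<in> S" "b = (nat (int a), nat (int a + k))"
        using young_pos[OF D b(2)] by (auto simp: S_def)
      then show "b \<in> (\<lambda>i. (nat i, nat (i + k))) ` S" by blast
    qed (auto simp: S_def diag_def)
  qed
  have "finite {b \<in> D. diag b = k}" using young_finite[OF D] by simp
  then have fin: "finite S" using bij_betw_finite[OF bij] by simp
  have "i \<in> S \<longleftrightarrow> max 0 (- k) < i \<and> i \<le> max 0 (- k) + int (card S)"
  proof (rule downward_segment[OF fin])
    fix i assume i: "i \<in> S"
    then show "max 0 (- k) < i" by (auto simp: S_def)
    show "i - 1 \<in> S" if "max 0 (- k) < i - 1"
      using that i young_mem[OF D, of "nat i" "nat (i + k)" "nat (i - 1)" "nat (i - 1 + k)"]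
      by (auto simp: S_def)
  qed
  moreover have "int (card S) = int (card {b \<in> D. diag b = k})"
    using bij_betw_same_card[OF bij] by simp
  ultimately show ?thesis using i by (auto simp: S_def thr_def)
qed

lemma mem_thr:
  assumes "young_diagram D" "1 \<le> i" "1 \<le> j" "k = int j - int i"
  shows "(i, j) \<in> D \<longleftrightarrow> int i \<le> thr D k"
  using mem_thr_int[OF assms(1), of "int i" k] assms by simp

lemma interlace:
  assumes D: "young_diagram D"
  shows "thr D (k + 1) \<le> thr D k" "thr D k \<le> thr D (k + 1) + 1"
proof -
  let ?i = "thr D (k + 1)"
  show "thr D (k + 1) \<le> thr D k"
  proof (cases "1 \<le> ?i \<and> 1 \<le> ?i + k")
    case True
    then have "(nat ?i, nat (?i + (k + 1))) \<in> D" using mem_thr_int[OF D, of ?i "k + 1"] by simp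
    then have "(nat ?i, nat (?i + k)) \<in> D" by (rule young_mem[OF D]) (use True in auto)
    then show ?thesis using mem_thr_int[OF D, of ?i k] True by simp
  qed (use thr_ge(1,2)[where D=D and k=k] in linarith)
next
  let ?i = "thr D k"
  show "thr D k \<le> thr D (k + 1) + 1"
  proof (cases "2 \<le> ?i \<and> 1 \<le> ?i + k")
    case True
    then have "(nat ?i, nat (?i + k)) \<in> D" using mem_thr_int[OF D, of ?i k] by simp
    then have "(nat (?i - 1), nat (?i - 1 + (k + 1))) \<in> D" by (rule young_mem[OF D]) (use True in auto)
    then show ?thesis using mem_thr_int[OF D, of "?i - 1" "k + 1"] True by simp
  qed (use thr_ge(1,2)[where D=D and k="k + 1"] in linarith)
qed

lemma interlace': "young_diagram D \<Longrightarrow> thr D k \<le> thr D (k - 1)"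
  "young_diagram D \<Longrightarrow> thr D (k - 1) \<le> thr D k + 1"
  using interlace[of D "k - 1"] by simp_all

lemma k_shift:
  assumes "k = int j - int i"
  shows "2 \<le> i \<Longrightarrow> k + 1 = int j - int (i - 1)" "2 \<le> j \<Longrightarrow> k - 1 = int (j - 1) - int i"
    "k + 1 = int (j + 1) - int i" "k - 1 = int j - int (i + 1)"
  using assms by (simp_all add: of_nat_diff)

text \<open>A box can be added exactly when it is the first missing box on its diagonal and its
  upper and left neighbours are present.\<close>

lemma addable_iff:
  assumes D: "young_diagram D" and k: "k = int j - int i"
  shows "(i, j) \<in> addable D \<longleftrightarrow> 1 \<le> i \<and> 1 \<le> j \<and> int i = thr D k + 1 \<and>
    thr D (k + 1) = thr D k \<and> thr D (k - 1) = thr D k + 1"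
proof
  assume "(i, j) \<in> addable D"
  then have nD: "(i, j) \<notin> D" and Y: "young_diagram (insert (i, j) D)" by (auto simp: addable_def)
  have ij: "1 \<le> i" "1 \<le> j" using young_pos[OF Y] by auto
  have 1: "thr D k < int i" using nD mem_thr[OF D ij k] by simp
  have 2: "int i - 1 \<le> thr D (k + 1)"
  proof (cases "i = 1")
    case True then show ?thesis using thr_ge by simp
  next
    case False
    then have "(i - 1, j) \<in> insert (i, j) D" by (intro young_mem[OF Y insertI1]) (use ij in auto)
    then have "(i - 1, j) \<in> D" using ij by auto
    then show ?thesis 
      using mem_thr[OF D, of "i - 1" j "k + 1", OF _ _ k_shift(1)[OF k]] ij False by simp
  qed
  have 3: "int i \<le> thr D (k - 1)"
  proof (cases "j = 1")
    case True then show ?thesis using thr_ge(2)[of "k - 1" D] k by simp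
  next
    case False
    then have "(i, j - 1) \<in> insert (i, j) D" by (intro young_mem[OF Y insertI1]) (use ij in auto)
    then have "(i, j - 1) \<in> D" using ij by auto
    then show ?thesis 
      using mem_thr[OF D, of i "j - 1" "k - 1", OF _ _ k_shift(2)[OF k]] ij False by simp
  qed
  show "1 \<le> i \<and> 1 \<le> j \<and> int i = thr D k + 1 \<and> thr D (k + 1) = thr D k \<and> thr D (k - 1) = thr D k + 1"
    using 1 2 3 ij interlace[OF D, of k] interlace'[OF D, of k] by linarith
next
  assume A: "1 \<le> i \<and> 1 \<le> j \<and> int i = thr D k + 1 \<and> thr D (k + 1) = thr D k \<and> thr D (k - 1) = thr D k + 1"
  then have nD: "(i, j) \<notin> D" using mem_thr[OF D _ _ k] by simp
  have up: "(i - 1, j) \<in> D" if "2 \<le> i" 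
    using mem_thr[OF D, of "i - 1" j "k + 1", OF _ _ k_shift(1)[OF k that]] A that by simp
  have left: "(i, j - 1) \<in> D" if "2 \<le> j" 
    using mem_thr[OF D, of i "j - 1" "k - 1", OF _ _ k_shift(2)[OF k that]] A that by simp
  have "(a', b') \<in> insert (i, j) D"
    if h: "(a, b) \<in> insert (i, j) D" "1 \<le> a'" "a' \<le> a" "1 \<le> b'" "b' \<le> b" for a b a' b'
  proof (cases "(a, b) \<in> D")
    case True then show ?thesis using young_mem[OF D] h by blast
  next
    case False
    then have ab: "a = i" "b = j" using h(1) by auto
    consider "a' = i" "b' = j" | "a' < i" | "b' < j" using h ab by linarith
    then show ?thesis
    proof cases
      case 2 then show ?thesis using young_mem[OF D up, of a' b'] h ab by auto
    next
      case 3 then show ?thesis using young_mem[OF D left, of a' b'] h ab by auto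
    qed simp
  qed
  moreover have "1 \<le> a \<and> 1 \<le> b" if "(a, b) \<in> insert (i, j) D" for a b
    using that A young_pos[OF D] by blast
  ultimately have "young_diagram (insert (i, j) D)"
    using young_finite[OF D] by (intro youngI) blast+
  then show "(i, j) \<in> addable D" using nD by (simp add: addable_def)
qed

lemma removable_iff:
  assumes D: "young_diagram D" and k: "k = int j - int i"
  shows "(i, j) \<in> removable D \<longleftrightarrow> 1 \<le> i \<and> 1 \<le> j \<and> int i = thr D k \<and>
    thr D (k + 1) = thr D k - 1 \<and> thr D (k - 1) = thr D k"
proof
  assume "(i, j) \<in> removable D"
  then have iD: "(i, j) \<in> D" and Y: "young_diagram (D - {(i, j)})" by (auto simp: removable_def)
  have ij: "1 \<le> i" "1 \<le> j" using young_pos[OF D iD] by auto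
  have 1: "int i \<le> thr D k" using iD mem_thr[OF D ij k] by simp
  have "(i, j + 1) \<notin> D" using young_mem[OF Y, of i "j + 1" i j] ij by auto
  then have 2: "thr D (k + 1) < int i" 
    using mem_thr[OF D, of i "j + 1" "k + 1", OF _ _ k_shift(3)[OF k]] ij by simp
  have "(i + 1, j) \<notin> D" using young_mem[OF Y, of "i + 1" j i j] ij by auto
  then have 3: "thr D (k - 1) < int i + 1" 
    using mem_thr[OF D, of "i + 1" j "k - 1", OF _ _ k_shift(4)[OF k]] ij by simp
  show "1 \<le> i \<and> 1 \<le> j \<and> int i = thr D k \<and> thr D (k + 1) = thr D k - 1 \<and> thr D (k - 1) = thr D k"
    using 1 2 3 ij interlace[OF D, of k] interlace'[OF D, of k] by linarith
next
  assume A: "1 \<le> i \<and> 1 \<le> j \<and> int i = thr D k \<and> thr D (k + 1) = thr D k - 1 \<and> thr D (k - 1) = thr D k"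
  then have iD: "(i, j) \<in> D" using mem_thr[OF D _ _ k] by simp
  have right: "(i, j + 1) \<notin> D" 
    using mem_thr[OF D, of i "j + 1" "k + 1", OF _ _ k_shift(3)[OF k]] A by simp
  have down: "(i + 1, j) \<notin> D" 
    using mem_thr[OF D, of "i + 1" j "k - 1", OF _ _ k_shift(4)[OF k]] A by simp
  have "(a', b') \<in> D - {(i, j)}"
    if h: "(a, b) \<in> D - {(i, j)}" "1 \<le> a'" "a' \<le> a" "1 \<le> b'" "b' \<le> b" for a b a' b'
  proof -
    have "(a', b') \<noteq> (i, j)"
    proof
      assume "(a', b') = (i, j)"
      then consider "i + 1 \<le> a" "j \<le> b" | "i \<le> a" "j + 1 \<le> b" using h by fastforce
      then show False
      proof cases
        case 1 then show ?thesis using young_mem[OF D, of a b "i + 1" j] h A down by auto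
      next
        case 2 then show ?thesis using young_mem[OF D, of a b i "j + 1"] h A right by auto
      qed
    qed
    then show ?thesis using young_mem[OF D] h by blast
  qed
  then have "young_diagram (D - {(i, j)})"
    using young_finite[OF D] young_pos[OF D] by (intro youngI) blast+
  then show "(i, j) \<in> removable D" using iD by (simp add: removable_def)
qed

lemma diag_inj:
  assumes "young_diagram D"
  shows "inj_on diag (addable D)" "inj_on diag (removable D)"
  using addable_iff[OF assms refl] removable_iff[OF assms refl]
  by (auto simp: inj_on_def diag_def)

lemma diag_addable:
  assumes D: "young_diagram D"
  shows "k \<in> diag ` addable D \<longleftrightarrow> thr D (k + 1) = thr D k \<and> thr D (k - 1) = thr D k + 1"
proof
  assume "thr D (k + 1) = thr D k \<and> thr D (k - 1) = thr D k + 1"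
  then have "(nat (thr D k + 1), nat (thr D k + 1 + k)) \<in> addable D"
    using thr_ge(1,2)[where D=D and k=k] by (subst addable_iff[OF D, of k]) auto
  moreover have "diag (nat (thr D k + 1), nat (thr D k + 1 + k)) = k"
    using thr_ge(1)[of D k] thr_ge(2)[of k D] by (simp add: diag_def)
  ultimately show "k \<in> diag ` addable D" by (metis image_eqI)
qed (use addable_iff[OF D refl] in \<open>auto simp: diag_def\<close>)

lemma diag_removable:
  assumes D: "young_diagram D"
  shows "k \<in> diag ` removable D \<longleftrightarrow> thr D (k + 1) = thr D k - 1 \<and> thr D (k - 1) = thr D k"
proof
  assume A: "thr D (k + 1) = thr D k - 1 \<and> thr D (k - 1) = thr D k"
  then have B: "1 \<le> thr D k" "1 \<le> thr D k + k"
    using thr_ge(1)[of D "k + 1"] thr_ge(2)[of "k - 1" D] by auto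
  then have "(nat (thr D k), nat (thr D k + k)) \<in> removable D"
    using A by (subst removable_iff[OF D, of k]) auto
  moreover have "diag (nat (thr D k), nat (thr D k + k)) = k"
    using B by (simp add: diag_def)
  ultimately show "k \<in> diag ` removable D" by (metis image_eqI)
qed (use removable_iff[OF D refl] in \<open>auto simp: diag_def\<close>)

lemma finite_corners:
  assumes D: "young_diagram D"
  shows "finite (addable D)" "finite (removable D)"
proof -
  have "b \<in> insert (1, 1) ((\<lambda>(i, j). (i + 1, j)) ` D \<union> (\<lambda>(i, j). (i, j + 1)) ` D)" if "b \<in> addable D" for b
  proof -
    obtain i j where b: "b = (i, j)" by (cases b)
    then have Y: "young_diagram (insert (i, j) D)" using that by (auto simp: addable_def)
    have ij: "1 \<le> i" "1 \<le> j" using young_pos[OF Y] by auto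
    consider "i = 1" "j = 1" | "2 \<le> i" | "2 \<le> j" using ij by linarith
    then show ?thesis
    proof cases
      case 2
      then have "(i - 1, j) \<in> insert (i, j) D" by (intro young_mem[OF Y insertI1]) (use ij in auto)
      then have "(i - 1, j) \<in> D" "b = (i - 1 + 1, j)" using ij 2 b by auto
      then show ?thesis by force
    next
      case 3
      then have "(i, j - 1) \<in> insert (i, j) D" by (intro young_mem[OF Y insertI1]) (use ij in auto)
      then have "(i, j - 1) \<in> D" "b = (i, j - 1 + 1)" using ij 3 b by auto
      then show ?thesis by force
    qed (use b in simp)
  qed
  then show "finite (addable D)" using young_finite[OF D] by (meson finite.insertI finite_UnI finite_imageI finite_subset subsetI)
  show "finite (removable D)" using young_finite[OF D] by (rule rev_finite_subset) (auto simp: removable_def)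
qed

lemma thr_insert:
  assumes "finite D" "b \<notin> D"
  shows "thr (insert b D) k = thr D k + (if k = diag b then 1 else 0)"
proof -
  have "{x \<in> insert b D. diag x = k} = (if k = diag b then insert b {x \<in> D. diag x = k} else {x \<in> D. diag x = k})"
    by auto
  then show ?thesis using assms by (simp add: thr_def)
qed

lemma prod_by_diag:
  fixes \<theta> :: "int \<Rightarrow> 'a::comm_monoid_mult"
  assumes "inj_on diag B" "finite F" "diag ` B \<subseteq> F"
  shows "(\<Prod>b\<in>B. \<theta> (diag b)) = (\<Prod>k\<in>F. \<theta> k ^ (if k \<in> diag ` B then 1 else 0))"
proof -
  have "(\<Prod>b\<in>B. \<theta> (diag b)) = (\<Prod>k\<in>diag ` B. \<theta> k)"
    by (simp add: prod.reindex[OF assms(1)])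
  also have "\<dots> = (\<Prod>k\<in>F. \<theta> k ^ (if k \<in> diag ` B then 1 else 0))"
    by (intro prod.mono_neutral_cong_left assms) auto
  finally show ?thesis .
qed

text \<open>For the exponents of \<open>\<theta> k\<close> this says that the number of addable
  boxes minus the number of removable boxes on diagonal \<open>k\<close> changes by the second
  difference of the indicator of the diagonal of the new box. With suitable
  \<open>\<theta>\<close> the lemma gives the change of the generating polynomial of the contents
  and the change of the number of corners.\<close>

lemma corner_step:
  fixes \<theta> :: "int \<Rightarrow> 'a::comm_monoid_mult"
  assumes D: "young_diagram D" and b: "b \<in> addable D" and D': "D' = insert b D" and k0: "k0 = diag b"
  shows "(\<Prod>b\<in>addable D'. \<theta> (diag b)) * (\<Prod>b\<in>removable D. \<theta> (diag b)) * (\<theta> k0 * \<theta> k0) =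
    (\<Prod>b\<in>addable D. \<theta> (diag b)) * (\<Prod>b\<in>removable D'. \<theta> (diag b)) * (\<theta> (k0 + 1) * \<theta> (k0 - 1))"
proof -
  have Y: "young_diagram D'" and bD: "b \<notin> D" using b D' by (auto simp: addable_def)
  define F where "F = diag ` addable D' \<union> diag ` removable D' \<union> diag ` addable D \<union> diag ` removable D \<union> {k0, k0 + 1, k0 - 1}"
  have F: "finite F" by (simp add: F_def finite_corners D Y)
  have one: "\<theta> l = (\<Prod>k\<in>F. \<theta> k ^ (if k = l then 1 else 0))" if "l \<in> F" for l
  proof -
    have "(\<Prod>k\<in>F. \<theta> k ^ (if k = l then 1 else 0)) = (\<Prod>k\<in>F. if k = l then \<theta> k else 1)"
      by (intro prod.cong refl) auto
    then show ?thesis using F that by simp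
  qed
  have t: "thr D' k = thr D k + (if k = k0 then 1 else 0)" for k
    unfolding D' k0 by (rule thr_insert[OF young_finite[OF D] bD])
  have l: "k0 \<in> F" "k0 + 1 \<in> F" "k0 - 1 \<in> F" by (auto simp: F_def)
  have s: "diag ` addable D' \<subseteq> F" "diag ` removable D' \<subseteq> F" "diag ` addable D \<subseteq> F" "diag ` removable D \<subseteq> F"
    by (auto simp: F_def)
  have add0: "thr D (k0 + 1) = thr D k0" "thr D (k0 - 1) = thr D k0 + 1"
    using b diag_addable[OF D, of k0] k0 by auto
  have ex: "(if k \<in> diag ` addable D' then 1 else 0) + (if k \<in> diag ` removable D then 1 else 0) +
      ((if k = k0 then 1 else 0) + (if k = k0 then 1 else 0)) =
    (if k \<in> diag ` addable D then 1 else 0) + (if k \<in> diag ` removable D' then 1 else 0) +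
      ((if k = k0 + 1 then 1 else 0) + (if k = k0 - 1 then 1 else (0::nat)))" for k
  proof -
    consider "k = k0" | "k = k0 + 1" | "k = k0 - 1" | "k \<notin> {k0, k0 + 1, k0 - 1}" by auto
    then show ?thesis
    proof cases
      case 1
      then show ?thesis using add0 unfolding diag_addable[OF D] diag_addable[OF Y] diag_removable[OF D] diag_removable[OF Y] t
        by simp
    next
      case 2
      then show ?thesis using add0 interlace[OF D, of k] interlace[OF Y, of k]
        unfolding diag_addable[OF D] diag_addable[OF Y] diag_removable[OF D] diag_removable[OF Y] t
        by auto
    next
      case 3
      then show ?thesis using add0 interlace'[OF D, of k] interlace'[OF Y, of k]
        unfolding diag_addable[OF D] diag_addable[OF Y] diag_removable[OF D] diag_removable[OF Y] t
        by auto
    next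
      case 4
      then have "k \<noteq> k0" "k + 1 \<noteq> k0" "k - 1 \<noteq> k0" by auto
      then show ?thesis using 4
        unfolding diag_addable[OF D] diag_addable[OF Y] diag_removable[OF D] diag_removable[OF Y] t
        by simp
    qed
  qed
  note pd = prod_by_diag[OF diag_inj(1)[OF Y] F s(1)] prod_by_diag[OF diag_inj(2)[OF Y] F s(2)]
    prod_by_diag[OF diag_inj(1)[OF D] F s(3)] prod_by_diag[OF diag_inj(2)[OF D] F s(4)]
  show ?thesis
    unfolding pd
    apply (subst (1 2) one[OF l(1)], subst one[OF l(2)], subst one[OF l(3)])
    unfolding prod.distrib[symmetric] power_add[symmetric] ex ..
qed

text \<open>A label records whether a box is addable or removable, and its diagonal. The contents
  are functions of the labels, so that the same list serves the generic contents and their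
  specializations at integer parameters.\<close>

definition labels :: "box set \<Rightarrow> box \<Rightarrow> (bool \<times> int) list" where
  "labels D b = map (\<lambda>b. (True, diag b)) (sorted_list_of_set (addable D - {b})) @
     map (\<lambda>b. (False, diag b)) (sorted_list_of_set (removable D - {b}))"

definition step_label :: "box set list \<Rightarrow> nat \<Rightarrow> bool \<times> int" where
  "step_label T r = (added T r, diag (box_at T r))"

text \<open>The label of the current step comes last, since Newton's form isolates the last root.\<close>

definition all_labels :: "box set list \<Rightarrow> nat \<Rightarrow> (bool \<times> int) list" where
  "all_labels T r = labels (shape T (r - 1)) (box_at T r) @ [step_label T r]"

fun cont :: "'k::field \<Rightarrow> bool \<times> int \<Rightarrow> 'k" where
  "cont a (q, k) = (if q then a + of_int k else - (a + of_int k))"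

lemma other_contents_labels: "other_contents D b = map (cont ((omega - 1) / 2)) (labels D b)"
  by (simp add: other_contents_def labels_def add_content_def rem_content_def)

lemma content_label: "content T r = cont ((omega - 1) / 2) (step_label T r)"
  by (simp add: content_def step_label_def add_content_def rem_content_def)

lemma prod_sorted_list:
  fixes f :: "'b::linorder \<Rightarrow> 'a::comm_monoid_mult"
  shows "finite A \<Longrightarrow> prod_list (map f (sorted_list_of_set A)) = prod f A"
  by (metis distinct_sorted_list_of_set prod.distinct_set_conv_list set_sorted_list_of_set)

context
  fixes lam T
  assumes T: "updown_tableau lam T"
begin

lemma shape_0: "shape T 0 = {}" by (simp add: shape_def)

lemma young_shape: "r \<le> length T \<Longrightarrow> young_diagram (shape T r)"
  using T by (cases r) (auto simp: updown_tableau_def shape_def young_diagram_def)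

lemma step_cases:
  assumes "1 \<le> r" "r \<le> length T"
  obtains "added T r" "box_at T r \<in> addable (shape T (r - 1))" "shape T r = insert (box_at T r) (shape T (r - 1))"
  | "\<not> added T r" "box_at T r \<in> removable (shape T (r - 1))" "shape T r = shape T (r - 1) - {box_at T r}"
proof -
  have "(\<exists>b\<in>addable (shape T (r - 1)). shape T r = insert b (shape T (r - 1))) \<or>
        (\<exists>b\<in>removable (shape T (r - 1)). shape T r = shape T (r - 1) - {b})"
    using T assms by (auto simp: updown_tableau_def)
  then show ?thesis
  proof (elim disjE bexE)
    fix b assume b: "b \<in> addable (shape T (r - 1))" "shape T r = insert b (shape T (r - 1))"
    then have "b \<notin> shape T (r - 1)" by (simp add: addable_def)
    then have "added T r" "(shape T r - shape T (r - 1)) \<union> (shape T (r - 1) - shape T r) = {b}"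
      using b(2) by (auto simp: added_def)
    then show ?thesis using that(1) b by (simp add: box_at_def)
  next
    fix b assume b: "b \<in> removable (shape T (r - 1))" "shape T r = shape T (r - 1) - {b}"
    then have "b \<in> shape T (r - 1)" by (simp add: removable_def)
    then have "\<not> added T r" "(shape T r - shape T (r - 1)) \<union> (shape T (r - 1) - shape T r) = {b}"
      using b(2) by (auto simp: added_def)
    then show ?thesis using that(2) b by (simp add: box_at_def)
  qed
qed

lemma prod_all_labels:
  fixes f :: "bool \<times> int \<Rightarrow> 'a::comm_monoid_mult"
  assumes r: "1 \<le> r" "r \<le> length T"
  shows "prod_list (map f (all_labels T r)) =
    (\<Prod>b\<in>addable (shape T (r - 1)). f (True, diag b)) * (\<Prod>b\<in>removable (shape T (r - 1)). f (False, diag b))"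
proof -
  let ?D = "shape T (r - 1)" let ?b = "box_at T r"
  have D: "young_diagram ?D" using r by (intro young_shape) auto
  note fin = finite_corners[OF D]
  have "prod_list (map f (all_labels T r)) =
    (\<Prod>b\<in>addable ?D - {?b}. f (True, diag b)) * (\<Prod>b\<in>removable ?D - {?b}. f (False, diag b)) * f (step_label T r)"
    using fin by (simp add: all_labels_def labels_def o_def prod_sorted_list mult.assoc)
  also have "\<dots> = (\<Prod>b\<in>addable ?D. f (True, diag b)) * (\<Prod>b\<in>removable ?D. f (False, diag b))"
  proof (rule step_cases[OF r])
    assume A: "added T r" "?b \<in> addable ?D"
    then have "removable ?D - {?b} = removable ?D" by (auto simp: addable_def removable_def)
    then show ?thesis
      using prod.remove[OF fin(1) A(2), of "\<lambda>b. f (True, diag b)"] A(1) by (simp add: step_label_def mult_ac)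
  next
    assume A: "\<not> added T r" "?b \<in> removable ?D"
    then have "addable ?D - {?b} = addable ?D" by (auto simp: addable_def removable_def)
    then show ?thesis
      using prod.remove[OF fin(2) A(2), of "\<lambda>b. f (False, diag b)"] A(1) by (simp add: step_label_def mult_ac)
  qed
  finally show ?thesis .
qed

lemma content_step_labels:
  assumes r: "1 \<le> r" "Suc r \<le> length T"
  shows "content_step (cont a (step_label T r)) (map (cont a) (all_labels T r)) (map (cont a) (all_labels T (Suc r)))"
proof -
  define \<theta> where "\<theta> k = 1 - fps_const (a + of_int k) * fps_X" for k :: int
  define \<theta>' where "\<theta>' k = 1 - fps_const (- (a + of_int k)) * fps_X" for k :: int
  let ?D = "shape T (r - 1)" let ?D' = "shape T r"
  let ?P = "\<lambda>\<theta> B. (\<Prod>b\<in>B. \<theta> (diag b) :: 'a fps)"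
  have dp: "dprod (map (cont a) (all_labels T m)) = ?P \<theta> (addable (shape T (m - 1))) * ?P \<theta>' (removable (shape T (m - 1)))"
    "dprod (map uminus (map (cont a) (all_labels T m))) = ?P \<theta>' (addable (shape T (m - 1))) * ?P \<theta> (removable (shape T (m - 1)))"
    if "1 \<le> m" "m \<le> length T" for m
    using prod_all_labels[OF that, of "\<lambda>l. 1 - fps_const (cont a l) * fps_X"]
      prod_all_labels[OF that, of "\<lambda>l. 1 - fps_const (- cont a l) * fps_X"]
    by (simp_all add: dprod_def o_def \<theta>_def \<theta>'_def add.commute)
  have r': "r \<le> length T" using r by simp
  have D: "young_diagram ?D" "young_diagram ?D'" using r by (auto intro: young_shape)
  let ?k = "diag (box_at T r)"
  show ?thesis
  proof (rule step_cases[OF r(1) r'])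
    assume A: "added T r" "box_at T r \<in> addable ?D" "?D' = insert (box_at T r) ?D"
    note st = corner_step[OF D(1) A(2,3) refl, of \<theta>] corner_step[OF D(1) A(2,3) refl, of \<theta>']
    have four: "dprod [a + of_int ?k, a + of_int ?k, - (a + of_int ?k + 1), - (a + of_int ?k - 1)] =
        \<theta> ?k * \<theta> ?k * (\<theta>' (?k + 1) * \<theta>' (?k - 1))" (is ?four1)
      "dprod [- (a + of_int ?k), - (a + of_int ?k), a + of_int ?k + 1, a + of_int ?k - 1] =
        \<theta>' ?k * \<theta>' ?k * (\<theta> (?k + 1) * \<theta> (?k - 1))" (is ?four2)
    proof -
      have l: "[a + of_int ?k, a + of_int ?k, - (a + of_int ?k + 1), - (a + of_int ?k - 1)] = [a + of_int ?k, a + of_int ?k, - (a + of_int (?k + 1)), - (a + of_int (?k - 1))]" "[- (a + of_int ?k), - (a + of_int ?k), a + of_int ?k + 1, a + of_int ?k - 1] = [- (a + of_int ?k), - (a + of_int ?k), a + of_int (?k + 1), a + of_int (?k - 1)]"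
        by (simp_all add: algebra_simps)
      show ?four1 ?four2
        unfolding l dprod_simps \<theta>_def \<theta>'_def by (simp_all only: mult_1_right mult.assoc)
    qed
    show ?thesis
      unfolding content_step_def dp[OF r(1) r'] using dp[of "Suc r"] r A(1) four st
      by (simp add: step_label_def) algebra
  next
    assume A: "\<not> added T r" "box_at T r \<in> removable ?D" "?D' = ?D - {box_at T r}"
    then have B: "box_at T r \<in> addable ?D'" "?D = insert (box_at T r) ?D'"
      using D by (auto simp: addable_def removable_def insert_absorb)
    note st = corner_step[OF D(2) B refl, of \<theta>] corner_step[OF D(2) B refl, of \<theta>']
    have four: "dprod [- (a + of_int ?k), - (a + of_int ?k), - (- (a + of_int ?k) + 1), - (- (a + of_int ?k) - 1)] =
        \<theta>' ?k * \<theta>' ?k * (\<theta> (?k + 1) * \<theta> (?k - 1))" (is ?four1)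
      "dprod [- (- (a + of_int ?k)), - (- (a + of_int ?k)), - (a + of_int ?k) + 1, - (a + of_int ?k) - 1] =
        \<theta> ?k * \<theta> ?k * (\<theta>' (?k + 1) * \<theta>' (?k - 1))" (is ?four2)
    proof -
      have l: "[- (a + of_int ?k), - (a + of_int ?k), - (- (a + of_int ?k) + 1), - (- (a + of_int ?k) - 1)] = [- (a + of_int ?k), - (a + of_int ?k), a + of_int (?k - 1), a + of_int (?k + 1)]" "[- (- (a + of_int ?k)), - (- (a + of_int ?k)), - (a + of_int ?k) + 1, - (a + of_int ?k) - 1] = [a + of_int ?k, a + of_int ?k, - (a + of_int (?k - 1)), - (a + of_int (?k + 1))]"
        by (simp_all add: algebra_simps)
      show ?four1 ?four2
        unfolding l dprod_simps \<theta>_def \<theta>'_def by (simp_all only: mult_ac mult_1_left)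
    qed
    show ?thesis
      unfolding content_step_def dp[OF r(1) r'] using dp[of "Suc r"] r A(1) four st
      by (simp add: step_label_def) algebra
  qed
qed

lemma young_empty: "young_diagram {}" by (simp add: young_diagram_def)

lemma corners_empty: "addable {} = {(1, 1)}" "removable {} = {}"
proof -
  have "b \<in> addable {} \<longleftrightarrow> b = (1, 1)" for b
  proof (cases b)
    case (Pair i j)
    show ?thesis unfolding Pair addable_iff[OF young_empty refl] by (auto simp: thr_def max_def)
  qed
  then show "addable {} = {(1, 1)}" by auto
qed (simp add: removable_def)

text \<open>The number of addable boxes exceeds the number of removable boxes by one; only the
  parity of their sum is used, and it does not change along the tableau.\<close>

lemma card_corners: "r \<le> length T \<Longrightarrow> odd (card (addable (shape T r)) + card (removable (shape T r)))"
proof (induction r)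
  case 0
  show ?case by (simp add: shape_0 corners_empty)
next
  case (Suc r)
  have D: "young_diagram (shape T r)" "young_diagram (shape T (Suc r))" using Suc.prems by (auto intro: young_shape)
  have r: "1 \<le> Suc r" "Suc r \<le> length T" using Suc.prems by auto
  have inj: "(2::nat) ^ p = 2 ^ q \<Longrightarrow> p = q" for p q by simp
  show ?case
  proof (rule step_cases[OF r])
    assume A: "box_at T (Suc r) \<in> addable (shape T (Suc r - 1))" "shape T (Suc r) = insert (box_at T (Suc r)) (shape T (Suc r - 1))"
    from corner_step[OF _ A refl, of "\<lambda>_. 2::nat"] D(1)
    have "(2::nat) ^ (card (addable (shape T (Suc r))) + card (removable (shape T r))) =
      2 ^ (card (addable (shape T r)) + card (removable (shape T (Suc r))))" by (simp add: power_add)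
    from inj[OF this] show ?thesis using Suc by presburger
  next
    assume A: "box_at T (Suc r) \<in> removable (shape T (Suc r - 1))" "shape T (Suc r) = shape T (Suc r - 1) - {box_at T (Suc r)}"
    then have B: "box_at T (Suc r) \<in> addable (shape T (Suc r))" "shape T r = insert (box_at T (Suc r)) (shape T (Suc r))"
      using D by (auto simp: addable_def removable_def insert_absorb)
    from corner_step[OF D(2) B refl, of "\<lambda>_. 2::nat"]
    have "(2::nat) ^ (card (addable (shape T r)) + card (removable (shape T (Suc r)))) =
      2 ^ (card (addable (shape T (Suc r))) + card (removable (shape T r)))" by (simp add: power_add)
    from inj[OF this] show ?thesis using Suc by presburger
  qed
qed

lemma odd_labels:
  assumes "1 \<le> r" "r \<le> length T"
  shows "odd (length (all_labels T r))"
proof -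
  have "prod_list (map (\<lambda>_. 2::nat) L) = 2 ^ length L" for L :: "(bool \<times> int) list" by (induction L) auto
  then have "(2::nat) ^ length (all_labels T r) = 2 ^ (card (addable (shape T (r - 1))) + card (removable (shape T (r - 1))))"
    using prod_all_labels[OF assms, of "\<lambda>_. 2::nat"] by (simp add: power_add)
  then have "length (all_labels T r) = card (addable (shape T (r - 1))) + card (removable (shape T (r - 1)))" by simp
  then show ?thesis using card_corners[of "r - 1"] assms by simp
qed

lemma first_label: "1 \<le> length T \<Longrightarrow> all_labels T 1 = [(True, 0)]"
proof -
  assume n: "1 \<le> length T"
  show ?thesis
  proof (rule step_cases[OF order_refl n])
    assume "added T 1" "box_at T 1 \<in> addable (shape T (1 - 1))"
    then show ?thesis by (simp add: all_labels_def labels_def step_label_def shape_0 corners_empty diag_def)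
  qed (simp add: shape_0 corners_empty)
qed

lemma step_label_fresh:
  assumes r: "1 \<le> r" "r \<le> length T"
  shows "step_label T r \<notin> set (labels (shape T (r - 1)) (box_at T r))"
proof -
  have D: "young_diagram (shape T (r - 1))" using r by (intro young_shape) auto
  show ?thesis
  proof (rule step_cases[OF r])
    assume "added T r" "box_at T r \<in> addable (shape T (r - 1))"
    then show ?thesis using finite_corners[OF D] diag_inj[OF D] by (auto simp: labels_def step_label_def inj_on_def)
  next
    assume "\<not> added T r" "box_at T r \<in> removable (shape T (r - 1))"
    then show ?thesis using finite_corners[OF D] diag_inj[OF D] by (auto simp: labels_def step_label_def inj_on_def)
  qed
qed

end

subsection \<open>Counting the steps on a diagonal\<close>

text \<open>This replaces the sum over all boxes in the definition of the exponents by a count of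
  steps, to which the induction along the tableau applies.\<close>

lemma Sum_any_card:
  fixes B :: "nat \<Rightarrow> box"
  assumes "finite R"
  shows "Sum_any (\<lambda>b. if diag b = k then int (card {r \<in> R. P r \<and> B r = b}) else 0) =
    int (card {r \<in> R. P r \<and> diag (B r) = k})"
proof -
  let ?f = "\<lambda>b. if diag b = k then int (card {r \<in> R. P r \<and> B r = b}) else 0"
  have "Sum_any ?f = (\<Sum>b\<in>B ` R. ?f b)"
  proof (rule Sum_any.expand_superset)
    show "{b. ?f b \<noteq> 0} \<subseteq> B ` R"
    proof
      fix b assume "b \<in> {b. ?f b \<noteq> 0}"
      then have "card {r \<in> R. P r \<and> B r = b} \<noteq> 0" by (auto split: if_splits)
      then have "{r \<in> R. P r \<and> B r = b} \<noteq> {}" by (metis card.empty)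
      then show "b \<in> B ` R" by auto
    qed
  qed (use assms in simp)
  also have "\<dots> = (\<Sum>b\<in>B ` R. int (\<Sum>r\<in>{r \<in> R. B r = b}. if P r \<and> diag (B r) = k then 1 else 0))"
  proof (intro sum.cong refl)
    fix b
    have "(\<Sum>r\<in>{r \<in> R. B r = b}. if P r \<and> diag (B r) = k then 1 else 0) =
       card {r \<in> {r \<in> R. B r = b}. P r \<and> diag (B r) = k}"
      using assms by (simp add: sum.If_cases Int_def) (rule arg_cong[where f = card], auto)
    moreover have "{r \<in> {r \<in> R. B r = b}. P r \<and> diag (B r) = k} = (if diag b = k then {r \<in> R. P r \<and> B r = b} else {})"
      by auto
    ultimately show "?f b = int (\<Sum>r\<in>{r \<in> R. B r = b}. if P r \<and> diag (B r) = k then 1 else 0)" by simp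
  qed
  also have "\<dots> = int (\<Sum>r\<in>R. if P r \<and> diag (B r) = k then 1 else 0)"
    unfolding of_nat_sum[symmetric] by (subst sum.image_gen[OF assms, of _ B]) simp
  also have "\<dots> = int (card {r \<in> R. P r \<and> diag (B r) = k})"
    using assms by (simp add: sum.If_cases Int_def)
  finally show ?thesis .
qed

lemma take_facts:
  assumes "r \<le> m" "m \<le> length T"
  shows "shape (take m T) r = shape T r" "added (take m T) r = added T r" "box_at (take m T) r = box_at T r"
proof -
  have s: "shape (take m T) i = shape T i" if "i \<le> m" for i
    using that assms by (cases i) (auto simp: shape_def)
  show "shape (take m T) r = shape T r" "added (take m T) r = added T r" "box_at (take m T) r = box_at T r"
    using s[of r] s[of "r - 1"] assms by (simp_all add: added_def box_at_def)
qed

lemma d_take: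
  assumes m: "m \<le> length T"
  shows "d_add (take m T) k = int (card {r \<in> {1..m}. added T r \<and> diag (box_at T r) = k})"
    "d_rem (take m T) k = int (card {r \<in> {1..m}. \<not> added T r \<and> diag (box_at T r) = k})"
proof -
  have "{r \<in> {1..length (take m T)}. Q (added (take m T) r) \<and> R (box_at (take m T) r)} =
      {r \<in> {1..m}. Q (added T r) \<and> R (box_at T r)}" for Q R
    using m by (auto simp: take_facts)
  note S = this[of "\<lambda>x. x" "\<lambda>x. x = b" for b] this[of Not "\<lambda>x. x = b" for b]
  show "d_add (take m T) k = int (card {r \<in> {1..m}. added T r \<and> diag (box_at T r) = k})"
    unfolding d_add_def m_add_def S by (rule Sum_any_card) simp
  show "d_rem (take m T) k = int (card {r \<in> {1..m}. \<not> added T r \<and> diag (box_at T r) = k})"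
    unfolding d_rem_def m_rem_def S by (rule Sum_any_card) simp
qed

lemma d_Suc:
  assumes m: "Suc m \<le> length T"
  shows "d_add (take (Suc m) T) k = d_add (take m T) k + (if step_label T (Suc m) = (True, k) then 1 else 0)"
    "d_rem (take (Suc m) T) k = d_rem (take m T) k + (if step_label T (Suc m) = (False, k) then 1 else 0)"
proof -
  have m': "m \<le> length T" using m by simp
  have "card {r \<in> {1..Suc m}. P r} = card {r \<in> {1..m}. P r} + (if P (Suc m) then 1 else 0)" for P
  proof -
    have "{r \<in> {1..Suc m}. P r} = (if P (Suc m) then insert (Suc m) {r \<in> {1..m}. P r} else {r \<in> {1..m}. P r})"
      by (auto simp: le_Suc_eq)
    then show ?thesis by simp
  qed
  then show "d_add (take (Suc m) T) k = d_add (take m T) k + (if step_label T (Suc m) = (True, k) then 1 else 0)"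
    "d_rem (take (Suc m) T) k = d_rem (take m T) k + (if step_label T (Suc m) = (False, k) then 1 else 0)"
    unfolding d_take[OF m] d_take[OF m'] by (simp_all add: step_label_def)
qed

section \<open>The minimal polynomial of a Jucys--Murphy element\<close>

lemma acts_supported: "acts n w A a \<Longrightarrow> supported n F \<Longrightarrow> supported n (ap A F)"
  by (simp add: acts_def brauer_mult_supported)

lemma spec_Pop: "spec n a h \<Longrightarrow> spec n a (\<lambda>N g. ap (Pop N) (h N g))"
  unfolding spec_def
proof (elim exE conjE)
  fix p assume p: "\<forall>d\<in>diagrams n. a d = rp (p d)"
    "\<forall>N g. valid N g \<longrightarrow> h N g = (\<lambda>f. \<Sum>d\<in>diagrams n. poly (p d) (real N) * K N d g f)"
  have "ap (Pop N) (h N g) = h N g" if "valid N g" for N g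
    using p(2) that by (auto simp: ap_Pop K_def fun_eq_iff)
  then show "\<exists>p. (\<forall>d\<in>diagrams n. a d = rp (p d)) \<and>
      (\<forall>N g. valid N g \<longrightarrow> ap (Pop N) (h N g) = (\<lambda>f. \<Sum>d\<in>diagrams n. poly (p d) (real N) * K N d g f))"
    using p by (intro exI[of _ p]) simp
qed

lemma (in brauer_relations) EE_scale:
  "EE p k L r = scl (\<Prod>i\<in>{1..r}. k i) (EE p (\<lambda>_. 1) L r)"
proof (induction r)
  case 0
  show ?case by (simp add: scl_1)
next
  case (Suc r)
  have "EE p k L (Suc r) = scl (k (Suc r)) (scl (\<Prod>i\<in>{1..r}. k i) (EE p (\<lambda>_. 1) L r) * pp (x (Suc r)) (L (Suc r)))"
    using Suc by simp
  then show ?case by (simp add: scl_1 scl_left scl_scl mult.commute)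
qed

context brauer_alg
begin

primrec elem :: "(nat \<Rightarrow> 'k) \<Rightarrow> (nat \<Rightarrow> 'k list) \<Rightarrow> nat \<Rightarrow> 'k brauer" where
  "elem k L 0 = brauer_one n"
| "elem k L (Suc r) = (\<lambda>d. k (Suc r) * brauer_mult n w (elem k L r)
     (brauer_prod n w (map (\<lambda>a d. jm_elem n w (Suc r) d - a * brauer_one n d) (L (Suc r)))) d)"

lemma acts_EE: "r \<le> n \<Longrightarrow> acts n w (br.EE (Pn n) k L r) (elem k L r)"
proof (induction r)
  case 0
  show ?case using acts_one(2)[OF n] by simp
next
  case (Suc r)
  then show ?case unfolding br.EE.simps elem.simps br.scl_def
    by (intro acts_scale acts_mult acts_pp) auto
qed

lemma Pn_x: "r \<le> n \<Longrightarrow> br.commutes (Pn n) (br.x r)"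
  unfolding br.x_def br.jj_def
  using Pn_gen by (intro br.commutes_add br.commutes_c br.commutes_sum br.commutes_diff) (auto intro: br.commutes_sym)

lemma EE_projection: "r \<le> n \<Longrightarrow> br.EE (Pn n) k L r * Pn n = br.EE (Pn n) k L r"
proof (induction r)
  case 0
  show ?case by (simp add: Pn_Lop)
next
  case (Suc r)
  have "Pn n * br.pp (br.x (Suc r)) (L (Suc r)) = br.pp (br.x (Suc r)) (L (Suc r)) * Pn n"
    using br.commutes_pp[OF Pn_x[OF Suc.prems]] by (simp add: br.commutes_def)
  then have "br.EE (Pn n) k L r * br.pp (br.x (Suc r)) (L (Suc r)) * Pn n =
    br.EE (Pn n) k L r * Pn n * br.pp (br.x (Suc r)) (L (Suc r))"
    by (simp only: mult.assoc)
  then show ?case using Suc by (simp add: br.scl_left)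
qed

lemma EE_pp_eq_0:
  assumes r: "Suc r \<le> n" and 0: "ap (br.EE (Pn n) k L r * br.pp (br.x (Suc r)) M) (brauer_one n) = (\<lambda>_. 0)"
  shows "br.EE (Pn n) k L r * br.pp (br.x (Suc r)) M = 0" (is "?Z = 0")
proof -
  have r': "r \<le> n" using r by simp
  note A = acts_mult[OF acts_EE[OF r', of k L] acts_pp[OF r, of M]]
  from acts_one_vector[OF n A] 0 A have "acts n w ?Z (\<lambda>_. 0)" by simp
  then have "?Z * Pn n = 0" by (rule acts_zero_Pn)
  moreover have "?Z * Pn n = br.EE (Pn n) k L r * Pn n * br.pp (br.x (Suc r)) M"
    using br.commutes_pp[OF Pn_x[OF r], of M] by (simp add: br.commutes_def mult.assoc)
  ultimately show ?thesis using EE_projection[OF r'] by simp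
qed

end

lemma spec_pp:
  assumes n: "1 \<le> n" and r: "r \<le> n" and a: "spec n a h" "supported n a"
  shows "spec n (ap (brauer_relations.pp sc (brauer_relations.x sc (const omega) (Sn n (const omega)) (Cn n (const omega)) r) (map rp Q)) a)
      (\<lambda>N g. ap (col.pp (col.x N r) (map (\<lambda>q. poly q (real N)) Q)) (h N g)) \<and>
    supported n (ap (brauer_relations.pp sc (brauer_relations.x sc (const omega) (Sn n (const omega)) (Cn n (const omega)) r) (map rp Q)) a)"
proof -
  interpret br: brauer_alg n "const omega" by (rule brauer_alg.intro[OF n ufun_two])
  show ?thesis
  proof (induction Q)
    case Nil
    show ?case using a by (simp add: br.br.pp_simps col.pp_simps ap_simps)
  next
    case (Cons q Q)
    then show ?case
      using spec_x[OF r _ _ n, of _ _ q] acts_supported[OF br.acts_x_shift[OF r]]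
      by (simp add: br.br.pp_simps col.pp_simps ap_times)
  qed
qed

lemma spec_EE:
  assumes n: "1 \<le> n" and r: "r \<le> n" and a: "spec n a h" "supported n a"
  shows "spec n (ap (brauer_relations.EE sc (const omega) (Sn n (const omega)) (Cn n (const omega)) (Pn n) (\<lambda>_. 1) (\<lambda>m. map rp (Q m)) r) a)
      (\<lambda>N g. ap (col.EE N (Pop N) (\<lambda>_. 1) (\<lambda>m. map (\<lambda>q. poly q (real N)) (Q m)) r) (h N g))"
proof -
  interpret br: brauer_alg n "const omega" by (rule brauer_alg.intro[OF n ufun_two])
  show ?thesis
    using r a
  proof (induction r arbitrary: a h)
    case 0
    then show ?case using spec_Pop by (simp add: Pn_supported)
  next
    case (Suc r)
    note pp = spec_pp[OF n Suc.prems, of "Q (Suc r)"]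
    from Suc.IH[OF _ conjunct1[OF pp] conjunct2[OF pp]] Suc.prems(1) show ?case
      by (simp add: br.br.scl_1 col.scl_1 ap_times)
  qed
qed

text \<open>The relation is applied to the unit of the algebra, where it becomes a statement about
  an element that can be specialized.\<close>

lemma minimal_transfer:
  assumes n: "1 \<le> n" and r: "Suc r \<le> n"
    and col: "\<And>N. col.EE N (Pop N) (\<lambda>_. 1) (\<lambda>m. map (\<lambda>q. poly q (real N)) (Q m)) r *
      col.pp (col.x N (Suc r)) (map (\<lambda>q. poly q (real N)) Q') = 0"
  shows "brauer_relations.EE sc (const omega) (Sn n (const omega)) (Cn n (const omega)) (Pn n) k (\<lambda>m. map rp (Q m)) r *
    brauer_relations.pp sc (brauer_relations.x sc (const omega) (Sn n (const omega)) (Cn n (const omega)) (Suc r)) (map rp Q') = 0"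
proof -
  interpret br: brauer_alg n "const omega" by (rule brauer_alg.intro[OF n ufun_two])
  let ?E = "br.br.EE (Pn n) (\<lambda>_. 1) (\<lambda>m. map rp (Q m)) r" and ?P = "br.br.pp (br.br.x (Suc r)) (map rp Q')"
  have r': "r \<le> n" using r by simp
  note pp = spec_pp[OF n r spec_one supported_one, of Q']
  note E = spec_EE[OF n r' conjunct1[OF pp] conjunct2[OF pp], of Q]
  have "ap ?E (ap ?P (brauer_one n)) = (\<lambda>_. 0)"
  proof (rule spec_vanish[OF E])
    show "supported n (ap ?E (ap ?P (brauer_one n)))"
      by (rule acts_supported[OF br.acts_EE[OF r'] conjunct2[OF pp]])
    show "ap (col.EE N (Pop N) (\<lambda>_. 1) (\<lambda>m. map (\<lambda>q. poly q (real N)) (Q m)) r)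
        (ap (col.pp (col.x N (Suc r)) (map (\<lambda>q. poly q (real N)) Q')) (K N (one_diag n) g)) f = 0" for N g f
      unfolding ap_times[symmetric] col by (simp add: ap_simps)
  qed
  then have "?E * ?P = 0" by (intro br.EE_pp_eq_0[OF r]) (simp add: ap_times)
  then show ?thesis unfolding br.br.EE_scale[of _ k] by (simp add: br.br.scl_left) (simp add: br.br.scl_def)
qed

subsection \<open>The idempotents of an updown tableau\<close>

lemma const_cont: "const (cont a l) = cont (const a) l"
  by (cases l) (simp add: const_simps const_uminus const_of_int const_diff)

lemma const_brauer_mult:
  "const (brauer_mult n w a b d) = brauer_mult n (const w) (\<lambda>d. const (a d)) (\<lambda>d. const (b d)) d"
  by (simp add: brauer_mult_def const_sum const_simps const_power if_distrib cong: if_cong)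

lemma const_basis: "const (brauer_basis d d') = brauer_basis d d'"
  by (simp add: brauer_basis_def const_simps)

lemma const_jm: "const (jm_elem n w r d) = jm_elem n (const w) r d"
  by (simp add: jm_elem_def const_simps const_sum const_diff const_divide const_numeral elem_diag const_basis)

lemma const_brauer_prod:
  "const (brauer_prod n w as d) = brauer_prod n (const w) (map (\<lambda>a d. const (a d)) as) d"
proof (induction as arbitrary: d)
  case Nil
  show ?case by (simp add: brauer_prod_def elem_diag const_basis)
next
  case (Cons a as)
  then show ?case by (simp add: brauer_prod_def const_brauer_mult)
qed

lemma const_prod_list: "const (prod_list (map f L)) = prod_list (map (\<lambda>a. const (f a)) L)"
  by (induction L) (simp_all add: const_simps)

lemma prod_list_inverse: "prod_list (map (\<lambda>a. 1 / f a) L) = 1 / prod_list (map f L)" for f :: "'a \<Rightarrow> 'k::field"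
  by (induction L) simp_all

definition tab_content :: "box set list \<Rightarrow> nat \<Rightarrow> ufun" where
  "tab_content T r = const (content T r)"

definition tab_others :: "box set list \<Rightarrow> nat \<Rightarrow> ufun list" where
  "tab_others T r = map const (other_contents (shape T (r - 1)) (box_at T r))"

definition tab_norm :: "box set list \<Rightarrow> nat \<Rightarrow> ufun" where
  "tab_norm T r = 1 / prod_list (map (\<lambda>a. tab_content T r - a) (tab_others T r))"

locale tableau =
  fixes lam :: "box set" and T :: "box set list"
  assumes T: "updown_tableau lam T"

sublocale tableau \<subseteq> brauer_alg "length T" "const omega"
  using T by (intro brauer_alg.intro[OF _ ufun_two]) (cases T; simp add: updown_tableau_def)

context tableau
begin

abbreviation "n \<equiv> length T"
abbreviation "E r \<equiv> br.EE (Pn n) (tab_norm T) (tab_others T) r"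

text \<open>The contents as polynomials in the parameter, which specialize to the contents in the
  action on colourings.\<close>

definition label_poly :: "bool \<times> int \<Rightarrow> real poly" where
  "label_poly = (\<lambda>(q, k). if q then [:- (1/2), 1/2:] + of_int k else - ([:- (1/2), 1/2:] + of_int k))"

lemma label_poly: "rp (label_poly l) = const (cont ((omega - 1) / 2) l)"
  "poly (label_poly l) (real N) = cont ((real N - 1) / 2) l"
proof -
  define H :: "real poly" where "H = [:- (1/2), 1/2:]"
  have H: "rp H = (const omega - 1) / 2" "poly H (real N) = (real N - 1) / 2"
    unfolding H_def rp_half by (simp_all add: field_simps)
  show "rp (label_poly l) = const (cont ((omega - 1) / 2) l)"
    unfolding const_cont label_poly_def H_def[symmetric]
    by (cases l) (simp add: rp_add rp_diff rp_uminus H(1) rp_of_int const_simps const_diff const_divide const_numeral)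
  show "poly (label_poly l) (real N) = cont ((real N - 1) / 2) l"
    unfolding label_poly_def H_def[symmetric]
    by (cases l) (simp add: H(2) of_int_poly)
qed

lemma tab_others_labels: "tab_others T r = map rp (map label_poly (labels (shape T (r - 1)) (box_at T r)))"
  by (simp add: tab_others_def other_contents_labels label_poly)

lemma tab_all_labels: "tab_others T r @ [tab_content T r] = map rp (map label_poly (all_labels T r))"
  by (simp add: tab_others_def tab_content_def other_contents_labels content_label all_labels_def label_poly)

text \<open>The corners of the shapes of a tableau satisfy the hypotheses of
  \<open>colour_minimal\<close> for every number of colours.\<close>

theorem minimal_polynomial:
  assumes r: "Suc r \<le> n"
  shows "E r * br.pp (br.x (Suc r)) (tab_others T (Suc r) @ [tab_content T (Suc r)]) = 0"
  unfolding tab_all_labels unfolding tab_others_labels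
proof (rule minimal_transfer[OF n r])
  fix N
  let ?c = "cont ((real N - 1) / 2)"
  have "col.EE N (Pop N) (\<lambda>_. 1) (\<lambda>m. map ?c (labels (shape T (m - 1)) (box_at T m))) r *
      col.pp (col.x N (Suc r)) ((\<lambda>m. map ?c (all_labels T m)) (Suc r)) = 0"
  proof (rule colour_minimal[where R = r and g = "\<lambda>m. ?c (step_label T m)"])
    show "map ?c (all_labels T 1) = [(real N - 1) / 2]"
      using first_label[OF T n] by simp
    show "odd (length (map ?c (all_labels T (Suc m))))" if "m \<le> r" for m
      using odd_labels[OF T, of "Suc m"] that r by simp
    show "map ?c (all_labels T (Suc m)) = map ?c (labels (shape T (Suc m - 1)) (box_at T (Suc m))) @ [?c (step_label T (Suc m))]" for m
      by (simp add: all_labels_def)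
    show "content_step (?c (step_label T (Suc m))) (map ?c (all_labels T (Suc m))) (map ?c (all_labels T (Suc (Suc m))))" if "m < r" for m
      using content_step_labels[OF T, of "Suc m"] that r by simp
  qed simp
  then show "col.EE N (Pop N) (\<lambda>_. 1) (\<lambda>m. map (\<lambda>q. poly q (real N)) (map label_poly (labels (shape T (m - 1)) (box_at T m)))) r *
      col.pp (col.x N (Suc r)) (map (\<lambda>q. poly q (real N)) (map label_poly (all_labels T (Suc r)))) = 0"
    by (simp add: o_def label_poly(2))
qed

lemma E_pp_x:
  assumes r: "Suc r \<le> n"
  shows "E r * br.pp (br.x (Suc r)) (tab_others T (Suc r)) * br.x (Suc r) =
    sc (tab_content T (Suc r)) * (E r * br.pp (br.x (Suc r)) (tab_others T (Suc r)))"
proof -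
  have "E r * br.pp (br.x (Suc r)) (tab_others T (Suc r)) * (br.x (Suc r) - sc (tab_content T (Suc r))) = 0"
    using minimal_polynomial[OF r] by (simp add: br.pp_simps mult.assoc)
  then show ?thesis
    by (simp add: right_diff_distrib br.c_central)
qed

text \<open>The minimal polynomial contains the factors that define the next idempotent, so what
  remains is a single linear factor.\<close>

lemma E_eigen:
  assumes "1 \<le> r" "r \<le> n"
  shows "E r * br.x r = sc (tab_content T r) * E r"
proof -
  obtain m where r: "r = Suc m" using assms(1) by (cases r) auto
  show ?thesis
    using E_pp_x[of m] assms unfolding r
    by (simp add: br.scl_left) (simp add: br.c_scl br.scl_scl mult.commute)
qed

lemma tab_others_1: "tab_others T 1 = []" "tab_content T 1 = (const omega - 1) / 2"
proof -
  have "tab_others T 1 @ [tab_content T 1] = [(const omega - 1) / 2]"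
    unfolding tab_all_labels first_label[OF T n] by (simp add: label_poly_def rp_half)
  then show "tab_others T 1 = []" "tab_content T 1 = (const omega - 1) / 2" by auto
qed

text \<open>The product of operators corresponds to the recursive definition of the idempotents;
  the scalars are constant functions of the variables.\<close>

lemma E_acts:
  assumes "r \<le> n"
  shows "acts n (const omega) (E r) (\<lambda>d. const (idem_step n T r d))"
proof -
  have "elem (tab_norm T) (tab_others T) r = (\<lambda>d. const (idem_step n T r d))"
    using assms
  proof (induction r)
    case 0
    show ?case by (simp add: elem_diag const_basis)
  next
    case (Suc r)
    show ?case
    proof (cases r)
      case 0
      then show ?thesis
        using tab_others_1(1) brauer_mult_unit(1)[OF n supported_one, of "const omega"]
        by (simp add: tab_norm_def brauer_prod_def) (simp add: elem_diag const_basis)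
    next
      case (Suc m)
      let ?as = "other_contents (shape T r) (box_at T (Suc r))"
      define num where "num = brauer_prod n omega (map (\<lambda>a d. jm_elem n omega (Suc r) d - a * brauer_one n d) ?as)"
      define den where "den = prod_list (map (\<lambda>a. content T (Suc r) - a) ?as)"
      define P where "P = brauer_prod n (const omega) (map (\<lambda>a d. jm_elem n (const omega) (Suc r) d - a * brauer_one n d) (tab_others T (Suc r)))"
      have "brauer_one n d = const (brauer_one n d)" for d by (simp add: elem_diag const_basis)
      then have P: "const (num d) = P d" for d
        unfolding num_def P_def const_brauer_prod
        by (simp add: tab_others_def o_def const_diff const_simps const_jm)
      have den: "tab_norm T (Suc r) = 1 / const den"
        by (simp add: tab_norm_def den_def const_prod_list const_diff tab_content_def tab_others_def o_def)
      have "idem_step n T (Suc r) = brauer_mult n omega (idem_step n T r) (\<lambda>d. num d / den)"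
        by (simp add: Suc num_def den_def Let_def)
      then have "(\<lambda>d. const (idem_step n T (Suc r) d)) =
        brauer_mult n (const omega) (\<lambda>d. const (idem_step n T r d)) (\<lambda>d. 1 / const den * P d + 0)"
        by (simp add: const_brauer_mult const_divide P)
      also have "\<dots> = elem (tab_norm T) (tab_others T) (Suc r)"
        unfolding brauer_mult_lin_right using Suc.IH Suc.prems
        by (simp add: den brauer_mult_zero flip: P_def)
      finally show ?thesis by simp
    qed
  qed
  then show ?thesis using acts_EE[OF assms, of "tab_norm T" "tab_others T"] by simp
qed

end

section \<open>Consecutive evaluation\<close>

subsection \<open>Values of rational functions\<close>

lemma subst_simps: "subst_poly r c 0 = 0" "subst_poly r c 1 = 1"
proof -
  have u: "Poly_Mapping.update r 0 (0 :: nat \<Rightarrow>\<^sub>0 nat) = 0"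
    by (intro poly_mapping_eqI) (simp add: update.rep_eq)
  show "subst_poly r c 0 = 0" by (simp add: subst_poly_def)
  show "subst_poly r c 1 = 1" using subst_poly_single[of r c 0 1] by (simp add: u)
qed

lemma value_at_Fract: "subst_poly r c q \<noteq> 0 \<Longrightarrow> value_at r c (Fract p q) (Fract (subst_poly r c p) (subst_poly r c q))"
  unfolding value_at_def by blast

lemma value_at_const: "value_at r c (const a) (const a)"
proof -
  have u: "Poly_Mapping.update r 0 (0 :: nat \<Rightarrow>\<^sub>0 nat) = 0"
    by (intro poly_mapping_eqI) (simp add: update.rep_eq)
  show ?thesis
    using value_at_Fract[of r c 1 "Poly_Mapping.single 0 a"]
    by (simp add: const_def subst_simps subst_poly_single u)
qed

lemma value_at_var: "value_at r c (var r) (const c)"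
proof -
  have "Poly_Mapping.update r 0 (Poly_Mapping.single r 1) = (0 :: nat \<Rightarrow>\<^sub>0 nat)"
    by (intro poly_mapping_eqI) (simp add: update.rep_eq lookup_single when_def)
  then show ?thesis
    using value_at_Fract[of r c 1 "Poly_Mapping.single (Poly_Mapping.single r 1) 1"]
    by (simp add: const_def var_def subst_simps subst_poly_single)
qed

lemma value_at_other_var: "s \<noteq> r \<Longrightarrow> value_at r c (var s) (var s)"
proof -
  assume s: "s \<noteq> r"
  have "Poly_Mapping.update r 0 (Poly_Mapping.single s 1) = (Poly_Mapping.single s 1 :: nat \<Rightarrow>\<^sub>0 nat)"
    by (intro poly_mapping_eqI) (use s in \<open>auto simp: update.rep_eq lookup_single when_def\<close>)
  then show ?thesis
    using value_at_Fract[of r c 1 "Poly_Mapping.single (Poly_Mapping.single s 1) 1"] s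
    by (simp add: var_def subst_simps subst_poly_single lookup_single)
qed

context
  fixes r :: nat and c :: scal
begin

lemma value_at_cases:
  assumes "value_at r c f v"
  obtains p q where "f = Fract p q" "v = Fract (subst_poly r c p) (subst_poly r c q)" "subst_poly r c q \<noteq> 0" "q \<noteq> 0"
proof -
  obtain p q where "f = Fract p q" "v = Fract (subst_poly r c p) (subst_poly r c q)" "subst_poly r c q \<noteq> 0"
    using assms unfolding value_at_def by blast
  moreover then have "q \<noteq> 0" by (metis subst_simps(1))
  ultimately show ?thesis using that by blast
qed

lemma value_at_add:
  assumes "value_at r c f v" "value_at r c g w"
  shows "value_at r c (f + g) (v + w)"
proof (rule value_at_cases[OF assms(1)], rule value_at_cases[OF assms(2)])
  fix p q p' q'
  assume "f = Fract p q" "v = Fract (subst_poly r c p) (subst_poly r c q)" "subst_poly r c q \<noteq> 0" "q \<noteq> 0"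
    "g = Fract p' q'" "w = Fract (subst_poly r c p') (subst_poly r c q')" "subst_poly r c q' \<noteq> 0" "q' \<noteq> 0"
  then show ?thesis
    using value_at_Fract[of r c "q * q'" "p * q' + p' * q"] by (simp add: subst_poly_mult subst_poly_add)
qed

lemma value_at_mult:
  assumes "value_at r c f v" "value_at r c g w"
  shows "value_at r c (f * g) (v * w)"
proof (rule value_at_cases[OF assms(1)], rule value_at_cases[OF assms(2)])
  fix p q p' q'
  assume "f = Fract p q" "v = Fract (subst_poly r c p) (subst_poly r c q)" "subst_poly r c q \<noteq> 0" "q \<noteq> 0"
    "g = Fract p' q'" "w = Fract (subst_poly r c p') (subst_poly r c q')" "subst_poly r c q' \<noteq> 0" "q' \<noteq> 0"
  then show ?thesis
    using value_at_Fract[of r c "q * q'" "p * p'"] by (simp add: subst_poly_mult)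
qed

lemma value_at_inverse:
  assumes "value_at r c f v" "v \<noteq> 0"
  shows "value_at r c (inverse f) (inverse v)"
proof (rule value_at_cases[OF assms(1)])
  fix p q assume *: "f = Fract p q" "v = Fract (subst_poly r c p) (subst_poly r c q)" "subst_poly r c q \<noteq> 0" "q \<noteq> 0"
  then have "subst_poly r c p \<noteq> 0" using assms(2) by (auto simp: fract_collapse)
  then show ?thesis using * value_at_Fract[of r c p q] by simp
qed

lemma value_at_0: "value_at r c 0 0" and value_at_1: "value_at r c 1 1"
  using value_at_const[of r c 0] value_at_const[of r c 1] by (simp_all add: const_simps)

lemma value_at_uminus: "value_at r c f v \<Longrightarrow> value_at r c (- f) (- v)"
  using value_at_mult[OF value_at_const[of r c "-1"], of f v] by (simp add: const_uminus const_simps)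

lemma value_at_diff: "value_at r c f v \<Longrightarrow> value_at r c g w \<Longrightarrow> value_at r c (f - g) (v - w)"
  using value_at_add[OF _ value_at_uminus, of f v g w] by simp

lemma value_at_divide: "value_at r c f v \<Longrightarrow> value_at r c g w \<Longrightarrow> w \<noteq> 0 \<Longrightarrow> value_at r c (f / g) (v / w)"
  unfolding divide_inverse by (intro value_at_mult value_at_inverse)

lemma value_at_sum: "(\<And>i. i \<in> J \<Longrightarrow> value_at r c (f i) (v i)) \<Longrightarrow> value_at r c (\<Sum>i\<in>J. f i) (\<Sum>i\<in>J. v i)"
  by (induction J rule: infinite_finite_induct) (simp_all add: value_at_0 value_at_add)

lemma value_at_prod: "(\<And>i. i \<in> J \<Longrightarrow> value_at r c (f i) (v i)) \<Longrightarrow> value_at r c (\<Prod>i\<in>J. f i) (\<Prod>i\<in>J. v i)"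
  by (induction J rule: infinite_finite_induct) (simp_all add: value_at_1 value_at_mult)

lemma value_at_power: "value_at r c f v \<Longrightarrow> value_at r c (f ^ k) (v ^ k)"
  by (induction k) (simp_all add: value_at_1 value_at_mult)

lemma value_at_powi: "value_at r c f v \<Longrightarrow> v \<noteq> 0 \<Longrightarrow> value_at r c (f powi k) (v powi k)"
  unfolding power_int_def by (auto intro: value_at_power value_at_inverse)

lemma value_at_prod_list:
  "(\<And>i. i \<in> set J \<Longrightarrow> value_at r c (f i) (v i)) \<Longrightarrow> value_at r c (prod_list (map f J)) (prod_list (map v J))"
  by (induction J) (simp_all add: value_at_1 value_at_mult)

text \<open>An operator with coefficients that are rational functions has a value if it maps
  functions with values to functions with the corresponding values. This is compatible with sums
  and products.\<close>

definition op_value :: "(diagram, ufun) lop \<Rightarrow> (diagram, ufun) lop \<Rightarrow> bool" where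
  "op_value A B \<longleftrightarrow> (\<forall>F G. (\<forall>d. value_at r c (F d) (G d)) \<longrightarrow> (\<forall>d. value_at r c (ap A F d) (ap B G d)))"

lemma op_value_add: "op_value A B \<Longrightarrow> op_value A' B' \<Longrightarrow> op_value (A + A') (B + B')"
  by (simp add: op_value_def ap_simps value_at_add)
lemma op_value_diff: "op_value A B \<Longrightarrow> op_value A' B' \<Longrightarrow> op_value (A - A') (B - B')"
  by (simp add: op_value_def ap_simps value_at_diff)
lemma op_value_mult: "op_value A B \<Longrightarrow> op_value A' B' \<Longrightarrow> op_value (A * A') (B * B')"
  by (simp add: op_value_def ap_simps)
lemma op_value_1: "op_value 1 1"
  by (simp add: op_value_def ap_simps)
lemma op_value_0: "op_value 0 0"
  by (simp add: op_value_def ap_simps value_at_0)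
lemma op_value_sc: "value_at r c f v \<Longrightarrow> op_value (sc f) (sc v)"
  by (simp add: op_value_def ap_simps value_at_mult)
lemma op_value_sum: "(\<And>i. i \<in> J \<Longrightarrow> op_value (A i) (B i)) \<Longrightarrow> op_value (\<Sum>i\<in>J. A i) (\<Sum>i\<in>J. B i)"
  by (induction J rule: infinite_finite_induct) (simp_all add: op_value_0 op_value_add)
lemma op_value_prod_list:
  "(\<And>i. i \<in> set J \<Longrightarrow> op_value (A i) (B i)) \<Longrightarrow> op_value (prod_list (map A J)) (prod_list (map B J))"
  by (induction J) (simp_all add: op_value_1 op_value_mult)

lemma op_value_Pn: "op_value (Pn n) (Pn n)"
  by (simp add: op_value_def ap_Pn value_at_0)

lemma op_value_Lop: "op_value (Lop n (const w) (brauer_basis d')) (Lop n (const w) (brauer_basis d'))"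
  unfolding op_value_def ap_Lop brauer_mult_def
proof (intro allI impI value_at_sum)
  fix F G :: "ufun brauer" and d d1 d2
  assume "\<forall>d. value_at r c (F d) (G d)"
  then have "value_at r c (const (brauer_basis d' d1) * F d2 * const (w ^ loops n d1 d2)) (const (brauer_basis d' d1) * G d2 * const (w ^ loops n d1 d2))"
    by (intro value_at_mult value_at_const) simp
  then show "value_at r c (if compose d1 d2 = d then brauer_basis d' d1 * F d2 * const w ^ loops n d1 d2 else 0)
      (if compose d1 d2 = d then brauer_basis d' d1 * G d2 * const w ^ loops n d1 d2 else 0)"
    by (simp add: value_at_0 const_basis const_power)
qed

lemma op_value_gen: "op_value (Sn n (const w) i j) (Sn n (const w) i j)" "op_value (Cn n (const w) i j) (Cn n (const w) i j)"
  unfolding Sn_def Cn_def elem_diag by (intro op_value_add op_value_diff op_value_1 op_value_Pn op_value_Lop)+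

end

text \<open>Rational functions in which the variable \<open>u\<close> with index \<open>s\<close>
  does not occur. The denominators of the factors are of the form \<open>u\<close> plus or minus
  such a function, and hence are nonzero.\<close>

definition free_of :: "nat \<Rightarrow> ufun \<Rightarrow> bool" where
  "free_of s f \<longleftrightarrow> (\<forall>c. value_at s c f f)"

lemma free_of_nonzero:
  assumes f: "free_of s f" shows "var s + f \<noteq> 0" "f - var s \<noteq> 0"
proof -
  have A: "f \<noteq> - var s" 
  proof
    assume "f = - var s"
    moreover have "value_at s c (- var s) (- const c)" for c by (intro value_at_uminus value_at_var)
    ultimately have "f = - const c" for c using f value_at_unique unfolding free_of_def by metis
    from this[of 0] this[of 1] show False by (simp add: const_simps)
  qed
  then show "var s + f \<noteq> 0" by (simp add: add_eq_0_iff)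
  show "f - var s \<noteq> 0"
  proof
    assume "f - var s = 0"
    moreover have "value_at s c (f - var s) (f - const c)" for c
      using f by (intro value_at_diff value_at_var) (simp add: free_of_def)
    ultimately have "f - const c = 0" for c using value_at_0 value_at_unique by metis
    from this[of 0] this[of 1] show False by (simp add: const_simps)
  qed
qed

lemma free_of_intros: "free_of s f \<Longrightarrow> free_of s g \<Longrightarrow> free_of s (f + g)" "free_of s f \<Longrightarrow> free_of s g \<Longrightarrow> free_of s (f - g)"
  "free_of s f \<Longrightarrow> free_of s (- f)" "free_of s (const a)" "i \<noteq> s \<Longrightarrow> free_of s (var i)"
  unfolding free_of_def by (auto intro: value_at_add value_at_diff value_at_uminus value_at_const value_at_other_var)

subsection \<open>The scalar factor\<close>

context tableau
begin

text \<open>The diagonals that occur in the exponents of some step; all products over diagonals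
  may be taken over this finite set.\<close>

definition diagonals :: "int set" where
  "diagonals = insert 0 (\<Union>r\<in>{1..n}. {diag (box_at T r) - 1, diag (box_at T r), diag (box_at T r) + 1})"

lemma finite_diagonals: "finite diagonals" by (simp add: diagonals_def)

lemma in_diagonals: "1 \<le> r \<Longrightarrow> r \<le> n \<Longrightarrow> {diag (box_at T r), diag (box_at T r) + 1, diag (box_at T r) - 1} \<subseteq> diagonals"
  by (auto simp: diagonals_def)

text \<open>The second difference of the indicator function of \<open>l\<close>, which is the
  change of the numbers \<open>g\<close> when a box on diagonal \<open>l\<close> is added or
  removed.\<close>

definition bump :: "int \<Rightarrow> int \<Rightarrow> int" where
  "bump l k = (if k = l + 1 then 1 else 0) + (if k = l - 1 then 1 else 0) + (if k = l then - 2 else 0)"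

lemma g_0: "g_add (take 0 T) k = (if k = 0 then 1 else 0)" "g_rem (take 0 T) k = 0"
  unfolding g_add_def g_rem_def using d_take[of 0 T] by simp_all

lemma g_Suc:
  assumes "Suc r \<le> n"
  shows "g_add (take (Suc r) T) k = g_add (take r T) k + (if added T (Suc r) then bump (diag (box_at T (Suc r))) k else 0)"
    "g_rem (take (Suc r) T) k = g_rem (take r T) k + (if added T (Suc r) then 0 else bump (diag (box_at T (Suc r))) k)"
  unfolding g_add_def g_rem_def d_Suc[OF assms] bump_def step_label_def by auto

lemma g_support: "r \<le> n \<Longrightarrow> k \<notin> diagonals \<Longrightarrow> g_add (take r T) k = 0 \<and> g_rem (take r T) k = 0"
proof (induction r)
  case 0
  then show ?case unfolding g_0 by (auto simp: diagonals_def)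
next
  case (Suc r)
  then show ?case
    using g_Suc[OF Suc.prems(1), of k] in_diagonals[of "Suc r"] by (auto simp: bump_def)
qed

lemma prod_bump:
  fixes X :: "int \<Rightarrow> 'a::field"
  assumes "finite F" "\<And>k. k \<in> F \<Longrightarrow> X k \<noteq> 0" "{l, l + 1, l - 1} \<subseteq> F"
  shows "(\<Prod>k\<in>F. X k powi (g k + bump l k)) = (\<Prod>k\<in>F. X k powi g k) * (X (l + 1) * X (l - 1) / (X l)\<^sup>2)"
proof -
  have one: "(\<Prod>k\<in>F. X k powi (if k = m then e else 0)) = X m powi e" if "m \<in> F" for m e
  proof -
    have "(\<Prod>k\<in>F. X k powi (if k = m then e else 0)) = (\<Prod>k\<in>F. if k = m then X m powi e else 1)"
      by (intro prod.cong refl) auto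
    then show ?thesis using assms(1) that by simp
  qed
  have "X l powi -2 = 1 / (X l)\<^sup>2" by (simp add: power_int_minus divide_inverse)
  then show ?thesis
    using assms(3) by (simp add: bump_def power_int_add assms(2) prod.distrib one mult.assoc cong: prod.cong)
qed

text \<open>The factor \<open>1 - 1 / v^2 = (v - 1) (v + 1) / v^2\<close> that a step contributes
  to \<open>phi\<close> changes the exponents at three consecutive diagonals by
  \<open>bump\<close>.\<close>

lemma phi_product:
  assumes "r \<le> n" and u: "\<And>a. u + const a \<noteq> 0"
    and z: "\<And>i. 1 \<le> i \<Longrightarrow> i \<le> r \<Longrightarrow> z i = tab_content T i"
  shows "br.phi z u r * (u + const ((omega - 1) / 2) - kappa) =
    (\<Prod>k\<in>diagonals. (u - const ((omega - 1) / 2 + of_int k)) powi g_add (take r T) k) *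
    (\<Prod>k\<in>diagonals. (u + const ((omega - 1) / 2 + of_int k)) powi g_rem (take r T) k)"
  using assms(1) z
proof (induction r)
  case 0
  let ?X = "\<lambda>k. u - const ((omega - 1) / 2 + of_int k)"
  have "(\<Prod>k\<in>diagonals. ?X k powi (if k = 0 then 1 else 0)) = (\<Prod>k\<in>diagonals. if k = 0 then ?X 0 else 1)"
    by (intro prod.cong refl) auto
  also have "\<dots> = u - const ((omega - 1) / 2)" using finite_diagonals by (simp add: diagonals_def)
  finally have "(\<Prod>k\<in>diagonals. ?X k powi (if k = 0 then 1 else 0)) = u - const ((omega - 1) / 2)" .
  moreover have "u + const ((omega - 1) / 2) - kappa \<noteq> 0"
    unfolding kappa_def by (metis u add_diff_eq const_diff)
  ultimately show ?case
    unfolding g_0 by (simp add: br.kap_def kappa_def const_simps const_diff const_divide const_numeral)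
next
  case (Suc r)
  let ?X = "\<lambda>k. u - const ((omega - 1) / 2 + of_int k)" and ?Y = "\<lambda>k. u + const ((omega - 1) / 2 + of_int k)"
  let ?l = "diag (box_at T (Suc r))"
  have X: "?X k \<noteq> 0" and Y: "?Y k \<noteq> 0" for k
    using u[of "- ((omega - 1) / 2 + of_int k)"] u[of "(omega - 1) / 2 + of_int k"] by (simp_all only: const_uminus) simp_all
  have IH: "br.phi z u r * (u + const ((omega - 1) / 2) - kappa) =
    (\<Prod>k\<in>diagonals. ?X k powi g_add (take r T) k) * (\<Prod>k\<in>diagonals. ?Y k powi g_rem (take r T) k)"
    using Suc by simp
  have zS: "z (Suc r) = tab_content T (Suc r)" using Suc.prems(2) by simp
  have diags: "{?l, ?l + 1, ?l - 1} \<subseteq> diagonals" using in_diagonals[of "Suc r"] Suc.prems by simp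
  have frac: "1 - 1 / (v ^ 2) = (v - 1) * (v + 1) / v ^ 2" if "v \<noteq> 0" for v :: ufun
    using that by (simp add: field_simps power2_eq_square)
  show ?case
  proof (cases "added T (Suc r)")
    case True
    have v: "u - z (Suc r) = ?X ?l" "?X ?l - 1 = ?X (?l + 1)" "?X ?l + 1 = ?X (?l - 1)"
      using True by (simp_all add: zS tab_content_def content_def add_content_def const_simps const_diff)
    have "1 - 1 / (u - z (Suc r))\<^sup>2 = ?X (?l + 1) * ?X (?l - 1) / (?X ?l)\<^sup>2"
      unfolding v(1) frac[OF X] v(2,3) ..
    then show ?thesis
      using IH True prod_bump[of diagonals ?X ?l "g_add (take r T)", OF finite_diagonals X diags]
      by (simp add: g_Suc[OF Suc.prems(1)])
  next
    case False
    have v: "u - z (Suc r) = ?Y ?l" "?Y ?l - 1 = ?Y (?l - 1)" "?Y ?l + 1 = ?Y (?l + 1)"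
      using False by (simp_all add: zS tab_content_def content_def rem_content_def const_simps const_diff const_uminus)
    have "1 - 1 / (u - z (Suc r))\<^sup>2 = ?Y (?l + 1) * ?Y (?l - 1) / (?Y ?l)\<^sup>2"
      unfolding v(1) frac[OF Y] v(2,3) by (simp only: mult.commute)
    then show ?thesis
      using IH False prod_bump[of diagonals ?Y ?l "g_rem (take r T)", OF finite_diagonals Y diags]
      by (simp add: g_Suc[OF Suc.prems(1)])
  qed
qed

end

lemma const_power_int: "const (a powi k) = const a powi k"
  by (simp add: power_int_def const_power const_divide[of 1, simplified] const_simps inverse_eq_divide)

lemma const_prod: "const (\<Prod>i\<in>J. f i) = (\<Prod>i\<in>J. const (f i))"
  by (induction J rule: infinite_finite_induct) (simp_all add: const_simps)

text \<open>The divisions by two are hidden in the letters \<open>h\<close> and \<open>q\<close>,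
  so that the remaining identities are ring identities.\<close>

lemma half_omega:
  obtains h q :: scal where "omega = 2 * h" "omega / 2 = h" "2 * q = 1" "(omega - 1) / 2 = h - q"
proof
  show "omega = 2 * (omega / 2)" "2 * (1 / 2 :: scal) = 1" "omega / 2 = omega / 2"
    using scal_two by simp_all
  show "(omega - 1) / 2 = omega / 2 - 1 / (2::scal)" by (simp add: diff_divide_distrib)
qed

lemma prod_cancel_factor:
  fixes X :: "int \<Rightarrow> 'a::field"
  assumes "finite F" "l \<in> F" "X l \<noteq> 0"
  shows "X l powi (- g l) * (\<Prod>k\<in>F. X k powi g k) = (\<Prod>k\<in>F. if k = l then 1 else X k powi g k)"
proof -
  have "(\<Prod>k\<in>F. X k powi g k) = X l powi g l * (\<Prod>k\<in>F - {l}. X k powi g k)"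
    by (rule prod.remove[OF assms(1,2)])
  moreover have "(\<Prod>k\<in>F. if k = l then 1 else X k powi g k) = (\<Prod>k\<in>F - {l}. X k powi g k)"
  proof -
    have "(\<Prod>k\<in>F - {l}. if k = l then 1 else X k powi g k) = (\<Prod>k\<in>F - {l}. X k powi g k)"
      by (intro prod.cong) auto
    then show ?thesis unfolding prod.remove[OF assms(1,2), of "\<lambda>k. if k = l then 1 else X k powi g k"] by simp
  qed
  moreover have "X l powi (- g l) * X l powi g l = 1"
    using assms(3) by (simp flip: power_int_add)
  ultimately show ?thesis by (simp add: mult.assoc[symmetric])
qed

context tableau
begin

abbreviation c0 :: scal where "c0 \<equiv> (omega - 1) / 2"
abbreviation kappa0 :: scal where "kappa0 \<equiv> omega / 2 - 1"

text \<open>All these scalars are linear in the parameter or nonzero integers, so they cannot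
  vanish, except for the factor that belongs to the current step.\<close>

lemma content_nonzero:
  fixes t
  defines "a \<equiv> content T t" and "l \<equiv> diag (box_at T t)"
  shows "a + a - kappa0 \<noteq> 0" "a + c0 - kappa0 \<noteq> 0"
    "\<not> (added T t \<and> k = l) \<Longrightarrow> a - (c0 + of_int k) \<noteq> 0"
    "\<not> (\<not> added T t \<and> k = l) \<Longrightarrow> a + (c0 + of_int k) \<noteq> 0"
proof -
  obtain h q :: scal where h: "omega = 2 * h" "omega / 2 = h" "2 * q = 1" "(omega - 1) / 2 = h - q"
    by (rule half_omega)
  have nz: "of_int i * (2 * h) + of_int j \<noteq> 0" if "i \<noteq> 0 \<or> j \<noteq> 0" for i j
    using linear_omega_nonzero[OF that] h(1) by simp
  have nz2: "X \<noteq> 0" if "2 * X = of_int i * (2 * h) + of_int j" "i \<noteq> 0" for X i j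
    using nz[of i j] that by (metis mult_zero_right)
  have nz1: "X \<noteq> 0" if "X = of_int i * (2 * h) + of_int j" "i \<noteq> 0" for X i j
    using nz[of i j] that by metis
  define K :: scal where "K = of_int l"
  have a: "a = (if added T t then h - q + K else - (h - q + K))"
    by (simp add: a_def content_def add_content_def rem_content_def h(4) l_def K_def)
  show "a + a - kappa0 \<noteq> 0"
  proof (cases "added T t")
    case True
    then have "2 * (a + a - kappa0) = of_int 1 * (2 * h) + of_int (4 * l)"
      using h(3) unfolding a h(2) by (simp add: K_def algebra_simps) 
    then show ?thesis by (rule nz2) simp
  next
    case False
    then have "2 * (a + a - kappa0) = of_int (- 3) * (2 * h) + of_int (4 - 4 * l)"
      using h(3) unfolding a h(2) by (simp add: K_def algebra_simps)
    then show ?thesis by (rule nz2) simp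
  qed
  show "a + c0 - kappa0 \<noteq> 0"
  proof (cases "added T t")
    case True
    then have "2 * (a + c0 - kappa0) = of_int 1 * (2 * h) + of_int (2 * l)"
      using h(3) unfolding a h(2,4) by (simp add: K_def algebra_simps)
    then show ?thesis by (rule nz2) simp
  next
    case False
    then have "2 * (a + c0 - kappa0) = of_int (- 1) * (2 * h) + of_int (2 - 2 * l)"
      using h(3) unfolding a h(2,4) by (simp add: K_def algebra_simps)
    then show ?thesis by (rule nz2) simp
  qed
  show "a - (c0 + of_int k) \<noteq> 0" if "\<not> (added T t \<and> k = l)"
  proof (cases "added T t")
    case True
    then have "a - (c0 + of_int k) = of_int (l - k)" unfolding a h(4) by (simp add: K_def)
    moreover have "(of_int (l - k) :: scal) \<noteq> 0" using that True by (simp only: scal_of_int) simp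
    ultimately show ?thesis by (simp only: not_False_eq_True)
  next
    case False
    then have "a - (c0 + of_int k) = of_int (- 1) * (2 * h) + of_int (1 - l - k)"
      using h(3) unfolding a h(4) by (simp add: K_def algebra_simps)
    then show ?thesis by (rule nz1) simp
  qed
  show "a + (c0 + of_int k) \<noteq> 0" if "\<not> (\<not> added T t \<and> k = l)"
  proof (cases "added T t")
    case False
    then have "a + (c0 + of_int k) = of_int (k - l)" unfolding a h(4) by (simp add: K_def)
    moreover have "(of_int (k - l) :: scal) \<noteq> 0" using that False by (simp only: scal_of_int) simp
    ultimately show ?thesis by (simp only: not_False_eq_True)
  next
    case True
    then have "a + (c0 + of_int k) = of_int 1 * (2 * h) + of_int (l + k - 1)"
      using h(3) unfolding a h(4) by (simp add: K_def algebra_simps)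
    then show ?thesis by (rule nz1) simp
  qed
qed

text \<open>Both cases of the definition of \<open>psi\<close> in a common form: the value at the
  content \<open>a\<close> of the current step of the scalar factor, without the factor that
  vanishes or has a pole.\<close>

lemma psi_formula:
  assumes "Suc r \<le> n"
  defines "a \<equiv> content T (Suc r)" and "l \<equiv> diag (box_at T (Suc r))"
  shows "psi T (Suc r) = (a + a - kappa0) / (a + c0 - kappa0) *
    (\<Prod>k\<in>diagonals. if added T (Suc r) \<and> k = l then 1 else (a - (c0 + of_int k)) powi g_add (take r T) k) *
    (\<Prod>k\<in>diagonals. if \<not> added T (Suc r) \<and> k = l then 1 else (a + (c0 + of_int k)) powi g_rem (take r T) k)"
proof -
  obtain h q :: scal where h: "omega = 2 * h" "omega / 2 = h" "2 * q = 1" "(omega - 1) / 2 = h - q"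
    by (rule half_omega)
  define K :: scal where "K = of_int l"
  have a: "a = (if added T (Suc r) then h - q + K else - (h - q + K))"
    by (simp add: a_def content_def add_content_def rem_content_def h(4) l_def K_def)
  have r: "r \<le> n" using assms(1) by simp
  have any: "Prod_any f = prod f diagonals" if "\<And>k. g_add (take r T) k = 0 \<and> g_rem (take r T) k = 0 \<Longrightarrow> f k = 1"
    for f :: "int \<Rightarrow> scal"
    by (rule Prod_any.expand_superset[OF finite_diagonals]) (use that g_support[OF r] in auto)
  have two: "2 * x / (2 * y) = x / y" for x y :: scal using scal_two by simp
  show ?thesis
  proof (cases "added T (Suc r)")
    case True
    have 1: "(4 * K + omega) / (2 * K + omega) = (a + a - kappa0) / (a + c0 - kappa0)"
    proof -
      have "4 * K + omega = 2 * (2 * K + h)" "2 * K + omega = 2 * (K + h)" "a + a - kappa0 = 2 * K + h" "a + c0 - kappa0 = K + h"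
        using True h(3) unfolding a h(2,4) unfolding h(1) by (simp_all add: algebra_simps)
      then show ?thesis by (simp only: two)
    qed
    have 2: "K - of_int k = a - (c0 + of_int k)" "K + of_int k + omega - 1 = a + (c0 + of_int k)" for k
      using True h(3) unfolding a h(4) unfolding h(1) by (simp_all add: algebra_simps)
    have psi': "psi T (Suc r) = (4 * K + omega) / (2 * K + omega) *
        (\<Prod>k\<in>diagonals. if k = l then 1 else (K - of_int k) powi g_add (take r T) k) *
        (\<Prod>k\<in>diagonals. (K + of_int k + omega - 1) powi g_rem (take r T) k)"
      using True unfolding psi_def Let_def diff_Suc_1 l_def[symmetric] K_def[symmetric] by (subst (1 2) any) auto
    show ?thesis
      unfolding psi' 1 2 using True by simp
  next
    case False
    have 1: "(4 * K + 3 * omega - 4) / (2 * K + omega - 2) = (a + a - kappa0) / (a + c0 - kappa0)"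
    proof -
      have "4 * K + 3 * omega - 4 = 2 * (2 * K + 3 * h - 2)" "2 * K + omega - 2 = 2 * (K + h - 1)"
        "a + a - kappa0 = - (2 * K + 3 * h - 2)" "a + c0 - kappa0 = - (K + h - 1)"
        using False h(3) unfolding a h(2,4) unfolding h(1) by (simp_all add: algebra_simps)
      then show ?thesis by (simp only: two minus_divide_divide)
    qed
    have 2: "- K + of_int k = a + (c0 + of_int k)" "- K - of_int k - omega + 1 = a - (c0 + of_int k)" for k
      using False h(3) unfolding a h(4) unfolding h(1) by (simp_all add: algebra_simps)
    have "psi T (Suc r) = (4 * K + 3 * omega - 4) / (2 * K + omega - 2) *
        (\<Prod>k\<in>diagonals. if k = l then 1 else (- K + of_int k) powi g_rem (take r T) k) *
        (\<Prod>k\<in>diagonals. (- K - of_int k - omega + 1) powi g_add (take r T) k)"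
      using False unfolding psi_def Let_def diff_Suc_1 l_def[symmetric] K_def[symmetric] by (subst (1 2) any) auto
    then show ?thesis
      unfolding 1 2 using False by (simp only: mult_ac simp_thms if_False)
  qed
qed

text \<open>The exponent of the tableau cancels exactly the power of \<open>u - a\<close> in
  \<open>phi\<close>, up to the simple factor that the pole of the resolvent consumes.\<close>

lemma theta_value:
  assumes r: "Suc r \<le> n"
    and z: "\<And>i. 1 \<le> i \<Longrightarrow> i \<le> r \<Longrightarrow> z i = tab_content T i"
  defines "u \<equiv> var (Suc r)" and "a \<equiv> content T (Suc r)"
  shows "value_at (Suc r) a ((u - const a) powi (exponent T (Suc r) - 1) * br.phi z u r * (u + const a - kappa)) (const (psi T (Suc r)))"
proof -
  define l where "l = diag (box_at T (Suc r))"
  have u: "u + const b \<noteq> 0" for b unfolding u_def by (intro free_of_nonzero free_of_intros)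
  let ?X = "\<lambda>k. u - const (c0 + of_int k)" and ?Y = "\<lambda>k. u + const (c0 + of_int k)"
  have X: "?X k \<noteq> 0" and Y: "?Y k \<noteq> 0" for k
    using u[of "- (c0 + of_int k)"] u[of "c0 + of_int k"] by (simp_all only: const_uminus) simp_all
  have D: "u + const c0 - kappa \<noteq> 0" unfolding kappa_def by (metis u add_diff_eq const_diff)
  let ?G = "\<lambda>k. ?X k powi g_add (take r T) k" and ?G' = "\<lambda>k. ?Y k powi g_rem (take r T) k"
  have l: "l \<in> diagonals" using in_diagonals[of "Suc r"] r by (simp add: l_def)
  have ph: "br.phi z u r * (u + const c0 - kappa) = (\<Prod>k\<in>diagonals. ?G k) * (\<Prod>k\<in>diagonals. ?G' k)"
    by (rule phi_product) (use r u z in auto)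
  have "(u - const a) powi (exponent T (Suc r) - 1) * ((\<Prod>k\<in>diagonals. ?G k) * (\<Prod>k\<in>diagonals. ?G' k)) =
    (\<Prod>k\<in>diagonals. if added T (Suc r) \<and> k = l then 1 else ?G k) * (\<Prod>k\<in>diagonals. if \<not> added T (Suc r) \<and> k = l then 1 else ?G' k)"
  proof (cases "added T (Suc r)")
    case True
    then have "u - const a = ?X l" "exponent T (Suc r) - 1 = - g_add (take r T) l"
      by (simp_all add: a_def content_def add_content_def exponent_def Let_def l_def)
    then show ?thesis
      using True prod_cancel_factor[OF finite_diagonals l, of ?X "g_add (take r T)"] X by (simp add: mult.assoc[symmetric])
  next
    case False
    then have e: "u - const a = ?Y l" "exponent T (Suc r) - 1 = - g_rem (take r T) l"
      by (simp_all add: a_def content_def rem_content_def exponent_def Let_def l_def const_diff const_uminus const_simps)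
    show ?thesis
      unfolding e using False prod_cancel_factor[OF finite_diagonals l, of ?Y "g_rem (take r T)"] Y by (simp add: mult.left_commute)
  qed
  then have "(u - const a) powi (exponent T (Suc r) - 1) * br.phi z u r * (u + const c0 - kappa) =
    (\<Prod>k\<in>diagonals. if added T (Suc r) \<and> k = l then 1 else ?G k) * (\<Prod>k\<in>diagonals. if \<not> added T (Suc r) \<and> k = l then 1 else ?G' k)"
    (is "?A * (u + const c0 - kappa) = ?P * ?Q") unfolding mult.assoc ph by simp
  then have "?A = ?P * ?Q / (u + const c0 - kappa)" using D by (simp add: eq_divide_eq)
  then have "?A * (u + const a - kappa) = (u + const a - kappa) / (u + const c0 - kappa) * ?P * ?Q" by simp
  moreover have "value_at (Suc r) a ((u + const a - kappa) / (u + const c0 - kappa) * ?P * ?Q)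
    ((const a + const a - kappa) / (const a + const c0 - kappa) *
     (\<Prod>k\<in>diagonals. if added T (Suc r) \<and> k = l then 1 else (const a - const (c0 + of_int k)) powi g_add (take r T) k) *
     (\<Prod>k\<in>diagonals. if \<not> added T (Suc r) \<and> k = l then 1 else (const a + const (c0 + of_int k)) powi g_rem (take r T) k))"
    (is "value_at _ _ _ ?V")
    unfolding u_def kappa_def
  proof (intro value_at_mult value_at_divide value_at_prod value_at_add value_at_diff value_at_var value_at_const)
    show "const a + const c0 - const (omega / 2 - 1) \<noteq> 0"
      using content_nonzero(2)[of "Suc r"] unfolding a_def by (metis const_eq_0 const_simps(3) const_diff)
    fix k
    show "value_at (Suc r) a (if added T (Suc r) \<and> k = l then 1 else (var (Suc r) - const (c0 + of_int k)) powi g_add (take r T) k)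
      (if added T (Suc r) \<and> k = l then 1 else (const a - const (c0 + of_int k)) powi g_add (take r T) k)"
      using content_nonzero(3)[of "Suc r" k] unfolding a_def l_def
      by (auto intro!: value_at_powi value_at_diff value_at_var value_at_const value_at_1 simp: const_inj)
    show "value_at (Suc r) a (if \<not> added T (Suc r) \<and> k = l then 1 else (var (Suc r) + const (c0 + of_int k)) powi g_rem (take r T) k)
      (if \<not> added T (Suc r) \<and> k = l then 1 else (const a + const (c0 + of_int k)) powi g_rem (take r T) k)"
      using content_nonzero(4)[of "Suc r" k] unfolding a_def l_def const_simps(3)[symmetric, of _ "c0 + of_int k"]
      by (auto intro!: value_at_powi value_at_add value_at_var value_at_const value_at_1 simp: const_eq_0 simp del: const_simps)
         (auto simp: const_simps(3) intro!: value_at_add value_at_var value_at_const)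
  qed
  moreover have "?V = const (psi T (Suc r))"
    unfolding psi_formula[OF r] a_def l_def kappa_def
    by (simp only: const_simps(3,4) const_divide const_diff const_prod if_distrib[of const] const_power_int const_simps(2))
  ultimately show ?thesis by simp
qed

end

subsection \<open>Evaluating one variable\<close>

context tableau
begin

lemma op_value_x: "op_value r c (br.x m) (br.x m)"
proof -
  have "op_value r c (br.jj i m) (br.jj i m)" for i
    unfolding br.jj_def by (intro op_value_diff op_value_gen)
  moreover have "(const omega - 1) / 2 = const ((omega - 1) / 2)"
    by (simp add: const_divide const_diff const_simps const_numeral)
  ultimately show ?thesis
    unfolding br.x_def by (metis op_value_add op_value_sc op_value_sum value_at_const)
qed

lemma op_value_pp: "op_value r c (br.pp (br.x m) (map const L)) (br.pp (br.x m) (map const L))"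
  by (induction L) (simp_all add: br.pp_simps op_value_1 op_value_mult op_value_diff op_value_x op_value_sc value_at_const)

lemma tab_norm_const: "tab_norm T r = const (1 / prod_list (map (\<lambda>a. content T r - a) (other_contents (shape T (r - 1)) (box_at T r))))"
  by (simp add: tab_norm_def const_divide const_simps const_prod_list const_diff tab_content_def tab_others_def o_def)

lemma op_value_scl: "value_at r c f v \<Longrightarrow> op_value r c A B \<Longrightarrow> op_value r c (br.scl f A) (br.scl v B)"
  unfolding br.scl_def by (intro op_value_mult op_value_sc)

lemma op_value_E: "op_value r c (E m) (E m)"
proof (induction m)
  case 0
  show ?case by (simp add: op_value_Pn)
next
  case (Suc m)
  have "op_value r c (br.pp (br.x (Suc m)) (tab_others T (Suc m))) (br.pp (br.x (Suc m)) (tab_others T (Suc m)))"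
    unfolding tab_others_def by (rule op_value_pp)
  moreover have "value_at r c (tab_norm T (Suc m)) (tab_norm T (Suc m))"
    unfolding tab_norm_const by (rule value_at_const)
  ultimately show ?case
    unfolding br.EE.simps by (intro op_value_scl op_value_mult Suc)
qed

lemma op_value_newt:
  assumes "c \<notin> set L"
  shows "op_value r c (br.newt (var r) (br.x m) (map const L)) (br.newt (const c) (br.x m) (map const L))"
  using assms
proof (induction L)
  case Nil
  show ?case by (simp add: op_value_0)
next
  case (Cons a L)
  then have ca: "const c - const a \<noteq> 0" and IH: "op_value r c (br.newt (var r) (br.x m) (map const L)) (br.newt (const c) (br.x m) (map const L))"
    by (simp_all add: const_inj)
  have "value_at r c (1 / (var r - const a)) (1 / (const c - const a))"
    using ca by (intro value_at_divide value_at_1 value_at_diff value_at_var value_at_const)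
  then show ?case
    unfolding list.map br.newt.simps
    by (intro op_value_scl op_value_add op_value_mult op_value_diff op_value_1 op_value_x op_value_sc value_at_const IH)
qed

text \<open>Two boxes on the same side have different diagonals, and the difference of the
  contents of an addable and a removable box depends on the parameter; so the content of the
  current step differs from the other contents.\<close>

lemma content_fresh:
  assumes "1 \<le> r" "r \<le> n"
  shows "content T r \<notin> set (other_contents (shape T (r - 1)) (box_at T r))"
proof
  assume "content T r \<in> set (other_contents (shape T (r - 1)) (box_at T r))"
  then obtain m where m: "m \<in> set (labels (shape T (r - 1)) (box_at T r))"
    "cont ((omega - 1) / 2) (step_label T r) = cont ((omega - 1) / 2) m"
    unfolding content_label other_contents_labels by auto
  obtain q k q' k' where l: "step_label T r = (q, k)" "m = (q', k')" by (metis surj_pair)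
  have two: "2 * ((omega - 1) / 2) = omega - 1" using scal_two by simp
  have "q = q'"
  proof (rule ccontr)
    assume "q \<noteq> q'"
    moreover have "a + b = 0" if "(if q then a else - a) = (if q' then b else - b)" "q \<noteq> q'" for a b :: scal
      using that by (cases q; cases q') auto
    ultimately have sum: "(omega - 1) / 2 + of_int k + ((omega - 1) / 2 + of_int k') = 0"
      using m(2) unfolding l cont.simps by blast
    define x where "x = (omega - 1) / 2"
    have om: "omega = 2 * x + 1" using two unfolding x_def[symmetric] by (simp add: eq_diff_eq)
    have "of_int 1 * omega + of_int (k + k' - 1) = x + of_int k + (x + of_int k')"
      unfolding om by simp
    then have "of_int 1 * omega + of_int (k + k' - 1) = 0"
      unfolding x_def using sum by (simp only:)
    then show False using linear_omega_nonzero[of 1 "k + k' - 1"] by auto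
  qed
  moreover then have "k = k'"
    using m(2) l scal_of_int[of "k - k'"] by (cases q) auto
  ultimately show False using m(1) l step_label_fresh[OF T assms] by simp
qed

text \<open>The parameters after the first \<open>r\<close> evaluations.\<close>

definition mixed :: "nat \<Rightarrow> nat \<Rightarrow> ufun" where
  "mixed r i = (if i \<le> r then tab_content T i else var i)"

lemma kap: "br.kap = kappa"
  by (simp add: br.kap_def kappa_def const_diff const_divide const_simps const_numeral)

text \<open>The fused row has two parts according to \<open>newt_append1\<close>. The part without
  a pole is multiplied by a scalar with a simple zero at the content and disappears. In the other
  part the element \<open>x\<close> acts by the content, which is why the product over the other
  contents remains: it is the next idempotent up to its normalization.\<close>

lemma fusion_step:
  assumes r: "Suc r \<le> n"
  shows "op_value (Suc r) (content T (Suc r))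
    (br.scl ((var (Suc r) - tab_content T (Suc r)) powi exponent T (Suc r)) (E r * br.BB r (Suc r) (mixed r) (var (Suc r))))
    (br.scl (const (psi T (Suc r))) (E (Suc r)))"
proof -
  define u where "u = var (Suc r)"
  define a where "a = content T (Suc r)"
  define p where "p = exponent T (Suc r)"
  define L where "L = other_contents (shape T r) (box_at T (Suc r))"
  define X where "X = br.x (Suc r)"
  define ph where "ph = br.phi (mixed r) u r"
  have u: "u + const b \<noteq> 0" "u - const b \<noteq> 0" for b
    using free_of_nonzero(1)[OF free_of_intros(4), of "Suc r" b] free_of_nonzero(1)[OF free_of_intros(4), of "Suc r" "- b"]
    by (simp_all add: u_def const_uminus)
  have uc: "u + y \<noteq> 0 \<and> u - y \<noteq> 0" if "y \<in> range const" for y using that u by auto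
  have rc: "x + y \<in> range const" "x - y \<in> range const" if "x \<in> range const" "y \<in> range const" for x y
    using that by (auto simp flip: const_simps const_diff)
  have kr: "kappa \<in> range const" and zr: "mixed r m \<in> range const" if "m \<le> r" for m
    using that by (auto simp: kappa_def mixed_def tab_content_def)
  have L: "tab_others T (Suc r) = map const L" "tab_content T (Suc r) = const a"
    by (simp_all add: tab_others_def tab_content_def L_def a_def)
  have "E r * br.BB r (Suc r) (mixed r) u =
      br.scl ph (E r * (sc u + X - sc br.kap) * br.newt u X (tab_others T (Suc r) @ [tab_content T (Suc r)]))"
    unfolding ph_def X_def
  proof (rule br.idempotent_fusion[where L' = "\<lambda>m. tab_others T m @ [tab_content T m]"])
    show "{1..Suc r} \<subseteq> {1..n}" using r by auto
    show "br.commutes (Sn n (const omega) i j) (Pn n) \<and> br.commutes (Cn n (const omega) i j) (Pn n)"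
      if "i \<in> {1..n}" "j \<in> {1..n}" "i \<noteq> j" for i j using Pn_gen that by blast
    show "tab_others T 1 @ [tab_content T 1] = [(const omega - 1) / 2]" using tab_others_1 by simp
    show "E m * br.pp (br.x (Suc m)) (tab_others T (Suc m) @ [tab_content T (Suc m)]) = 0" if "m \<le> r" for m
      using minimal_polynomial[of m] that r by simp
    show "E m * br.x m = sc (mixed r m) * E m" if "1 \<le> m" "m \<le> r" for m
      using E_eigen[of m] that r by (simp add: mixed_def)
    show "u \<noteq> b" if "b \<in> set (tab_others T m @ [tab_content T m])" for m b
      using that u(2) by (auto simp: tab_others_def tab_content_def)
    show "u + (const omega - 1) / 2 - br.kap \<noteq> 0"
    proof -
      have "(const omega - 1) / 2 = const c0" by (simp add: const_divide const_diff const_simps const_numeral)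
      moreover have "const c0 - kappa \<in> range const" by (intro rc(2) rangeI kr[of 0]) simp
      ultimately show ?thesis using uc unfolding kap by (metis add_diff_eq)
    qed
    show "u + mixed r m - br.kap \<noteq> 0 \<and> u + mixed r m \<noteq> 0 \<and> u - mixed r m \<noteq> 0 \<and>
        u - mixed r m - br.kap \<noteq> 0 \<and> u - mixed r m + br.kap \<noteq> 0" if "1 \<le> m" "m \<le> r" for m
      using uc[OF rc(2)[OF zr kr], of m 0] uc[OF zr, of m] uc[OF rc(1)[OF zr kr], of m 0] that unfolding kap
      by (simp add: algebra_simps)
  qed
  also have "br.newt u X (tab_others T (Suc r) @ [tab_content T (Suc r)]) =
      br.newt u X (map const L) + br.scl (prod_list (map (\<lambda>b. 1 / (u - const b)) L) / (u - const a)) (br.pp X (map const L))"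
    unfolding L br.newt_append1 by (simp add: o_def)
  finally have 1: "E r * br.BB r (Suc r) (mixed r) u =
      br.scl ph (E r * (sc u + X - sc kappa) * br.newt u X (map const L)) +
      br.scl ph (br.scl (prod_list (map (\<lambda>b. 1 / (u - const b)) L) / (u - const a)) (E r * (sc u + X - sc kappa) * br.pp X (map const L)))"
    unfolding kap by (simp add: distrib_left br.scl_right br.scl_plus)
  have "E r * (sc u + X - sc kappa) * br.pp X (map const L) = E r * br.pp X (map const L) * (sc u + X - sc kappa)"
  proof -
    have "br.commutes (sc u + X - sc kappa) (br.pp X (map const L))"
      by (rule br.commutes_pp, rule br.commutes_sym)
        (intro br.commutes_diff br.commutes_add br.commutes_c br.commutes_refl)
    then show ?thesis by (simp add: br.commutes_def mult.assoc)
  qed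
  also have "\<dots> = br.scl (u + const a - kappa) (E r * br.pp X (map const L))"
    using E_pp_x[OF r] unfolding L X_def[symmetric]
    by (simp add: distrib_left right_diff_distrib br.c_scl br.scl_plus br.scl_add br.scl_diff)
  finally have 2: "E r * (sc u + X - sc kappa) * br.pp X (map const L) = br.scl (u + const a - kappa) (E r * br.pp X (map const L))" .
  define th where "th = (u - const a) powi (p - 1) * ph * (u + const a - kappa)"
  have ua: "u - const a \<noteq> 0" and uk: "u + const a - kappa \<noteq> 0"
    using u(2) uc[OF rc(2)[OF _ kr], of "const a" 0] by (simp_all add: add_diff_eq)
  have pw: "(u - const a) powi p = (u - const a) powi (p - 1) * (u - const a)"
    using ua power_int_add[of "u - const a" "p - 1" 1] by simp
  \<comment> \<open>The part without the pole keeps a factor \<open>u - const a\<close>, which makes its value vanish.\<close>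
  have s1: "(u - const a) powi p * ph = th * (u - const a) / (u + const a - kappa)"
    using uk by (simp add: th_def pw)
  have s2: "(u - const a) powi p * (ph * (q / (u - const a) * (u + const a - kappa))) = th * q" for q
    using ua by (simp add: th_def pw)
  have 3: "br.scl ((u - const a) powi p) (E r * br.BB r (Suc r) (mixed r) u) =
      br.scl (th * (u - const a) / (u + const a - kappa)) (E r * (sc u + X - sc kappa) * br.newt u X (map const L)) +
      br.scl (th * prod_list (map (\<lambda>b. 1 / (u - const b)) L)) (E r * br.pp X (map const L))"
    unfolding 1 2 br.scl_plus br.scl_scl s1 by (simp only: s2 mult.assoc)
  have th: "value_at (Suc r) a th (const (psi T (Suc r)))"
    unfolding th_def ph_def p_def u_def a_def by (rule theta_value[OF r]) (simp add: mixed_def)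
  have aL: "a \<notin> set L" using content_fresh[of "Suc r"] r by (simp add: a_def L_def)
  have ak: "const a + const a - kappa \<noteq> 0"
    using content_nonzero(1)[of "Suc r"] unfolding a_def kappa_def by (metis const_eq_0 const_simps(3) const_diff)
  have 4: "op_value (Suc r) a (br.scl ((u - const a) powi p) (E r * br.BB r (Suc r) (mixed r) u))
      (br.scl (const (psi T (Suc r)) * (const a - const a) / (const a + const a - kappa))
        (E r * (sc (const a) + X - sc kappa) * br.newt (const a) X (map const L)) +
      br.scl (const (psi T (Suc r)) * prod_list (map (\<lambda>b. 1 / (const a - const b)) L)) (E r * br.pp X (map const L)))"
    unfolding 3
  proof (intro op_value_add op_value_scl op_value_mult op_value_diff op_value_E)
    show "value_at (Suc r) a (th * (u - const a) / (u + const a - kappa)) (const (psi T (Suc r)) * (const a - const a) / (const a + const a - kappa))"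
      using ak unfolding u_def kappa_def by (intro value_at_divide value_at_mult th value_at_diff value_at_add value_at_var value_at_const)
    show "value_at (Suc r) a (th * prod_list (map (\<lambda>b. 1 / (u - const b)) L)) (const (psi T (Suc r)) * prod_list (map (\<lambda>b. 1 / (const a - const b)) L))"
      unfolding u_def by (intro value_at_mult th value_at_prod_list value_at_divide value_at_1 value_at_diff value_at_var value_at_const)
        (use aL in \<open>auto simp: const_inj\<close>)
    show "op_value (Suc r) a (br.newt u X (map const L)) (br.newt (const a) X (map const L))"
      unfolding u_def X_def by (rule op_value_newt[OF aL])
    show "op_value (Suc r) a (br.pp X (map const L)) (br.pp X (map const L))"
      unfolding X_def by (rule op_value_pp)
    show "op_value (Suc r) a (sc u) (sc (const a))" unfolding u_def by (intro op_value_sc value_at_var)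
    show "op_value (Suc r) a X X" unfolding X_def by (rule op_value_x)
    show "op_value (Suc r) a (sc kappa) (sc kappa)" unfolding kappa_def by (intro op_value_sc value_at_const)
  qed
  have 5: "E (Suc r) = br.scl (prod_list (map (\<lambda>b. 1 / (const a - const b)) L)) (E r * br.pp X (map const L))"
    by (simp add: tab_norm_def L X_def prod_list_inverse o_def)
  show ?thesis
    using 4 unfolding 5 br.scl_scl unfolding u_def a_def p_def L(2)[unfolded a_def, symmetric]
    by (simp add: br.scl_def lop_eqI[of "sc 0" 0] ap_simps)
qed

lemma op_value_rho:
  assumes "value_at r c f v" "v \<noteq> 0" "v - kappa \<noteq> 0"
  shows "op_value r c (br.rho i j f) (br.rho i j v)"
proof -
  have "value_at r c (1 / f) (1 / v)" "value_at r c (1 / (f - br.kap)) (1 / (v - br.kap))"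
    using assms unfolding kap kappa_def by (auto intro!: value_at_divide value_at_1 value_at_diff value_at_const)
  then show ?thesis
    unfolding br.rho_def by (intro op_value_add op_value_diff op_value_1 op_value_scl op_value_gen)
qed

lemma value_at_mixed: "value_at (Suc r) (content T (Suc r)) (mixed r i) (mixed (Suc r) i)"
  by (cases "i = Suc r") (auto simp: mixed_def tab_content_def intro: value_at_const value_at_var value_at_other_var)

lemma free_of_mixed: "i \<noteq> s \<Longrightarrow> free_of s (mixed r i)"
  by (simp add: mixed_def tab_content_def free_of_intros)

lemma op_value_BB:
  assumes s: "Suc r < s"
  shows "m < s \<Longrightarrow> op_value (Suc r) (content T (Suc r)) (br.BB m s (mixed r) (mixed r s)) (br.BB m s (mixed (Suc r)) (mixed (Suc r) s))"
proof (induction m)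
  case 0
  show ?case by (simp add: op_value_1)
next
  case (Suc m)
  let ?z = "mixed (Suc r)"
  have zs: "?z s = var s" using s by (simp add: mixed_def)
  have fr: "free_of s (?z (Suc m))" "free_of s kappa"
    using Suc.prems by (auto simp: kappa_def intro: free_of_mixed free_of_intros)
  have nz0: "- ?z (Suc m) + kappa - var s \<noteq> 0" "- ?z (Suc m) - var s \<noteq> 0" "?z (Suc m) - var s \<noteq> 0" "?z (Suc m) - kappa - var s \<noteq> 0"
    by (rule free_of_nonzero(2); intro free_of_intros fr)+
  have nz: "- ?z (Suc m) - ?z s + br.kap \<noteq> 0" "- ?z (Suc m) - ?z s + br.kap - kappa \<noteq> 0"
    "?z (Suc m) - ?z s \<noteq> 0" "?z (Suc m) - ?z s - kappa \<noteq> 0"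
    unfolding zs kap add_diff_cancel_right' using nz0 by (auto simp: algebra_simps)
  have "op_value (Suc r) (content T (Suc r)) (br.rho (Suc m) s (- mixed r (Suc m) - mixed r s + br.kap)) (br.rho (Suc m) s (- ?z (Suc m) - ?z s + br.kap))"
    "op_value (Suc r) (content T (Suc r)) (br.rho (Suc m) s (mixed r (Suc m) - mixed r s)) (br.rho (Suc m) s (?z (Suc m) - ?z s))"
    using nz by (auto intro!: op_value_rho value_at_add value_at_diff value_at_uminus value_at_mixed simp: kap)
      (simp add: kappa_def value_at_const)
  then show ?case using Suc by (simp add: op_value_mult)
qed

subsection \<open>The fusion product\<close>

text \<open>The rows that have not been evaluated, after \<open>r\<close> evaluations, beginning
  with the row of strand \<open>l\<close>.\<close>

definition rest :: "nat \<Rightarrow> nat \<Rightarrow> (diagram, ufun) lop" where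
  "rest r l = prod_list (map (\<lambda>s. br.BB (s - 1) s (mixed r) (mixed r s)) [l..<Suc n])"

lemma op_value_rest: "op_value (Suc r) (content T (Suc r)) (rest r (Suc (Suc r))) (rest (Suc r) (Suc (Suc r)))"
  unfolding rest_def by (intro op_value_prod_list op_value_BB) auto

lemma rest_Suc: "Suc r \<le> n \<Longrightarrow> rest r (Suc r) = br.BB r (Suc r) (mixed r) (var (Suc r)) * rest r (Suc (Suc r))"
  by (simp add: rest_def upt_conv_Cons[of "Suc r"] mixed_def del: upt_Suc)

lemma acts_prod_list: "list_all2 (acts n (const omega)) As as \<Longrightarrow> acts n (const omega) (prod_list As) (brauer_prod n (const omega) as)"
  by (induction rule: list_all2_induct) (simp_all add: brauer_prod_def acts_one(1)[OF n] acts_mult)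

lemma acts_rho:
  assumes "i \<in> {1..n}" "j \<in> {1..n}" "i \<noteq> j"
  shows "acts n (const omega) (br.rho i j u) (Defs.rho n i j u)"
proof -
  have "acts n (const omega) (1 - sc (1 / u) * Sn n (const omega) i j + sc (1 / (u - kappa)) * Cn n (const omega) i j)
    (\<lambda>d. brauer_one n d - 1 / u * s_elem n i j d + 1 / (u - kappa) * eps_elem n i j d)"
    by (intro acts_add acts_diff acts_scale acts_one(1)[OF n] acts_Sn acts_Cn assms)
  then show ?thesis by (simp add: br.rho_def br.scl_def kap Defs.rho_def)
qed

lemma set_lex_pairs: "set (lex_pairs n) = {(i, j). 1 \<le> i \<and> i < j \<and> j \<le> n}"
proof -
  have "finite {(i, j). 1 \<le> i \<and> i < j \<and> j \<le> n}"
    by (rule finite_subset[of _ "{1..n} \<times> {1..n}"]) auto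
  then show ?thesis by (simp add: lex_pairs_def)
qed

text \<open>The Yang--Baxter equation may be used since the parameters are still independent
  variables.\<close>

lemma Omega_rest: "ap (rest 0 1) (brauer_one n) = Omega n"
proof -
  let ?z = "mixed 0"
  let ?f = "\<lambda>i j. br.rho i j (- ?z i - ?z j + br.kap)" and ?g = "\<lambda>i j. br.rho i j (?z i - ?z j)"
  have z: "?z i = var i" if "1 \<le> i" for i using that by (simp add: mixed_def)
  have comm: "br.commutes (br.rho i j a) (br.rho k l b)"
    if "{i, j, k, l} \<subseteq> {1..n}" "distinct [i, j, k, l]" for i j k l a b
    using that by (intro br.rho_commutes) auto
  have "prod_list (map (\<lambda>(i, j). ?f i j) (lex_pairs n)) * prod_list (map (\<lambda>(i, j). ?g i j) (lex_pairs n)) =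
      br.tri ?f n * br.tri ?g n"
    by (subst (1 2) br.lex_product) (auto intro!: comm)
  also have "\<dots> = rest 0 1"
    unfolding rest_def
  proof (rule br.triangular_factorization[OF _ _ order_refl])
    fix i j assume ij: "i \<in> {1..n}" "j \<in> {1..n}" "i \<noteq> j"
    have k: "free_of i kappa" unfolding kappa_def by (rule free_of_intros)
    have "var i + var j \<noteq> 0" "var i + (var j - kappa) \<noteq> 0" "var i + (- var j) \<noteq> 0" "var i + (- var j - kappa) \<noteq> 0"
      by (rule free_of_nonzero(1); intro free_of_intros k ij(3)[symmetric])+
    then show "?z i + ?z j \<noteq> 0 \<and> ?z i + ?z j \<noteq> br.kap \<and> ?z i - ?z j \<noteq> 0 \<and> ?z i - ?z j \<noteq> br.kap"
      using ij by (simp add: z kap add_diff_eq)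
  qed simp
  finally have 1: "prod_list (map (\<lambda>(i, j). ?f i j) (lex_pairs n) @ map (\<lambda>(i, j). ?g i j) (lex_pairs n)) = rest 0 1"
    by simp
  have "acts n (const omega) (prod_list (map (\<lambda>(i, j). ?f i j) (lex_pairs n) @ map (\<lambda>(i, j). ?g i j) (lex_pairs n))) (Omega n)"
    unfolding Omega_def
  proof (intro acts_prod_list list_all2_appendI)
    show "list_all2 (acts n (const omega)) (map (\<lambda>(i, j). ?f i j) (lex_pairs n)) (map (\<lambda>(i, j). Defs.rho n i j (- var i - var j + kappa)) (lex_pairs n))"
      unfolding list.rel_map by (rule list.rel_refl_strong) (auto simp: set_lex_pairs z kap intro!: acts_rho)
    show "list_all2 (acts n (const omega)) (map (\<lambda>(i, j). ?g i j) (lex_pairs n)) (map (\<lambda>(i, j). Defs.rho n i j (var i - var j)) (lex_pairs n))"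
      unfolding list.rel_map by (rule list.rel_refl_strong) (auto simp: set_lex_pairs z intro!: acts_rho)
  qed
  then show ?thesis unfolding 1 by (rule acts_one_vector[OF n])
qed

text \<open>The result of the first \<open>r\<close> evaluations.\<close>

definition stage :: "nat \<Rightarrow> ufun brauer" where
  "stage r = (\<lambda>d. (\<Prod>s\<in>{Suc r..n}. (var s - tab_content T s) powi exponent T s) *
     const (\<Prod>s\<in>{1..r}. psi T s) * ap (E r * rest r (Suc r)) (brauer_one n) d)"

lemma stage_0: "stage 0 = weighted_Omega T"
proof -
  have "supported n (Omega n)" unfolding Omega_def brauer_prod_def
    by (cases "lex_pairs n") (auto simp: supported_one brauer_mult_supported split: prod.split)
  then have "ap (E 0 * rest 0 (Suc 0)) (brauer_one n) = Omega n"
    using Omega_rest by (simp add: ap_times Pn_supported)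
  then show ?thesis by (simp add: stage_def weighted_Omega_def tab_content_def const_simps)
qed

lemma stage_value:
  assumes r: "Suc r \<le> n"
  shows "value_at (Suc r) (content T (Suc r)) (stage r d) (stage (Suc r) d)"
proof -
  let ?t = "Suc r" and ?c = "content T (Suc r)"
  let ?p = "\<lambda>s. (var s - tab_content T s) powi exponent T s"
  let ?A = "br.scl (?p ?t) (E r * br.BB r ?t (mixed r) (var ?t))"
  have one: "value_at ?t ?c (brauer_one n d) (brauer_one n d)" for d
    using value_at_const[of ?t ?c "brauer_one n d"] by (simp add: elem_diag const_basis)
  have "op_value ?t ?c (?A * rest r (Suc ?t)) (br.scl (const (psi T ?t)) (E ?t) * rest ?t (Suc ?t))"
    by (intro op_value_mult op_value_rest fusion_step r)
  then have ap: "value_at ?t ?c (ap (?A * rest r (Suc ?t)) (brauer_one n) d) (ap (br.scl (const (psi T ?t)) (E ?t) * rest ?t (Suc ?t)) (brauer_one n) d)"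
    using one unfolding op_value_def by blast
  have w: "value_at ?t ?c (\<Prod>s\<in>{Suc ?t..n}. ?p s) (\<Prod>s\<in>{Suc ?t..n}. ?p s)"
  proof (intro value_at_prod value_at_powi)
    fix s assume s: "s \<in> {Suc ?t..n}"
    show "value_at ?t ?c (var s - tab_content T s) (var s - tab_content T s)"
      unfolding tab_content_def by (intro value_at_diff value_at_const value_at_other_var) (use s in auto)
    show "var s - tab_content T s \<noteq> 0"
      using free_of_nonzero(1)[of s "- tab_content T s"] by (simp add: tab_content_def free_of_intros)
  qed
  have "stage r d = (\<Prod>s\<in>{Suc ?t..n}. ?p s) * const (\<Prod>s\<in>{1..r}. psi T s) * ap (?A * rest r (Suc ?t)) (brauer_one n) d"
  proof -
    have "{?t..n} = insert ?t {Suc ?t..n}" using r by auto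
    then have "(\<Prod>s\<in>{?t..n}. ?p s) = ?p ?t * (\<Prod>s\<in>{Suc ?t..n}. ?p s)" by simp
    moreover have "ap (?A * rest r (Suc ?t)) (brauer_one n) d = ?p ?t * ap (E r * rest r ?t) (brauer_one n) d"
      by (simp add: rest_Suc[OF r] br.scl_def ap_simps mult.assoc)
    ultimately show ?thesis by (simp add: stage_def mult_ac)
  qed
  moreover have "stage ?t d = (\<Prod>s\<in>{Suc ?t..n}. ?p s) * const (\<Prod>s\<in>{1..r}. psi T s) *
      ap (br.scl (const (psi T ?t)) (E ?t) * rest ?t (Suc ?t)) (brauer_one n) d"
    by (simp add: stage_def br.scl_def ap_simps const_simps mult_ac del: br.EE.simps)
  ultimately show ?thesis
    using value_at_mult[OF value_at_mult[OF w value_at_const] ap] by simp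
qed

lemma consec_stage: "r \<le> n \<Longrightarrow> consec_eval (content T) (weighted_Omega T) r = stage r"
proof (induction r)
  case 0
  show ?case by (simp add: stage_0)
next
  case (Suc r)
  then show ?case
    using value_at_unique[OF _ stage_value[OF Suc.prems]] stage_value[OF Suc.prems]
    by (simp add: fun_eq_iff eval_at_def the_equality)
qed

text \<open>So the constant of the first step may be included in the product that defines
  \<open>h_const\<close>, which makes the first evaluation an instance of the general step.\<close>

lemma psi_1: "psi T 1 = 1"
proof -
  have l: "added T 1" "diag (box_at T 1) = 0"
    using first_label[OF T n] by (auto simp: all_labels_def step_label_def)
  have "omega \<noteq> 0" using linear_omega_nonzero[of 1 0] by simp
  moreover have "Prod_any (\<lambda>k. if k = 0 then 1 else (of_int 0 - of_int k :: scal) powi g_add [] k) = 1"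
    "Prod_any (\<lambda>k. (of_int 0 + of_int k + omega - 1) powi g_rem [] k) = 1"
  proof -
    have "(\<lambda>k. if k = 0 then 1 else (of_int 0 - of_int k :: scal) powi g_add [] k) = (\<lambda>_. 1)"
      "(\<lambda>k. (of_int 0 + of_int k + omega - 1) powi g_rem [] k) = (\<lambda>_. 1)"
      using g_0 by (auto simp: fun_eq_iff)
    then show "Prod_any (\<lambda>k. if k = 0 then 1 else (of_int 0 - of_int k :: scal) powi g_add [] k) = 1"
      "Prod_any (\<lambda>k. (of_int 0 + of_int k + omega - 1) powi g_rem [] k) = 1" by (simp_all only: Prod_any.neutral)
  qed
  ultimately show ?thesis
    unfolding psi_def Let_def l diff_self_eq_0 take_0 if_True using l(1) by simp
qed

lemma stage_n: "stage n = (\<lambda>d. const (h_const T * idempotent T d))"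
proof -
  have "{1..n} = insert 1 {2..n}" using n by auto
  then have "(\<Prod>s\<in>{1..n}. psi T s) = h_const T" by (simp add: h_const_def psi_1[unfolded One_nat_def])
  moreover have "ap (E n) (brauer_one n) = (\<lambda>d. const (idempotent T d))"
    unfolding idempotent_def by (rule acts_one_vector[OF n E_acts]) simp
  ultimately show ?thesis by (simp add: stage_def rest_def const_simps)
qed

end

unbundle no fps_syntax

theorem corollary2p5:
  fixes lam :: "box set" and T :: "box set list"
  assumes "updown_tableau lam T"
  shows "consec_eval_defined (content T) (weighted_Omega T) (length T) \<and>
    consec_eval (content T) (weighted_Omega T) (length T) =
      (\<lambda>d. const (h_const T * idempotent T d))"
proof -
  interpret tableau lam T by (rule tableau.intro) fact
  have "regular_at r (content T r) (consec_eval (content T) (weighted_Omega T) (r - 1) d)"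
    if "r \<in> {1..length T}" for r d
    using consec_stage[of "r - 1"] stage_value[of "r - 1" d] that by (auto simp: regular_at_def)
  then show ?thesis
    using consec_stage[of "length T"] stage_n by (simp add: consec_eval_defined_def)
qed

end
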